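(* Let $\mathcal{A}$, $\mathcal{C}$ be fusion categories over $k$, and let $\mathcal{B}$ be a finite tensor category over $k$. Suppose that $\mathcal{M}$ is an indecomposable exact (i.e., semisimple) module category over $\mathcal{A}$ such that there is an exact sequence $$\mathcal{A}\xrightarrow{\iota}\mathcal{B}\xrightarrow{F}\mathcal{C}\boxtimes\mathrm{End}(\mathcal{M})$$ with respect to $\mathcal{M}$. Then $\mathcal{B}$ is a fusion category (i.e., it is semisimple).
   Context: Conventions. $k$ is an algebraically closed field. A $k$-linear abelian category is finite if it is equivalent to the category of finite dimensional modules over a finite dimensional $k$-algebra. A finite tensor category is a finite $k$-linear abelian rigid monoidal category with bilinear tensor product and $\mathrm{End}(\mathbf 1)=k$. A fusion category is a semisimple finite tensor category. $\boxtimes$ is the Deligne tensor product. $\mathcal{C}^{\rm op}$ is $\mathcal{C}$ with opposite tensor product. "Module category" means left module category. A module category $\mathcal{M}$ over $\mathcal{A}$ is indecomposable if it is not a direct sum of two nonzero module categories, and exact if $P\otimes M$ is projective for every projective $P\in\mathcal{A}$ and every $M\in\mathcal{M}$. Exact sequences with respect to $\mathcal{M}$. $\mathrm{End}(\mathcal{M})$ is the category of right exact endofunctors of $\mathcal{M}$, monoidal under composition. Let $\iota:\mathcal{A}\to\mathcal{B}$ be a fully faithful tensor functor; we regard $\mathcal{A}\subseteq\mathcal{B}$. $\mathcal{C}\boxtimes\mathcal{M}$ is a module category over $\mathcal{C}^{\rm op}\boxtimes\mathcal{A}$ ($\mathcal{C}$ acts on $\mathcal C$ by right multiplication, $\mathcal{A}$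 acts on $\mathcal{M}$). The category of right exact $\mathcal{C}^{\rm op}$-linear endofunctors of $\mathcal{C}\boxtimes\mathcal{M}$ is $\mathcal{C}\boxtimes\mathrm{End}(\mathcal{M})$; so an extension of this action to an action of $\mathcal{C}^{\rm op}\boxtimes\mathcal{B}$ is encoded by an exact monoidal functor $F:\mathcal{B}\to\mathcal{C}\boxtimes\mathrm{End}(\mathcal{M})$ (the action functor), whose restriction to $\mathcal{A}$ is the action functor $\mathcal{A}\to\mathrm{End}(\mathcal{M})$. We regard $\mathrm{End}(\mathcal{M})\subseteq\mathcal{C}\boxtimes\mathrm{End}(\mathcal{M})$ via $Z\mapsto\mathbf 1\boxtimes Z$. $F$ is surjective if every object of the target is a subquotient of $F(X)$ for some $X\in\mathcal{B}$. $\mathrm{Ker}(F)$ is the full subcategory of $X\in\mathcal{B}$ with $F(X)\in\mathrm{End}(\mathcal{M})$. The sequence $\mathcal{A}\xrightarrow{\iota}\mathcal{B}\xrightarrow{F}\mathcal{C}\boxtimes\mathrm{End}(\mathcal{M})$, with such an $F$, is exact with respect to $\mathcal{M}$ if $F$ is surjective, $\mathcal{A}=\mathrm{Ker}(F)$, and $F$ is normal, i.e., one of the following two equivalent conditions holds: (1) for any $X\in\mathcal{B}$ there is a subobject $X_0\subseteq X$ such that $F(X_0)$ is the largest subobject of $F(X)$ contained in $\mathrm{End}(\mathcal{M})$; (2) for any $X\in\mathcal{B}$ there is a quotient object $X_0$ of $X$ such that $F(X_0)$ is the largest quotient object of $F(X)$ contained in $\mathrm{End}(\mathcal{M})$. 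*)

theory Defs
  imports
    "HOL-Computational_Algebra.Polynomial"
    "HOL-Library.FuncSet"
    "Jordan_Normal_Form.Matrix"
begin

section \<open>Linear categories\<close>

text \<open>
  A category is given by sets of objects and arrows, every arrow carrying its source and target,
  so that distinct hom-sets are disjoint. Operations are only constrained on composable (parallel)
  arrows.
\<close>

record ('o, 'm, 'k) lcat =
  Ob :: "'o set"
  Ar :: "'m set"
  Src :: "'m \<Rightarrow> 'o"
  Tgt :: "'m \<Rightarrow> 'o"
  Idn :: "'o \<Rightarrow> 'm"
  Cmp :: "'m \<Rightarrow> 'm \<Rightarrow> 'm"  (infixr \<open>\<cdot>\<index>\<close> 70)
  Add :: "'m \<Rightarrow> 'm \<Rightarrow> 'm"
  Zero :: "'o \<Rightarrow> 'o \<Rightarrow> 'm"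
  Scale :: "'k \<Rightarrow> 'm \<Rightarrow> 'm"

definition Hom :: "('o, 'm, 'k, 'r) lcat_scheme \<Rightarrow> 'o \<Rightarrow> 'o \<Rightarrow> 'm set" where
  "Hom C X Y = {f \<in> Ar C. Src C f = X \<and> Tgt C f = Y}"

locale category =
  fixes C :: "('o, 'm, 'k, 'r) lcat_scheme" (structure)
  assumes src_Ob: "f \<in> Ar C \<Longrightarrow> Src C f \<in> Ob C"
    and tgt_Ob: "f \<in> Ar C \<Longrightarrow> Tgt C f \<in> Ob C"
    and idn_Hom: "X \<in> Ob C \<Longrightarrow> Idn C X \<in> Hom C X X"
    and cmp_Hom: "f \<in> Hom C X Y \<Longrightarrow> g \<in> Hom C Y Z \<Longrightarrow> g \<cdot> f \<in> Hom C X Z"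
    and cmp_idn_left: "f \<in> Hom C X Y \<Longrightarrow> Idn C Y \<cdot> f = f"
    and cmp_idn_right: "f \<in> Hom C X Y \<Longrightarrow> f \<cdot> Idn C X = f"
    and cmp_assoc: "f \<in> Hom C W X \<Longrightarrow> g \<in> Hom C X Y \<Longrightarrow> h \<in> Hom C Y Z
                      \<Longrightarrow> (h \<cdot> g) \<cdot> f = h \<cdot> (g \<cdot> f)"

locale linear_category = category C
  for C :: "('o, 'm, 'k::field, 'r) lcat_scheme" (structure) +
  assumes zero_Hom: "X \<in> Ob C \<Longrightarrow> Y \<in> Ob C \<Longrightarrow> Zero C X Y \<in> Hom C X Y"
    and add_Hom: "f \<in> Hom C X Y \<Longrightarrow> g \<in> Hom C X Y \<Longrightarrow> Add C f g \<in> Hom C X Y"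
    and scale_Hom: "f \<in> Hom C X Y \<Longrightarrow> Scale C c f \<in> Hom C X Y"
    and add_assoc: "f \<in> Hom C X Y \<Longrightarrow> g \<in> Hom C X Y \<Longrightarrow> h \<in> Hom C X Y
                      \<Longrightarrow> Add C (Add C f g) h = Add C f (Add C g h)"
    and add_commute: "f \<in> Hom C X Y \<Longrightarrow> g \<in> Hom C X Y \<Longrightarrow> Add C f g = Add C g f"
    and add_zero: "f \<in> Hom C X Y \<Longrightarrow> Add C f (Zero C X Y) = f"
    and add_minus: "f \<in> Hom C X Y \<Longrightarrow> Add C f (Scale C (-1) f) = Zero C X Y"
    and scale_add_right: "f \<in> Hom C X Y \<Longrightarrow> g \<in> Hom C X Y
                      \<Longrightarrow> Scale C c (Add C f g) = Add C (Scale C c f) (Scale C c g)"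
    and scale_add_left: "f \<in> Hom C X Y
                      \<Longrightarrow> Scale C (c + d) f = Add C (Scale C c f) (Scale C d f)"
    and scale_scale: "f \<in> Hom C X Y \<Longrightarrow> Scale C c (Scale C d f) = Scale C (c * d) f"
    and scale_one: "f \<in> Hom C X Y \<Longrightarrow> Scale C 1 f = f"
    and cmp_add_left: "f \<in> Hom C X Y \<Longrightarrow> g \<in> Hom C Y Z \<Longrightarrow> h \<in> Hom C Y Z
                      \<Longrightarrow> Add C g h \<cdot> f = Add C (g \<cdot> f) (h \<cdot> f)"
    and cmp_add_right: "f \<in> Hom C X Y \<Longrightarrow> g \<in> Hom C X Y \<Longrightarrow> h \<in> Hom C Y Z
                      \<Longrightarrow> h \<cdot> Add C f g = Add C (h \<cdot> f) (h \<cdot> g)"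
    and cmp_scale_left: "f \<in> Hom C X Y \<Longrightarrow> g \<in> Hom C Y Z
                      \<Longrightarrow> Scale C c g \<cdot> f = Scale C c (g \<cdot> f)"
    and cmp_scale_right: "f \<in> Hom C X Y \<Longrightarrow> g \<in> Hom C Y Z
                      \<Longrightarrow> g \<cdot> Scale C c f = Scale C c (g \<cdot> f)"

definition inverse_arrows :: "('o, 'm, 'k, 'r) lcat_scheme \<Rightarrow> 'm \<Rightarrow> 'm \<Rightarrow> bool" where
  "inverse_arrows C f g \<longleftrightarrow> f \<in> Ar C \<and> g \<in> Hom C (Tgt C f) (Src C f) \<and>
     g \<cdot>\<^bsub>C\<^esub> f = Idn C (Src C f) \<and> f \<cdot>\<^bsub>C\<^esub> g = Idn C (Tgt C f)"

definition is_iso :: "('o, 'm, 'k, 'r) lcat_scheme \<Rightarrow> 'm \<Rightarrow> bool" where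
  "is_iso C f \<longleftrightarrow> (\<exists>g. inverse_arrows C f g)"

definition Inv :: "('o, 'm, 'k, 'r) lcat_scheme \<Rightarrow> 'm \<Rightarrow> 'm" where
  "Inv C f = (THE g. inverse_arrows C f g)"

definition isomorphic :: "('o, 'm, 'k, 'r) lcat_scheme \<Rightarrow> 'o \<Rightarrow> 'o \<Rightarrow> bool" where
  "isomorphic C X Y \<longleftrightarrow> (\<exists>f \<in> Hom C X Y. is_iso C f)"

definition is_mono :: "('o, 'm, 'k, 'r) lcat_scheme \<Rightarrow> 'm \<Rightarrow> bool" where
  "is_mono C f \<longleftrightarrow> f \<in> Ar C \<and>
     (\<forall>W. \<forall>g \<in> Hom C W (Src C f). \<forall>h \<in> Hom C W (Src C f). f \<cdot>\<^bsub>C\<^esub> g = f \<cdot>\<^bsub>C\<^esub> h \<longrightarrow> g = h)"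

definition is_epi :: "('o, 'm, 'k, 'r) lcat_scheme \<Rightarrow> 'm \<Rightarrow> bool" where
  "is_epi C f \<longleftrightarrow> f \<in> Ar C \<and>
     (\<forall>W. \<forall>g \<in> Hom C (Tgt C f) W. \<forall>h \<in> Hom C (Tgt C f) W. g \<cdot>\<^bsub>C\<^esub> f = h \<cdot>\<^bsub>C\<^esub> f \<longrightarrow> g = h)"

definition is_kernel :: "('o, 'm, 'k, 'r) lcat_scheme \<Rightarrow> 'm \<Rightarrow> 'm \<Rightarrow> bool" where
  "is_kernel C f i \<longleftrightarrow> f \<in> Ar C \<and> i \<in> Ar C \<and> Tgt C i = Src C f \<and>
     f \<cdot>\<^bsub>C\<^esub> i = Zero C (Src C i) (Tgt C f) \<and>
     (\<forall>W. \<forall>h \<in> Hom C W (Src C f). f \<cdot>\<^bsub>C\<^esub> h = Zero C W (Tgt C f) \<longrightarrow>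
        (\<exists>!u. u \<in> Hom C W (Src C i) \<and> i \<cdot>\<^bsub>C\<^esub> u = h))"

definition is_cokernel :: "('o, 'm, 'k, 'r) lcat_scheme \<Rightarrow> 'm \<Rightarrow> 'm \<Rightarrow> bool" where
  "is_cokernel C f q \<longleftrightarrow> f \<in> Ar C \<and> q \<in> Ar C \<and> Src C q = Tgt C f \<and>
     q \<cdot>\<^bsub>C\<^esub> f = Zero C (Src C f) (Tgt C q) \<and>
     (\<forall>W. \<forall>h \<in> Hom C (Tgt C f) W. h \<cdot>\<^bsub>C\<^esub> f = Zero C (Src C f) W \<longrightarrow>
        (\<exists>!u. u \<in> Hom C (Tgt C q) W \<and> u \<cdot>\<^bsub>C\<^esub> q = h))"

definition is_zero_object :: "('o, 'm, 'k, 'r) lcat_scheme \<Rightarrow> 'o \<Rightarrow> bool" where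
  "is_zero_object C X \<longleftrightarrow> X \<in> Ob C \<and>
     (\<forall>Y \<in> Ob C. Hom C X Y = {Zero C X Y} \<and> Hom C Y X = {Zero C Y X})"

primrec arrow_sum :: "('o, 'm, 'k, 'r) lcat_scheme \<Rightarrow> 'o \<Rightarrow> 'o \<Rightarrow> (nat \<Rightarrow> 'm) \<Rightarrow> nat \<Rightarrow> 'm" where
  "arrow_sum C X Y g 0 = Zero C X Y"
| "arrow_sum C X Y g (Suc n) = Add C (arrow_sum C X Y g n) (g n)"

definition is_direct_sum ::
  "('o, 'm, 'k, 'r) lcat_scheme \<Rightarrow> nat \<Rightarrow> (nat \<Rightarrow> 'o) \<Rightarrow> 'o \<Rightarrow> (nat \<Rightarrow> 'm) \<Rightarrow> (nat \<Rightarrow> 'm) \<Rightarrow> bool" where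
  "is_direct_sum C n S X i p \<longleftrightarrow> X \<in> Ob C \<and>
     (\<forall>j<n. S j \<in> Ob C \<and> i j \<in> Hom C (S j) X \<and> p j \<in> Hom C X (S j)) \<and>
     (\<forall>j<n. \<forall>l<n. p l \<cdot>\<^bsub>C\<^esub> i j = (if j = l then Idn C (S j) else Zero C (S j) (S l))) \<and>
     arrow_sum C X X (\<lambda>j. i j \<cdot>\<^bsub>C\<^esub> p j) n = Idn C X"

text \<open>The existence of direct sums includes the empty one, i.e. the zero object.\<close>

locale abelian_category = linear_category C
  for C :: "('o, 'm, 'k::field, 'r) lcat_scheme" (structure) +
  assumes has_direct_sums: "(\<And>j. j < n \<Longrightarrow> S j \<in> Ob C) \<Longrightarrow> \<exists>X i p. is_direct_sum C n S X i p"
    and has_kernels: "f \<in> Ar C \<Longrightarrow> \<exists>i. is_kernel C f i"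
    and has_cokernels: "f \<in> Ar C \<Longrightarrow> \<exists>q. is_cokernel C f q"
    and mono_is_kernel: "is_mono C i \<Longrightarrow> \<exists>f. is_kernel C f i"
    and epi_is_cokernel: "is_epi C q \<Longrightarrow> \<exists>f. is_cokernel C f q"

definition is_simple :: "('o, 'm, 'k, 'r) lcat_scheme \<Rightarrow> 'o \<Rightarrow> bool" where
  "is_simple C S \<longleftrightarrow> S \<in> Ob C \<and> \<not> is_zero_object C S \<and>
     (\<forall>i. is_mono C i \<and> Tgt C i = S \<longrightarrow> is_zero_object C (Src C i) \<or> is_iso C i)"

definition semisimple_category :: "('o, 'm, 'k, 'r) lcat_scheme \<Rightarrow> bool" where
  "semisimple_category C \<longleftrightarrow>
     (\<forall>X \<in> Ob C. \<exists>n S i p. (\<forall>j<n. is_simple C (S j)) \<and> is_direct_sum C n S X i p)"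

definition is_projective :: "('o, 'm, 'k, 'r) lcat_scheme \<Rightarrow> 'o \<Rightarrow> bool" where
  "is_projective C P \<longleftrightarrow> P \<in> Ob C \<and>
     (\<forall>e. is_epi C e \<longrightarrow> (\<forall>f \<in> Hom C P (Tgt C e). \<exists>g \<in> Hom C P (Src C e). e \<cdot>\<^bsub>C\<^esub> g = f))"


section \<open>Functors\<close>

record ('o1, 'm1, 'o2, 'm2) ftr =
  FOb :: "'o1 \<Rightarrow> 'o2"
  FAr :: "'m1 \<Rightarrow> 'm2"

definition is_functor ::
  "('o1, 'm1, 'k1, 'r1) lcat_scheme \<Rightarrow> ('o2, 'm2, 'k2, 'r2) lcat_scheme \<Rightarrow>
   ('o1, 'm1, 'o2, 'm2, 's) ftr_scheme \<Rightarrow> bool" where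
  "is_functor C D F \<longleftrightarrow>
     (\<forall>X \<in> Ob C. FOb F X \<in> Ob D) \<and>
     (\<forall>X Y. \<forall>f \<in> Hom C X Y. FAr F f \<in> Hom D (FOb F X) (FOb F Y)) \<and>
     (\<forall>X \<in> Ob C. FAr F (Idn C X) = Idn D (FOb F X)) \<and>
     (\<forall>X Y Z. \<forall>f \<in> Hom C X Y. \<forall>g \<in> Hom C Y Z. FAr F (g \<cdot>\<^bsub>C\<^esub> f) = FAr F g \<cdot>\<^bsub>D\<^esub> FAr F f)"

definition linear_functor ::
  "('o1, 'm1, 'k, 'r1) lcat_scheme \<Rightarrow> ('o2, 'm2, 'k, 'r2) lcat_scheme \<Rightarrow>
   ('o1, 'm1, 'o2, 'm2, 's) ftr_scheme \<Rightarrow> bool" where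
  "linear_functor C D F \<longleftrightarrow> is_functor C D F \<and>
     (\<forall>X Y. \<forall>f \<in> Hom C X Y. \<forall>g \<in> Hom C X Y. FAr F (Add C f g) = Add D (FAr F f) (FAr F g)) \<and>
     (\<forall>X Y c. \<forall>f \<in> Hom C X Y. FAr F (Scale C c f) = Scale D c (FAr F f))"

definition right_exact ::
  "('o1, 'm1, 'k, 'r1) lcat_scheme \<Rightarrow> ('o2, 'm2, 'k, 'r2) lcat_scheme \<Rightarrow>
   ('o1, 'm1, 'o2, 'm2, 's) ftr_scheme \<Rightarrow> bool" where
  "right_exact C D F \<longleftrightarrow> (\<forall>f q. is_cokernel C f q \<longrightarrow> is_cokernel D (FAr F f) (FAr F q))"

definition left_exact ::
  "('o1, 'm1, 'k, 'r1) lcat_scheme \<Rightarrow> ('o2, 'm2, 'k, 'r2) lcat_scheme \<Rightarrow>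
   ('o1, 'm1, 'o2, 'm2, 's) ftr_scheme \<Rightarrow> bool" where
  "left_exact C D F \<longleftrightarrow> (\<forall>f i. is_kernel C f i \<longrightarrow> is_kernel D (FAr F f) (FAr F i))"

definition right_exact_functor ::
  "('o1, 'm1, 'k, 'r1) lcat_scheme \<Rightarrow> ('o2, 'm2, 'k, 'r2) lcat_scheme \<Rightarrow>
   ('o1, 'm1, 'o2, 'm2, 's) ftr_scheme \<Rightarrow> bool" where
  "right_exact_functor C D F \<longleftrightarrow> linear_functor C D F \<and> right_exact C D F"

definition exact_functor ::
  "('o1, 'm1, 'k, 'r1) lcat_scheme \<Rightarrow> ('o2, 'm2, 'k, 'r2) lcat_scheme \<Rightarrow>
   ('o1, 'm1, 'o2, 'm2, 's) ftr_scheme \<Rightarrow> bool" where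
  "exact_functor C D F \<longleftrightarrow> linear_functor C D F \<and> left_exact C D F \<and> right_exact C D F"

definition fully_faithful ::
  "('o1, 'm1, 'k1, 'r1) lcat_scheme \<Rightarrow> ('o2, 'm2, 'k2, 'r2) lcat_scheme \<Rightarrow>
   ('o1, 'm1, 'o2, 'm2, 's) ftr_scheme \<Rightarrow> bool" where
  "fully_faithful C D F \<longleftrightarrow>
     (\<forall>X \<in> Ob C. \<forall>Y \<in> Ob C. bij_betw (FAr F) (Hom C X Y) (Hom D (FOb F X) (FOb F Y)))"

definition nat_trans ::
  "('o1, 'm1, 'k1, 'r1) lcat_scheme \<Rightarrow> ('o2, 'm2, 'k2, 'r2) lcat_scheme \<Rightarrow>
   ('o1, 'm1, 'o2, 'm2, 's) ftr_scheme \<Rightarrow> ('o1, 'm1, 'o2, 'm2, 't) ftr_scheme \<Rightarrow>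
   ('o1 \<Rightarrow> 'm2) \<Rightarrow> bool" where
  "nat_trans C D F G \<eta> \<longleftrightarrow>
     (\<forall>X \<in> Ob C. \<eta> X \<in> Hom D (FOb F X) (FOb G X)) \<and>
     (\<forall>X Y. \<forall>f \<in> Hom C X Y. \<eta> Y \<cdot>\<^bsub>D\<^esub> FAr F f = FAr G f \<cdot>\<^bsub>D\<^esub> \<eta> X)"

definition nat_iso ::
  "('o1, 'm1, 'k1, 'r1) lcat_scheme \<Rightarrow> ('o2, 'm2, 'k2, 'r2) lcat_scheme \<Rightarrow>
   ('o1, 'm1, 'o2, 'm2, 's) ftr_scheme \<Rightarrow> ('o1, 'm1, 'o2, 'm2, 't) ftr_scheme \<Rightarrow>
   ('o1 \<Rightarrow> 'm2) \<Rightarrow> bool" where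
  "nat_iso C D F G \<eta> \<longleftrightarrow> nat_trans C D F G \<eta> \<and> (\<forall>X \<in> Ob C. is_iso D (\<eta> X))"

definition id_ftr :: "('o, 'm, 'o, 'm) ftr" where
  "id_ftr = \<lparr>FOb = (\<lambda>X. X), FAr = (\<lambda>f. f)\<rparr>"

definition comp_ftr ::
  "('o2, 'm2, 'o3, 'm3, 's) ftr_scheme \<Rightarrow> ('o1, 'm1, 'o2, 'm2, 't) ftr_scheme \<Rightarrow>
   ('o1, 'm1, 'o3, 'm3) ftr" where
  "comp_ftr F G = \<lparr>FOb = (\<lambda>X. FOb F (FOb G X)), FAr = (\<lambda>f. FAr F (FAr G f))\<rparr>"

definition is_equivalence ::
  "('o1, 'm1, 'k, 'r1) lcat_scheme \<Rightarrow> ('o2, 'm2, 'k, 'r2) lcat_scheme \<Rightarrow>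
   ('o1, 'm1, 'o2, 'm2) ftr \<Rightarrow> bool" where
  "is_equivalence C D F \<longleftrightarrow> linear_functor C D F \<and>
     (\<exists>G :: ('o2, 'm2, 'o1, 'm1) ftr. linear_functor D C G \<and>
        (\<exists>\<eta>. nat_iso C C id_ftr (comp_ftr G F) \<eta>) \<and>
        (\<exists>\<epsilon>. nat_iso D D (comp_ftr F G) id_ftr \<epsilon>))"


section \<open>Finite categories\<close>

text \<open>
  Up to isomorphism, a finite dimensional algebra is a bilinear associative unital multiplication
  on \<open>k\<^sup>n\<close>, and a finite dimensional module over it a bilinear associative unital action
  on some \<open>k\<^sup>d\<close>.
\<close>

definition vec_bilinear ::
  "nat \<Rightarrow> nat \<Rightarrow> nat \<Rightarrow> ('k::field vec \<Rightarrow> 'k vec \<Rightarrow> 'k vec) \<Rightarrow> bool" where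
  "vec_bilinear n d e b \<longleftrightarrow>
     (\<forall>u \<in> carrier_vec n. \<forall>v \<in> carrier_vec d. b u v \<in> carrier_vec e) \<and>
     (\<forall>u \<in> carrier_vec n. \<forall>u' \<in> carrier_vec n. \<forall>v \<in> carrier_vec d. b (u + u') v = b u v + b u' v) \<and>
     (\<forall>u \<in> carrier_vec n. \<forall>v \<in> carrier_vec d. \<forall>v' \<in> carrier_vec d. b u (v + v') = b u v + b u v') \<and>
     (\<forall>c. \<forall>u \<in> carrier_vec n. \<forall>v \<in> carrier_vec d.
        b (c \<cdot>\<^sub>v u) v = c \<cdot>\<^sub>v b u v \<and> b u (c \<cdot>\<^sub>v v) = c \<cdot>\<^sub>v b u v)"

record 'k fd_alg =
  adim :: nat
  amult :: "'k vec \<Rightarrow> 'k vec \<Rightarrow> 'k vec"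
  aone :: "'k vec"

definition fd_algebra :: "'k::field fd_alg \<Rightarrow> bool" where
  "fd_algebra A \<longleftrightarrow> vec_bilinear (adim A) (adim A) (adim A) (amult A) \<and>
     aone A \<in> carrier_vec (adim A) \<and>
     (\<forall>a \<in> carrier_vec (adim A). amult A (aone A) a = a \<and> amult A a (aone A) = a) \<and>
     (\<forall>a \<in> carrier_vec (adim A). \<forall>b \<in> carrier_vec (adim A). \<forall>c \<in> carrier_vec (adim A).
        amult A (amult A a b) c = amult A a (amult A b c))"

type_synonym 'k fd_mod = "nat \<times> ('k vec \<Rightarrow> 'k vec \<Rightarrow> 'k vec)"

definition fd_module :: "'k::field fd_alg \<Rightarrow> 'k fd_mod \<Rightarrow> bool" where
  "fd_module A V \<longleftrightarrow> vec_bilinear (adim A) (fst V) (fst V) (snd V) \<and>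
     (\<forall>v \<in> carrier_vec (fst V). snd V (aone A) v = v) \<and>
     (\<forall>a \<in> carrier_vec (adim A). \<forall>b \<in> carrier_vec (adim A). \<forall>v \<in> carrier_vec (fst V).
        snd V (amult A a b) v = snd V a (snd V b v))"

definition fd_module_hom :: "'k::field fd_alg \<Rightarrow> 'k fd_mod \<Rightarrow> 'k fd_mod \<Rightarrow> 'k mat \<Rightarrow> bool" where
  "fd_module_hom A V W f \<longleftrightarrow> f \<in> carrier_mat (fst W) (fst V) \<and>
     (\<forall>a \<in> carrier_vec (adim A). \<forall>v \<in> carrier_vec (fst V). f *\<^sub>v snd V a v = snd W a (f *\<^sub>v v))"

definition Mod_cat ::
  "'k::field fd_alg \<Rightarrow> ('k fd_mod, 'k fd_mod \<times> 'k mat \<times> 'k fd_mod, 'k) lcat" where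
  "Mod_cat A =
     \<lparr>Ob = {V. fd_module A V},
      Ar = {(V, f, W). fd_module A V \<and> fd_module A W \<and> fd_module_hom A V W f},
      Src = (\<lambda>(V, f, W). V),
      Tgt = (\<lambda>(V, f, W). W),
      Idn = (\<lambda>V. (V, 1\<^sub>m (fst V), V)),
      Cmp = (\<lambda>(V', g, W') (V, f, W). (V, g * f, W')),
      Add = (\<lambda>(V, f, W) (V', g, W'). (V, f + g, W)),
      Zero = (\<lambda>V W. (V, 0\<^sub>m (fst W) (fst V), W)),
      Scale = (\<lambda>c (V, f, W). (V, c \<cdot>\<^sub>m f, W))\<rparr>"

definition finite_category :: "('o, 'm, 'k::field, 'r) lcat_scheme \<Rightarrow> bool" where
  "finite_category C \<longleftrightarrow> abelian_category C \<and>
     (\<exists>A F. fd_algebra A \<and> is_equivalence C (Mod_cat A) F)"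


section \<open>Bifunctors and the Deligne tensor product\<close>

text \<open>
  The product category, with the componentwise linear structure (so that as a linear category it
  is the direct sum of \<open>C\<close> and \<open>D\<close>). Bifunctors are functors on it that are
  not required to respect this linear structure.
\<close>

definition prod_cat ::
  "('o1, 'm1, 'k, 'r1) lcat_scheme \<Rightarrow> ('o2, 'm2, 'k, 'r2) lcat_scheme \<Rightarrow>
   ('o1 \<times> 'o2, 'm1 \<times> 'm2, 'k) lcat" where
  "prod_cat C D =
     \<lparr>Ob = Ob C \<times> Ob D,
      Ar = Ar C \<times> Ar D,
      Src = (\<lambda>(f, g). (Src C f, Src D g)),
      Tgt = (\<lambda>(f, g). (Tgt C f, Tgt D g)),
      Idn = (\<lambda>(X, Y). (Idn C X, Idn D Y)),
      Cmp = (\<lambda>(f', g') (f, g). (f' \<cdot>\<^bsub>C\<^esub> f, g' \<cdot>\<^bsub>D\<^esub> g)),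
      Add = (\<lambda>(f, g) (f', g'). (Add C f f', Add D g g')),
      Zero = (\<lambda>(X, Y) (X', Y'). (Zero C X X', Zero D Y Y')),
      Scale = (\<lambda>c (f, g). (Scale C c f, Scale D c g))\<rparr>"

definition fix_fst ::
  "('o1, 'm1, 'k, 'r) lcat_scheme \<Rightarrow> ('o1 \<times> 'o2, 'm1 \<times> 'm2, 'o3, 'm3, 's) ftr_scheme \<Rightarrow> 'o1 \<Rightarrow>
   ('o2, 'm2, 'o3, 'm3) ftr" where
  "fix_fst C G X = \<lparr>FOb = (\<lambda>Y. FOb G (X, Y)), FAr = (\<lambda>g. FAr G (Idn C X, g))\<rparr>"

definition fix_snd ::
  "('o2, 'm2, 'k, 'r) lcat_scheme \<Rightarrow> ('o1 \<times> 'o2, 'm1 \<times> 'm2, 'o3, 'm3, 's) ftr_scheme \<Rightarrow> 'o2 \<Rightarrow>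
   ('o1, 'm1, 'o3, 'm3) ftr" where
  "fix_snd D G Y = \<lparr>FOb = (\<lambda>X. FOb G (X, Y)), FAr = (\<lambda>f. FAr G (f, Idn D Y))\<rparr>"

definition bilinear_bifunctor ::
  "('o1, 'm1, 'k, 'r1) lcat_scheme \<Rightarrow> ('o2, 'm2, 'k, 'r2) lcat_scheme \<Rightarrow>
   ('o3, 'm3, 'k, 'r3) lcat_scheme \<Rightarrow> ('o1 \<times> 'o2, 'm1 \<times> 'm2, 'o3, 'm3, 's) ftr_scheme \<Rightarrow> bool" where
  "bilinear_bifunctor C D E G \<longleftrightarrow> is_functor (prod_cat C D) E G \<and>
     (\<forall>X \<in> Ob C. linear_functor D E (fix_fst C G X)) \<and>
     (\<forall>Y \<in> Ob D. linear_functor C E (fix_snd D G Y))"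

definition right_exact_bifunctor ::
  "('o1, 'm1, 'k, 'r1) lcat_scheme \<Rightarrow> ('o2, 'm2, 'k, 'r2) lcat_scheme \<Rightarrow>
   ('o3, 'm3, 'k, 'r3) lcat_scheme \<Rightarrow> ('o1 \<times> 'o2, 'm1 \<times> 'm2, 'o3, 'm3, 's) ftr_scheme \<Rightarrow> bool" where
  "right_exact_bifunctor C D E G \<longleftrightarrow> bilinear_bifunctor C D E G \<and>
     (\<forall>X \<in> Ob C. right_exact D E (fix_fst C G X)) \<and>
     (\<forall>Y \<in> Ob D. right_exact C E (fix_snd D G Y))"

definition exact_bifunctor ::
  "('o1, 'm1, 'k, 'r1) lcat_scheme \<Rightarrow> ('o2, 'm2, 'k, 'r2) lcat_scheme \<Rightarrow>
   ('o3, 'm3, 'k, 'r3) lcat_scheme \<Rightarrow> ('o1 \<times> 'o2, 'm1 \<times> 'm2, 'o3, 'm3, 's) ftr_scheme \<Rightarrow> bool" where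
  "exact_bifunctor C D E G \<longleftrightarrow> bilinear_bifunctor C D E G \<and>
     (\<forall>X \<in> Ob C. exact_functor D E (fix_fst C G X)) \<and>
     (\<forall>Y \<in> Ob D. exact_functor C E (fix_snd D G Y))"

text \<open>
  The Deligne tensor product of \<open>C\<close> and \<open>D\<close>: a finite category \<open>T\<close> with a bilinear bifunctor
  \<open>\<boxtimes>\<close>, right exact in each variable, such that precomposition with \<open>\<boxtimes>\<close> is an equivalence
  from the right exact linear functors \<open>T \<Rightarrow> E\<close> to the bilinear bifunctors
  \<open>C \<times> D \<Rightarrow> E\<close> right exact in each variable; the two clauses state that it is essentially
  surjective and fully faithful. The property is invariant under equivalences of
  \<open>E\<close>, so that letting \<open>E\<close> run through the categories of finite dimensional modules over
  finite dimensional algebras accounts for all finite categories, whatever their types.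
\<close>

definition deligne_product ::
  "('o1, 'm1, 'k::field, 'r1) lcat_scheme \<Rightarrow> ('o2, 'm2, 'k, 'r2) lcat_scheme \<Rightarrow>
   ('o3, 'm3, 'k, 'r3) lcat_scheme \<Rightarrow> ('o1 \<times> 'o2, 'm1 \<times> 'm2, 'o3, 'm3, 's) ftr_scheme \<Rightarrow> bool" where
  "deligne_product C D T bx \<longleftrightarrow> finite_category T \<and> right_exact_bifunctor C D T bx \<and>
     (\<forall>R :: 'k fd_alg. fd_algebra R \<longrightarrow>
        (\<forall>G :: ('o1 \<times> 'o2, 'm1 \<times> 'm2, 'k fd_mod, 'k fd_mod \<times> 'k mat \<times> 'k fd_mod) ftr.
           right_exact_bifunctor C D (Mod_cat R) G \<longrightarrow>
           (\<exists>H :: ('o3, 'm3, 'k fd_mod, 'k fd_mod \<times> 'k mat \<times> 'k fd_mod) ftr.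
              right_exact_functor T (Mod_cat R) H \<and>
              (\<exists>\<eta>. nat_iso (prod_cat C D) (Mod_cat R) (comp_ftr H bx) G \<eta>))) \<and>
        (\<forall>(H :: ('o3, 'm3, 'k fd_mod, 'k fd_mod \<times> 'k mat \<times> 'k fd_mod) ftr)
          (H' :: ('o3, 'm3, 'k fd_mod, 'k fd_mod \<times> 'k mat \<times> 'k fd_mod) ftr) \<theta>.
           right_exact_functor T (Mod_cat R) H \<and> right_exact_functor T (Mod_cat R) H' \<and>
           nat_trans (prod_cat C D) (Mod_cat R) (comp_ftr H bx) (comp_ftr H' bx) \<theta> \<longrightarrow>
           (\<exists>!\<eta>. \<eta> \<in> extensional (Ob T) \<and> nat_trans T (Mod_cat R) H H' \<eta> \<and>
              (\<forall>X \<in> Ob C. \<forall>Y \<in> Ob D. \<eta> (FOb bx (X, Y)) = \<theta> (X, Y)))))"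


section \<open>Monoidal categories\<close>

record ('o, 'm, 'k) moncat = "('o, 'm, 'k) lcat" +
  Tens :: "('o \<times> 'o, 'm \<times> 'm, 'o, 'm) ftr"
  Unit :: 'o
  Assoc :: "'o \<Rightarrow> 'o \<Rightarrow> 'o \<Rightarrow> 'm"
  LUnit :: "'o \<Rightarrow> 'm"
  RUnit :: "'o \<Rightarrow> 'm"

abbreviation tens_ob ::
  "('o, 'm, 'k, 'r) moncat_scheme \<Rightarrow> 'o \<Rightarrow> 'o \<Rightarrow> 'o" (infixr \<open>\<otimes>\<^sub>o\<index>\<close> 75) where
  "tens_ob C X Y \<equiv> FOb (Tens C) (X, Y)"

abbreviation tens_ar ::
  "('o, 'm, 'k, 'r) moncat_scheme \<Rightarrow> 'm \<Rightarrow> 'm \<Rightarrow> 'm" (infixr \<open>\<otimes>\<^sub>a\<index>\<close> 75) where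
  "tens_ar C f g \<equiv> FAr (Tens C) (f, g)"

locale monoidal_category = category C
  for C :: "('o, 'm, 'k, 'r) moncat_scheme" (structure) +
  assumes tens_functor: "is_functor (prod_cat C C) C (Tens C)"
    and unit_Ob: "Unit C \<in> Ob C"
    and assoc_Hom: "X \<in> Ob C \<Longrightarrow> Y \<in> Ob C \<Longrightarrow> Z \<in> Ob C
          \<Longrightarrow> Assoc C X Y Z \<in> Hom C ((X \<otimes>\<^sub>o Y) \<otimes>\<^sub>o Z) (X \<otimes>\<^sub>o (Y \<otimes>\<^sub>o Z))"
    and assoc_iso: "X \<in> Ob C \<Longrightarrow> Y \<in> Ob C \<Longrightarrow> Z \<in> Ob C \<Longrightarrow> is_iso C (Assoc C X Y Z)"
    and assoc_natural: "f \<in> Hom C X X' \<Longrightarrow> g \<in> Hom C Y Y' \<Longrightarrow> h \<in> Hom C Z Z'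
          \<Longrightarrow> Assoc C X' Y' Z' \<cdot> ((f \<otimes>\<^sub>a g) \<otimes>\<^sub>a h) = (f \<otimes>\<^sub>a (g \<otimes>\<^sub>a h)) \<cdot> Assoc C X Y Z"
    and lunit_Hom: "X \<in> Ob C \<Longrightarrow> LUnit C X \<in> Hom C (Unit C \<otimes>\<^sub>o X) X"
    and lunit_iso: "X \<in> Ob C \<Longrightarrow> is_iso C (LUnit C X)"
    and lunit_natural: "f \<in> Hom C X Y
          \<Longrightarrow> LUnit C Y \<cdot> (Idn C (Unit C) \<otimes>\<^sub>a f) = f \<cdot> LUnit C X"
    and runit_Hom: "X \<in> Ob C \<Longrightarrow> RUnit C X \<in> Hom C (X \<otimes>\<^sub>o Unit C) X"
    and runit_iso: "X \<in> Ob C \<Longrightarrow> is_iso C (RUnit C X)"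
    and runit_natural: "f \<in> Hom C X Y
          \<Longrightarrow> RUnit C Y \<cdot> (f \<otimes>\<^sub>a Idn C (Unit C)) = f \<cdot> RUnit C X"
    and pentagon: "W \<in> Ob C \<Longrightarrow> X \<in> Ob C \<Longrightarrow> Y \<in> Ob C \<Longrightarrow> Z \<in> Ob C
          \<Longrightarrow> Assoc C W X (Y \<otimes>\<^sub>o Z) \<cdot> Assoc C (W \<otimes>\<^sub>o X) Y Z =
              (Idn C W \<otimes>\<^sub>a Assoc C X Y Z) \<cdot> Assoc C W (X \<otimes>\<^sub>o Y) Z \<cdot> (Assoc C W X Y \<otimes>\<^sub>a Idn C Z)"
    and triangle: "X \<in> Ob C \<Longrightarrow> Y \<in> Ob C
          \<Longrightarrow> (Idn C X \<otimes>\<^sub>a LUnit C Y) \<cdot> Assoc C X (Unit C) Y = RUnit C X \<otimes>\<^sub>a Idn C Y"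

definition left_dual ::
  "('o, 'm, 'k, 'r) moncat_scheme \<Rightarrow> 'o \<Rightarrow> 'o \<Rightarrow> 'm \<Rightarrow> 'm \<Rightarrow> bool" where
  "left_dual C X X' ev coev \<longleftrightarrow> X \<in> Ob C \<and> X' \<in> Ob C \<and>
     ev \<in> Hom C (X' \<otimes>\<^sub>o\<^bsub>C\<^esub> X) (Unit C) \<and> coev \<in> Hom C (Unit C) (X \<otimes>\<^sub>o\<^bsub>C\<^esub> X') \<and>
     RUnit C X \<cdot>\<^bsub>C\<^esub> (Idn C X \<otimes>\<^sub>a\<^bsub>C\<^esub> ev) \<cdot>\<^bsub>C\<^esub> Assoc C X X' X \<cdot>\<^bsub>C\<^esub> (coev \<otimes>\<^sub>a\<^bsub>C\<^esub> Idn C X)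
       = LUnit C X \<and>
     LUnit C X' \<cdot>\<^bsub>C\<^esub> (ev \<otimes>\<^sub>a\<^bsub>C\<^esub> Idn C X') \<cdot>\<^bsub>C\<^esub> Inv C (Assoc C X' X X') \<cdot>\<^bsub>C\<^esub> (Idn C X' \<otimes>\<^sub>a\<^bsub>C\<^esub> coev)
       = RUnit C X'"

text \<open>\<open>Y\<close> is a right dual of \<open>X\<close> iff \<open>X\<close> is a left dual of \<open>Y\<close>.\<close>

definition rigid :: "('o, 'm, 'k, 'r) moncat_scheme \<Rightarrow> bool" where
  "rigid C \<longleftrightarrow> (\<forall>X \<in> Ob C. (\<exists>X' ev coev. left_dual C X X' ev coev) \<and>
                           (\<exists>X' ev coev. left_dual C X' X ev coev))"

definition finite_tensor_category :: "('o, 'm, 'k::field, 'r) moncat_scheme \<Rightarrow> bool" where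
  "finite_tensor_category C \<longleftrightarrow> finite_category C \<and> monoidal_category C \<and>
     bilinear_bifunctor C C C (Tens C) \<and> rigid C \<and>
     bij_betw (\<lambda>c. Scale C c (Idn C (Unit C))) UNIV (Hom C (Unit C) (Unit C))"

definition fusion_category :: "('o, 'm, 'k::field, 'r) moncat_scheme \<Rightarrow> bool" where
  "fusion_category C \<longleftrightarrow> finite_tensor_category C \<and> semisimple_category C"


section \<open>Monoidal functors\<close>

record ('o1, 'm1, 'o2, 'm2) mftr = "('o1, 'm1, 'o2, 'm2) ftr" +
  MTens :: "'o1 \<Rightarrow> 'o1 \<Rightarrow> 'm2"  \<comment> \<open>\<open>F X \<otimes> F Y \<rightarrow> F (X \<otimes> Y)\<close>\<close>
  MUnit :: 'm2                  \<comment> \<open>\<open>1 \<rightarrow> F 1\<close>\<close>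

definition monoidal_functor ::
  "('o1, 'm1, 'k1, 'r1) moncat_scheme \<Rightarrow> ('o2, 'm2, 'k2, 'r2) moncat_scheme \<Rightarrow>
   ('o1, 'm1, 'o2, 'm2, 's) mftr_scheme \<Rightarrow> bool" where
  "monoidal_functor C D F \<longleftrightarrow> is_functor C D F \<and>
     (\<forall>X \<in> Ob C. \<forall>Y \<in> Ob C.
        MTens F X Y \<in> Hom D (FOb F X \<otimes>\<^sub>o\<^bsub>D\<^esub> FOb F Y) (FOb F (X \<otimes>\<^sub>o\<^bsub>C\<^esub> Y)) \<and> is_iso D (MTens F X Y)) \<and>
     (\<forall>X X' Y Y'. \<forall>f \<in> Hom C X X'. \<forall>g \<in> Hom C Y Y'.
        MTens F X' Y' \<cdot>\<^bsub>D\<^esub> (FAr F f \<otimes>\<^sub>a\<^bsub>D\<^esub> FAr F g) = FAr F (f \<otimes>\<^sub>a\<^bsub>C\<^esub> g) \<cdot>\<^bsub>D\<^esub> MTens F X Y) \<and>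
     MUnit F \<in> Hom D (Unit D) (FOb F (Unit C)) \<and> is_iso D (MUnit F) \<and>
     (\<forall>X \<in> Ob C. \<forall>Y \<in> Ob C. \<forall>Z \<in> Ob C.
        FAr F (Assoc C X Y Z) \<cdot>\<^bsub>D\<^esub> MTens F (X \<otimes>\<^sub>o\<^bsub>C\<^esub> Y) Z \<cdot>\<^bsub>D\<^esub> (MTens F X Y \<otimes>\<^sub>a\<^bsub>D\<^esub> Idn D (FOb F Z)) =
        MTens F X (Y \<otimes>\<^sub>o\<^bsub>C\<^esub> Z) \<cdot>\<^bsub>D\<^esub> (Idn D (FOb F X) \<otimes>\<^sub>a\<^bsub>D\<^esub> MTens F Y Z)
          \<cdot>\<^bsub>D\<^esub> Assoc D (FOb F X) (FOb F Y) (FOb F Z)) \<and>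
     (\<forall>X \<in> Ob C.
        FAr F (LUnit C X) \<cdot>\<^bsub>D\<^esub> MTens F (Unit C) X \<cdot>\<^bsub>D\<^esub> (MUnit F \<otimes>\<^sub>a\<^bsub>D\<^esub> Idn D (FOb F X)) =
        LUnit D (FOb F X)) \<and>
     (\<forall>X \<in> Ob C.
        FAr F (RUnit C X) \<cdot>\<^bsub>D\<^esub> MTens F X (Unit C) \<cdot>\<^bsub>D\<^esub> (Idn D (FOb F X) \<otimes>\<^sub>a\<^bsub>D\<^esub> MUnit F) =
        RUnit D (FOb F X))"

definition comp_mftr ::
  "('o3, 'm3, 'k, 'r) lcat_scheme \<Rightarrow> ('o2, 'm2, 'o3, 'm3, 's) mftr_scheme \<Rightarrow>
   ('o1, 'm1, 'o2, 'm2, 't) mftr_scheme \<Rightarrow> ('o1, 'm1, 'o3, 'm3) mftr" where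
  "comp_mftr E F G =
     \<lparr>FOb = (\<lambda>X. FOb F (FOb G X)),
      FAr = (\<lambda>f. FAr F (FAr G f)),
      MTens = (\<lambda>X Y. FAr F (MTens G X Y) \<cdot>\<^bsub>E\<^esub> MTens F (FOb G X) (FOb G Y)),
      MUnit = FAr F (MUnit G) \<cdot>\<^bsub>E\<^esub> MUnit F\<rparr>"

definition monoidal_nat_iso ::
  "('o1, 'm1, 'k1, 'r1) moncat_scheme \<Rightarrow> ('o2, 'm2, 'k2, 'r2) moncat_scheme \<Rightarrow>
   ('o1, 'm1, 'o2, 'm2, 's) mftr_scheme \<Rightarrow> ('o1, 'm1, 'o2, 'm2, 't) mftr_scheme \<Rightarrow>
   ('o1 \<Rightarrow> 'm2) \<Rightarrow> bool" where
  "monoidal_nat_iso C D F G \<eta> \<longleftrightarrow> nat_iso C D F G \<eta> \<and>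
     (\<forall>X \<in> Ob C. \<forall>Y \<in> Ob C.
        \<eta> (X \<otimes>\<^sub>o\<^bsub>C\<^esub> Y) \<cdot>\<^bsub>D\<^esub> MTens F X Y = MTens G X Y \<cdot>\<^bsub>D\<^esub> (\<eta> X \<otimes>\<^sub>a\<^bsub>D\<^esub> \<eta> Y)) \<and>
     \<eta> (Unit C) \<cdot>\<^bsub>D\<^esub> MUnit F = MUnit G"

definition prod_moncat ::
  "('o1, 'm1, 'k, 'r1) moncat_scheme \<Rightarrow> ('o2, 'm2, 'k, 'r2) moncat_scheme \<Rightarrow>
   ('o1 \<times> 'o2, 'm1 \<times> 'm2, 'k) moncat" where
  "prod_moncat C D = lcat.extend (prod_cat C D) (moncat.fields
     \<lparr>FOb = (\<lambda>((X, Y), (X', Y')). (X \<otimes>\<^sub>o\<^bsub>C\<^esub> X', Y \<otimes>\<^sub>o\<^bsub>D\<^esub> Y')),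
      FAr = (\<lambda>((f, g), (f', g')). (f \<otimes>\<^sub>a\<^bsub>C\<^esub> f', g \<otimes>\<^sub>a\<^bsub>D\<^esub> g'))\<rparr>
     (Unit C, Unit D)
     (\<lambda>(X, Y) (X', Y') (X'', Y''). (Assoc C X X' X'', Assoc D Y Y' Y''))
     (\<lambda>(X, Y). (LUnit C X, LUnit D Y))
     (\<lambda>(X, Y). (RUnit C X, RUnit D Y)))"

text \<open>
  The Deligne tensor product of monoidal categories: the tensor product of \<open>T\<close> is bilinear and
  right exact in each variable, and satisfies
  \<open>(X \<boxtimes> Y) \<otimes> (X' \<boxtimes> Y') \<cong> (X \<otimes> X') \<boxtimes> (Y \<otimes> Y')\<close> coherently, which determines it.
\<close>

definition monoidal_deligne_product ::
  "('o1, 'm1, 'k::field, 'r1) moncat_scheme \<Rightarrow> ('o2, 'm2, 'k, 'r2) moncat_scheme \<Rightarrow>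
   ('o3, 'm3, 'k, 'r3) moncat_scheme \<Rightarrow> ('o1 \<times> 'o2, 'm1 \<times> 'm2, 'o3, 'm3) mftr \<Rightarrow> bool" where
  "monoidal_deligne_product C D T bx \<longleftrightarrow> deligne_product C D T bx \<and>
     monoidal_category T \<and> right_exact_bifunctor T T T (Tens T) \<and>
     monoidal_functor (prod_moncat C D) T bx"

text \<open>\<open>Z \<mapsto> 1 \<boxtimes> Z\<close> is monoidal through \<open>1 \<otimes> 1 \<cong> 1\<close>.\<close>

definition unit_box ::
  "('o1, 'm1, 'k, 'r1) moncat_scheme \<Rightarrow> ('o2, 'm2, 'k, 'r2) moncat_scheme \<Rightarrow>
   ('o3, 'm3, 'k, 'r3) moncat_scheme \<Rightarrow> ('o1 \<times> 'o2, 'm1 \<times> 'm2, 'o3, 'm3) mftr \<Rightarrow>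
   ('o2, 'm2, 'o3, 'm3) mftr" where
  "unit_box C D T bx =
     \<lparr>FOb = (\<lambda>Z. FOb bx (Unit C, Z)),
      FAr = (\<lambda>h. FAr bx (Idn C (Unit C), h)),
      MTens = (\<lambda>Z W. FAr bx (LUnit C (Unit C), Idn D (Z \<otimes>\<^sub>o\<^bsub>D\<^esub> W)) \<cdot>\<^bsub>T\<^esub> MTens bx (Unit C, Z) (Unit C, W)),
      MUnit = MUnit bx\<rparr>"


section \<open>The monoidal category of right exact endofunctors\<close>

text \<open>
  Arrows are triples \<open>(F, \<eta>, G)\<close> with \<open>\<eta>\<close> a natural transformation that is undefined outside
  the objects. The tensor product \<open>F \<otimes> G\<close> is the composition \<open>X \<mapsto> F (G X)\<close>.
\<close>

type_synonym ('o, 'm) endo = "('o, 'm, 'o, 'm) ftr"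
type_synonym ('o, 'm) endo_arrow = "('o, 'm) endo \<times> ('o \<Rightarrow> 'm) \<times> ('o, 'm) endo"

definition End_cat ::
  "('o, 'm, 'k) lcat \<Rightarrow> (('o, 'm) endo, ('o, 'm) endo_arrow, 'k) moncat" where
  "End_cat M =
     \<lparr>Ob = {F. right_exact_functor M M F},
      Ar = {(F, \<eta>, G). right_exact_functor M M F \<and> right_exact_functor M M G \<and>
              nat_trans M M F G \<eta> \<and> \<eta> \<in> extensional (Ob M)},
      Src = (\<lambda>(F, \<eta>, G). F),
      Tgt = (\<lambda>(F, \<eta>, G). G),
      Idn = (\<lambda>F. (F, \<lambda>X\<in>Ob M. Idn M (FOb F X), F)),
      Cmp = (\<lambda>(F', \<theta>, G') (F, \<eta>, G). (F, \<lambda>X\<in>Ob M. \<theta> X \<cdot>\<^bsub>M\<^esub> \<eta> X, G')),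
      Add = (\<lambda>(F, \<eta>, G) (F', \<theta>, G'). (F, \<lambda>X\<in>Ob M. Add M (\<eta> X) (\<theta> X), G)),
      Zero = (\<lambda>F G. (F, \<lambda>X\<in>Ob M. Zero M (FOb F X) (FOb G X), G)),
      Scale = (\<lambda>c (F, \<eta>, G). (F, \<lambda>X\<in>Ob M. Scale M c (\<eta> X), G)),
      Tens =
        \<lparr>FOb = (\<lambda>(F, G). comp_ftr F G),
         FAr = (\<lambda>((F, \<eta>, F'), (G, \<theta>, G')).
           (comp_ftr F G, \<lambda>X\<in>Ob M. \<eta> (FOb G' X) \<cdot>\<^bsub>M\<^esub> FAr F (\<theta> X), comp_ftr F' G'))\<rparr>,
      Unit = id_ftr,
      Assoc = (\<lambda>F G H. (comp_ftr (comp_ftr F G) H, \<lambda>X\<in>Ob M. Idn M (FOb F (FOb G (FOb H X))),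
                       comp_ftr F (comp_ftr G H))),
      LUnit = (\<lambda>F. (comp_ftr id_ftr F, \<lambda>X\<in>Ob M. Idn M (FOb F X), F)),
      RUnit = (\<lambda>F. (comp_ftr F id_ftr, \<lambda>X\<in>Ob M. Idn M (FOb F X), F))\<rparr>"


section \<open>Module categories\<close>

record ('ao, 'am, 'mo, 'mm) modstr =
  Act :: "('ao \<times> 'mo, 'am \<times> 'mm, 'mo, 'mm) ftr"
  MAssoc :: "'ao \<Rightarrow> 'ao \<Rightarrow> 'mo \<Rightarrow> 'mm"  \<comment> \<open>\<open>(X \<otimes> Y) \<otimes> M \<rightarrow> X \<otimes> (Y \<otimes> M)\<close>\<close>
  MLUnit :: "'mo \<Rightarrow> 'mm"                \<comment> \<open>\<open>1 \<otimes> M \<rightarrow> M\<close>\<close>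

abbreviation act_ob ::
  "('ao, 'am, 'mo, 'mm, 's) modstr_scheme \<Rightarrow> 'ao \<Rightarrow> 'mo \<Rightarrow> 'mo" (infixr \<open>\<rhd>\<^sub>o\<index>\<close> 75) where
  "act_ob S X m \<equiv> FOb (Act S) (X, m)"

abbreviation act_ar ::
  "('ao, 'am, 'mo, 'mm, 's) modstr_scheme \<Rightarrow> 'am \<Rightarrow> 'mm \<Rightarrow> 'mm" (infixr \<open>\<rhd>\<^sub>a\<index>\<close> 75) where
  "act_ar S f g \<equiv> FAr (Act S) (f, g)"

text \<open>
  Exactness of the action in the second variable is automatic over a rigid category; it is included
  so that the action functor visibly takes values in right exact endofunctors.
\<close>

locale module_category =
  fixes A :: "('ao, 'am, 'k::field) moncat"
    and M :: "('mo, 'mm, 'k) lcat"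
    and S :: "('ao, 'am, 'mo, 'mm) modstr"
  assumes finite_category: "finite_category M"
    and act_exact: "exact_bifunctor A M M (Act S)"
    and massoc_Hom: "X \<in> Ob A \<Longrightarrow> Y \<in> Ob A \<Longrightarrow> m \<in> Ob M
          \<Longrightarrow> MAssoc S X Y m \<in> Hom M ((X \<otimes>\<^sub>o\<^bsub>A\<^esub> Y) \<rhd>\<^sub>o\<^bsub>S\<^esub> m) (X \<rhd>\<^sub>o\<^bsub>S\<^esub> (Y \<rhd>\<^sub>o\<^bsub>S\<^esub> m))"
    and massoc_iso: "X \<in> Ob A \<Longrightarrow> Y \<in> Ob A \<Longrightarrow> m \<in> Ob M \<Longrightarrow> is_iso M (MAssoc S X Y m)"
    and massoc_natural: "f \<in> Hom A X X' \<Longrightarrow> g \<in> Hom A Y Y' \<Longrightarrow> h \<in> Hom M m m'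
          \<Longrightarrow> MAssoc S X' Y' m' \<cdot>\<^bsub>M\<^esub> ((f \<otimes>\<^sub>a\<^bsub>A\<^esub> g) \<rhd>\<^sub>a\<^bsub>S\<^esub> h) = (f \<rhd>\<^sub>a\<^bsub>S\<^esub> (g \<rhd>\<^sub>a\<^bsub>S\<^esub> h)) \<cdot>\<^bsub>M\<^esub> MAssoc S X Y m"
    and mlunit_Hom: "m \<in> Ob M \<Longrightarrow> MLUnit S m \<in> Hom M (Unit A \<rhd>\<^sub>o\<^bsub>S\<^esub> m) m"
    and mlunit_iso: "m \<in> Ob M \<Longrightarrow> is_iso M (MLUnit S m)"
    and mlunit_natural: "h \<in> Hom M m m'
          \<Longrightarrow> MLUnit S m' \<cdot>\<^bsub>M\<^esub> (Idn A (Unit A) \<rhd>\<^sub>a\<^bsub>S\<^esub> h) = h \<cdot>\<^bsub>M\<^esub> MLUnit S m"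
    and mpentagon: "X \<in> Ob A \<Longrightarrow> Y \<in> Ob A \<Longrightarrow> Z \<in> Ob A \<Longrightarrow> m \<in> Ob M
          \<Longrightarrow> MAssoc S X Y (Z \<rhd>\<^sub>o\<^bsub>S\<^esub> m) \<cdot>\<^bsub>M\<^esub> MAssoc S (X \<otimes>\<^sub>o\<^bsub>A\<^esub> Y) Z m =
              (Idn A X \<rhd>\<^sub>a\<^bsub>S\<^esub> MAssoc S Y Z m) \<cdot>\<^bsub>M\<^esub> MAssoc S X (Y \<otimes>\<^sub>o\<^bsub>A\<^esub> Z) m
                \<cdot>\<^bsub>M\<^esub> (Assoc A X Y Z \<rhd>\<^sub>a\<^bsub>S\<^esub> Idn M m)"
    and mtriangle: "X \<in> Ob A \<Longrightarrow> m \<in> Ob M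
          \<Longrightarrow> (Idn A X \<rhd>\<^sub>a\<^bsub>S\<^esub> MLUnit S m) \<cdot>\<^bsub>M\<^esub> MAssoc S X (Unit A) m = RUnit A X \<rhd>\<^sub>a\<^bsub>S\<^esub> Idn M m"

definition exact_module_category ::
  "('ao, 'am, 'k::field) moncat \<Rightarrow> ('mo, 'mm, 'k) lcat \<Rightarrow> ('ao, 'am, 'mo, 'mm) modstr \<Rightarrow> bool" where
  "exact_module_category A M S \<longleftrightarrow> module_category A M S \<and>
     (\<forall>P m. is_projective A P \<and> m \<in> Ob M \<longrightarrow> is_projective M (P \<rhd>\<^sub>o\<^bsub>S\<^esub> m))"

definition module_equivalence ::
  "('ao, 'am, 'k::field) moncat \<Rightarrow> ('o1, 'm1, 'k) lcat \<Rightarrow> ('ao, 'am, 'o1, 'm1) modstr \<Rightarrow>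
   ('o2, 'm2, 'k) lcat \<Rightarrow> ('ao, 'am, 'o2, 'm2) modstr \<Rightarrow>
   ('o1, 'm1, 'o2, 'm2) ftr \<Rightarrow> ('ao \<Rightarrow> 'o1 \<Rightarrow> 'm2) \<Rightarrow> bool" where
  "module_equivalence A M S N R \<Phi> s \<longleftrightarrow> is_equivalence M N \<Phi> \<and>
     (\<forall>X \<in> Ob A. \<forall>m \<in> Ob M.
        s X m \<in> Hom N (FOb \<Phi> (X \<rhd>\<^sub>o\<^bsub>S\<^esub> m)) (X \<rhd>\<^sub>o\<^bsub>R\<^esub> FOb \<Phi> m) \<and> is_iso N (s X m)) \<and>
     (\<forall>X X' m m'. \<forall>f \<in> Hom A X X'. \<forall>h \<in> Hom M m m'.
        s X' m' \<cdot>\<^bsub>N\<^esub> FAr \<Phi> (f \<rhd>\<^sub>a\<^bsub>S\<^esub> h) = (f \<rhd>\<^sub>a\<^bsub>R\<^esub> FAr \<Phi> h) \<cdot>\<^bsub>N\<^esub> s X m) \<and>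
     (\<forall>X \<in> Ob A. \<forall>Y \<in> Ob A. \<forall>m \<in> Ob M.
        (Idn A X \<rhd>\<^sub>a\<^bsub>R\<^esub> s Y m) \<cdot>\<^bsub>N\<^esub> s X (Y \<rhd>\<^sub>o\<^bsub>S\<^esub> m) \<cdot>\<^bsub>N\<^esub> FAr \<Phi> (MAssoc S X Y m) =
        MAssoc R X Y (FOb \<Phi> m) \<cdot>\<^bsub>N\<^esub> s (X \<otimes>\<^sub>o\<^bsub>A\<^esub> Y) m) \<and>
     (\<forall>m \<in> Ob M. MLUnit R (FOb \<Phi> m) \<cdot>\<^bsub>N\<^esub> s (Unit A) m = FAr \<Phi> (MLUnit S m))"

definition sum_modstr ::
  "('ao, 'am, 'o1, 'm1) modstr \<Rightarrow> ('ao, 'am, 'o2, 'm2) modstr \<Rightarrow>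
   ('ao, 'am, 'o1 \<times> 'o2, 'm1 \<times> 'm2) modstr" where
  "sum_modstr S R =
     \<lparr>Act = \<lparr>FOb = (\<lambda>(X, (m, n)). (X \<rhd>\<^sub>o\<^bsub>S\<^esub> m, X \<rhd>\<^sub>o\<^bsub>R\<^esub> n)),
             FAr = (\<lambda>(f, (g, h)). (f \<rhd>\<^sub>a\<^bsub>S\<^esub> g, f \<rhd>\<^sub>a\<^bsub>R\<^esub> h))\<rparr>,
      MAssoc = (\<lambda>X Y (m, n). (MAssoc S X Y m, MAssoc R X Y n)),
      MLUnit = (\<lambda>(m, n). (MLUnit S m, MLUnit R n))\<rparr>"

text \<open>
  The direct sum of \<open>M1\<close> and \<open>M2\<close> is \<open>prod_cat M1 M2\<close> with the componentwise action. Taking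
  \<open>M1\<close> and \<open>M2\<close> over the types of \<open>M\<close> is no restriction: if \<open>M\<close> is equivalent to a direct sum,
  the summands are equivalent to full subcategories of \<open>M\<close> closed under the action.
\<close>

definition indecomposable_module_category ::
  "('ao, 'am, 'k::field) moncat \<Rightarrow> ('mo, 'mm, 'k) lcat \<Rightarrow> ('ao, 'am, 'mo, 'mm) modstr \<Rightarrow> bool" where
  "indecomposable_module_category A M S \<longleftrightarrow> module_category A M S \<and>
     \<not> (\<exists>(M1 :: ('mo, 'mm, 'k) lcat) S1 (M2 :: ('mo, 'mm, 'k) lcat) S2 \<Phi> s.
          module_category A M1 S1 \<and> (\<exists>m \<in> Ob M1. \<not> is_zero_object M1 m) \<and>
          module_category A M2 S2 \<and> (\<exists>m \<in> Ob M2. \<not> is_zero_object M2 m) \<and>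
          module_equivalence A (prod_cat M1 M2) (sum_modstr S1 S2) M S \<Phi> s)"

text \<open>\<open>X \<mapsto> (m \<mapsto> X \<otimes> m)\<close>, with the inverses of the associativity and unit constraints of \<open>M\<close>.\<close>

definition action_functor ::
  "('ao, 'am, 'k) moncat \<Rightarrow> ('mo, 'mm, 'k) lcat \<Rightarrow> ('ao, 'am, 'mo, 'mm) modstr \<Rightarrow>
   ('ao, 'am, ('mo, 'mm) endo, ('mo, 'mm) endo_arrow) mftr" where
  "action_functor A M S =
     \<lparr>FOb = fix_fst A (Act S),
      FAr = (\<lambda>f. (fix_fst A (Act S) (Src A f), \<lambda>m\<in>Ob M. f \<rhd>\<^sub>a\<^bsub>S\<^esub> Idn M m, fix_fst A (Act S) (Tgt A f))),
      MTens = (\<lambda>X Y. (comp_ftr (fix_fst A (Act S) X) (fix_fst A (Act S) Y),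
                      \<lambda>m\<in>Ob M. Inv M (MAssoc S X Y m),
                      fix_fst A (Act S) (X \<otimes>\<^sub>o\<^bsub>A\<^esub> Y))),
      MUnit = (id_ftr, \<lambda>m\<in>Ob M. Inv M (MLUnit S m), fix_fst A (Act S) (Unit A))\<rparr>"


section \<open>Exact sequences with respect to a module category\<close>

definition in_image :: "('o2, 'm2, 'k, 'r) lcat_scheme \<Rightarrow> ('o1, 'm1, 'k, 'q) lcat_scheme \<Rightarrow>
    ('o1, 'm1, 'o2, 'm2, 's) ftr_scheme \<Rightarrow> 'o2 \<Rightarrow> bool" where
  "in_image D C F Y \<longleftrightarrow> Y \<in> Ob D \<and> (\<exists>X \<in> Ob C. isomorphic D Y (FOb F X))"

definition surjective_functor ::
  "('o1, 'm1, 'k, 'r1) lcat_scheme \<Rightarrow> ('o2, 'm2, 'k, 'r2) lcat_scheme \<Rightarrow>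
   ('o1, 'm1, 'o2, 'm2, 's) ftr_scheme \<Rightarrow> bool" where
  "surjective_functor B T F \<longleftrightarrow>
     (\<forall>Y \<in> Ob T. \<exists>X \<in> Ob B. \<exists>i q. is_mono T i \<and> Tgt T i = FOb F X \<and>
                  is_epi T q \<and> Src T q = Src T i \<and> Tgt T q = Y)"

text \<open>
  In the following, \<open>E\<close> is the predicate that an object of \<open>T\<close> lies in the full subcategory
  \<open>End(M)\<close>, i.e. is isomorphic to some \<open>1 \<boxtimes> Z\<close>.
\<close>

definition normal_sub ::
  "('o1, 'm1, 'k, 'r1) lcat_scheme \<Rightarrow> ('o2, 'm2, 'k, 'r2) lcat_scheme \<Rightarrow> ('o2 \<Rightarrow> bool) \<Rightarrow>
   ('o1, 'm1, 'o2, 'm2, 's) ftr_scheme \<Rightarrow> bool" where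
  "normal_sub B T E F \<longleftrightarrow>
     (\<forall>X \<in> Ob B. \<exists>X0. \<exists>i \<in> Hom B X0 X. is_mono B i \<and>
        is_mono T (FAr F i) \<and> E (FOb F X0) \<and>
        (\<forall>j. is_mono T j \<and> Tgt T j = FOb F X \<and> E (Src T j) \<longrightarrow>
           (\<exists>u \<in> Hom T (Src T j) (FOb F X0). FAr F i \<cdot>\<^bsub>T\<^esub> u = j)))"

definition normal_quot ::
  "('o1, 'm1, 'k, 'r1) lcat_scheme \<Rightarrow> ('o2, 'm2, 'k, 'r2) lcat_scheme \<Rightarrow> ('o2 \<Rightarrow> bool) \<Rightarrow>
   ('o1, 'm1, 'o2, 'm2, 's) ftr_scheme \<Rightarrow> bool" where
  "normal_quot B T E F \<longleftrightarrow>
     (\<forall>X \<in> Ob B. \<exists>X0. \<exists>q \<in> Hom B X X0. is_epi B q \<and>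
        is_epi T (FAr F q) \<and> E (FOb F X0) \<and>
        (\<forall>r. is_epi T r \<and> Src T r = FOb F X \<and> E (Tgt T r) \<longrightarrow>
           (\<exists>u \<in> Hom T (FOb F X0) (Tgt T r). u \<cdot>\<^bsub>T\<^esub> FAr F q = r)))"

text \<open>
  \<open>T\<close> with \<open>bx\<close> is a Deligne product of \<open>C\<close> and \<open>End_cat M\<close>. The last clause of the first group
  says that the restriction of \<open>F\<close> to \<open>A\<close> is the action functor. \<open>A\<close> is regarded as a full
  subcategory of \<open>B\<close>, closed under isomorphism, when it is compared with the kernel.
  Normality may be given in either of its two (equivalent) forms.
\<close>

definition exact_sequence_wrt ::
  "('ao, 'am, 'k::field) moncat \<Rightarrow> ('bo, 'bm, 'k) moncat \<Rightarrow> ('co, 'cm, 'k) moncat \<Rightarrow>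
   ('mo, 'mm, 'k) lcat \<Rightarrow> ('ao, 'am, 'mo, 'mm) modstr \<Rightarrow>
   ('to, 'tm, 'k) moncat \<Rightarrow>
   ('co \<times> ('mo, 'mm) endo, 'cm \<times> ('mo, 'mm) endo_arrow, 'to, 'tm) mftr \<Rightarrow>
   ('ao, 'am, 'bo, 'bm) mftr \<Rightarrow> ('bo, 'bm, 'to, 'tm) mftr \<Rightarrow> bool" where
  "exact_sequence_wrt A B C M S T bx \<iota> F \<longleftrightarrow>
     (monoidal_deligne_product C (End_cat M) T bx \<and>
      monoidal_functor A B \<iota> \<and> exact_functor A B \<iota> \<and> fully_faithful A B \<iota> \<and>
      monoidal_functor B T F \<and> exact_functor B T F \<and>
      (\<exists>\<eta>. monoidal_nat_iso A T (comp_mftr T F \<iota>)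
             (comp_mftr T (unit_box C (End_cat M) T bx) (action_functor A M S)) \<eta>)) \<and>
     (let E = in_image T (End_cat M) (unit_box C (End_cat M) T bx)
      in surjective_functor B T F \<and>
         (\<forall>X \<in> Ob B. in_image B A \<iota> X \<longleftrightarrow> E (FOb F X)) \<and>
         (normal_sub B T E F \<or> normal_quot B T E F))"

end

theory Submission
  imports Defs "Jordan_Normal_Form.Char_Poly"
begin

text \<open>
  A finite tensor category is semisimple as soon as every epi in it splits, and rigidity reduces this
  to epis onto the unit object. If \<open>Y'\<close> is a left dual of \<open>Y\<close>, then a section of \<open>e: X \<rightarrow> Y\<close> is the
  same thing as a lift of the coevaluation \<open>1 \<rightarrow> Y \<otimes> Y'\<close> along \<open>e \<otimes> Y'\<close>
  (\<open>section_from_coev_lift\<close>), and such a lift comes from a section of the pullback of \<open>e \<otimes> Y'\<close> along the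
  coevaluation, which is an arrow \<open>q: X' \<rightarrow> 1\<close>. In \<open>T = C \<boxtimes> End(M)\<close> the image \<open>F q\<close> is again a pullback of
  an epi, hence an epi onto \<open>F 1\<close>.
  
  Suppose that \<open>F q\<close> has a section. If \<open>F\<close> is normal with respect to subobjects, the section factors through
  \<open>F X0\<close> for a subobject \<open>X0\<close> of \<open>X'\<close> that lies in \<open>A\<close>. The composite \<open>y: X0 \<rightarrow> 1\<close> is an arrow of the semisimple
  category \<open>A\<close>, so \<open>y g y = y\<close> for some \<open>g\<close>. As \<open>End(1) = k\<close>, the arrow \<open>y g\<close> is a scalar, and this scalar is
  not \<open>0\<close> because \<open>F y\<close> has a section; so \<open>y\<close> and therefore \<open>q\<close> have sections (\<open>unit_section_sub\<close>). If \<open>F\<close>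
  is normal with respect to quotients, the same argument splits arrows out of \<open>1\<close>
  (\<open>unit_retraction_quot\<close>), and duality exchanges arrows into and out of \<open>1\<close>. This breaks down only if
  \<open>F 1 = 0\<close>, which happens for \<open>M = 0\<close>. Then \<open>F = 0\<close>, so all of \<open>B\<close> is in the kernel and \<open>B\<close> is
  equivalent to \<open>A\<close> (\<open>regular_if_F_unit_zero\<close>).
  
  What remains is that every epi of \<open>T\<close> onto \<open>F 1\<close>, which is isomorphic to \<open>1 \<boxtimes> Id\<close>, splits. Nothing is known
  about \<open>T\<close> beyond the universal property of the Deligne product, and the lemma \<open>epi_onto_box_splits\<close> extracts
  the claim from it. Let \<open>Z1\<close> and \<open>Z2\<close> be objects of \<open>C\<close> and \<open>D = End(M)\<close>. If the bifunctor
  \<open>Hom(Z1, -) \<otimes> Hom(Z2, -)\<close> is right exact, it extends to a right exact functor \<open>H\<close> from \<open>T\<close> to vector spaces, and the maps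
  \<open>a \<otimes> b \<mapsto> a \<boxtimes> b\<close> extend to a natural transformation \<open>H(W) \<otimes> (Z1 \<boxtimes> Z2) \<rightarrow> W\<close>. For an epi \<open>e: W \<rightarrow> Z1 \<boxtimes> Z2\<close>
  the map \<open>H(e)\<close> is onto; a preimage in \<open>H(W)\<close> of the element \<open>id \<otimes> id\<close> is sent to a section of \<open>e\<close>.
  
  The bifunctor is right exact because \<open>C\<close> and \<open>D\<close> are von Neumann regular: every arrow \<open>f\<close> has a \<open>g\<close>
  with \<open>f g f = f\<close>. Then all cokernels are split, and every linear functor preserves them. For \<open>C\<close> regularity
  is a form of semisimplicity. For \<open>D\<close>, note that \<open>M\<close> is semisimple, because each of its objects \<open>m\<close> is isomorphic to \<open>1 \<rhd> m\<close> and
  hence projective. Natural transformations between endofunctors of \<open>M\<close> are given by their components at simple objects, and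
  by Schur's lemma the choices of \<open>g\<close> at these components can be made naturally (\<open>End_regular\<close>).
\<close>

section \<open>Arrows of linear categories\<close>

text \<open>
  The rules below speak of \<open>Ar\<close>, \<open>Src\<close> and \<open>Tgt\<close> rather than of hom-sets: in \<open>cmp_Hom\<close> the middle
  object is not determined by the conclusion, whereas the condition \<open>Src C g = Tgt C f\<close> lets the simplifier decide
  composability.
\<close>

context category
begin

lemma arr_cmp [simp]: "f \<in> Ar C \<Longrightarrow> g \<in> Ar C \<Longrightarrow> Src C g = Tgt C f \<Longrightarrow> g \<cdot> f \<in> Ar C"
  and src_cmp [simp]: "f \<in> Ar C \<Longrightarrow> g \<in> Ar C \<Longrightarrow> Src C g = Tgt C f \<Longrightarrow> Src C (g \<cdot> f) = Src C f"
  and tgt_cmp [simp]: "f \<in> Ar C \<Longrightarrow> g \<in> Ar C \<Longrightarrow> Src C g = Tgt C f \<Longrightarrow> Tgt C (g \<cdot> f) = Tgt C g"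
  using cmp_Hom[of f "Src C f" "Tgt C f" g "Tgt C g"] by (auto simp: Hom_def)

lemma arr_idn [simp]: "X \<in> Ob C \<Longrightarrow> Idn C X \<in> Ar C"
  and src_idn [simp]: "X \<in> Ob C \<Longrightarrow> Src C (Idn C X) = X"
  and tgt_idn [simp]: "X \<in> Ob C \<Longrightarrow> Tgt C (Idn C X) = X"
  using idn_Hom by (auto simp: Hom_def)

lemma idn_cmp [simp]: "f \<in> Ar C \<Longrightarrow> Tgt C f = Y \<Longrightarrow> Idn C Y \<cdot> f = f"
  using cmp_idn_left by (auto simp: Hom_def)

lemma cmp_idn [simp]: "f \<in> Ar C \<Longrightarrow> Src C f = X \<Longrightarrow> f \<cdot> Idn C X = f"
  using cmp_idn_right by (auto simp: Hom_def)

lemma assoc [simp]: "f \<in> Ar C \<Longrightarrow> g \<in> Ar C \<Longrightarrow> h \<in> Ar C \<Longrightarrow> Src C g = Tgt C f \<Longrightarrow> Src C h = Tgt C g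
    \<Longrightarrow> (h \<cdot> g) \<cdot> f = h \<cdot> (g \<cdot> f)"
  using cmp_assoc by (auto simp: Hom_def)

declare src_Ob [simp] tgt_Ob [simp]

text \<open>
  Composites are normalised by moving the brackets to the right; this rule applies an equation for
  \<open>g \<cdot> f\<close> inside such a normal form.
\<close>

lemma rewrite_pair: "g \<cdot> f = h \<Longrightarrow> x \<in> Ar C \<Longrightarrow> f \<in> Ar C \<Longrightarrow> g \<in> Ar C \<Longrightarrow> Src C f = Tgt C x
    \<Longrightarrow> Src C g = Tgt C f \<Longrightarrow> g \<cdot> (f \<cdot> x) = h \<cdot> x"
  using assoc by metis

lemma inverse_arrowsD:
  assumes "inverse_arrows C f g"
  shows "f \<in> Ar C" "g \<in> Ar C" "Src C g = Tgt C f" "Tgt C g = Src C f"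
    "g \<cdot> f = Idn C (Src C f)" "f \<cdot> g = Idn C (Tgt C f)"
  using assms by (auto simp: inverse_arrows_def Hom_def)

lemma Inv_inverse: assumes "is_iso C f" shows "inverse_arrows C f (Inv C f)"
proof -
  obtain g where g: "inverse_arrows C f g" using assms by (auto simp: is_iso_def)
  have "h = g" if "inverse_arrows C f h" for h
  proof -
    note h = inverse_arrowsD[OF that] and g = inverse_arrowsD[OF g]
    have "h = h \<cdot> (f \<cdot> g)" using h g by simp
    also have "\<dots> = (h \<cdot> f) \<cdot> g" using h g by (subst assoc) auto
    finally show ?thesis using h g by simp
  qed
  then have "Inv C f = g" using g unfolding Inv_def by blast
  then show ?thesis using g by simp
qed

lemmas Inv_simps [simp] = inverse_arrowsD(2-6)[OF Inv_inverse]

lemma iso_arr: "is_iso C f \<Longrightarrow> f \<in> Ar C"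
  using Inv_inverse inverse_arrowsD by blast

lemma iso_idn: "X \<in> Ob C \<Longrightarrow> is_iso C (Idn C X)"
  unfolding is_iso_def inverse_arrows_def by (rule exI[of _ "Idn C X"]) (auto simp: Hom_def)

lemma isoI: "f \<in> Ar C \<Longrightarrow> g \<in> Ar C \<Longrightarrow> Src C g = Tgt C f \<Longrightarrow> Tgt C g = Src C f \<Longrightarrow>
    g \<cdot> f = Idn C (Src C f) \<Longrightarrow> f \<cdot> g = Idn C (Tgt C f) \<Longrightarrow> is_iso C f"
  unfolding is_iso_def inverse_arrows_def by (auto simp: Hom_def)

lemma iso_Inv: "is_iso C f \<Longrightarrow> is_iso C (Inv C f)"
  by (rule isoI[where g = f]) (auto intro: iso_arr)

lemma iso_cmp: assumes f: "is_iso C f" and g: "is_iso C g" and fg: "Src C g = Tgt C f" shows "is_iso C (g \<cdot> f)"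
proof (rule isoI[where g = "Inv C f \<cdot> Inv C g"])
  note a = iso_arr[OF f] iso_arr[OF g] Inv_simps[OF f] Inv_simps[OF g]
  show "(Inv C f \<cdot> Inv C g) \<cdot> (g \<cdot> f) = Idn C (Src C (g \<cdot> f))"
    using a fg rewrite_pair[OF a(11), of f] by simp
  show "(g \<cdot> f) \<cdot> (Inv C f \<cdot> Inv C g) = Idn C (Tgt C (g \<cdot> f))"
    using a fg rewrite_pair[OF a(7), of "Inv C g"] by simp
qed (use f g fg in \<open>simp_all add: iso_arr\<close>)

lemma split_mono_is_mono:
  assumes "i \<in> Ar C" "r \<in> Ar C" "Src C r = Tgt C i" "Tgt C r = Src C i" "r \<cdot> i = Idn C (Src C i)"
  shows "is_mono C i"
  unfolding is_mono_def
proof (intro conjI allI ballI impI)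
  fix W g h assume g: "g \<in> Hom C W (Src C i)" and h: "h \<in> Hom C W (Src C i)" and eq: "i \<cdot> g = i \<cdot> h"
  have "(r \<cdot> i) \<cdot> g = (r \<cdot> i) \<cdot> h" using assms(1-4) g h eq by (subst (1 2) assoc) (auto simp: Hom_def)
  then show "g = h" using assms g h by (auto simp: Hom_def)
qed (rule assms)

lemma split_epi_is_epi:
  assumes "q \<in> Ar C" "s \<in> Ar C" "Src C s = Tgt C q" "Tgt C s = Src C q" "q \<cdot> s = Idn C (Tgt C q)"
  shows "is_epi C q"
  unfolding is_epi_def
proof (intro conjI allI ballI impI)
  fix W g h assume g: "g \<in> Hom C (Tgt C q) W" and h: "h \<in> Hom C (Tgt C q) W" and eq: "g \<cdot> q = h \<cdot> q"
  have "(g \<cdot> q) \<cdot> s = (h \<cdot> q) \<cdot> s" using eq by simp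
  then have "g \<cdot> (q \<cdot> s) = h \<cdot> (q \<cdot> s)" using assms(1-4) g h by (auto simp: Hom_def)
  then show "g = h" using assms g h by (auto simp: Hom_def)
qed (rule assms)

lemma monoD: "is_mono C i \<Longrightarrow> g \<in> Ar C \<Longrightarrow> h \<in> Ar C \<Longrightarrow> Tgt C g = Src C i \<Longrightarrow> Tgt C h = Src C i
    \<Longrightarrow> Src C g = Src C h \<Longrightarrow> i \<cdot> g = i \<cdot> h \<Longrightarrow> g = h"
  unfolding is_mono_def Hom_def by blast

lemma epiD: "is_epi C q \<Longrightarrow> g \<in> Ar C \<Longrightarrow> h \<in> Ar C \<Longrightarrow> Src C g = Tgt C q \<Longrightarrow> Src C h = Tgt C q
    \<Longrightarrow> Tgt C g = Tgt C h \<Longrightarrow> g \<cdot> q = h \<cdot> q \<Longrightarrow> g = h"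
  unfolding is_epi_def Hom_def by blast

lemma mono_arr: "is_mono C i \<Longrightarrow> i \<in> Ar C" and epi_arr: "is_epi C q \<Longrightarrow> q \<in> Ar C"
  by (auto simp: is_mono_def is_epi_def)

lemma mono_cmp: assumes "is_mono C i" "is_mono C j" "Src C i = Tgt C j" shows "is_mono C (i \<cdot> j)"
  unfolding is_mono_def
proof (intro conjI allI ballI impI)
  note a = mono_arr[OF assms(1)] mono_arr[OF assms(2)]
  show "i \<cdot> j \<in> Ar C" using a assms(3) by simp
  fix W g h assume g: "g \<in> Hom C W (Src C (i \<cdot> j))" and h: "h \<in> Hom C W (Src C (i \<cdot> j))"
    and eq: "(i \<cdot> j) \<cdot> g = (i \<cdot> j) \<cdot> h"
  have "i \<cdot> (j \<cdot> g) = i \<cdot> (j \<cdot> h)" using a g h eq assms(3) by (auto simp: Hom_def)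
  then have "j \<cdot> g = j \<cdot> h" by (rule monoD[OF assms(1), rotated -1]) (use a g h assms(3) in \<open>auto simp: Hom_def\<close>)
  then show "g = h" by (rule monoD[OF assms(2), rotated -1]) (use a g h assms(3) in \<open>auto simp: Hom_def\<close>)
qed

lemma epi_cmp: assumes "is_epi C p" "is_epi C q" "Src C p = Tgt C q" shows "is_epi C (p \<cdot> q)"
  unfolding is_epi_def
proof (intro conjI allI ballI impI)
  note a = epi_arr[OF assms(1)] epi_arr[OF assms(2)]
  show "p \<cdot> q \<in> Ar C" using a assms(3) by simp
  fix W g h assume g: "g \<in> Hom C (Tgt C (p \<cdot> q)) W" and h: "h \<in> Hom C (Tgt C (p \<cdot> q)) W"
    and eq: "g \<cdot> (p \<cdot> q) = h \<cdot> (p \<cdot> q)"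
  have "(g \<cdot> p) \<cdot> q = (h \<cdot> p) \<cdot> q" using a g h eq assms(3) by (auto simp: Hom_def)
  then have "g \<cdot> p = h \<cdot> p" by (rule epiD[OF assms(2), rotated -1]) (use a g h assms(3) in \<open>auto simp: Hom_def\<close>)
  then show "g = h" by (rule epiD[OF assms(1), rotated -1]) (use a g h assms(3) in \<open>auto simp: Hom_def\<close>)
qed

lemma iso_is_mono: "is_iso C f \<Longrightarrow> is_mono C f"
  by (rule split_mono_is_mono[where r = "Inv C f"]) (auto intro: iso_arr)

lemma iso_is_epi: "is_iso C f \<Longrightarrow> is_epi C f"
  by (rule split_epi_is_epi[where s = "Inv C f"]) (auto intro: iso_arr)

lemma epi_right_factor:
  assumes "is_epi C (p \<cdot> q)" "p \<in> Ar C" "q \<in> Ar C" "Src C p = Tgt C q"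
  shows "is_epi C p"
  unfolding is_epi_def
proof (intro conjI allI ballI impI)
  fix W g h assume g: "g \<in> Hom C (Tgt C p) W" and h: "h \<in> Hom C (Tgt C p) W" and eq: "g \<cdot> p = h \<cdot> p"
  have "(g \<cdot> p) \<cdot> q = (h \<cdot> p) \<cdot> q" using eq by simp
  then have "g \<cdot> (p \<cdot> q) = h \<cdot> (p \<cdot> q)" using assms(2-4) g h by (auto simp: Hom_def)
  then show "g = h" by (rule epiD[OF assms(1), rotated -1]) (use g h assms in \<open>auto simp: Hom_def\<close>)
qed (rule assms)

end

text \<open>
  Von Neumann regularity, i.e. every arrow has a generalised inverse. For an abelian category it means that all
  short exact sequences split, but it makes sense, and is easy to verify, for categories of functors that are
  not known to be abelian.
\<close>
definition regular_category :: "('o, 'm, 'k, 'r) lcat_scheme \<Rightarrow> bool" where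
  "regular_category C \<longleftrightarrow> (\<forall>f \<in> Ar C. \<exists>g \<in> Hom C (Tgt C f) (Src C f). f \<cdot>\<^bsub>C\<^esub> (g \<cdot>\<^bsub>C\<^esub> f) = f)"

definition epis_split :: "('o, 'm, 'k, 'r) lcat_scheme \<Rightarrow> bool" where
  "epis_split C \<longleftrightarrow> (\<forall>e. is_epi C e \<longrightarrow> (\<exists>s \<in> Hom C (Tgt C e) (Src C e). e \<cdot>\<^bsub>C\<^esub> s = Idn C (Tgt C e)))"

definition monos_split :: "('o, 'm, 'k, 'r) lcat_scheme \<Rightarrow> bool" where
  "monos_split C \<longleftrightarrow> (\<forall>i. is_mono C i \<longrightarrow> (\<exists>r \<in> Hom C (Tgt C i) (Src C i). r \<cdot>\<^bsub>C\<^esub> i = Idn C (Src C i)))"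

definition Sub :: "('o, 'm, 'k::field, 'r) lcat_scheme \<Rightarrow> 'm \<Rightarrow> 'm \<Rightarrow> 'm" where
  "Sub C f g = Add C f (Scale C (-1) g)"

context linear_category
begin

lemma arr_zero [simp]: "X \<in> Ob C \<Longrightarrow> Y \<in> Ob C \<Longrightarrow> Zero C X Y \<in> Ar C"
  and src_zero [simp]: "X \<in> Ob C \<Longrightarrow> Y \<in> Ob C \<Longrightarrow> Src C (Zero C X Y) = X"
  and tgt_zero [simp]: "X \<in> Ob C \<Longrightarrow> Y \<in> Ob C \<Longrightarrow> Tgt C (Zero C X Y) = Y"
  using zero_Hom by (auto simp: Hom_def)

lemma arr_add [simp]: "f \<in> Ar C \<Longrightarrow> g \<in> Ar C \<Longrightarrow> Src C g = Src C f \<Longrightarrow> Tgt C g = Tgt C f \<Longrightarrow> Add C f g \<in> Ar C"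
  and src_add [simp]: "f \<in> Ar C \<Longrightarrow> g \<in> Ar C \<Longrightarrow> Src C g = Src C f \<Longrightarrow> Tgt C g = Tgt C f \<Longrightarrow> Src C (Add C f g) = Src C f"
  and tgt_add [simp]: "f \<in> Ar C \<Longrightarrow> g \<in> Ar C \<Longrightarrow> Src C g = Src C f \<Longrightarrow> Tgt C g = Tgt C f \<Longrightarrow> Tgt C (Add C f g) = Tgt C f"
  using add_Hom[of f "Src C f" "Tgt C f" g] by (auto simp: Hom_def)

lemma arr_scale [simp]: "f \<in> Ar C \<Longrightarrow> Scale C c f \<in> Ar C"
  and src_scale [simp]: "f \<in> Ar C \<Longrightarrow> Src C (Scale C c f) = Src C f"
  and tgt_scale [simp]: "f \<in> Ar C \<Longrightarrow> Tgt C (Scale C c f) = Tgt C f"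
  using scale_Hom[of f "Src C f" "Tgt C f"] by (auto simp: Hom_def)

lemma arr_sub [simp]: "f \<in> Ar C \<Longrightarrow> g \<in> Ar C \<Longrightarrow> Src C g = Src C f \<Longrightarrow> Tgt C g = Tgt C f \<Longrightarrow> Sub C f g \<in> Ar C"
  and src_sub [simp]: "f \<in> Ar C \<Longrightarrow> g \<in> Ar C \<Longrightarrow> Src C g = Src C f \<Longrightarrow> Tgt C g = Tgt C f \<Longrightarrow> Src C (Sub C f g) = Src C f"
  and tgt_sub [simp]: "f \<in> Ar C \<Longrightarrow> g \<in> Ar C \<Longrightarrow> Src C g = Src C f \<Longrightarrow> Tgt C g = Tgt C f \<Longrightarrow> Tgt C (Sub C f g) = Tgt C f"
  unfolding Sub_def by simp_all

lemma scale_zero_left: "f \<in> Ar C \<Longrightarrow> Scale C 0 f = Zero C (Src C f) (Tgt C f)"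
  using scale_add_left[of f "Src C f" "Tgt C f" 1 "-1"] add_minus[of f "Src C f" "Tgt C f"]
    scale_one[of f "Src C f" "Tgt C f"]
  by (auto simp: Hom_def)

lemma cmp_zero [simp]: "f \<in> Ar C \<Longrightarrow> W \<in> Ob C \<Longrightarrow> Src C f = X \<Longrightarrow> f \<cdot> Zero C W X = Zero C W (Tgt C f)"
proof -
  assume a: "f \<in> Ar C" "W \<in> Ob C" "Src C f = X"
  then have X: "X \<in> Ob C" by auto
  with a have "f \<cdot> Scale C 0 (Zero C W X) = Scale C 0 (f \<cdot> Zero C W X)"
    by (intro cmp_scale_right) (auto simp: Hom_def)
  then show ?thesis using a X by (simp add: scale_zero_left)
qed

lemma zero_cmp [simp]: "f \<in> Ar C \<Longrightarrow> W \<in> Ob C \<Longrightarrow> Tgt C f = X \<Longrightarrow> Zero C X W \<cdot> f = Zero C (Src C f) W"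
proof -
  assume a: "f \<in> Ar C" "W \<in> Ob C" "Tgt C f = X"
  then have X: "X \<in> Ob C" by auto
  with a have "Scale C 0 (Zero C X W) \<cdot> f = Scale C 0 (Zero C X W \<cdot> f)"
    by (intro cmp_scale_left) (auto simp: Hom_def)
  then show ?thesis using a X by (simp add: scale_zero_left)
qed

lemma add_zero_right [simp]: "f \<in> Ar C \<Longrightarrow> X = Src C f \<Longrightarrow> Y = Tgt C f \<Longrightarrow> Add C f (Zero C X Y) = f"
  using add_zero by (auto simp: Hom_def)

lemma add_zero_left [simp]: "f \<in> Ar C \<Longrightarrow> X = Src C f \<Longrightarrow> Y = Tgt C f \<Longrightarrow> Add C (Zero C X Y) f = f"
  using add_zero add_commute[of f X Y "Zero C X Y"] zero_Hom[of X Y] by (auto simp: Hom_def)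

lemma cmp_add [simp]: "f \<in> Ar C \<Longrightarrow> g \<in> Ar C \<Longrightarrow> Src C g = Src C f \<Longrightarrow> Tgt C g = Tgt C f \<Longrightarrow> h \<in> Ar C \<Longrightarrow> Src C h = Tgt C f
    \<Longrightarrow> h \<cdot> Add C f g = Add C (h \<cdot> f) (h \<cdot> g)"
  using cmp_add_right by (auto simp: Hom_def)

lemma add_cmp [simp]: "f \<in> Ar C \<Longrightarrow> g \<in> Ar C \<Longrightarrow> Src C g = Src C f \<Longrightarrow> Tgt C g = Tgt C f \<Longrightarrow> h \<in> Ar C \<Longrightarrow> Tgt C h = Src C f
    \<Longrightarrow> Add C f g \<cdot> h = Add C (f \<cdot> h) (g \<cdot> h)"
  using cmp_add_left by (auto simp: Hom_def)

lemma cmp_scale [simp]: "f \<in> Ar C \<Longrightarrow> h \<in> Ar C \<Longrightarrow> Src C h = Tgt C f \<Longrightarrow> h \<cdot> Scale C c f = Scale C c (h \<cdot> f)"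
  using cmp_scale_right by (auto simp: Hom_def)

lemma scale_cmp [simp]: "f \<in> Ar C \<Longrightarrow> h \<in> Ar C \<Longrightarrow> Src C f = Tgt C h \<Longrightarrow> Scale C c f \<cdot> h = Scale C c (f \<cdot> h)"
  using cmp_scale_left by (auto simp: Hom_def)

lemma scale_scale' [simp]: "f \<in> Ar C \<Longrightarrow> Scale C c (Scale C d f) = Scale C (c * d) f"
  using scale_scale by (auto simp: Hom_def)

lemma scale_one' [simp]: "f \<in> Ar C \<Longrightarrow> Scale C 1 f = f"
  using scale_one by (auto simp: Hom_def)

lemma cmp_sub: "f \<in> Ar C \<Longrightarrow> g \<in> Ar C \<Longrightarrow> Src C g = Src C f \<Longrightarrow> Tgt C g = Tgt C f \<Longrightarrow> h \<in> Ar C \<Longrightarrow> Src C h = Tgt C f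
    \<Longrightarrow> h \<cdot> Sub C f g = Sub C (h \<cdot> f) (h \<cdot> g)"
  by (simp add: Sub_def)

lemma sub_cmp: "f \<in> Ar C \<Longrightarrow> g \<in> Ar C \<Longrightarrow> Src C g = Src C f \<Longrightarrow> Tgt C g = Tgt C f \<Longrightarrow> h \<in> Ar C \<Longrightarrow> Tgt C h = Src C f
    \<Longrightarrow> Sub C f g \<cdot> h = Sub C (f \<cdot> h) (g \<cdot> h)"
  by (simp add: Sub_def)

lemma sub_self: "f \<in> Ar C \<Longrightarrow> Sub C f f = Zero C (Src C f) (Tgt C f)"
  unfolding Sub_def by (intro add_minus) (simp add: Hom_def)

lemma sub_add: "f \<in> Ar C \<Longrightarrow> g \<in> Ar C \<Longrightarrow> Src C g = Src C f \<Longrightarrow> Tgt C g = Tgt C f \<Longrightarrow> Add C (Sub C f g) g = f"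
proof -
  assume a: "f \<in> Ar C" "g \<in> Ar C" "Src C g = Src C f" "Tgt C g = Tgt C f"
  have "Add C (Sub C f g) g = Add C f (Add C (Scale C (-1) g) g)"
    unfolding Sub_def using a by (intro add_assoc) (auto simp: Hom_def)
  also have "Add C (Scale C (-1) g) g = Add C g (Scale C (-1) g)"
    using a by (intro add_commute) (auto simp: Hom_def)
  also have "\<dots> = Zero C (Src C g) (Tgt C g)" using a by (intro add_minus) (auto simp: Hom_def)
  finally show ?thesis using a by simp
qed

lemma sub_eq_zeroD: "f \<in> Ar C \<Longrightarrow> g \<in> Ar C \<Longrightarrow> Src C g = Src C f \<Longrightarrow> Tgt C g = Tgt C f \<Longrightarrow>
    Sub C f g = Zero C (Src C f) (Tgt C f) \<Longrightarrow> f = g"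
  using sub_add[of f g] by simp

lemma sub_zero: "f \<in> Ar C \<Longrightarrow> Sub C f (Zero C (Src C f) (Tgt C f)) = f"
  using sub_add[of f "Zero C (Src C f) (Tgt C f)"] by simp

lemma monoI_zero:
  assumes "i \<in> Ar C"
    and "\<And>g. g \<in> Ar C \<Longrightarrow> Tgt C g = Src C i \<Longrightarrow> i \<cdot> g = Zero C (Src C g) (Tgt C i) \<Longrightarrow> g = Zero C (Src C g) (Src C i)"
  shows "is_mono C i"
  unfolding is_mono_def
proof (intro conjI allI ballI impI)
  fix W g h assume g: "g \<in> Hom C W (Src C i)" and h: "h \<in> Hom C W (Src C i)" and eq: "i \<cdot> g = i \<cdot> h"
  have "i \<cdot> Sub C g h = Zero C W (Tgt C i)"
    using g h eq assms(1) sub_self[of "i \<cdot> h"] by (auto simp: Hom_def cmp_sub)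
  then have "Sub C g h = Zero C W (Src C i)" using assms(2)[of "Sub C g h"] g h by (auto simp: Hom_def)
  then show "g = h" using sub_eq_zeroD[of g h] g h by (auto simp: Hom_def)
qed (rule assms)

lemma epiI_zero:
  assumes "q \<in> Ar C"
    and "\<And>g. g \<in> Ar C \<Longrightarrow> Src C g = Tgt C q \<Longrightarrow> g \<cdot> q = Zero C (Src C q) (Tgt C g) \<Longrightarrow> g = Zero C (Tgt C q) (Tgt C g)"
  shows "is_epi C q"
  unfolding is_epi_def
proof (intro conjI allI ballI impI)
  fix W g h assume g: "g \<in> Hom C (Tgt C q) W" and h: "h \<in> Hom C (Tgt C q) W" and eq: "g \<cdot> q = h \<cdot> q"
  have "Sub C g h \<cdot> q = Zero C (Src C q) W"
    using g h eq assms(1) sub_self[of "h \<cdot> q"] by (auto simp: Hom_def sub_cmp)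
  then have "Sub C g h = Zero C (Tgt C q) W" using assms(2)[of "Sub C g h"] g h by (auto simp: Hom_def)
  then show "g = h" using sub_eq_zeroD[of g h] g h by (auto simp: Hom_def)
qed (rule assms)

lemma mono_zeroD:
  assumes "is_mono C i" "g \<in> Ar C" "Tgt C g = Src C i" "i \<cdot> g = Zero C (Src C g) (Tgt C i)"
  shows "g = Zero C (Src C g) (Src C i)"
  by (rule monoD[OF assms(1)]) (use assms mono_arr in auto)

lemma epi_zeroD:
  assumes "is_epi C q" "g \<in> Ar C" "Src C g = Tgt C q" "g \<cdot> q = Zero C (Src C q) (Tgt C g)"
  shows "g = Zero C (Tgt C q) (Tgt C g)"
  by (rule epiD[OF assms(1)]) (use assms epi_arr in auto)

lemma kernelD:
  assumes "is_kernel C f i"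
  shows "f \<in> Ar C" "i \<in> Ar C" "Tgt C i = Src C f" "f \<cdot> i = Zero C (Src C i) (Tgt C f)"
    "is_mono C i"
    "\<And>h. h \<in> Ar C \<Longrightarrow> Tgt C h = Src C f \<Longrightarrow> f \<cdot> h = Zero C (Src C h) (Tgt C f) \<Longrightarrow>
       \<exists>u. u \<in> Ar C \<and> Src C u = Src C h \<and> Tgt C u = Src C i \<and> i \<cdot> u = h"
proof -
  show a: "f \<in> Ar C" "i \<in> Ar C" "Tgt C i = Src C f" "f \<cdot> i = Zero C (Src C i) (Tgt C f)"
    using assms by (auto simp: is_kernel_def)
  show "is_mono C i" unfolding is_mono_def
  proof (intro conjI allI ballI impI)
    fix W g h assume g: "g \<in> Hom C W (Src C i)" and h: "h \<in> Hom C W (Src C i)" and eq: "i \<cdot> g = i \<cdot> h"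
    have "f \<cdot> (i \<cdot> g) = Zero C W (Tgt C f)"
      using a g rewrite_pair[OF a(4)] by (auto simp: Hom_def)
    moreover have "i \<cdot> g \<in> Hom C W (Src C f)" using a g by (auto simp: Hom_def)
    ultimately show "g = h" using assms g h eq unfolding is_kernel_def by metis
  qed (rule a)
  show "\<And>h. h \<in> Ar C \<Longrightarrow> Tgt C h = Src C f \<Longrightarrow> f \<cdot> h = Zero C (Src C h) (Tgt C f) \<Longrightarrow>
       \<exists>u. u \<in> Ar C \<and> Src C u = Src C h \<and> Tgt C u = Src C i \<and> i \<cdot> u = h"
    using assms unfolding is_kernel_def Hom_def by blast
qed

lemma cokernelD:
  assumes "is_cokernel C f q"
  shows "f \<in> Ar C" "q \<in> Ar C" "Src C q = Tgt C f" "q \<cdot> f = Zero C (Src C f) (Tgt C q)"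
    "is_epi C q"
    "\<And>h. h \<in> Ar C \<Longrightarrow> Src C h = Tgt C f \<Longrightarrow> h \<cdot> f = Zero C (Src C f) (Tgt C h) \<Longrightarrow>
       \<exists>u. u \<in> Ar C \<and> Src C u = Tgt C q \<and> Tgt C u = Tgt C h \<and> u \<cdot> q = h"
proof -
  show a: "f \<in> Ar C" "q \<in> Ar C" "Src C q = Tgt C f" "q \<cdot> f = Zero C (Src C f) (Tgt C q)"
    using assms by (auto simp: is_cokernel_def)
  show "is_epi C q" unfolding is_epi_def
  proof (intro conjI allI ballI impI)
    fix W g h assume g: "g \<in> Hom C (Tgt C q) W" and h: "h \<in> Hom C (Tgt C q) W" and eq: "g \<cdot> q = h \<cdot> q"
    have "(g \<cdot> q) \<cdot> f = Zero C (Src C f) W"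
      using a g by (auto simp: Hom_def)
    moreover have "g \<cdot> q \<in> Hom C (Tgt C f) W" using a g by (auto simp: Hom_def)
    ultimately show "g = h" using assms g h eq unfolding is_cokernel_def by metis
  qed (rule a)
  show "\<And>h. h \<in> Ar C \<Longrightarrow> Src C h = Tgt C f \<Longrightarrow> h \<cdot> f = Zero C (Src C f) (Tgt C h) \<Longrightarrow>
       \<exists>u. u \<in> Ar C \<and> Src C u = Tgt C q \<and> Tgt C u = Tgt C h \<and> u \<cdot> q = h"
    using assms unfolding is_cokernel_def Hom_def by blast
qed

lemma cokernelI:
  assumes "f \<in> Ar C" "q \<in> Ar C" "Src C q = Tgt C f" "q \<cdot> f = Zero C (Src C f) (Tgt C q)" "is_epi C q"
    "\<And>h. h \<in> Ar C \<Longrightarrow> Src C h = Tgt C f \<Longrightarrow> h \<cdot> f = Zero C (Src C f) (Tgt C h) \<Longrightarrow>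
       \<exists>u. u \<in> Ar C \<and> Src C u = Tgt C q \<and> Tgt C u = Tgt C h \<and> u \<cdot> q = h"
  shows "is_cokernel C f q"
  unfolding is_cokernel_def
proof (intro conjI allI ballI impI)
  fix W h assume h: "h \<in> Hom C (Tgt C f) W" "h \<cdot> f = Zero C (Src C f) W"
  then obtain u where u: "u \<in> Hom C (Tgt C q) W" "u \<cdot> q = h" using assms(6)[of h] by (auto simp: Hom_def)
  then show "\<exists>!u. u \<in> Hom C (Tgt C q) W \<and> u \<cdot> q = h"
    using assms(5) unfolding is_epi_def by blast
qed (use assms in auto)

text \<open>
  The hypotheses are equations between composites and sums, so that a cokernel of this kind is preserved by every
  linear functor.
\<close>

lemma split_cokernelI:
  assumes "f \<in> Hom C X Y" "q \<in> Hom C Y Z" "g \<in> Hom C Y X" "s \<in> Hom C Z Y"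
    and "q \<cdot> f = Zero C X Z" "q \<cdot> s = Idn C Z" "Add C (f \<cdot> g) (s \<cdot> q) = Idn C Y"
  shows "is_cokernel C f q"
proof (rule cokernelI)
  show "is_epi C q" by (rule split_epi_is_epi[where s = s]) (use assms in \<open>auto simp: Hom_def\<close>)
  fix h assume h: "h \<in> Ar C" "Src C h = Tgt C f" "h \<cdot> f = Zero C (Src C f) (Tgt C h)"
  note a = assms(1-4)[unfolded Hom_def]
  have "h = h \<cdot> Add C (f \<cdot> g) (s \<cdot> q)" using assms h a by simp
  also have "\<dots> = Add C (h \<cdot> (f \<cdot> g)) (h \<cdot> (s \<cdot> q))" using h a by auto
  also have "h \<cdot> (f \<cdot> g) = Zero C Y (Tgt C h)" using h a by (subst rewrite_pair[OF h(3)]) auto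
  finally have "h = (h \<cdot> s) \<cdot> q" using h a by simp
  then show "\<exists>u. u \<in> Ar C \<and> Src C u = Tgt C q \<and> Tgt C u = Tgt C h \<and> u \<cdot> q = h"
    using h a by (intro exI[of _ "h \<cdot> s"]) auto
qed (use assms in \<open>auto simp: Hom_def\<close>)

text \<open>
  If \<open>f g f = f\<close> then \<open>1 - f g\<close> vanishes on \<open>f\<close> and factors through the cokernel \<open>q\<close>. The second factor is a
  section of \<open>q\<close>.
\<close>

lemma regular_cokernel_splits:
  assumes "regular_category C" "is_cokernel C f q"
  obtains g s where "g \<in> Hom C (Tgt C f) (Src C f)" "s \<in> Hom C (Tgt C q) (Tgt C f)"
    "q \<cdot> s = Idn C (Tgt C q)" "Add C (f \<cdot> g) (s \<cdot> q) = Idn C (Tgt C f)"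
proof -
  note q = cokernelD[OF assms(2)]
  obtain g where g: "g \<in> Ar C" "Src C g = Tgt C f" "Tgt C g = Src C f" "f \<cdot> (g \<cdot> f) = f"
    using assms(1) q(1) unfolding regular_category_def Hom_def by blast
  let ?c = "Sub C (Idn C (Tgt C f)) (f \<cdot> g)"
  have "?c \<cdot> f = Zero C (Src C f) (Tgt C f)" using q g sub_self[of f] by (simp add: sub_cmp)
  then obtain s where s: "s \<in> Ar C" "Src C s = Tgt C q" "Tgt C s = Tgt C f" "s \<cdot> q = ?c"
    using q(6)[of ?c] q g by auto
  have "q \<cdot> (f \<cdot> g) = Zero C (Tgt C f) (Tgt C q)" using q g by (subst rewrite_pair[OF q(4)]) auto
  then have "q \<cdot> ?c = q" using q g sub_zero[of q] by (simp add: cmp_sub)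
  then have "(q \<cdot> s) \<cdot> q = Idn C (Tgt C q) \<cdot> q" using q s by simp
  then have qs: "q \<cdot> s = Idn C (Tgt C q)" by (rule epiD[OF q(5), rotated -1]) (use q s in auto)
  have "Add C (f \<cdot> g) (s \<cdot> q) = Add C ?c (f \<cdot> g)"
    using s g q add_commute[of ?c "Tgt C f" "Tgt C f" "f \<cdot> g"] by (auto simp: Hom_def)
  also have "\<dots> = Idn C (Tgt C f)" using g q by (intro sub_add) auto
  finally show ?thesis using that[of g s] g s qs by (auto simp: Hom_def)
qed

lemma zero_objectI:
  assumes "X \<in> Ob C" "Idn C X = Zero C X X" shows "is_zero_object C X"
  unfolding is_zero_object_def
proof (intro conjI ballI)
  fix Y assume Y: "Y \<in> Ob C"
  show "Hom C X Y = {Zero C X Y}"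
  proof (intro equalityI subsetI)
    fix f assume "f \<in> Hom C X Y"
    then have "f = f \<cdot> Idn C X" by (auto simp: Hom_def)
    then show "f \<in> {Zero C X Y}" using assms \<open>f \<in> Hom C X Y\<close> by (auto simp: Hom_def)
  qed (use assms Y zero_Hom in auto)
  show "Hom C Y X = {Zero C Y X}"
  proof (intro equalityI subsetI)
    fix f assume "f \<in> Hom C Y X"
    then have "f = Idn C X \<cdot> f" by (auto simp: Hom_def)
    then show "f \<in> {Zero C Y X}" using assms \<open>f \<in> Hom C Y X\<close> by (auto simp: Hom_def)
  qed (use assms Y zero_Hom in auto)
qed (rule assms)

lemma zero_objectD: "is_zero_object C X \<Longrightarrow> Idn C X = Zero C X X"
  using idn_Hom unfolding is_zero_object_def by blast

lemma zero_object_arr: "is_zero_object C X \<Longrightarrow> f \<in> Ar C \<Longrightarrow> Src C f = X \<Longrightarrow> f = Zero C X (Tgt C f)"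
  unfolding is_zero_object_def using tgt_Ob[of f] by (auto simp: Hom_def)

end

section \<open>Abelian and semisimple categories\<close>

context linear_category
begin

lemma arrow_sum_Hom:
  "X \<in> Ob C \<Longrightarrow> Y \<in> Ob C \<Longrightarrow> (\<And>j. j < n \<Longrightarrow> g j \<in> Hom C X Y) \<Longrightarrow> arrow_sum C X Y g n \<in> Hom C X Y"
  by (induct n) (auto intro!: add_Hom zero_Hom)

lemma arrow_sum_cong:
  "(\<And>j. j < n \<Longrightarrow> g j = h j) \<Longrightarrow> arrow_sum C X Y g n = arrow_sum C X Y h n"
  by (induct n) auto

lemma cmp_arrow_sum:
  assumes "X \<in> Ob C" "h \<in> Ar C" "Src C h = Y" "\<And>j. j < n \<Longrightarrow> g j \<in> Hom C X Y"
  shows "h \<cdot> arrow_sum C X Y g n = arrow_sum C X (Tgt C h) (\<lambda>j. h \<cdot> g j) n"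
  using assms
proof (induct n)
  case (Suc n)
  have "Y \<in> Ob C" using Suc by auto
  then have "arrow_sum C X Y g n \<in> Hom C X Y" using Suc by (intro arrow_sum_Hom) auto
  moreover have "g n \<in> Hom C X Y" using Suc by auto
  ultimately show ?case using Suc by (auto simp: Hom_def)
qed auto

lemma arrow_sum_cmp:
  assumes "Y \<in> Ob C" "h \<in> Ar C" "Tgt C h = X" "\<And>j. j < n \<Longrightarrow> g j \<in> Hom C X Y"
  shows "arrow_sum C X Y g n \<cdot> h = arrow_sum C (Src C h) Y (\<lambda>j. g j \<cdot> h) n"
  using assms
proof (induct n)
  case (Suc n)
  have "X \<in> Ob C" using Suc by auto
  then have "arrow_sum C X Y g n \<in> Hom C X Y" using Suc by (intro arrow_sum_Hom) auto
  moreover have "g n \<in> Hom C X Y" using Suc by auto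
  ultimately show ?case using Suc by (auto simp: Hom_def)
qed auto

lemma arrow_sum_zero:
  "X \<in> Ob C \<Longrightarrow> Y \<in> Ob C \<Longrightarrow> (\<And>j. j < n \<Longrightarrow> g j = Zero C X Y) \<Longrightarrow> arrow_sum C X Y g n = Zero C X Y"
  by (induct n) auto

lemma direct_sumD:
  assumes "is_direct_sum C n S X i p" "j < n"
  shows "S j \<in> Ob C" "i j \<in> Ar C" "Src C (i j) = S j" "Tgt C (i j) = X"
    "p j \<in> Ar C" "Src C (p j) = X" "Tgt C (p j) = S j"
  using assms by (auto simp: is_direct_sum_def Hom_def)

lemma direct_sum_jointly_mono:
  assumes "is_direct_sum C n S X i p" "m \<in> Ar C" "Tgt C m = X"
    and "\<And>j. j < n \<Longrightarrow> p j \<cdot> m = Zero C (Src C m) (S j)"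
  shows "m = Zero C (Src C m) X"
proof -
  note d = direct_sumD[OF assms(1)]
  have X: "X \<in> Ob C" using assms by auto
  have "m = arrow_sum C X X (\<lambda>j. i j \<cdot> p j) n \<cdot> m"
    using assms(1-3) by (auto simp: is_direct_sum_def)
  also have "\<dots> = arrow_sum C (Src C m) X (\<lambda>j. (i j \<cdot> p j) \<cdot> m) n"
    using assms d X by (intro arrow_sum_cmp) (auto simp: Hom_def)
  also have "\<dots> = Zero C (Src C m) X"
  proof (rule arrow_sum_zero)
    fix j assume j: "j < n"
    have "(i j \<cdot> p j) \<cdot> m = i j \<cdot> (p j \<cdot> m)" using d[OF j] assms by simp
    then show "(i j \<cdot> p j) \<cdot> m = Zero C (Src C m) X" using d[OF j] assms j by simp
  qed (use assms in auto)
  finally show ?thesis .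
qed

end

context abelian_category
begin

lemma epi_cokernel_of_kernel:
  assumes "is_epi C q" "is_kernel C q k"
  shows "is_cokernel C k q"
proof -
  note k = kernelD(1-5)[OF assms(2)] and kL = kernelD(6)[OF assms(2)]
  obtain f where f: "is_cokernel C f q" using epi_is_cokernel[OF assms(1)] by blast
  note c = cokernelD(1-5)[OF f] and cL = cokernelD(6)[OF f]
  obtain u where u: "u \<in> Ar C" "Src C u = Src C f" "Tgt C u = Src C k" "k \<cdot> u = f" using kL[of f] c by auto
  show ?thesis
  proof (rule cokernelI)
    fix h assume h: "h \<in> Ar C" "Src C h = Tgt C k" "h \<cdot> k = Zero C (Src C k) (Tgt C h)"
    have "h \<cdot> (k \<cdot> u) = Zero C (Src C f) (Tgt C h)" using h k u by (subst rewrite_pair[OF h(3)]) auto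
    then show "\<exists>u. u \<in> Ar C \<and> Src C u = Tgt C q \<and> Tgt C u = Tgt C h \<and> u \<cdot> q = h"
      using cL[of h] h u k c by auto
  qed (use k assms in auto)
qed

lemma mono_kernel_of_cokernel:
  assumes "is_mono C m" "is_cokernel C m q"
  shows "\<And>h. h \<in> Ar C \<Longrightarrow> Tgt C h = Tgt C m \<Longrightarrow> q \<cdot> h = Zero C (Src C h) (Tgt C q) \<Longrightarrow>
       \<exists>u. u \<in> Ar C \<and> Src C u = Src C h \<and> Tgt C u = Src C m \<and> m \<cdot> u = h"
proof -
  note c = cokernelD(1-5)[OF assms(2)] and cL = cokernelD(6)[OF assms(2)]
  obtain f where f: "is_kernel C f m" using mono_is_kernel[OF assms(1)] by blast
  note k = kernelD(1-5)[OF f] and kL = kernelD(6)[OF f]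
  obtain u where u: "u \<in> Ar C" "Src C u = Tgt C q" "Tgt C u = Tgt C f" "u \<cdot> q = f" using cL[of f] k by auto
  fix h assume h: "h \<in> Ar C" "Tgt C h = Tgt C m" "q \<cdot> h = Zero C (Src C h) (Tgt C q)"
  have "f \<cdot> h = u \<cdot> (q \<cdot> h)" using h u c by auto
  also have "\<dots> = Zero C (Src C h) (Tgt C f)" using h u by simp
  finally show "\<exists>u. u \<in> Ar C \<and> Src C u = Src C h \<and> Tgt C u = Src C m \<and> m \<cdot> u = h"
    using kL[of h] h k by auto
qed

text \<open>
  Here \<open>m\<close> is the kernel of the cokernel of \<open>f\<close>, and only \<open>is_epi C e\<close> needs an argument. If \<open>g\<close> kills \<open>e\<close> and \<open>m'\<close> is the kernel
  of \<open>g\<close>, then \<open>f\<close> factors through \<open>m m'\<close>. Hence \<open>m\<close> is killed by the cokernel of \<open>m m'\<close> and factors through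
  \<open>m m'\<close> itself, so that \<open>m'\<close> has a right inverse and \<open>g = 0\<close>.
\<close>

lemma image_factorization:
  assumes "f \<in> Ar C"
  obtains m e where "is_mono C m" "is_epi C e" "Src C m = Tgt C e" "Src C e = Src C f" "Tgt C m = Tgt C f"
    "m \<cdot> e = f"
proof -
  obtain q where "is_cokernel C f q" using has_cokernels[OF assms] by blast
  note q = cokernelD(1-5)[OF this] and qL = cokernelD(6)[OF this]
  obtain m where "is_kernel C q m" using has_kernels[OF q(2)] by blast
  note m = kernelD(1-5)[OF this] and mL = kernelD(6)[OF this]
  obtain e where e: "e \<in> Ar C" "Src C e = Src C f" "Tgt C e = Src C m" "m \<cdot> e = f" using mL[of f] q by auto
  have "is_epi C e"
  proof (rule epiI_zero[OF e(1)])
    fix g assume g: "g \<in> Ar C" "Src C g = Tgt C e" "g \<cdot> e = Zero C (Src C e) (Tgt C g)"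
    obtain m' where "is_kernel C g m'" using has_kernels[OF g(1)] by blast
    note m' = kernelD(1-5)[OF this] and m'L = kernelD(6)[OF this]
    obtain e' where e': "e' \<in> Ar C" "Src C e' = Src C e" "Tgt C e' = Src C m'" "m' \<cdot> e' = e" using m'L[of e] e g by auto
    have mm: "is_mono C (m \<cdot> m')" using m m' g e by (intro mono_cmp) auto
    obtain r where r: "is_cokernel C (m \<cdot> m') r" using has_cokernels[OF mono_arr[OF mm]] by blast
    note rr = cokernelD(1-5)[OF r] and rrL = cokernelD(6)[OF r]
    have m'm: "Tgt C m' = Src C m" "m \<cdot> m' \<in> Ar C" "Src C (m \<cdot> m') = Src C m'" "Tgt C (m \<cdot> m') = Tgt C m"
      using m(2) m'(2,3) g(2) e(3) by simp_all
    have "f = (m \<cdot> m') \<cdot> e'" using m(2) m'(2) e'(1,3,4) e(4) m'm by simp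
    then have "r \<cdot> f = (r \<cdot> (m \<cdot> m')) \<cdot> e'" using rr(2,3) m'm e'(1,3) by simp
    also have "\<dots> = Zero C (Src C f) (Tgt C r)" unfolding rr(4) using rr(2) e'(1-3) m'm e(2) by simp
    finally obtain w where w: "w \<in> Ar C" "Src C w = Tgt C q" "Tgt C w = Tgt C r" "w \<cdot> q = r"
      using qL[of r] rr m m' e g q by auto
    have "r \<cdot> m = w \<cdot> (q \<cdot> m)" using w q m by auto
    also have "\<dots> = Zero C (Src C m) (Tgt C r)" using w q m by simp
    finally obtain x where x: "x \<in> Ar C" "Src C x = Src C m" "Tgt C x = Src C m'" "(m \<cdot> m') \<cdot> x = m"
      using mono_kernel_of_cokernel[OF mm r m(2)] m'm by metis
    have "m' \<cdot> x = Idn C (Src C m)"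
      by (rule monoD[OF m(5)]) (use x m(2) m'(2) m'm in auto)
    then have "g = g \<cdot> (m' \<cdot> x)" using g(1,2) e(3) by simp
    also have "\<dots> = (g \<cdot> m') \<cdot> x" using g(1,2) e(3) m'(2) m'm(1) x(1,3) by simp
    also have "\<dots> = Zero C (Tgt C e) (Tgt C g)" unfolding m'(4) using x(1-3) g(1) e(3) m'(2) by simp
    finally show "g = Zero C (Tgt C e) (Tgt C g)" .
  qed
  then show ?thesis using that[of m e] m e q by auto
qed

lemma arrow_to_simple:
  assumes "is_simple C S" "p \<in> Ar C" "Tgt C p = S" "p \<noteq> Zero C (Src C p) S"
  shows "is_epi C p"
proof -
  obtain m e where me: "is_mono C m" "is_epi C e" "Src C m = Tgt C e" "Src C e = Src C p" "Tgt C m = Tgt C p" "m \<cdot> e = p"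
    using image_factorization[OF assms(2)] .
  have "\<not> is_zero_object C (Src C m)"
  proof
    assume "is_zero_object C (Src C m)"
    then have "m = Zero C (Src C m) (Tgt C m)" using zero_object_arr mono_arr[OF me(1)] by blast
    then have "m \<cdot> e = Zero C (Src C m) (Tgt C m) \<cdot> e" by (rule arg_cong)
    also have "\<dots> = Zero C (Src C p) (Tgt C p)"
      using me(3,4,5) epi_arr[OF me(2)] mono_arr[OF me(1)]
      by (metis tgt_Ob zero_cmp)
    finally show False using me(6) assms by simp
  qed
  then have "is_iso C m" using assms me unfolding is_simple_def by blast
  then have "is_epi C (m \<cdot> e)" by (rule epi_cmp[OF iso_is_epi me(2,3)])
  then show ?thesis using me by simp
qed

text \<open>
  Induction on the number \<open>n\<close> of summands that \<open>m\<close> can meet. If \<open>p n \<cdot> m\<close> is not zero, it is epi because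
  \<open>S n\<close> is simple. Its kernel \<open>k\<close> meets fewer summands, so \<open>m k\<close> has a retraction \<open>r\<close>. The arrow
  \<open>k r\<close> need not be a retraction of \<open>m\<close>, but \<open>1 - k r m\<close> vanishes on \<open>k\<close>. Hence it has the form \<open>g p\<^sub>n m\<close>, and
  \<open>g p\<^sub>n + k r\<close> is a retraction of \<open>m\<close>.
\<close>

lemma semisimple_monos_split_aux:
  assumes sum: "is_direct_sum C N S X i p" and simple: "\<And>j. j < N \<Longrightarrow> is_simple C (S j)"
    and n: "n \<le> N" and m: "is_mono C m" "Tgt C m = X"
    and zero: "\<And>j. n \<le> j \<Longrightarrow> j < N \<Longrightarrow> p j \<cdot> m = Zero C (Src C m) (S j)"
  shows "\<exists>r. r \<in> Ar C \<and> Src C r = X \<and> Tgt C r = Src C m \<and> r \<cdot> m = Idn C (Src C m)"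
  using n m zero
proof (induct n arbitrary: m)
  case 0
  note d = direct_sumD[OF sum]
  have ma: "m \<in> Ar C" using 0 mono_arr by auto
  then have X: "X \<in> Ob C" using 0 by auto
  have "m = Zero C (Src C m) X" using direct_sum_jointly_mono[OF sum ma] 0 by auto
  then have "m \<cdot> Idn C (Src C m) = Zero C (Src C (Idn C (Src C m))) (Tgt C m)" using ma 0 by simp
  then have "Idn C (Src C m) = Zero C (Src C m) (Src C m)"
    using mono_zeroD[OF 0(2), of "Idn C (Src C m)"] ma by auto
  then show ?case using ma X by (intro exI[of _ "Zero C X (Src C m)"]) (use 0 in auto)
next
  case (Suc n)
  note d = direct_sumD[OF sum]
  have nN: "n < N" using Suc by auto
  note dn = d[OF nN]
  have ma: "m \<in> Ar C" using Suc mono_arr by auto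
  then have X: "X \<in> Ob C" using Suc by auto
  show ?case
  proof (cases "p n \<cdot> m = Zero C (Src C m) (S n)")
    case True
    have "p j \<cdot> m = Zero C (Src C m) (S j)" if "n \<le> j" "j < N" for j
      using that True Suc(5)[of j] by (cases "j = n") auto
    then show ?thesis using Suc(1)[OF _ Suc(3,4)] nN by auto
  next
    case False
    have "is_epi C (p n \<cdot> m)"
      by (rule arrow_to_simple[OF simple[OF nN]]) (use dn ma Suc False in auto)
    moreover obtain k where k: "is_kernel C (p n \<cdot> m) k" using has_kernels[of "p n \<cdot> m"] dn ma Suc by auto
    ultimately have c: "is_cokernel C k (p n \<cdot> m)" by (rule epi_cokernel_of_kernel)
    note kk = kernelD(1-5)[OF k] and kkL = kernelD(6)[OF k]
    note cc = cokernelD(1-5)[OF c] and ccL = cokernelD(6)[OF c]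
    have t: "Tgt C k = Src C m" using kk dn ma Suc by simp
    have pj: "p j \<cdot> (m \<cdot> k) = Zero C (Src C k) (S j)" if j: "n \<le> j" "j < N" for j
    proof (cases "j = n")
      case True
      then show ?thesis using kk(4) t dn ma Suc(4) kk(2) by simp
    next
      case False
      then have "p j \<cdot> m = Zero C (Src C m) (S j)" using Suc(5) j by auto
      then show ?thesis using t d[OF j(2)] ma Suc(4) kk(2) by (subst rewrite_pair) auto
    qed
    have "\<exists>r. r \<in> Ar C \<and> Src C r = X \<and> Tgt C r = Src C (m \<cdot> k) \<and> r \<cdot> (m \<cdot> k) = Idn C (Src C (m \<cdot> k))"
      by (rule Suc(1)) (use Suc nN kk t ma pj in \<open>auto intro!: mono_cmp\<close>)
    then obtain r where r: "r \<in> Ar C" "Src C r = X" "Tgt C r = Src C k" "r \<cdot> (m \<cdot> k) = Idn C (Src C k)"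
      using ma kk t by auto
    let ?d = "Sub C (Idn C (Src C m)) ((k \<cdot> r) \<cdot> m)"
    have d: "?d \<in> Ar C" "Src C ?d = Src C m" "Tgt C ?d = Src C m" using ma kk(2) t r Suc(4) by auto
    have "((k \<cdot> r) \<cdot> m) \<cdot> k = k" using ma kk(2) t r Suc(4) by simp
    then have "?d \<cdot> k = Sub C k k" using ma kk(2) t r Suc(4) by (subst sub_cmp) auto
    then have "?d \<cdot> k = Zero C (Src C k) (Src C m)" using sub_self kk(2) t by simp
    then obtain g where g: "g \<in> Ar C" "Src C g = S n" "Tgt C g = Src C m" "g \<cdot> (p n \<cdot> m) = ?d"
      using ccL[of ?d] d t dn ma Suc(4) by auto
    have "Add C (g \<cdot> p n) (k \<cdot> r) \<cdot> m = Add C ?d ((k \<cdot> r) \<cdot> m)"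
      using g dn ma Suc(4) kk(2) t r by simp
    also have "\<dots> = Idn C (Src C m)" using ma kk(2) t r Suc(4) by (intro sub_add) auto
    finally show ?thesis
      by (intro exI[of _ "Add C (g \<cdot> p n) (k \<cdot> r)"]) (use g dn ma Suc(4) kk(2) t r in auto)
  qed
qed

lemma semisimple_monos_split: "semisimple_category C \<Longrightarrow> monos_split C"
  unfolding monos_split_def
proof (intro allI impI)
  fix m assume ss: "semisimple_category C" and m: "is_mono C m"
  then have "Tgt C m \<in> Ob C" using mono_arr by auto
  then obtain n S i p where "\<forall>j<n. is_simple C (S j)" "is_direct_sum C n S (Tgt C m) i p"
    using ss unfolding semisimple_category_def by blast
  then show "\<exists>r\<in>Hom C (Tgt C m) (Src C m). r \<cdot> m = Idn C (Src C m)"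
    using semisimple_monos_split_aux[of n S "Tgt C m" i p n m] m by (auto simp: Hom_def)
qed

lemma split_mono_cokernel_splits:
  assumes k: "is_cokernel C k e" and r: "r \<in> Ar C" "Src C r = Tgt C k" "Tgt C r = Src C k" "r \<cdot> k = Idn C (Src C k)"
  shows "\<exists>s \<in> Hom C (Tgt C e) (Src C e). e \<cdot> s = Idn C (Tgt C e)"
proof -
  note c = cokernelD(1-5)[OF k] and cL = cokernelD(6)[OF k]
  let ?d = "Sub C (Idn C (Tgt C k)) (k \<cdot> r)"
  have "?d \<cdot> k = Zero C (Src C k) (Tgt C k)" using c r sub_self[of k] by (simp add: sub_cmp)
  then obtain s where s: "s \<in> Ar C" "Src C s = Tgt C e" "Tgt C s = Tgt C k" "s \<cdot> e = ?d"
    using cL[of ?d] c r by auto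
  have "e \<cdot> (k \<cdot> r) = Zero C (Tgt C k) (Tgt C e)" using c r by (subst rewrite_pair[OF c(4)]) auto
  then have "e \<cdot> ?d = e" using c r sub_zero[of e] by (simp add: cmp_sub)
  then have "(e \<cdot> s) \<cdot> e = Idn C (Tgt C e) \<cdot> e" using c s by simp
  then have "e \<cdot> s = Idn C (Tgt C e)" by (rule epiD[OF c(5), rotated -1]) (use c s in auto)
  then show ?thesis using s c by (auto simp: Hom_def)
qed

lemma monos_split_epis_split: assumes "monos_split C" shows "epis_split C"
  unfolding epis_split_def
proof (intro allI impI)
  fix e assume e: "is_epi C e"
  obtain k where k: "is_kernel C e k" using has_kernels epi_arr[OF e] by blast
  note kk = kernelD(1-5)[OF k] and kkL = kernelD(6)[OF k]
  obtain r where "r \<in> Hom C (Tgt C k) (Src C k)" "r \<cdot> k = Idn C (Src C k)" using assms kk unfolding monos_split_def by blast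
  then show "\<exists>s \<in> Hom C (Tgt C e) (Src C e). e \<cdot> s = Idn C (Tgt C e)"
    using split_mono_cokernel_splits[OF epi_cokernel_of_kernel[OF e k]] by (auto simp: Hom_def)
qed

lemma epis_split_monos_split: assumes "epis_split C" shows "monos_split C"
  unfolding monos_split_def
proof (intro allI impI)
  fix m assume m: "is_mono C m"
  obtain q where q: "is_cokernel C m q" using has_cokernels mono_arr[OF m] by blast
  note c = cokernelD(1-5)[OF q] and cL = cokernelD(6)[OF q]
  obtain s where s: "s \<in> Ar C" "Src C s = Tgt C q" "Tgt C s = Tgt C m" "q \<cdot> s = Idn C (Tgt C q)"
    using assms c unfolding epis_split_def Hom_def by force
  let ?d = "Sub C (Idn C (Tgt C m)) (s \<cdot> q)"
  have "q \<cdot> (s \<cdot> q) = q" using c(2,3) s by (subst rewrite_pair[OF s(4)]) auto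
  then have "q \<cdot> ?d = Zero C (Tgt C m) (Tgt C q)" using c s sub_self[of q] by (simp add: cmp_sub)
  then obtain r where r: "r \<in> Ar C" "Src C r = Tgt C m" "Tgt C r = Src C m" "m \<cdot> r = ?d"
    using mono_kernel_of_cokernel[OF m q, of ?d] c s by auto
  have "?d \<cdot> m = m" using c s sub_zero[of m] by (simp add: sub_cmp)
  then have "m \<cdot> (r \<cdot> m) = m \<cdot> Idn C (Src C m)" using c(1) r by (metis assoc cmp_idn)
  then have "r \<cdot> m = Idn C (Src C m)" by (rule monoD[OF m, rotated -1]) (use c r in auto)
  then show "\<exists>r \<in> Hom C (Tgt C m) (Src C m). r \<cdot> m = Idn C (Src C m)" using r by (auto simp: Hom_def)
qed

lemma split_regular: assumes "epis_split C" shows "regular_category C"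
  unfolding regular_category_def
proof
  fix f assume f: "f \<in> Ar C"
  obtain m e where me: "is_mono C m" "is_epi C e" "Src C m = Tgt C e" "Src C e = Src C f" "Tgt C m = Tgt C f" "m \<cdot> e = f"
    using image_factorization[OF f] .
  obtain s where s: "s \<in> Ar C" "Src C s = Tgt C e" "Tgt C s = Src C e" "e \<cdot> s = Idn C (Tgt C e)"
    using assms me unfolding epis_split_def Hom_def by force
  obtain r where r: "r \<in> Ar C" "Src C r = Tgt C m" "Tgt C r = Src C m" "r \<cdot> m = Idn C (Src C m)"
    using epis_split_monos_split[OF assms] me unfolding monos_split_def Hom_def by force
  note a = mono_arr[OF me(1)] epi_arr[OF me(2)]
  have "r \<cdot> f = e" using a me r rewrite_pair[OF r(4), of e] by auto
  moreover have "(m \<cdot> e) \<cdot> (s \<cdot> e) = m \<cdot> e"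
    using a me(3) s(1-3) rewrite_pair[OF s(4), of e] by simp
  then have "f \<cdot> (s \<cdot> e) = f" unfolding me(6) .
  ultimately have "f \<cdot> ((s \<cdot> r) \<cdot> f) = f" using me(3-5) s(1-3) r(1-3) f by simp
  then show "\<exists>g\<in>Hom C (Tgt C f) (Src C f). f \<cdot> (g \<cdot> f) = f"
    using s r me by (intro bexI[of _ "s \<cdot> r"]) (auto simp: Hom_def)
qed

text \<open>
  The kernel of \<open>d: A \<oplus> B \<rightarrow> Z\<close> is, up to a sign, the pullback of the two components of \<open>d\<close>, so this
  says that the pullback of an epi is epi. If \<open>g\<close> kills \<open>pA \<cdot> k\<close>, then \<open>g \<cdot> pA\<close> factors through \<open>d\<close>, which is the cokernel
  of \<open>k\<close>; the second factor kills the epi \<open>d \<cdot> iB\<close> and is therefore zero.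
\<close>

lemma pullback_epi:
  assumes sum: "pA \<in> Hom C P A" "iA \<in> Hom C A P" "iB \<in> Hom C B P"
      "pA \<cdot> iA = Idn C A" "pA \<cdot> iB = Zero C B A"
    and d: "d \<in> Hom C P Z" and epi: "is_epi C (d \<cdot> iB)" and k: "is_kernel C d k"
  shows "is_epi C (pA \<cdot> k)"
proof (rule epiI_zero)
  note s = sum(1-3)[unfolded Hom_def] d[unfolded Hom_def]
  note kk = kernelD(1-5)[OF k] and kkL = kernelD(6)[OF k]
  show "pA \<cdot> k \<in> Ar C" using s kk by auto
  have "is_epi C d" by (rule epi_right_factor[OF epi]) (use s in auto)
  then have c: "is_cokernel C k d" by (rule epi_cokernel_of_kernel[OF _ k])
  fix g assume g: "g \<in> Ar C" "Src C g = Tgt C (pA \<cdot> k)" "g \<cdot> (pA \<cdot> k) = Zero C (Src C (pA \<cdot> k)) (Tgt C g)"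
  have g': "Src C g = A" "(g \<cdot> pA) \<cdot> k = Zero C (Src C k) (Tgt C g)" using g s kk by auto
  obtain u where u: "u \<in> Ar C" "Src C u = Z" "Tgt C u = Tgt C g" "u \<cdot> d = g \<cdot> pA"
  proof -
    have gp: "g \<cdot> pA \<in> Ar C" "Src C (g \<cdot> pA) = P" "Tgt C (g \<cdot> pA) = Tgt C g" using g(1) g'(1) s by auto
    moreover have "Src C d = P" "Tgt C d = Z" using s by auto
    ultimately show thesis using that cokernelD(6)[OF c gp(1)] g'(2) kk(3) by metis
  qed
  have "(u \<cdot> d) \<cdot> iB = (g \<cdot> pA) \<cdot> iB" using u(4) by simp
  then have "u \<cdot> (d \<cdot> iB) = g \<cdot> (pA \<cdot> iB)" using u(1,2) s g(1) g'(1) by simp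
  also have "\<dots> = Zero C B (Tgt C g)" unfolding sum(5) using g(1) g'(1) s(3) by auto
  finally have "u = Zero C (Tgt C (d \<cdot> iB)) (Tgt C u)" using u s by (intro epi_zeroD[OF epi]) auto
  then have u0: "u = Zero C Z (Tgt C g)" using u s by simp
  have "g = (g \<cdot> pA) \<cdot> iA" using g(1) g'(1) s sum(4) by simp
  also have "\<dots> = (u \<cdot> d) \<cdot> iA" using u by simp
  also have "\<dots> = Zero C A (Tgt C g)" unfolding u0 using s g by auto
  finally show "g = Zero C (Tgt C (pA \<cdot> k)) (Tgt C g)" using s kk by simp
qed

end

section \<open>Matrices over a field\<close>

lemma linear_functional_expand:
  fixes \<phi> :: "'k::field vec \<Rightarrow> 'k"
  assumes add: "\<And>x y. x \<in> carrier_vec n \<Longrightarrow> y \<in> carrier_vec n \<Longrightarrow> \<phi> (x + y) = \<phi> x + \<phi> y"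
    and smult: "\<And>c x. x \<in> carrier_vec n \<Longrightarrow> \<phi> (c \<cdot>\<^sub>v x) = c * \<phi> x"
    and x: "x \<in> carrier_vec n"
  shows "\<phi> x = (\<Sum>i<n. x $ i * \<phi> (unit_vec n i))"
proof -
  have "\<phi> (vec n (\<lambda>i. if i < m then x $ i else 0)) = (\<Sum>i<m. x $ i * \<phi> (unit_vec n i))" if "m \<le> n" for m
    using that
  proof (induct m)
    case 0
    have "\<phi> (0 \<cdot>\<^sub>v 0\<^sub>v n) = 0" by (subst smult) auto
    moreover have "vec n (\<lambda>i. if i < 0 then x $ i else 0) = 0 \<cdot>\<^sub>v 0\<^sub>v n" by (intro eq_vecI) auto
    ultimately show ?case by simp
  next
    case (Suc m)
    have "vec n (\<lambda>i. if i < Suc m then x $ i else 0) =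
        vec n (\<lambda>i. if i < m then x $ i else 0) + x $ m \<cdot>\<^sub>v unit_vec n m"
      using Suc(2) by (intro eq_vecI) (auto simp: unit_vec_def less_Suc_eq)
    then show ?case using Suc by (simp add: add smult)
  qed
  from this[of n] have "\<phi> (vec n (\<lambda>i. if i < n then x $ i else 0)) = (\<Sum>i<n. x $ i * \<phi> (unit_vec n i))" by simp
  moreover have "vec n (\<lambda>i. if i < n then x $ i else 0) = x" using x by (intro eq_vecI) auto
  ultimately show ?thesis by simp
qed

definition vec_linear :: "nat \<Rightarrow> nat \<Rightarrow> ('k::field vec \<Rightarrow> 'k vec) \<Rightarrow> bool" where
  "vec_linear n m f \<longleftrightarrow> (\<forall>x \<in> carrier_vec n. f x \<in> carrier_vec m) \<and>
     (\<forall>x \<in> carrier_vec n. \<forall>y \<in> carrier_vec n. f (x + y) = f x + f y) \<and>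
     (\<forall>c. \<forall>x \<in> carrier_vec n. f (c \<cdot>\<^sub>v x) = c \<cdot>\<^sub>v f x)"

definition mat_of :: "nat \<Rightarrow> nat \<Rightarrow> ('k::field vec \<Rightarrow> 'k vec) \<Rightarrow> 'k mat" where
  "mat_of n m f = mat m n (\<lambda>(i, j). f (unit_vec n j) $ i)"

lemma mat_of_carrier [simp]: "mat_of n m f \<in> carrier_mat m n"
  by (simp add: mat_of_def)

lemma mat_of_mult: assumes "vec_linear n m f" "x \<in> carrier_vec n" shows "mat_of n m f *\<^sub>v x = f x"
proof (rule eq_vecI)
  have fx: "f x \<in> carrier_vec m" using assms by (auto simp: vec_linear_def)
  then show "dim_vec (mat_of n m f *\<^sub>v x) = dim_vec (f x)" by (simp add: mat_of_def)
  fix i assume "i < dim_vec (f x)"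
  then have i: "i < m" using fx by simp
  have "f x $ i = (\<Sum>j<n. x $ j * f (unit_vec n j) $ i)"
  proof (rule linear_functional_expand[OF _ _ assms(2)])
    fix x y :: "'a vec" assume xy: "x \<in> carrier_vec n" "y \<in> carrier_vec n"
    then have "f x \<in> carrier_vec m" "f y \<in> carrier_vec m" using assms by (auto simp: vec_linear_def)
    then show "f (x + y) $ i = f x $ i + f y $ i" using assms(1) xy i unfolding vec_linear_def by auto
  next
    fix c and x :: "'a vec" assume "x \<in> carrier_vec n"
    then show "f (c \<cdot>\<^sub>v x) $ i = c * f x $ i" using assms(1) i unfolding vec_linear_def by auto
  qed
  also have "\<dots> = (mat_of n m f *\<^sub>v x) $ i"
    using i assms(2) by (auto simp: mat_of_def scalar_prod_def mult.commute atLeast0LessThan intro!: sum.cong)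
  finally show "(mat_of n m f *\<^sub>v x) $ i = f x $ i" ..
qed

lemma mat_eq_by_vec:
  fixes A B :: "'k::field mat"
  assumes "A \<in> carrier_mat m n" "B \<in> carrier_mat m n" "\<And>x. x \<in> carrier_vec n \<Longrightarrow> A *\<^sub>v x = B *\<^sub>v x"
  shows "A = B"
proof (rule eq_matI)
  fix i j assume ij: "i < dim_row B" "j < dim_col B"
  have "(A *\<^sub>v unit_vec n j) $ i = (B *\<^sub>v unit_vec n j) $ i" using assms by simp
  then show "A $$ (i, j) = B $$ (i, j)" using ij assms(1,2) by simp
qed (use assms in auto)

text \<open>
  Every subspace \<open>W\<close> of \<open>k\<^sup>N\<close> is isomorphic to some \<open>k\<^sup>n\<close>, and an isomorphism extends to a linear map on all of
  \<open>k\<^sup>N\<close>; the extension is what yields generalised inverses of matrices. The induction is on a bound \<open>b\<close> for the supports of the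
  vectors in \<open>W\<close>.
\<close>

lemma subspace_coordinates_aux:
  fixes W :: "'k::field vec set"
  assumes "W \<subseteq> carrier_vec N" "0\<^sub>v N \<in> W" "\<And>x y. x \<in> W \<Longrightarrow> y \<in> W \<Longrightarrow> x + y \<in> W"
    and "\<And>c x. x \<in> W \<Longrightarrow> c \<cdot>\<^sub>v x \<in> W"
    and "b \<le> N" "\<And>w i. w \<in> W \<Longrightarrow> b \<le> i \<Longrightarrow> i < N \<Longrightarrow> w $ i = 0"
  shows "\<exists>n \<theta>. vec_linear N n \<theta> \<and> bij_betw \<theta> W (carrier_vec n)"
  using assms
proof (induct b arbitrary: W)
  case 0
  have "W = {0\<^sub>v N}" using 0(1,2,6) by (auto intro!: eq_vecI)
  then have "bij_betw (\<lambda>_. 0\<^sub>v 0) W (carrier_vec 0 :: 'k vec set)" by (auto simp: bij_betw_def)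
  moreover have "vec_linear N 0 (\<lambda>_. 0\<^sub>v 0)" by (auto simp: vec_linear_def)
  ultimately show ?case by blast
next
  case (Suc b)
  show ?case
  proof (cases "\<forall>w \<in> W. w $ b = 0")
    case True
    have "\<And>w i. w \<in> W \<Longrightarrow> b \<le> i \<Longrightarrow> i < N \<Longrightarrow> w $ i = 0"
      using True Suc(7) by (metis le_antisym not_less_eq_eq)
    then show ?thesis using Suc by auto
  next
    case False
    then obtain w1 where w1: "w1 \<in> W" "w1 $ b \<noteq> 0" by blast
    \<comment> \<open>\<open>red\<close> projects \<open>W\<close> along \<open>w0\<close> onto the vectors whose coordinate \<open>b\<close> vanishes; this coordinate becomes the last one of \<open>\<theta>'\<close>\<close>
    define w0 where "w0 = (1 / w1 $ b) \<cdot>\<^sub>v w1"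
    have b: "b < N" using Suc by simp
    have w0: "w0 \<in> W" "w0 $ b = 1" "w0 \<in> carrier_vec N" using w1 Suc(2,5) b unfolding w0_def by auto
    let ?W = "{w \<in> W. w $ b = 0}"
    have "\<exists>n \<theta>. vec_linear N n \<theta> \<and> bij_betw \<theta> ?W (carrier_vec n)"
    proof (rule Suc(1))
      fix w i assume "w \<in> ?W" "b \<le> i" "i < N"
      then show "w $ i = 0" using Suc(7)[of w i] by (cases "i = b") auto
    next
      fix x y assume "x \<in> ?W" "y \<in> ?W"
      moreover from this have "x \<in> carrier_vec N" "y \<in> carrier_vec N" using Suc(2) by auto
      ultimately show "x + y \<in> ?W" using Suc(4) b by auto
    next
      fix c x assume "x \<in> ?W"
      moreover from this have "x \<in> carrier_vec N" using Suc(2) by auto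
      ultimately show "c \<cdot>\<^sub>v x \<in> ?W" using Suc(5) b by auto
    qed (use Suc b in auto)
    then obtain n \<theta> where lin: "vec_linear N n \<theta>" and bij: "bij_betw \<theta> ?W (carrier_vec n)" by blast
    define red where "red w = w + (- w $ b) \<cdot>\<^sub>v w0" for w
    define \<theta>' where "\<theta>' w = vec (Suc n) (\<lambda>i. if i < n then \<theta> (red w) $ i else w $ b)" for w
    have red: "red w \<in> carrier_vec N" if "w \<in> carrier_vec N" for w using that w0 by (auto simp: red_def)
    have tr: "\<theta> (red w) \<in> carrier_vec n" if "w \<in> carrier_vec N" for w
      using lin red[OF that] by (auto simp: vec_linear_def)
    have redW: "red w \<in> ?W" if "w \<in> W" for w
    proof -
      have "w \<in> carrier_vec N" using that Suc(2) by auto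
      then show ?thesis using Suc(4,5) w0 that b unfolding red_def by auto
    qed
    have "vec_linear N (Suc n) \<theta>'"
      unfolding vec_linear_def
    proof (intro conjI ballI allI)
      fix x y :: "'k vec" assume x: "x \<in> carrier_vec N" and y: "y \<in> carrier_vec N"
      have "red (x + y) = red x + red y"
        unfolding red_def using x y w0 b by (intro eq_vecI) (auto simp: algebra_simps)
      then have "\<theta> (red (x + y)) = \<theta> (red x) + \<theta> (red y)"
        using lin red[OF x] red[OF y] by (auto simp: vec_linear_def)
      then show "\<theta>' (x + y) = \<theta>' x + \<theta>' y"
        using x y b tr[OF x] tr[OF y] by (intro eq_vecI) (auto simp: \<theta>'_def)
    next
      fix c and x :: "'k vec" assume x: "x \<in> carrier_vec N"
      have "red (c \<cdot>\<^sub>v x) = c \<cdot>\<^sub>v red x"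
        unfolding red_def using x w0 b by (intro eq_vecI) (auto simp: algebra_simps)
      then have "\<theta> (red (c \<cdot>\<^sub>v x)) = c \<cdot>\<^sub>v \<theta> (red x)"
        using lin red[OF x] by (auto simp: vec_linear_def)
      then show "\<theta>' (c \<cdot>\<^sub>v x) = c \<cdot>\<^sub>v \<theta>' x"
        using x b tr[OF x] by (intro eq_vecI) (auto simp: \<theta>'_def)
    qed (auto simp: \<theta>'_def)
    moreover have "bij_betw \<theta>' W (carrier_vec (Suc n))"
      unfolding bij_betw_def
    proof (intro conjI inj_onI equalityI subsetI)
      fix x y assume x: "x \<in> W" and y: "y \<in> W" and eq: "\<theta>' x = \<theta>' y"
      have c: "x \<in> carrier_vec N" "y \<in> carrier_vec N" using x y Suc(2) by auto
      have i: "\<theta>' x $ i = \<theta>' y $ i" for i using eq by simp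
      have xb: "x $ b = y $ b" using i[of n] by (simp add: \<theta>'_def)
      have "\<theta> (red x) = \<theta> (red y)"
      proof (rule eq_vecI)
        fix j assume "j < dim_vec (\<theta> (red y))"
        then have "j < n" using tr[OF c(2)] by auto
        then show "\<theta> (red x) $ j = \<theta> (red y) $ j" using i[of j] by (simp add: \<theta>'_def)
      qed (use tr[OF c(1)] tr[OF c(2)] in auto)
      then have r: "red x = red y" using bij redW[OF x] redW[OF y] by (auto simp: bij_betw_def inj_on_def)
      show "x = y"
      proof (rule eq_vecI)
        fix j assume "j < dim_vec y"
        then have j: "j < N" using c by auto
        have "red x $ j = red y $ j" using r by simp
        then show "x $ j = y $ j" using j c w0 xb by (simp add: red_def)
      qed (use c in auto)
    next
      fix z assume "z \<in> \<theta>' ` W"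
      then show "z \<in> carrier_vec (Suc n)" by (auto simp: \<theta>'_def)
    next
      fix z :: "'k vec" assume z: "z \<in> carrier_vec (Suc n)"
      have "vec n (\<lambda>i. z $ i) \<in> \<theta> ` ?W" using bij by (auto simp: bij_betw_def)
      then obtain w where w: "w \<in> W" "w $ b = 0" "\<theta> w = vec n (\<lambda>i. z $ i)" by auto
      let ?x = "w + z $ n \<cdot>\<^sub>v w0"
      have wc: "w \<in> carrier_vec N" using w Suc(2) by auto
      have "red ?x = w" unfolding red_def using wc w0 b w(2) by (intro eq_vecI) auto
      then have "\<theta>' ?x = z" using z w wc w0 b by (intro eq_vecI) (auto simp: \<theta>'_def less_Suc_eq)
      moreover have "?x \<in> W" using w w0 Suc(4,5) by auto
      ultimately show "z \<in> \<theta>' ` W" by (metis image_eqI)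
    qed
    ultimately show ?thesis by blast
  qed
qed

lemma subspace_coordinates:
  fixes W :: "'k::field vec set"
  assumes "W \<subseteq> carrier_vec N" "0\<^sub>v N \<in> W" "\<And>x y. x \<in> W \<Longrightarrow> y \<in> W \<Longrightarrow> x + y \<in> W"
    and "\<And>c x. x \<in> W \<Longrightarrow> c \<cdot>\<^sub>v x \<in> W"
  obtains n \<theta> where "vec_linear N n \<theta>" "bij_betw \<theta> W (carrier_vec n)"
  using subspace_coordinates_aux[OF assms, of N] by auto

text \<open>
  Let \<open>L\<close> be the matrix of a linear map that identifies the range of \<open>A\<close> with \<open>k\<^sup>r\<close>, and let the columns of \<open>X\<close> be
  preimages under \<open>L A\<close> of the standard basis. Then \<open>X L\<close> is a generalised inverse of \<open>A\<close>.
\<close>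

lemma matrix_regular:
  fixes A :: "'k::field mat"
  assumes A: "A \<in> carrier_mat m n"
  obtains B where "B \<in> carrier_mat n m" "A * (B * A) = A"
proof -
  let ?W = "(\<lambda>x. A *\<^sub>v x) ` carrier_vec n"
  obtain r \<theta> where lin: "vec_linear m r \<theta>" and bij: "bij_betw \<theta> ?W (carrier_vec r)"
  proof (rule subspace_coordinates)
    show "?W \<subseteq> carrier_vec m" using A by auto
    have "A *\<^sub>v 0\<^sub>v n = 0\<^sub>v m" using A by (intro eq_vecI) auto
    then show "0\<^sub>v m \<in> ?W" by (metis image_eqI zero_carrier_vec)
    show "\<And>x y. x \<in> ?W \<Longrightarrow> y \<in> ?W \<Longrightarrow> x + y \<in> ?W"
      using A by (auto simp flip: mult_add_distrib_mat_vec)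
    show "\<And>c x. x \<in> ?W \<Longrightarrow> c \<cdot>\<^sub>v x \<in> ?W"
      using A by (auto simp flip: mult_mat_vec)
  qed
  have "\<exists>x. x \<in> carrier_vec n \<and> \<theta> (A *\<^sub>v x) = y" if "y \<in> carrier_vec r" for y
    using bij that unfolding bij_betw_def by (metis (no_types, lifting) imageE)
  then have "\<exists>x. x \<in> carrier_vec n \<and> \<theta> (A *\<^sub>v x) = unit_vec r j" for j by simp
  then obtain x where x: "\<And>j. x j \<in> carrier_vec n" "\<And>j. \<theta> (A *\<^sub>v x j) = unit_vec r j" by metis
  define X where "X = mat n r (\<lambda>(i, j). x j $ i)"
  have X: "X \<in> carrier_mat n r" by (simp add: X_def)
  define L where "L = mat_of m r \<theta>"
  have L: "L \<in> carrier_mat r m" by (simp add: L_def)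
  have Lm: "L *\<^sub>v y = \<theta> y" if "y \<in> carrier_vec m" for y
    unfolding L_def by (rule mat_of_mult[OF lin that])
  have LAX: "L * (A * X) = 1\<^sub>m r"
  proof -
    have col: "col (L * (A * X)) j = unit_vec r j" if j: "j < r" for j
    proof -
      have "col (L * (A * X)) j = L *\<^sub>v (A *\<^sub>v col X j)" using j L A X by (simp add: col_mult2[where nr = r and n = m and nc = r] col_mult2[where nr = m and n = n and nc = r])
      also have "col X j = x j" using j x(1)[of j] by (intro eq_vecI) (auto simp: X_def)
      also have "L *\<^sub>v (A *\<^sub>v x j) = \<theta> (A *\<^sub>v x j)" using A x(1)[of j] by (intro Lm) auto
      finally show ?thesis using x by simp
    qed
    then show ?thesis
      using L A X by (intro mat_col_eqI) auto
  qed
  have "A * ((X * L) * A) = A"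
  proof (rule mat_eq_by_vec)
    show "A * ((X * L) * A) \<in> carrier_mat m n" using A X L by simp
    show "A \<in> carrier_mat m n" by (rule A)
    fix v :: "'k vec" assume v: "v \<in> carrier_vec n"
    have Av: "A *\<^sub>v v \<in> carrier_vec m" using A v by auto
    let ?z = "X *\<^sub>v (L *\<^sub>v (A *\<^sub>v v))"
    have Lz: "L *\<^sub>v (A *\<^sub>v v) \<in> carrier_vec r" using L Av by auto
    have z: "?z \<in> carrier_vec n" using X Lz by auto
    have e: "(A * ((X * L) * A)) *\<^sub>v v = A *\<^sub>v ?z"
      using assoc_mult_mat_vec[OF A _ v, of "(X * L) * A"] assoc_mult_mat_vec[OF mult_carrier_mat[OF X L] A v]
        assoc_mult_mat_vec[OF X L Av] A X L by simp
    have "\<theta> (A *\<^sub>v ?z) = L *\<^sub>v (A *\<^sub>v ?z)" using A z by (intro Lm[symmetric]) auto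
    also have "\<dots> = (L * (A * X)) *\<^sub>v (L *\<^sub>v (A *\<^sub>v v))"
      using assoc_mult_mat_vec[OF L _ Lz, of "A * X"] assoc_mult_mat_vec[OF A X Lz] A X by simp
    also have "\<dots> = \<theta> (A *\<^sub>v v)" unfolding LAX using L Av Lm[OF Av] one_mult_mat_vec[of "\<theta> (A *\<^sub>v v)" r] by (metis mult_mat_vec_carrier)
    finally have "A *\<^sub>v ?z = A *\<^sub>v v"
      using bij v z unfolding bij_betw_def inj_on_def by blast
    then show "(A * ((X * L) * A)) *\<^sub>v v = A *\<^sub>v v" using e by simp
  qed
  then show ?thesis using that[of "X * L"] X L by simp
qed

text \<open>
  For the first claim: if \<open>m > n\<close>, padding \<open>A\<close> and \<open>L\<close> with zeros to square matrices would give an invertible matrix with a zero row.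
\<close>

lemma left_inverse_dim:
  fixes A L :: "'k::field mat"
  assumes A: "A \<in> carrier_mat n m" and L: "L \<in> carrier_mat m n" and LA: "L * A = 1\<^sub>m m"
  shows "m \<le> n" "m = n \<Longrightarrow> A * L = 1\<^sub>m n"
proof -
  show "m = n \<Longrightarrow> A * L = 1\<^sub>m n" using assms mat_mult_left_right_inverse[of L n A] by blast
  show "m \<le> n"
  proof (rule ccontr)
    assume "\<not> m \<le> n" then have nm: "n < m" by simp
    let ?A = "mat m m (\<lambda>(i, j). if i < n then A $$ (i, j) else 0)"
    let ?L = "mat m m (\<lambda>(i, j). if j < n then L $$ (i, j) else 0)"
    have "?L * ?A = 1\<^sub>m m"
    proof (rule eq_matI)
      fix i j assume "i < dim_row (1\<^sub>m m :: 'k mat)" "j < dim_col (1\<^sub>m m :: 'k mat)"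
      then have ij: "i < m" "j < m" by auto
      have "(?L * ?A) $$ (i, j) = (\<Sum>t<m. (if t < n then L $$ (i, t) * A $$ (t, j) else 0))"
        using ij by (auto simp: scalar_prod_def atLeast0LessThan intro!: sum.cong)
      also have "\<dots> = (\<Sum>t<n. L $$ (i, t) * A $$ (t, j))"
        using nm by (subst sum.If_cases) (auto intro!: sum.cong)
      also have "\<dots> = (L * A) $$ (i, j)"
        using ij A L by (auto simp: scalar_prod_def atLeast0LessThan intro!: sum.cong)
      finally show "(?L * ?A) $$ (i, j) = 1\<^sub>m m $$ (i, j)" using LA by simp
    qed auto
    then have "?A * ?L = 1\<^sub>m m" by (intro mat_mult_left_right_inverse[of ?L m ?A]) auto
    then have "(?A * ?L) $$ (n, n) = 1" using nm by simp
    moreover have "(?A * ?L) $$ (n, n) = 0" using nm by (auto simp: scalar_prod_def intro!: sum.neutral)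
    ultimately show False by simp
  qed
qed

text \<open>
  The Kronecker product, with the index pair \<open>(i, i')\<close> coded as \<open>i * dim_row B + i'\<close>.
\<close>

definition kron :: "'k::field mat \<Rightarrow> 'k mat \<Rightarrow> 'k mat" where
  "kron A B = mat (dim_row A * dim_row B) (dim_col A * dim_col B)
     (\<lambda>(i, j). A $$ (i div dim_row B, j div dim_col B) * B $$ (i mod dim_row B, j mod dim_col B))"

lemma kron_dim [simp]: "dim_row (kron A B) = dim_row A * dim_row B" "dim_col (kron A B) = dim_col A * dim_col B"
  by (auto simp: kron_def)

lemma kron_carrier [intro]: "A \<in> carrier_mat a b \<Longrightarrow> B \<in> carrier_mat c d \<Longrightarrow> kron A B \<in> carrier_mat (a * c) (b * d)"
  by (auto simp: kron_def)

lemma div_less_mult: "(i::nat) < a * b \<Longrightarrow> i div b < a" and mod_less_mult: "(i::nat) < a * b \<Longrightarrow> i mod b < b"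
  by (metis less_mult_imp_div_less) (metis bot_nat_0.not_eq_extremum mod_less_divisor mult_0_right not_less_zero)

lemma sum_div_mod: "(\<Sum>t<a * b. F (t div b) (t mod b)) = (\<Sum>i<a. \<Sum>j<(b::nat). F i j :: 'k::comm_monoid_add)"
proof (induct a)
  case (Suc a)
  have split: "(\<Sum>t<p + q. f t) = (\<Sum>t<p. f t) + (\<Sum>t<q. f (p + t))" for f :: "nat \<Rightarrow> 'k" and p q
    by (induct q) (auto simp: add.assoc)
  have "(\<Sum>t<Suc a * b. F (t div b) (t mod b)) = (\<Sum>t<a * b + b. F (t div b) (t mod b))"
    by (simp add: add.commute)
  also have "\<dots> = (\<Sum>t<a * b. F (t div b) (t mod b)) + (\<Sum>j<b. F ((a * b + j) div b) ((a * b + j) mod b))"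
    by (rule split)
  also have "(\<Sum>j<b. F ((a * b + j) div b) ((a * b + j) mod b)) = (\<Sum>j<b. F a j)"
    by (intro sum.cong) auto
  finally show ?case using Suc by simp
qed simp

lemma kron_mult:
  fixes A B :: "'k::field mat"
  assumes "A \<in> carrier_mat a b" "B \<in> carrier_mat p q" "C \<in> carrier_mat b c" "D \<in> carrier_mat q r"
  shows "kron A B * kron C D = kron (A * C) (B * D)"
proof (rule eq_matI)
  fix i j assume "i < dim_row (kron (A * C) (B * D))" "j < dim_col (kron (A * C) (B * D))"
  then have ij: "i < a * p" "j < c * r" using assms by auto
  note l = div_less_mult[OF ij(1)] div_less_mult[OF ij(2)] mod_less_mult[OF ij(1)] mod_less_mult[OF ij(2)]
  have "(kron A B * kron C D) $$ (i, j) =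
      (\<Sum>t<b * q. (A $$ (i div p, t div q) * C $$ (t div q, j div r)) * (B $$ (i mod p, t mod q) * D $$ (t mod q, j mod r)))"
    using ij assms by (auto simp: scalar_prod_def kron_def atLeast0LessThan intro!: sum.cong)
  also have "\<dots> = (\<Sum>s<b. \<Sum>u<q. (A $$ (i div p, s) * C $$ (s, j div r)) * (B $$ (i mod p, u) * D $$ (u, j mod r)))"
    by (rule sum_div_mod)
  also have "\<dots> = (\<Sum>s<b. A $$ (i div p, s) * C $$ (s, j div r)) * (\<Sum>u<q. B $$ (i mod p, u) * D $$ (u, j mod r))"
    by (rule sum_product[symmetric])
  also have "\<dots> = (A * C) $$ (i div p, j div r) * (B * D) $$ (i mod p, j mod r)"
    using l assms by (auto simp: scalar_prod_def atLeast0LessThan)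
  also have "\<dots> = kron (A * C) (B * D) $$ (i, j)" using ij assms by (simp add: kron_def)
  finally show "(kron A B * kron C D) $$ (i, j) = kron (A * C) (B * D) $$ (i, j)" .
qed (use assms in auto)

lemma kron_one: "kron (1\<^sub>m a) (1\<^sub>m b) = (1\<^sub>m (a * b) :: 'k::field mat)"
proof (rule eq_matI)
  fix i j assume "i < dim_row (1\<^sub>m (a * b) :: 'k mat)" "j < dim_col (1\<^sub>m (a * b) :: 'k mat)"
  then have ij: "i < a * b" "j < a * b" by auto
  have "i = j \<longleftrightarrow> i div b = j div b \<and> i mod b = j mod b" by (metis div_mult_mod_eq)
  then show "kron (1\<^sub>m a) (1\<^sub>m b) $$ (i, j) = (1\<^sub>m (a * b) :: 'k mat) $$ (i, j)"
    using ij div_less_mult[OF ij(1)] div_less_mult[OF ij(2)] mod_less_mult[OF ij(1)] mod_less_mult[OF ij(2)]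
    by (auto simp: kron_def)
qed auto

lemma kron_add_left:
  assumes "A \<in> carrier_mat a b" "A' \<in> carrier_mat a b" "B \<in> carrier_mat c d"
  shows "kron (A + A') B = kron A B + kron A' (B :: 'k::field mat)"
  using assms by (intro eq_matI) (auto simp: kron_def div_less_mult mod_less_mult algebra_simps dest: div_less_mult mod_less_mult)

lemma kron_add_right:
  assumes "A \<in> carrier_mat a b" "B' \<in> carrier_mat c d" "B \<in> carrier_mat c d"
  shows "kron A (B + B') = kron A B + kron A (B' :: 'k::field mat)"
proof (rule eq_matI)
  fix i j assume "i < dim_row (kron A B + kron A B')" "j < dim_col (kron A B + kron A B')"
  then have ij: "i < a * c" "j < b * d" using assms by auto
  show "kron A (B + B') $$ (i, j) = (kron A B + kron A B') $$ (i, j)"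
    using ij mod_less_mult[OF ij(1)] mod_less_mult[OF ij(2)] assms by (simp add: kron_def algebra_simps)
qed (use assms in auto)

lemma kron_smult_left:
  assumes "A \<in> carrier_mat a b" "B \<in> carrier_mat c d"
  shows "kron (x \<cdot>\<^sub>m A) B = x \<cdot>\<^sub>m kron A (B :: 'k::field mat)"
  using assms by (intro eq_matI) (auto simp: kron_def div_less_mult mod_less_mult algebra_simps dest: div_less_mult mod_less_mult)

lemma kron_smult_right:
  assumes "A \<in> carrier_mat a b" "B \<in> carrier_mat c d"
  shows "kron A (x \<cdot>\<^sub>m B) = x \<cdot>\<^sub>m kron A (B :: 'k::field mat)"
proof (rule eq_matI)
  fix i j assume "i < dim_row (x \<cdot>\<^sub>m kron A B)" "j < dim_col (x \<cdot>\<^sub>m kron A B)"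
  then have ij: "i < a * c" "j < b * d" using assms by auto
  show "kron A (x \<cdot>\<^sub>m B) $$ (i, j) = (x \<cdot>\<^sub>m kron A B) $$ (i, j)"
    using ij mod_less_mult[OF ij(1)] mod_less_mult[OF ij(2)] assms by (simp add: kron_def algebra_simps)
qed (use assms in auto)

lemma kron_one_one: "kron (1\<^sub>m 1) A = (A :: 'k::field mat)"
  by (intro eq_matI) (auto simp: kron_def)

definition col_mat :: "'k::field vec \<Rightarrow> 'k mat" where
  "col_mat v = mat (dim_vec v) 1 (\<lambda>(i, j). v $ i)"

lemma col_mat_carrier [simp]: "v \<in> carrier_vec n \<Longrightarrow> col_mat v \<in> carrier_mat n 1"
  by (auto simp: col_mat_def)

lemma mult_col_mat: "A \<in> carrier_mat m n \<Longrightarrow> v \<in> carrier_vec n \<Longrightarrow> A * col_mat v = col_mat (A *\<^sub>v v)"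
  by (intro eq_matI) (auto simp: col_mat_def scalar_prod_def)

text \<open>
  The block matrix with the blocks \<open>B 0, \<dots>, B (n - 1)\<close>, each of size \<open>m \<times> d\<close>, side by side.
\<close>

definition hcat :: "nat \<Rightarrow> nat \<Rightarrow> nat \<Rightarrow> (nat \<Rightarrow> 'k::field mat) \<Rightarrow> 'k mat" where
  "hcat n d m B = mat m (n * d) (\<lambda>(r, c). B (c div d) $$ (r, c mod d))"

lemma hcat_carrier [simp]: "hcat n d m B \<in> carrier_mat m (n * d)"
  by (simp add: hcat_def)

text \<open>
  As the index \<open>i * n2 + j\<close> stands for the pair \<open>(i, j)\<close>, a block matrix represents a matrix-valued bilinear map of two
  vectors, given by its values on the standard basis vectors.
\<close>

lemma hcat_kron:
  fixes B :: "nat \<Rightarrow> 'k::field mat"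
  assumes x: "x \<in> carrier_vec n1" and y: "y \<in> carrier_vec n2" and r: "r < m" and c: "c < d"
  shows "(hcat (n1 * n2) d m B * kron (kron (col_mat x) (col_mat y)) (1\<^sub>m d)) $$ (r, c) =
    (\<Sum>i<n1. \<Sum>j<n2. x $ i * y $ j * B (i * n2 + j) $$ (r, c))"
proof -
  define f where "f = kron (col_mat x) (col_mat y)"
  have f: "f \<in> carrier_mat (n1 * n2) 1" unfolding f_def using kron_carrier[OF col_mat_carrier[OF x] col_mat_carrier[OF y]] by simp
  have ft: "f $$ (t, 0) = x $ (t div n2) * y $ (t mod n2)" if "t < n1 * n2" for t
    using that x y div_less_mult[OF that] mod_less_mult[OF that] by (auto simp: f_def kron_def col_mat_def)
  have "(hcat (n1 * n2) d m B * kron f (1\<^sub>m d)) $$ (r, c) =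
     (\<Sum>t<(n1 * n2) * d. B (t div d) $$ (r, t mod d) * (f $$ (t div d, 0) * (1\<^sub>m d :: 'k mat) $$ (t mod d, c)))"
    using r c f by (auto simp: scalar_prod_def hcat_def kron_def atLeast0LessThan intro!: sum.cong)
  also have "\<dots> = (\<Sum>t<n1 * n2. \<Sum>u<d. B t $$ (r, u) * (f $$ (t, 0) * (1\<^sub>m d :: 'k mat) $$ (u, c)))"
    by (rule sum_div_mod)
  also have "\<dots> = (\<Sum>t<n1 * n2. B t $$ (r, c) * f $$ (t, 0))"
  proof (intro sum.cong refl)
    fix t
    have "(\<Sum>u<d. B t $$ (r, u) * (f $$ (t, 0) * (1\<^sub>m d :: 'k mat) $$ (u, c))) =
       (\<Sum>u<d. if u = c then B t $$ (r, c) * f $$ (t, 0) else 0)"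
      using c by (intro sum.cong) auto
    then show "(\<Sum>u<d. B t $$ (r, u) * (f $$ (t, 0) * (1\<^sub>m d :: 'k mat) $$ (u, c))) = B t $$ (r, c) * f $$ (t, 0)"
      using c by simp
  qed
  also have "\<dots> = (\<Sum>t<n1 * n2. x $ (t div n2) * y $ (t mod n2) * B ((t div n2) * n2 + t mod n2) $$ (r, c))"
    by (intro sum.cong) (auto simp: ft)
  also have "\<dots> = (\<Sum>i<n1. \<Sum>j<n2. x $ i * y $ j * B (i * n2 + j) $$ (r, c))"
    by (rule sum_div_mod)
  finally show ?thesis unfolding f_def .
qed

lemma hcat_of_mat: assumes "X \<in> carrier_mat m (n * d)"
  shows "X = hcat n d m (\<lambda>i. mat m d (\<lambda>(r, c). X $$ (r, i * d + c)))"
  using assms by (intro eq_matI) (auto simp: hcat_def mod_less_mult)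

lemma mat_eq_by_kron:
  fixes X Y :: "'k::field mat"
  assumes X: "X \<in> carrier_mat m ((n1 * n2) * d)" and Y: "Y \<in> carrier_mat m ((n1 * n2) * d)"
    and eq: "\<And>x y. x \<in> carrier_vec n1 \<Longrightarrow> y \<in> carrier_vec n2 \<Longrightarrow>
       X * kron (kron (col_mat x) (col_mat y)) (1\<^sub>m d) = Y * kron (kron (col_mat x) (col_mat y)) (1\<^sub>m d)"
  shows "X = Y"
proof -
  have val: "(Z * kron (kron (col_mat (unit_vec n1 i)) (col_mat (unit_vec n2 j))) (1\<^sub>m d)) $$ (r, c) = Z $$ (r, (i * n2 + j) * d + c)"
    if Z: "Z \<in> carrier_mat m ((n1 * n2) * d)" and l: "i < n1" "j < n2" "c < d" "r < m" for Z :: "'k mat" and i j c r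
  proof -
    have "(Z * kron (kron (col_mat (unit_vec n1 i)) (col_mat (unit_vec n2 j))) (1\<^sub>m d)) $$ (r, c) =
      (\<Sum>i'<n1. \<Sum>j'<n2. unit_vec n1 i $ i' * unit_vec n2 j $ j' * Z $$ (r, (i' * n2 + j') * d + c))"
      apply (subst hcat_of_mat[OF Z])
      apply (subst hcat_kron)
      using l by (auto intro!: sum.cong)
    also have "\<dots> = (\<Sum>i'<n1. \<Sum>j'<n2. if j' = j then (if i' = i then Z $$ (r, (i * n2 + j) * d + c) else 0) else 0)"
      using l by (intro sum.cong) (auto simp: unit_vec_def)
    also have "\<dots> = Z $$ (r, (i * n2 + j) * d + c)" using l by simp
    finally show ?thesis .
  qed
  show ?thesis
  proof (rule eq_matI)
    fix r t assume "r < dim_row Y" "t < dim_col Y"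
    then have rt: "r < m" "t < (n1 * n2) * d" using Y by auto
    note t1 = div_less_mult[OF rt(2)]
    note l = div_less_mult[OF t1] mod_less_mult[OF t1] mod_less_mult[OF rt(2)]
    have "X $$ (r, (t div d div n2 * n2 + t div d mod n2) * d + t mod d) = Y $$ (r, (t div d div n2 * n2 + t div d mod n2) * d + t mod d)"
      using val[OF X l rt(1)] val[OF Y l rt(1)] eq by simp
    then show "X $$ (r, t) = Y $$ (r, t)" by simp
  qed (use X Y in auto)
qed

section \<open>Functors and equivalences\<close>

lemma functorD:
  assumes "is_functor C D F"
  shows "X \<in> Ob C \<Longrightarrow> FOb F X \<in> Ob D"
    and "f \<in> Ar C \<Longrightarrow> FAr F f \<in> Ar D"
    and "f \<in> Ar C \<Longrightarrow> Src D (FAr F f) = FOb F (Src C f)"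
    and "f \<in> Ar C \<Longrightarrow> Tgt D (FAr F f) = FOb F (Tgt C f)"
    and "X \<in> Ob C \<Longrightarrow> FAr F (Idn C X) = Idn D (FOb F X)"
    and "f \<in> Ar C \<Longrightarrow> g \<in> Ar C \<Longrightarrow> Src C g = Tgt C f \<Longrightarrow> FAr F (g \<cdot>\<^bsub>C\<^esub> f) = FAr F g \<cdot>\<^bsub>D\<^esub> FAr F f"
  using assms unfolding is_functor_def Hom_def by auto

lemma linear_functorD:
  assumes "linear_functor C D F"
  shows "is_functor C D F"
    and "f \<in> Ar C \<Longrightarrow> g \<in> Ar C \<Longrightarrow> Src C g = Src C f \<Longrightarrow> Tgt C g = Tgt C f \<Longrightarrow>
       FAr F (Add C f g) = Add D (FAr F f) (FAr F g)"
    and "f \<in> Ar C \<Longrightarrow> FAr F (Scale C c f) = Scale D c (FAr F f)"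
  using assms unfolding linear_functor_def Hom_def by auto

lemma functor_iso:
  assumes "category C" "category D" "is_functor C D F" "is_iso C f"
  shows "is_iso D (FAr F f)" "FAr F (Inv C f) \<cdot>\<^bsub>D\<^esub> FAr F f = Idn D (FOb F (Src C f))"
    "FAr F f \<cdot>\<^bsub>D\<^esub> FAr F (Inv C f) = Idn D (FOb F (Tgt C f))"
proof -
  interpret C: category C by fact
  interpret D: category D by fact
  note F [simp] = functorD[OF assms(3)]
  note f [simp] = C.iso_arr[OF assms(4)] assms(4)
  show 1: "FAr F (Inv C f) \<cdot>\<^bsub>D\<^esub> FAr F f = Idn D (FOb F (Src C f))"
    using F(6)[of f "Inv C f"] by simp
  show 2: "FAr F f \<cdot>\<^bsub>D\<^esub> FAr F (Inv C f) = Idn D (FOb F (Tgt C f))"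
    using F(6)[of "Inv C f" f] by simp
  show "is_iso D (FAr F f)"
    by (rule D.isoI[where g = "FAr F (Inv C f)"]) (auto simp: 1 2)
qed

lemma linear_functor_zero:
  assumes "linear_category C" "linear_category D" "linear_functor C D F" "X \<in> Ob C" "Y \<in> Ob C"
  shows "FAr F (Zero C X Y) = Zero D (FOb F X) (FOb F Y)"
proof -
  interpret C: linear_category C by fact
  interpret D: linear_category D by fact
  note F = functorD[OF linear_functorD(1)[OF assms(3)]]
  have "FAr F (Scale C 0 (Zero C X Y)) = Scale D 0 (FAr F (Zero C X Y))"
    using assms by (intro linear_functorD(3)) auto
  then show ?thesis using assms F by (simp add: C.scale_zero_left D.scale_zero_left)
qed

text \<open>
  Over a regular category every cokernel is split, and linear functors preserve split cokernels.
\<close>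

lemma regular_right_exact:
  assumes "linear_category C" "linear_category D" "linear_functor C D F" "regular_category C"
  shows "right_exact C D F"
  unfolding right_exact_def
proof (intro allI impI)
  interpret C: linear_category C by fact
  interpret D: linear_category D by fact
  note L = linear_functorD[OF assms(3)]
  note F = functorD[OF L(1)]
  fix f q assume fq: "is_cokernel C f q"
  note q = C.cokernelD(1-4)[OF fq]
  obtain g s where gs: "g \<in> Hom C (Tgt C f) (Src C f)" "s \<in> Hom C (Tgt C q) (Tgt C f)"
    "q \<cdot>\<^bsub>C\<^esub> s = Idn C (Tgt C q)" "Add C (f \<cdot>\<^bsub>C\<^esub> g) (s \<cdot>\<^bsub>C\<^esub> q) = Idn C (Tgt C f)"
    using C.regular_cokernel_splits[OF assms(4) fq] .
  note a = gs(1,2)[unfolded Hom_def]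
  show "is_cokernel D (FAr F f) (FAr F q)"
  proof (rule D.split_cokernelI)
    show "FAr F f \<in> Hom D (FOb F (Src C f)) (FOb F (Tgt C f))" using q F by (simp add: Hom_def)
    show "FAr F q \<in> Hom D (FOb F (Tgt C f)) (FOb F (Tgt C q))" using q F by (simp add: Hom_def)
    show "FAr F g \<in> Hom D (FOb F (Tgt C f)) (FOb F (Src C f))" using a F by (simp add: Hom_def)
    show "FAr F s \<in> Hom D (FOb F (Tgt C q)) (FOb F (Tgt C f))" using a F by (simp add: Hom_def)
    show "FAr F q \<cdot>\<^bsub>D\<^esub> FAr F f = Zero D (FOb F (Src C f)) (FOb F (Tgt C q))"
      using F(6)[of f q] q linear_functor_zero[OF assms(1-3)] by simp
    show "FAr F q \<cdot>\<^bsub>D\<^esub> FAr F s = Idn D (FOb F (Tgt C q))"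
      using F(6)[of s q] q a gs F by simp
    have "FAr F (Add C (f \<cdot>\<^bsub>C\<^esub> g) (s \<cdot>\<^bsub>C\<^esub> q)) = Add D (FAr F f \<cdot>\<^bsub>D\<^esub> FAr F g) (FAr F s \<cdot>\<^bsub>D\<^esub> FAr F q)"
      using a q F(6) by (subst L(2)) auto
    then show "Add D (FAr F f \<cdot>\<^bsub>D\<^esub> FAr F g) (FAr F s \<cdot>\<^bsub>D\<^esub> FAr F q) = Idn D (FOb F (Tgt C f))"
      unfolding gs(4) using q F by simp
  qed
qed

lemma id_linear: "linear_functor C C id_ftr"
  by (auto simp: is_functor_def linear_functor_def id_ftr_def)

lemma comp_functor: "is_functor D E F \<Longrightarrow> is_functor C D G \<Longrightarrow> is_functor C E (comp_ftr F G)"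
  unfolding is_functor_def comp_ftr_def by (simp, metis)

lemma comp_linear:
  assumes "linear_functor D E F" "linear_functor C D G" shows "linear_functor C E (comp_ftr F G)"
proof -
  have GHom: "\<And>f X Y. f \<in> Hom C X Y \<Longrightarrow> FAr G f \<in> Hom D (FOb G X) (FOb G Y)"
    using assms(2) unfolding linear_functor_def is_functor_def by blast
  show ?thesis unfolding linear_functor_def
  proof (intro conjI allI ballI)
    show "is_functor C E (comp_ftr F G)" using assms by (intro comp_functor[of D]) (auto simp: linear_functor_def)
    fix X Y f g assume f: "f \<in> Hom C X Y" and g: "g \<in> Hom C X Y"
    show "FAr (comp_ftr F G) (Add C f g) = Add E (FAr (comp_ftr F G) f) (FAr (comp_ftr F G) g)"
      using assms f g GHom[OF f] GHom[OF g] unfolding linear_functor_def comp_ftr_def by simp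
  next
    fix X Y c f assume f: "f \<in> Hom C X Y"
    show "FAr (comp_ftr F G) (Scale C c f) = Scale E c (FAr (comp_ftr F G) f)"
      using assms f GHom[OF f] unfolding linear_functor_def comp_ftr_def by simp
  qed
qed

lemma comp_right_exact_functor:
  "right_exact_functor D E F \<Longrightarrow> right_exact_functor C D G \<Longrightarrow> right_exact_functor C E (comp_ftr F G)"
  unfolding right_exact_functor_def using comp_linear[of D E F C G]
  by (auto simp: right_exact_def comp_ftr_def)

locale linear_equivalence = C: linear_category C + D: linear_category D
  for C :: "('o1, 'm1, 'k::field, 'r1) lcat_scheme" and D :: "('o2, 'm2, 'k, 'r2) lcat_scheme" +
  fixes F :: "('o1, 'm1, 'o2, 'm2) ftr"
  assumes equiv: "is_equivalence C D F"
begin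

lemma linear: "linear_functor C D F"
  using equiv by (simp add: is_equivalence_def)

lemmas F [simp] = functorD[OF linear_functorD(1)[OF linear]]

lemma faithful_full_ess_surj:
  shows faithful: "\<And>f g. f \<in> Ar C \<Longrightarrow> g \<in> Ar C \<Longrightarrow> Src C f = Src C g \<Longrightarrow> Tgt C f = Tgt C g
      \<Longrightarrow> FAr F f = FAr F g \<Longrightarrow> f = g"
    and full_Hom: "\<And>X Y h. X \<in> Ob C \<Longrightarrow> Y \<in> Ob C \<Longrightarrow> h \<in> Hom D (FOb F X) (FOb F Y) \<Longrightarrow> \<exists>f \<in> Hom C X Y. FAr F f = h"
    and ess_surj_Hom: "\<And>W. W \<in> Ob D \<Longrightarrow> \<exists>Z \<in> Ob C. \<exists>e \<in> Hom D (FOb F Z) W. is_iso D e"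
proof -
  obtain G :: "('o2, 'm2, 'o1, 'm1) ftr" and \<eta> \<epsilon> where G: "linear_functor D C G"
    and \<eta>: "nat_iso C C id_ftr (comp_ftr G F) \<eta>" and \<epsilon>: "nat_iso D D (comp_ftr F G) id_ftr \<epsilon>"
    using equiv unfolding is_equivalence_def by blast
  note G' [simp] = functorD[OF linear_functorD(1)[OF G]]
  have \<eta>1 [simp]: "\<eta> X \<in> Ar C" "Src C (\<eta> X) = X" "Tgt C (\<eta> X) = FOb G (FOb F X)" "is_iso C (\<eta> X)" if "X \<in> Ob C" for X
    using \<eta> that unfolding nat_iso_def nat_trans_def Hom_def by (auto simp: id_ftr_def comp_ftr_def)
  have \<eta>2: "\<eta> (Tgt C f) \<cdot>\<^bsub>C\<^esub> f = FAr G (FAr F f) \<cdot>\<^bsub>C\<^esub> \<eta> (Src C f)" if "f \<in> Ar C" for f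
    using \<eta> that unfolding nat_iso_def nat_trans_def Hom_def by (auto simp: id_ftr_def comp_ftr_def)
  have \<epsilon>1 [simp]: "\<epsilon> X \<in> Ar D" "Src D (\<epsilon> X) = FOb F (FOb G X)" "Tgt D (\<epsilon> X) = X" "is_iso D (\<epsilon> X)" if "X \<in> Ob D" for X
    using \<epsilon> that unfolding nat_iso_def nat_trans_def Hom_def by (auto simp: id_ftr_def comp_ftr_def)
  have \<epsilon>2: "\<epsilon> (Tgt D f) \<cdot>\<^bsub>D\<^esub> FAr F (FAr G f) = f \<cdot>\<^bsub>D\<^esub> \<epsilon> (Src D f)" if "f \<in> Ar D" for f
    using \<epsilon> that unfolding nat_iso_def nat_trans_def Hom_def by (auto simp: id_ftr_def comp_ftr_def)
  show faithful: "f = g" if "f \<in> Ar C" "g \<in> Ar C" "Src C f = Src C g" "Tgt C f = Tgt C g" "FAr F f = FAr F g" for f g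
  proof -
    have "\<eta> (Tgt C g) \<cdot>\<^bsub>C\<^esub> f = \<eta> (Tgt C g) \<cdot>\<^bsub>C\<^esub> g" using \<eta>2[of f] \<eta>2[of g] that by simp
    then show ?thesis by (rule C.monoD[OF C.iso_is_mono, rotated -1]) (use that in auto)
  qed
  have G_faithful: "f = g" if "f \<in> Ar D" "g \<in> Ar D" "Src D f = Src D g" "Tgt D f = Tgt D g" "FAr G f = FAr G g" for f g
  proof -
    have "f \<cdot>\<^bsub>D\<^esub> \<epsilon> (Src D g) = g \<cdot>\<^bsub>D\<^esub> \<epsilon> (Src D g)" using \<epsilon>2[of f] \<epsilon>2[of g] that by simp
    then show ?thesis by (rule D.epiD[OF D.iso_is_epi, rotated -1]) (use that in auto)
  qed
  show "\<exists>f \<in> Hom C X Y. FAr F f = h" if XY: "X \<in> Ob C" "Y \<in> Ob C" "h \<in> Hom D (FOb F X) (FOb F Y)" for X Y h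
  proof -
    have h: "h \<in> Ar D" "Src D h = FOb F X" "Tgt D h = FOb F Y" using XY by (auto simp: Hom_def)
    let ?f = "Inv C (\<eta> Y) \<cdot>\<^bsub>C\<^esub> (FAr G h \<cdot>\<^bsub>C\<^esub> \<eta> X)"
    have f: "?f \<in> Ar C" "Src C ?f = X" "Tgt C ?f = Y" using XY(1,2) h by auto
    have "\<eta> Y \<cdot>\<^bsub>C\<^esub> ?f = FAr G h \<cdot>\<^bsub>C\<^esub> \<eta> X"
      using XY(1,2) h by (subst C.rewrite_pair[of _ _ "Idn C (FOb G (FOb F Y))"]) auto
    then have "FAr G (FAr F ?f) \<cdot>\<^bsub>C\<^esub> \<eta> X = FAr G h \<cdot>\<^bsub>C\<^esub> \<eta> X" using \<eta>2[OF f(1)] f by simp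
    then have "FAr G (FAr F ?f) = FAr G h"
      by (rule C.epiD[OF C.iso_is_epi, rotated -1]) (use f F(2,3,4)[OF f(1)] h XY(1,2) in \<open>auto simp del: F\<close>)
    then have "FAr F ?f = h" by (rule G_faithful[rotated -1]) (use f F(2,3,4)[OF f(1)] h in \<open>auto simp del: F\<close>)
    then show ?thesis using f by (auto simp: Hom_def)
  qed
  show "\<exists>Z \<in> Ob C. \<exists>e \<in> Hom D (FOb F Z) W. is_iso D e" if "W \<in> Ob D" for W
    using that by (intro bexI[of _ "FOb G W"] bexI[of _ "\<epsilon> W"]) (auto simp: Hom_def)
qed

lemma full: assumes "X \<in> Ob C" "Y \<in> Ob C" "h \<in> Ar D" "Src D h = FOb F X" "Tgt D h = FOb F Y"
  obtains f where "f \<in> Ar C" "Src C f = X" "Tgt C f = Y" "FAr F f = h"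
  using full_Hom[OF assms(1,2), of h] assms(3-5) unfolding Hom_def by auto

lemma ess_surj: assumes "W \<in> Ob D"
  obtains Z e where "Z \<in> Ob C" "e \<in> Ar D" "Src D e = FOb F Z" "Tgt D e = W" "is_iso D e"
  using ess_surj_Hom[OF assms] unfolding Hom_def by auto

lemma right_exact: "right_exact C D F"
  unfolding right_exact_def
proof (intro allI impI)
  fix f q assume fq: "is_cokernel C f q"
  note q = C.cokernelD(1-5)[OF fq] and qL = C.cokernelD(6)[OF fq]
  show "is_cokernel D (FAr F f) (FAr F q)"
  proof (rule D.cokernelI)
    show "FAr F q \<cdot>\<^bsub>D\<^esub> FAr F f = Zero D (Src D (FAr F f)) (Tgt D (FAr F q))"
      using F(6)[of f q] q linear_functor_zero[OF C.linear_category_axioms D.linear_category_axioms linear] by simp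
    have lift: "\<exists>Z e h'. Z \<in> Ob C \<and> is_iso D e \<and> e \<in> Ar D \<and> Src D e = FOb F Z \<and> Tgt D e = W \<and>
        h' \<in> Ar C \<and> Src C h' = X \<and> Tgt C h' = Z \<and> h = e \<cdot>\<^bsub>D\<^esub> FAr F h'"
      if h: "h \<in> Ar D" "Src D h = FOb F X" "Tgt D h = W" "X \<in> Ob C" for h X W
    proof -
      obtain Z e where e: "Z \<in> Ob C" "e \<in> Ar D" "Src D e = FOb F Z" "Tgt D e = W" "is_iso D e"
        using ess_surj[OF D.tgt_Ob[OF h(1), unfolded h(3)]] by blast
      obtain h' where h': "h' \<in> Ar C" "Src C h' = X" "Tgt C h' = Z" "FAr F h' = Inv D e \<cdot>\<^bsub>D\<^esub> h"
        using full[of X Z "Inv D e \<cdot>\<^bsub>D\<^esub> h"] h e by auto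
      have "e \<cdot>\<^bsub>D\<^esub> FAr F h' = h" unfolding h'(4) using e h by (subst D.rewrite_pair[of _ _ "Idn D (Tgt D e)"]) auto
      then show ?thesis using e h' by metis
    qed
    show "is_epi D (FAr F q)"
    proof (rule D.epiI_zero)
      fix g assume g: "g \<in> Ar D" "Src D g = Tgt D (FAr F q)" "g \<cdot>\<^bsub>D\<^esub> FAr F q = Zero D (Src D (FAr F q)) (Tgt D g)"
      define W where "W = Tgt D g"
      note g = g[folded W_def]
      obtain Z e g' where *: "Z \<in> Ob C" "is_iso D e" "e \<in> Ar D" "Src D e = FOb F Z" "Tgt D e = W"
        "g' \<in> Ar C" "Src C g' = Tgt C q" "Tgt C g' = Z" "g = e \<cdot>\<^bsub>D\<^esub> FAr F g'"
        using lift[of g "Tgt C q" W] g q W_def by auto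
      have "e \<cdot>\<^bsub>D\<^esub> FAr F (g' \<cdot>\<^bsub>C\<^esub> q) = g \<cdot>\<^bsub>D\<^esub> FAr F q" using * q by simp
      then have "FAr F (g' \<cdot>\<^bsub>C\<^esub> q) = Zero D (Src D (FAr F (g' \<cdot>\<^bsub>C\<^esub> q))) (Src D e)"
        using g * q by (intro D.mono_zeroD[OF D.iso_is_mono[OF *(2)]]) auto
      also have "\<dots> = FAr F (Zero C (Src C q) Z)"
        using linear_functor_zero[OF C.linear_category_axioms D.linear_category_axioms linear] * q by simp
      finally have "g' \<cdot>\<^bsub>C\<^esub> q = Zero C (Src C q) Z" by (rule faithful[rotated -1]) (use * q in auto)
      then have "g' = Zero C (Tgt C q) (Tgt C g')" using * q by (intro C.epi_zeroD) auto
      then have "FAr F g' = Zero D (FOb F (Tgt C q)) (FOb F Z)"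
        using linear_functor_zero[OF C.linear_category_axioms D.linear_category_axioms linear] * q by (metis C.tgt_Ob)
      then have "g = Zero D (FOb F (Tgt C q)) W" using * q D.tgt_Ob[OF g(1)] W_def by simp
      then show "g = Zero D (Tgt D (FAr F q)) (Tgt D g)" using q unfolding W_def by simp
    qed (use q in auto)
    fix h assume h: "h \<in> Ar D" "Src D h = Tgt D (FAr F f)" "h \<cdot>\<^bsub>D\<^esub> FAr F f = Zero D (Src D (FAr F f)) (Tgt D h)"
    define W where "W = Tgt D h"
    note h = h[folded W_def]
    obtain Z e h' where *: "Z \<in> Ob C" "is_iso D e" "e \<in> Ar D" "Src D e = FOb F Z" "Tgt D e = W"
      "h' \<in> Ar C" "Src C h' = Tgt C f" "Tgt C h' = Z" "h = e \<cdot>\<^bsub>D\<^esub> FAr F h'"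
      using lift[of h "Tgt C f" W] h q W_def by auto
    have "e \<cdot>\<^bsub>D\<^esub> FAr F (h' \<cdot>\<^bsub>C\<^esub> f) = h \<cdot>\<^bsub>D\<^esub> FAr F f" using * q by simp
    then have "FAr F (h' \<cdot>\<^bsub>C\<^esub> f) = Zero D (Src D (FAr F (h' \<cdot>\<^bsub>C\<^esub> f))) (Src D e)"
      using h * q by (intro D.mono_zeroD[OF D.iso_is_mono[OF *(2)]]) auto
    also have "\<dots> = FAr F (Zero C (Src C f) Z)"
      using linear_functor_zero[OF C.linear_category_axioms D.linear_category_axioms linear] * q by simp
    finally have "h' \<cdot>\<^bsub>C\<^esub> f = Zero C (Src C f) Z" by (rule faithful[rotated -1]) (use * q in auto)
    then obtain u where u: "u \<in> Ar C" "Src C u = Tgt C q" "Tgt C u = Z" "u \<cdot>\<^bsub>C\<^esub> q = h'" using qL[of h'] * by auto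
    have "(e \<cdot>\<^bsub>D\<^esub> FAr F u) \<cdot>\<^bsub>D\<^esub> FAr F q = h" using u * q F(6)[of q u] by simp
    then show "\<exists>u. u \<in> Ar D \<and> Src D u = Tgt D (FAr F q) \<and> Tgt D u = Tgt D h \<and> u \<cdot>\<^bsub>D\<^esub> FAr F q = h"
      using u * q by (intro exI[of _ "e \<cdot>\<^bsub>D\<^esub> FAr F u"]) auto
  qed (use q in auto)
qed

end

section \<open>Modules over a finite dimensional algebra\<close>

type_synonym 'k fd_arrow = "'k fd_mod \<times> 'k mat \<times> 'k fd_mod"

abbreviation marr :: "'a \<times> 'k mat \<times> 'b \<Rightarrow> 'k mat" where "marr \<alpha> \<equiv> fst (snd \<alpha>)"

lemma Mod_simps [simp]:
  "Ob (Mod_cat A) = {V. fd_module A V}"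
  "Src (Mod_cat A) \<alpha> = fst \<alpha>" "Tgt (Mod_cat A) \<alpha> = snd (snd \<alpha>)"
  "Idn (Mod_cat A) V = (V, 1\<^sub>m (fst V), V)"
  "\<beta> \<cdot>\<^bsub>Mod_cat A\<^esub> \<alpha> = (fst \<alpha>, marr \<beta> * marr \<alpha>, snd (snd \<beta>))"
  "Add (Mod_cat A) \<alpha> \<beta> = (fst \<alpha>, marr \<alpha> + marr \<beta>, snd (snd \<alpha>))"
  "Zero (Mod_cat A) V W = (V, 0\<^sub>m (fst W) (fst V), W)"
  "Scale (Mod_cat A) c \<alpha> = (fst \<alpha>, c \<cdot>\<^sub>m marr \<alpha>, snd (snd \<alpha>))"
  by (auto simp: Mod_cat_def split: prod.splits)

lemma Mod_Ar: "\<alpha> \<in> Ar (Mod_cat A) \<longleftrightarrow> fd_module A (fst \<alpha>) \<and> fd_module A (snd (snd \<alpha>)) \<and> fd_module_hom A (fst \<alpha>) (snd (snd \<alpha>)) (marr \<alpha>)"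
  by (auto simp: Mod_cat_def split: prod.splits)

lemma marr_carrier: "\<alpha> \<in> Ar (Mod_cat A) \<Longrightarrow> marr \<alpha> \<in> carrier_mat (fst (snd (snd \<alpha>))) (fst (fst \<alpha>))"
  by (simp add: Mod_Ar fd_module_hom_def)

lemma fd_module_act: "fd_module A V \<Longrightarrow> a \<in> carrier_vec (adim A) \<Longrightarrow> v \<in> carrier_vec (fst V) \<Longrightarrow> snd V a v \<in> carrier_vec (fst V)"
  by (simp add: fd_module_def vec_bilinear_def)

lemma Mod_linear_category: "linear_category (Mod_cat (A :: 'k::field fd_alg))"
proof
  let ?M = "Mod_cat A"
  note [simp] = Hom_def Mod_Ar
  show "X \<in> Ob ?M \<Longrightarrow> Idn ?M X \<in> Hom ?M X X" for X
    by (auto simp: fd_module_hom_def fd_module_act)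
  show "X \<in> Ob ?M \<Longrightarrow> Y \<in> Ob ?M \<Longrightarrow> Zero ?M X Y \<in> Hom ?M X Y" for X Y
  proof -
    assume XY: "X \<in> Ob ?M" "Y \<in> Ob ?M"
    have "0\<^sub>m (fst Y) (fst X) *\<^sub>v snd X a v = snd Y a (0\<^sub>m (fst Y) (fst X) *\<^sub>v v)"
      if a: "a \<in> carrier_vec (adim A)" and v: "v \<in> carrier_vec (fst X)" for a v
    proof -
      have z: "0\<^sub>m (fst Y) (fst X) *\<^sub>v w = 0\<^sub>v (fst Y)" if "w \<in> carrier_vec (fst X)" for w :: "'k vec"
        using that by (intro eq_vecI) auto
      have av: "snd X a v \<in> carrier_vec (fst X)" using XY a v by (auto simp: fd_module_act)
      have "snd Y a (0 \<cdot>\<^sub>v 0\<^sub>v (fst Y)) = 0 \<cdot>\<^sub>v snd Y a (0\<^sub>v (fst Y))"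
        using XY a by (simp add: fd_module_def vec_bilinear_def)
      also have "\<dots> = 0\<^sub>v (fst Y)" using XY a fd_module_act[of A Y a "0\<^sub>v (fst Y)"] by (intro eq_vecI) auto
      moreover have "0 \<cdot>\<^sub>v 0\<^sub>v (fst Y) = (0\<^sub>v (fst Y) :: 'k vec)" by (intro eq_vecI) auto
      ultimately have "snd Y a (0\<^sub>v (fst Y)) = 0\<^sub>v (fst Y)" by simp
      then show ?thesis unfolding z[OF av] z[OF v] by simp
    qed
    then show ?thesis using XY by (auto simp: fd_module_hom_def)
  qed
  show "f \<in> Hom ?M X Y \<Longrightarrow> g \<in> Hom ?M Y Z \<Longrightarrow> g \<cdot>\<^bsub>?M\<^esub> f \<in> Hom ?M X Z" for f g X Y Z
  proof -
    assume f: "f \<in> Hom ?M X Y" and g: "g \<in> Hom ?M Y Z"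
    have "marr g * marr f *\<^sub>v snd X a v = snd Z a (marr g * marr f *\<^sub>v v)"
      if a: "a \<in> carrier_vec (adim A)" and v: "v \<in> carrier_vec (fst X)" for a v
    proof -
      have c: "marr f \<in> carrier_mat (fst Y) (fst X)" "marr g \<in> carrier_mat (fst Z) (fst Y)" using f g by (auto simp: fd_module_hom_def)
      have av: "snd X a v \<in> carrier_vec (fst X)" using f a v by (auto simp: fd_module_act)
      show ?thesis
        unfolding assoc_mult_mat_vec[OF c(2,1) av] assoc_mult_mat_vec[OF c(2,1) v]
        using f g a v c by (auto simp: fd_module_hom_def)
    qed
    then show ?thesis using f g by (auto simp: fd_module_hom_def)
  qed
  show "f \<in> Hom ?M X Y \<Longrightarrow> g \<in> Hom ?M X Y \<Longrightarrow> Add ?M f g \<in> Hom ?M X Y" for f g X Y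
  proof -
    assume f: "f \<in> Hom ?M X Y" and g: "g \<in> Hom ?M X Y"
    have "(marr f + marr g) *\<^sub>v snd X a v = snd Y a ((marr f + marr g) *\<^sub>v v)"
      if a: "a \<in> carrier_vec (adim A)" and v: "v \<in> carrier_vec (fst X)" for a v
    proof -
      have c: "marr f \<in> carrier_mat (fst Y) (fst X)" "marr g \<in> carrier_mat (fst Y) (fst X)" using f g by (auto simp: fd_module_hom_def)
      have av: "snd X a v \<in> carrier_vec (fst X)" using f a v by (auto simp: fd_module_act)
      have "snd Y a (marr f *\<^sub>v v + marr g *\<^sub>v v) = snd Y a (marr f *\<^sub>v v) + snd Y a (marr g *\<^sub>v v)"
        using f a mult_mat_vec_carrier[OF c(1) v] mult_mat_vec_carrier[OF c(2) v]
        unfolding Hom_def Mod_Ar fd_module_def vec_bilinear_def by auto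
      then show ?thesis
        unfolding add_mult_distrib_mat_vec[OF c av] add_mult_distrib_mat_vec[OF c v]
        using f g a v by (auto simp: fd_module_hom_def)
    qed
    then show ?thesis using f g by (auto simp: fd_module_hom_def)
  qed
  show "f \<in> Hom ?M X Y \<Longrightarrow> Scale ?M c f \<in> Hom ?M X Y" for c f X Y
  proof -
    assume f: "f \<in> Hom ?M X Y"
    have "(c \<cdot>\<^sub>m marr f) *\<^sub>v snd X a v = snd Y a ((c \<cdot>\<^sub>m marr f) *\<^sub>v v)"
      if a: "a \<in> carrier_vec (adim A)" and v: "v \<in> carrier_vec (fst X)" for a v
    proof -
      have cf: "marr f \<in> carrier_mat (fst Y) (fst X)" using f by (auto simp: fd_module_hom_def)
      have av: "snd X a v \<in> carrier_vec (fst X)" using f a v by (auto simp: fd_module_act)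
      have s: "(c \<cdot>\<^sub>m marr f) *\<^sub>v w = c \<cdot>\<^sub>v (marr f *\<^sub>v w)" if "w \<in> carrier_vec (fst X)" for w
        using cf that by (intro eq_vecI) auto
      have "snd Y a (c \<cdot>\<^sub>v (marr f *\<^sub>v v)) = c \<cdot>\<^sub>v snd Y a (marr f *\<^sub>v v)"
        using f a mult_mat_vec_carrier[OF cf v]
        unfolding Hom_def Mod_Ar fd_module_def vec_bilinear_def by auto
      then show ?thesis
        unfolding s[OF av] s[OF v] using f a v by (auto simp: fd_module_hom_def)
    qed
    then show ?thesis using f by (auto simp: fd_module_hom_def)
  qed
  show "f \<in> Hom ?M X Y \<Longrightarrow> Idn ?M Y \<cdot>\<^bsub>?M\<^esub> f = f" for f X Y
    by (auto simp: fd_module_hom_def prod_eq_iff)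
  show "f \<in> Hom ?M X Y \<Longrightarrow> f \<cdot>\<^bsub>?M\<^esub> Idn ?M X = f" for f X Y
    by (auto simp: fd_module_hom_def prod_eq_iff)
  show "f \<in> Hom ?M X Y \<Longrightarrow> g \<in> Hom ?M X Y \<Longrightarrow> h \<in> Hom ?M Y Z \<Longrightarrow> h \<cdot>\<^bsub>?M\<^esub> Add ?M f g = Add ?M (h \<cdot>\<^bsub>?M\<^esub> f) (h \<cdot>\<^bsub>?M\<^esub> g)" for f g h X Y Z
    by (auto simp: fd_module_hom_def intro!: mult_add_distrib_mat)
  show "f \<in> Hom ?M X Y \<Longrightarrow> g \<in> Hom ?M Y Z \<Longrightarrow> h \<in> Hom ?M Y Z \<Longrightarrow> Add ?M g h \<cdot>\<^bsub>?M\<^esub> f = Add ?M (g \<cdot>\<^bsub>?M\<^esub> f) (h \<cdot>\<^bsub>?M\<^esub> f)" for f g h X Y Z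
    by (auto simp: fd_module_hom_def intro!: add_mult_distrib_mat)
  show "f \<in> Hom ?M X Y \<Longrightarrow> Add ?M f (Scale ?M (-1) f) = Zero ?M X Y" for f X Y
    by (auto simp: fd_module_hom_def intro!: eq_matI)
  show "f \<in> Hom ?M X Y \<Longrightarrow> g \<in> Hom ?M X Y \<Longrightarrow> Add ?M f g = Add ?M g f" for f g X Y
    by (auto simp: fd_module_hom_def intro!: comm_add_mat)
  show "f \<in> Hom ?M X Y \<Longrightarrow> g \<in> Hom ?M X Y \<Longrightarrow> h \<in> Hom ?M X Y \<Longrightarrow> Add ?M (Add ?M f g) h = Add ?M f (Add ?M g h)" for f g h X Y
    by (auto simp: fd_module_hom_def intro!: assoc_add_mat)
  show "f \<in> Hom ?M W X \<Longrightarrow> g \<in> Hom ?M X Y \<Longrightarrow> h \<in> Hom ?M Y Z \<Longrightarrow> (h \<cdot>\<^bsub>?M\<^esub> g) \<cdot>\<^bsub>?M\<^esub> f = h \<cdot>\<^bsub>?M\<^esub> (g \<cdot>\<^bsub>?M\<^esub> f)" for f g h W X Y Z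
    by (auto simp: fd_module_hom_def intro!: assoc_mult_mat)
  show "f \<in> Hom ?M X Y \<Longrightarrow> g \<in> Hom ?M X Y \<Longrightarrow> Scale ?M c (Add ?M f g) = Add ?M (Scale ?M c f) (Scale ?M c g)" for c f g X Y
    by (auto simp: fd_module_hom_def intro!: add_smult_distrib_left_mat)
  show "f \<in> Hom ?M X Y \<Longrightarrow> Scale ?M (c + d) f = Add ?M (Scale ?M c f) (Scale ?M d f)" for c d f X Y
    by (auto simp: fd_module_hom_def intro!: add_smult_distrib_right_mat)
  show "f \<in> Hom ?M X Y \<Longrightarrow> g \<in> Hom ?M Y Z \<Longrightarrow> Scale ?M c g \<cdot>\<^bsub>?M\<^esub> f = Scale ?M c (g \<cdot>\<^bsub>?M\<^esub> f)" for c f g X Y Z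
    by (auto simp: fd_module_hom_def intro!: mult_smult_assoc_mat)
  show "f \<in> Hom ?M X Y \<Longrightarrow> g \<in> Hom ?M Y Z \<Longrightarrow> g \<cdot>\<^bsub>?M\<^esub> Scale ?M c f = Scale ?M c (g \<cdot>\<^bsub>?M\<^esub> f)" for c f g X Y Z
    by (auto simp: fd_module_hom_def intro!: mult_smult_distrib)
qed (auto simp: Hom_def Mod_Ar fd_module_hom_def prod_eq_iff intro!: eq_matI)

lemma finite_category_equivalence:
  assumes "finite_category C"
  obtains R F where "fd_algebra R" "linear_equivalence C (Mod_cat R) F"
  using assms unfolding finite_category_def linear_equivalence_def linear_equivalence_axioms_def abelian_category_def
  by (metis Mod_linear_category)

section \<open>Finite categories in which monos split\<close>

lemma (in linear_category) split_idempotent_zero: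
  assumes "r \<in> Ar C" "i \<in> Ar C" "Src C r = Tgt C i" "Tgt C r = Src C i" "r \<cdot> i = Idn C (Src C i)"
  shows "r \<cdot> Sub C (Idn C (Tgt C i)) (i \<cdot> r) = Zero C (Tgt C i) (Src C i)"
    "Sub C (Idn C (Tgt C i)) (i \<cdot> r) \<cdot> i = Zero C (Src C i) (Tgt C i)"
proof -
  have "r \<cdot> (i \<cdot> r) = r" using assms by (subst rewrite_pair[OF assms(5)]) auto
  then show "r \<cdot> Sub C (Idn C (Tgt C i)) (i \<cdot> r) = Zero C (Tgt C i) (Src C i)"
    using assms sub_self[of r] by (simp add: cmp_sub)
  show "Sub C (Idn C (Tgt C i)) (i \<cdot> r) \<cdot> i = Zero C (Src C i) (Tgt C i)"
    using assms sub_self[of i] by (simp add: sub_cmp)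
qed

locale finite_abelian = abelian_category C + linear_equivalence C "Mod_cat R" F
  for C :: "('o, 'm, 'k::field, 'r) lcat_scheme" (structure) and R :: "'k fd_alg" and F :: "('o, 'm, 'k fd_mod, 'k fd_arrow) ftr"
begin

definition dimension :: "'o \<Rightarrow> nat" where "dimension X = fst (FOb F X)"

lemma marr_F: "f \<in> Ar C \<Longrightarrow> marr (FAr F f) \<in> carrier_mat (dimension (Tgt C f)) (dimension (Src C f))"
  using marr_carrier[of "FAr F f" R] F(2)[of f] F(3,4)[of f] by (simp add: dimension_def)

lemma marr_cmp: "f \<in> Ar C \<Longrightarrow> g \<in> Ar C \<Longrightarrow> Src C g = Tgt C f \<Longrightarrow> marr (FAr F (g \<cdot> f)) = marr (FAr F g) * marr (FAr F f)"
  using F(6)[of f g] by simp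

lemma marr_idn: "X \<in> Ob C \<Longrightarrow> marr (FAr F (Idn C X)) = 1\<^sub>m (dimension X)"
  using F(5)[of X] by (simp add: dimension_def)

lemma marr_eqD:
  assumes "f \<in> Ar C" "g \<in> Ar C" "Src C f = Src C g" "Tgt C f = Tgt C g" "marr (FAr F f) = marr (FAr F g)"
  shows "f = g"
proof (rule faithful)
  show "FAr F f = FAr F g" using assms F(3,4)[of f] F(3,4)[of g] by (simp add: prod_eq_iff)
qed (use assms in auto)

lemma split_mono_dimension:
  assumes "r \<in> Ar C" "i \<in> Ar C" "Src C r = Tgt C i" "Tgt C r = Src C i" "r \<cdot> i = Idn C (Src C i)"
  shows "dimension (Src C i) \<le> dimension (Tgt C i)"
    "dimension (Src C i) = dimension (Tgt C i) \<Longrightarrow> i \<cdot> r = Idn C (Tgt C i)"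
proof -
  have 1: "marr (FAr F r) * marr (FAr F i) = 1\<^sub>m (dimension (Src C i))"
    using marr_cmp[of i r] marr_idn assms by simp
  have c: "marr (FAr F i) \<in> carrier_mat (dimension (Tgt C i)) (dimension (Src C i))"
    "marr (FAr F r) \<in> carrier_mat (dimension (Src C i)) (dimension (Tgt C i))" using marr_F[of r] marr_F[of i] assms by auto
  show "dimension (Src C i) \<le> dimension (Tgt C i)" by (rule left_inverse_dim(1)[OF c 1])
  assume "dimension (Src C i) = dimension (Tgt C i)"
  then have "marr (FAr F i) * marr (FAr F r) = 1\<^sub>m (dimension (Tgt C i))" by (rule left_inverse_dim(2)[OF c 1])
  then show "i \<cdot> r = Idn C (Tgt C i)"
    using assms by (intro marr_eqD) (auto simp: marr_cmp marr_idn simp del: F)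
qed

text \<open>
  A nonzero subobject of least dimension is simple, since a split mono between objects of the same dimension
  is an isomorphism.
\<close>

lemma simple_summand:
  assumes split: "monos_split C" and X: "X \<in> Ob C" "\<not> is_zero_object C X"
  obtains S i r where "is_simple C S" "i \<in> Ar C" "r \<in> Ar C" "Src C i = S" "Tgt C i = X" "Src C r = X" "Tgt C r = S"
    "r \<cdot> i = Idn C S"
proof -
  let ?P = "\<lambda>d. \<exists>i. is_mono C i \<and> Tgt C i = X \<and> \<not> is_zero_object C (Src C i) \<and> dimension (Src C i) = d"
  have "?P (dimension X)" using X by (intro exI[of _ "Idn C X"]) (auto intro: iso_is_mono iso_idn)
  then have "?P (LEAST d. ?P d)" by (rule LeastI)
  then obtain i where i: "is_mono C i" "Tgt C i = X" "\<not> is_zero_object C (Src C i)" "dimension (Src C i) = (LEAST d. ?P d)"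
    by blast
  have ia: "i \<in> Ar C" using mono_arr[OF i(1)] .
  have "is_simple C (Src C i)"
    unfolding is_simple_def
  proof (intro conjI allI impI)
    fix j assume j: "is_mono C j \<and> Tgt C j = Src C i"
    then have ja: "j \<in> Ar C" using mono_arr by blast
    show "is_zero_object C (Src C j) \<or> is_iso C j"
    proof (cases "is_zero_object C (Src C j)")
      case False
      have "is_mono C (i \<cdot> j)" using i j by (intro mono_cmp) auto
      then have "?P (dimension (Src C j))" using False ia ja j i(2) by (intro exI[of _ "i \<cdot> j"]) auto
      then have le: "dimension (Src C i) \<le> dimension (Src C j)" unfolding i(4) by (rule Least_le)
      obtain r where r: "r \<in> Ar C" "Src C r = Tgt C j" "Tgt C r = Src C j" "r \<cdot> j = Idn C (Src C j)"
        using split j unfolding monos_split_def Hom_def by blast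
      have "dimension (Src C j) = dimension (Tgt C j)" using split_mono_dimension(1)[of r j] r ja le j by auto
      then have "j \<cdot> r = Idn C (Tgt C j)" using split_mono_dimension(2)[of r j] r ja by auto
      then have "is_iso C j" using r ja by (intro isoI[of j r]) auto
      then show ?thesis ..
    qed auto
  qed (use i ia in auto)
  moreover obtain r where "r \<in> Ar C" "Src C r = Tgt C i" "Tgt C r = Src C i" "r \<cdot> i = Idn C (Src C i)"
    using split i(1) unfolding monos_split_def Hom_def by blast
  ultimately show ?thesis using that[of "Src C i" i r] ia i by auto
qed

text \<open>
  Split off a simple summand \<open>S\<close> and apply the induction hypothesis to its complement, the kernel of the retraction onto \<open>S\<close>.
\<close>

lemma split_semisimple:
  assumes split: "monos_split C" shows "semisimple_category C"
  unfolding semisimple_category_def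
proof
  fix X assume "X \<in> Ob C"
  then show "\<exists>n S i p. (\<forall>j<n. is_simple C (S j)) \<and> is_direct_sum C n S X i p"
  proof (induct "dimension X" arbitrary: X rule: less_induct)
    case less
    show ?case
    proof (cases "is_zero_object C X")
      case True
      then have "is_direct_sum C 0 S X i p" for S i p
        using less zero_objectD by (auto simp: is_direct_sum_def)
      then show ?thesis by blast
    next
      case False
      obtain S i r where s: "is_simple C S" "i \<in> Ar C" "r \<in> Ar C" "Src C i = S" "Tgt C i = X" "Src C r = X" "Tgt C r = S"
        "r \<cdot> i = Idn C S"
        using simple_summand[OF split less(2) False] .
      obtain k where k: "is_kernel C r k" using has_kernels s by blast
      note kk = kernelD(1-5)[OF k]
      let ?e = "Sub C (Idn C X) (i \<cdot> r)"
      have e: "?e \<in> Ar C" "Src C ?e = X" "Tgt C ?e = X" using s less(2) by auto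
      have re: "r \<cdot> ?e = Zero C X S" "?e \<cdot> i = Zero C S X"
        using split_idempotent_zero[of r i] s by auto
      obtain t where t: "t \<in> Ar C" "Src C t = X" "Tgt C t = Src C k" "k \<cdot> t = ?e"
        using kernelD(6)[OF k, of ?e] e re s by auto
      have ka: "k \<in> Ar C" "Tgt C k = X" "r \<cdot> k = Zero C (Src C k) S" using kk s by auto
      have "(i \<cdot> r) \<cdot> k = Zero C (Src C k) X" using ka s by simp
      then have "?e \<cdot> k = k" using s ka less(2) sub_zero[of k] by (subst sub_cmp) auto
      then have "(k \<cdot> t) \<cdot> k = k \<cdot> Idn C (Src C k)" unfolding t(4) using ka by simp
      then have "k \<cdot> (t \<cdot> k) = k \<cdot> Idn C (Src C k)" using t(1-3) ka by simp
      then have tk: "t \<cdot> k = Idn C (Src C k)" by (rule monoD[OF kk(5), rotated -1]) (use t ka in auto)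
      have "k \<cdot> (t \<cdot> i) = k \<cdot> Zero C S (Src C k)"
      proof -
        have "k \<cdot> (t \<cdot> i) = (k \<cdot> t) \<cdot> i" using t(1-3) ka s by simp
        then show ?thesis unfolding t(4) re using ka s less(2) src_Ob[OF s(2)] by auto
      qed
      then have ti: "t \<cdot> i = Zero C S (Src C k)" by (rule monoD[OF kk(5), rotated -1]) (use t ka s in auto)
      have "dimension (Src C k) < dimension X"
      proof (rule ccontr)
        assume "\<not> ?thesis"
        then have "dimension (Src C k) = dimension (Tgt C k)" using split_mono_dimension(1)[of t k] t(1-3) ka tk by auto
        then have "k \<cdot> t = Idn C X" using split_mono_dimension(2)[of t k] t(1-3) ka tk by auto
        then have "i = (k \<cdot> t) \<cdot> i" using s by simp
        also have "\<dots> = Zero C S X" unfolding t(4) using re by simp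
        finally have "r \<cdot> i = r \<cdot> Zero C S X" by simp
        then have "Idn C S = Zero C S S" using s less(2) src_Ob[OF s(2)] by simp
        then have "is_zero_object C S" using src_Ob[OF s(2)] s by (intro zero_objectI) auto
        then show False using s(1) by (simp add: is_simple_def)
      qed
      then obtain n T i' p where ind: "\<forall>j<n. is_simple C (T j)" "is_direct_sum C n T (Src C k) i' p"
        using less(1)[of "Src C k"] ka by auto
      note d = direct_sumD[OF ind(2)]
      define T' i'' p' where "T' j = (if j = n then S else T j)" and "i'' j = (if j = n then i else k \<cdot> i' j)"
        and "p' j = (if j = n then r else p j \<cdot> t)" for j
      have "is_direct_sum C (Suc n) T' X i'' p'"
        unfolding is_direct_sum_def
      proof (intro conjI allI impI)
        show "X \<in> Ob C" by (rule less)
        fix j assume j: "j < Suc n"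
        show "T' j \<in> Ob C" "i'' j \<in> Hom C (T' j) X" "p' j \<in> Hom C X (T' j)"
          using j s d[of j] ka t src_Ob[OF s(2)] by (auto simp: T'_def i''_def p'_def Hom_def less_Suc_eq)
        fix l assume l: "l < Suc n"
        show "p' l \<cdot> i'' j = (if j = l then Idn C (T' j) else Zero C (T' j) (T' l))"
        proof (cases "j = n"; cases "l = n")
          assume jl: "j = n" "l = n" then show ?thesis using s by (auto simp: T'_def i''_def p'_def)
        next
          assume jl: "j = n" "l \<noteq> n"
          then have l: "l < n" using l by simp
          have "p l \<cdot> (t \<cdot> i) = Zero C S (T l)" unfolding ti using d[OF l] src_Ob[OF s(2)] s by simp
          then show ?thesis using jl s t d[OF l] by (auto simp: T'_def i''_def p'_def)
        next
          assume jl: "j \<noteq> n" "l = n"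
          then have j: "j < n" using j by simp
          have "r \<cdot> (k \<cdot> i' j) = Zero C (T j) S" using rewrite_pair[OF ka(3)] d[OF j] ka s src_Ob[OF s(2)] by simp
          then show ?thesis using jl s t d[OF j] by (auto simp: T'_def i''_def p'_def)
        next
          assume jl: "j \<noteq> n" "l \<noteq> n"
          then have j: "j < n" and l: "l < n" using j l by simp_all
          have "t \<cdot> (k \<cdot> i' j) = i' j" using rewrite_pair[OF tk] d[OF j] ka t by simp
          then have "(p l \<cdot> t) \<cdot> (k \<cdot> i' j) = p l \<cdot> i' j" using t(1-3) ka d[OF j] d[OF l] by simp
          also have "\<dots> = (if j = l then Idn C (T j) else Zero C (T j) (T l))"
            using ind(2) j l unfolding is_direct_sum_def by blast
          finally show ?thesis using jl by (auto simp: T'_def i''_def p'_def)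
        qed
      next
        have H: "i' j \<cdot> p j \<in> Hom C (Src C k) (Src C k)" if "j < n" for j using d[OF that] by (auto simp: Hom_def)
        have K: "Src C k \<in> Ob C" using ka by auto
        have "arrow_sum C X X (\<lambda>j. i'' j \<cdot> p' j) n = arrow_sum C X X (\<lambda>j. k \<cdot> ((i' j \<cdot> p j) \<cdot> t)) n"
          using d ka t(1-3) by (intro arrow_sum_cong) (auto simp: i''_def p'_def)
        also have "\<dots> = k \<cdot> arrow_sum C X (Src C k) (\<lambda>j. (i' j \<cdot> p j) \<cdot> t) n"
          using H t(1-3) ka less(2) by (subst cmp_arrow_sum[of X k "Src C k"]) (auto simp: Hom_def)
        also have "arrow_sum C X (Src C k) (\<lambda>j. (i' j \<cdot> p j) \<cdot> t) n = arrow_sum C (Src C k) (Src C k) (\<lambda>j. i' j \<cdot> p j) n \<cdot> t"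
          using H t(1-3) ka K by (subst arrow_sum_cmp[of "Src C k" t "Src C k"]) auto
        also have "\<dots> = t" using ind(2) t(1-3) by (simp add: is_direct_sum_def)
        finally have "arrow_sum C X X (\<lambda>j. i'' j \<cdot> p' j) n = ?e" using t by simp
        then show "arrow_sum C X X (\<lambda>j. i'' j \<cdot> p' j) (Suc n) = Idn C X"
          using sub_add[of "Idn C X" "i \<cdot> r"] s less(2) by (simp add: i''_def p'_def)
      qed
      moreover have "\<forall>j<Suc n. is_simple C (T' j)" using ind(1) s(1) by (auto simp: T'_def less_Suc_eq)
      ultimately show ?thesis by blast
    qed
  qed
qed

end

lemma finite_abelianI:
  assumes "finite_category C"
  obtains R F where "fd_algebra R" "finite_abelian C R F"
proof -
  obtain R F where "fd_algebra R" "linear_equivalence C (Mod_cat R) F"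
    using finite_category_equivalence[OF assms] .
  moreover have "abelian_category C" using assms by (simp add: finite_category_def)
  ultimately show ?thesis using that by (auto simp: finite_abelian_def)
qed

section \<open>Bifunctors and coordinates on hom-sets\<close>

lemma smult_mat_mult_vec:
  "A \<in> carrier_mat m n \<Longrightarrow> v \<in> carrier_vec n \<Longrightarrow> (c \<cdot>\<^sub>m A) *\<^sub>v v = c \<cdot>\<^sub>v (A *\<^sub>v (v :: 'k::field vec))"
  by (intro eq_vecI) (auto simp: smult_scalar_prod_distrib[of _ n])

lemma bilinear_bifunctorD:
  assumes G: "bilinear_bifunctor C D E G" and "linear_category C" "linear_category D" "linear_category E"
  shows "X \<in> Ob C \<Longrightarrow> Y \<in> Ob D \<Longrightarrow> FOb G (X, Y) \<in> Ob E"
    and "f \<in> Ar C \<Longrightarrow> g \<in> Ar D \<Longrightarrow> FAr G (f, g) \<in> Ar E"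
    and "f \<in> Ar C \<Longrightarrow> g \<in> Ar D \<Longrightarrow> Src E (FAr G (f, g)) = FOb G (Src C f, Src D g)"
    and "f \<in> Ar C \<Longrightarrow> g \<in> Ar D \<Longrightarrow> Tgt E (FAr G (f, g)) = FOb G (Tgt C f, Tgt D g)"
    and "X \<in> Ob C \<Longrightarrow> Y \<in> Ob D \<Longrightarrow> FAr G (Idn C X, Idn D Y) = Idn E (FOb G (X, Y))"
    and "f \<in> Ar C \<Longrightarrow> g \<in> Ar D \<Longrightarrow> f' \<in> Ar C \<Longrightarrow> g' \<in> Ar D \<Longrightarrow> Src C f' = Tgt C f \<Longrightarrow> Src D g' = Tgt D g \<Longrightarrow>
       FAr G (f' \<cdot>\<^bsub>C\<^esub> f, g' \<cdot>\<^bsub>D\<^esub> g) = FAr G (f', g') \<cdot>\<^bsub>E\<^esub> FAr G (f, g)"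
    and "f \<in> Ar C \<Longrightarrow> g \<in> Ar D \<Longrightarrow> f' \<in> Ar C \<Longrightarrow> Src C f' = Src C f \<Longrightarrow> Tgt C f' = Tgt C f \<Longrightarrow>
       FAr G (Add C f f', g) = Add E (FAr G (f, g)) (FAr G (f', g))"
    and "f \<in> Ar C \<Longrightarrow> g \<in> Ar D \<Longrightarrow> g' \<in> Ar D \<Longrightarrow> Src D g' = Src D g \<Longrightarrow> Tgt D g' = Tgt D g \<Longrightarrow>
       FAr G (f, Add D g g') = Add E (FAr G (f, g)) (FAr G (f, g'))"
    and "f \<in> Ar C \<Longrightarrow> g \<in> Ar D \<Longrightarrow> FAr G (Scale C c f, g) = Scale E c (FAr G (f, g))"
    and "f \<in> Ar C \<Longrightarrow> g \<in> Ar D \<Longrightarrow> FAr G (f, Scale D c g) = Scale E c (FAr G (f, g))"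
proof -
  interpret C: linear_category C by fact
  interpret D: linear_category D by fact
  interpret E: linear_category E by fact
  have "is_functor (prod_cat C D) E G" using G by (simp add: bilinear_bifunctor_def)
  note F = functorD[OF this]
  have prod: "Ob (prod_cat C D) = Ob C \<times> Ob D" "Ar (prod_cat C D) = Ar C \<times> Ar D"
    "\<And>f g. Src (prod_cat C D) (f, g) = (Src C f, Src D g)" "\<And>f g. Tgt (prod_cat C D) (f, g) = (Tgt C f, Tgt D g)"
    "\<And>X Y. Idn (prod_cat C D) (X, Y) = (Idn C X, Idn D Y)"
    "\<And>f g f' g'. (f', g') \<cdot>\<^bsub>prod_cat C D\<^esub> (f, g) = (f' \<cdot>\<^bsub>C\<^esub> f, g' \<cdot>\<^bsub>D\<^esub> g)"
    by (auto simp: prod_cat_def)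
  show 1: "\<And>X Y. X \<in> Ob C \<Longrightarrow> Y \<in> Ob D \<Longrightarrow> FOb G (X, Y) \<in> Ob E" using F(1) prod by auto
  show 2: "\<And>f g. f \<in> Ar C \<Longrightarrow> g \<in> Ar D \<Longrightarrow> FAr G (f, g) \<in> Ar E" using F(2) prod by auto
  show 3: "\<And>f g. f \<in> Ar C \<Longrightarrow> g \<in> Ar D \<Longrightarrow> Src E (FAr G (f, g)) = FOb G (Src C f, Src D g)" using F(3) prod by auto
  show 4: "\<And>f g. f \<in> Ar C \<Longrightarrow> g \<in> Ar D \<Longrightarrow> Tgt E (FAr G (f, g)) = FOb G (Tgt C f, Tgt D g)" using F(4) prod by auto
  show 5: "\<And>X Y. X \<in> Ob C \<Longrightarrow> Y \<in> Ob D \<Longrightarrow> FAr G (Idn C X, Idn D Y) = Idn E (FOb G (X, Y))" using F(5)[of "(_, _)"] prod by auto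
  show 6: "\<And>f g f' g'. f \<in> Ar C \<Longrightarrow> g \<in> Ar D \<Longrightarrow> f' \<in> Ar C \<Longrightarrow> g' \<in> Ar D \<Longrightarrow> Src C f' = Tgt C f \<Longrightarrow> Src D g' = Tgt D g \<Longrightarrow>
       FAr G (f' \<cdot>\<^bsub>C\<^esub> f, g' \<cdot>\<^bsub>D\<^esub> g) = FAr G (f', g') \<cdot>\<^bsub>E\<^esub> FAr G (f, g)"
    using F(6)[of "(_, _)" "(_, _)"] prod by auto
  have linD: "linear_functor D E (fix_fst C G X)" if "X \<in> Ob C" for X using G that by (simp add: bilinear_bifunctor_def)
  have linC: "linear_functor C E (fix_snd D G Y)" if "Y \<in> Ob D" for Y using G that by (simp add: bilinear_bifunctor_def)
  have decC: "FAr G (f, g) = FAr G (f, Idn D (Tgt D g)) \<cdot>\<^bsub>E\<^esub> FAr G (Idn C (Src C f), g)" if "f \<in> Ar C" "g \<in> Ar D" for f g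
    using 6[of "Idn C (Src C f)" g f "Idn D (Tgt D g)"] that by simp
  have decD: "FAr G (f, g) = FAr G (Idn C (Tgt C f), g) \<cdot>\<^bsub>E\<^esub> FAr G (f, Idn D (Src D g))" if "f \<in> Ar C" "g \<in> Ar D" for f g
    using 6[of f "Idn D (Src D g)" "Idn C (Tgt C f)" g] that by simp
  note simps = 1 2 3 4
  show "FAr G (Add C f f', g) = Add E (FAr G (f, g)) (FAr G (f', g))"
    if "f \<in> Ar C" "g \<in> Ar D" "f' \<in> Ar C" "Src C f' = Src C f" "Tgt C f' = Tgt C f"
    using linear_functorD(2)[OF linC[of "Tgt D g"], of f f'] that decC[of "Add C f f'" g] decC[of f g] decC[of f' g]
    by (simp add: fix_snd_def simps)
  show "FAr G (f, Add D g g') = Add E (FAr G (f, g)) (FAr G (f, g'))"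
    if "f \<in> Ar C" "g \<in> Ar D" "g' \<in> Ar D" "Src D g' = Src D g" "Tgt D g' = Tgt D g"
    using linear_functorD(2)[OF linD[of "Tgt C f"], of g g'] that decD[of f "Add D g g'"] decD[of f g] decD[of f g']
    by (simp add: fix_fst_def simps)
  show "FAr G (Scale C c f, g) = Scale E c (FAr G (f, g))" if "f \<in> Ar C" "g \<in> Ar D"
    using linear_functorD(3)[OF linC[of "Tgt D g"], of f c] that decC[of "Scale C c f" g] decC[of f g]
    by (simp add: fix_snd_def simps)
  show "FAr G (f, Scale D c g) = Scale E c (FAr G (f, g))" if "f \<in> Ar C" "g \<in> Ar D"
    using linear_functorD(3)[OF linD[of "Tgt C f"], of g c] that decD[of f "Scale D c g"] decD[of f g]
    by (simp add: fix_fst_def simps)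
qed

lemma fix_fst_functor:
  assumes "category C" "is_functor (prod_cat C D) E G" "X \<in> Ob C"
  shows "is_functor D E (fix_fst C G X)"
proof -
  interpret C: category C by fact
  note F = functorD[OF assms(2)]
  show ?thesis unfolding is_functor_def
  proof (intro conjI allI ballI)
    fix Y Y' Y'' f g assume "f \<in> Hom D Y Y'" "g \<in> Hom D Y' Y''"
    then show "FAr (fix_fst C G X) (g \<cdot>\<^bsub>D\<^esub> f) = FAr (fix_fst C G X) g \<cdot>\<^bsub>E\<^esub> FAr (fix_fst C G X) f"
      using F(6)[of "(Idn C X, f)" "(Idn C X, g)"] assms(3) by (auto simp: fix_fst_def prod_cat_def Hom_def)
  qed (use F assms(3) in \<open>auto simp: fix_fst_def prod_cat_def Hom_def\<close>)
qed

lemma fix_snd_functor: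
  assumes "category D" "is_functor (prod_cat C D) E G" "Y \<in> Ob D"
  shows "is_functor C E (fix_snd D G Y)"
proof -
  interpret D: category D by fact
  note F = functorD[OF assms(2)]
  show ?thesis unfolding is_functor_def
  proof (intro conjI allI ballI)
    fix X X' X'' f g assume "f \<in> Hom C X X'" "g \<in> Hom C X' X''"
    then show "FAr (fix_snd D G Y) (g \<cdot>\<^bsub>C\<^esub> f) = FAr (fix_snd D G Y) g \<cdot>\<^bsub>E\<^esub> FAr (fix_snd D G Y) f"
      using F(6)[of "(f, Idn D Y)" "(g, Idn D Y)"] assms(3) by (auto simp: fix_snd_def prod_cat_def Hom_def)
  qed (use F assms(3) in \<open>auto simp: fix_snd_def prod_cat_def Hom_def\<close>)
qed

text \<open>
  Addition and scalar multiplication of arrows are operations on a type that are only specified on each hom-set.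
  Finite dimension of a hom-set is therefore expressed by a linear embedding into some \<open>k\<^sup>N\<close>.
\<close>

definition finite_homs_from :: "('o, 'm, 'k::field, 'r) lcat_scheme \<Rightarrow> 'o \<Rightarrow> bool" where
  "finite_homs_from C Z \<longleftrightarrow> Z \<in> Ob C \<and> (\<forall>X \<in> Ob C. \<exists>N (\<psi> :: 'm \<Rightarrow> 'k vec).
     (\<forall>f \<in> Hom C Z X. \<psi> f \<in> carrier_vec N) \<and> inj_on \<psi> (Hom C Z X) \<and>
     (\<forall>f \<in> Hom C Z X. \<forall>g \<in> Hom C Z X. \<psi> (Add C f g) = \<psi> f + \<psi> g) \<and>
     (\<forall>c. \<forall>f \<in> Hom C Z X. \<psi> (Scale C c f) = c \<cdot>\<^sub>v \<psi> f))"

locale hom_coordinates = linear_category C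
  for C :: "('o, 'm, 'k::field, 'r) lcat_scheme" (structure) +
  fixes Z :: 'o and n :: "'o \<Rightarrow> nat" and \<theta> :: "'o \<Rightarrow> 'm \<Rightarrow> 'k vec"
  assumes Z [simp]: "Z \<in> Ob C"
    and coord_bij: "X \<in> Ob C \<Longrightarrow> bij_betw (\<theta> X) (Hom C Z X) (carrier_vec (n X))"
    and coord_add: "X \<in> Ob C \<Longrightarrow> f \<in> Hom C Z X \<Longrightarrow> g \<in> Hom C Z X \<Longrightarrow> \<theta> X (Add C f g) = \<theta> X f + \<theta> X g"
    and coord_scale: "X \<in> Ob C \<Longrightarrow> f \<in> Hom C Z X \<Longrightarrow> \<theta> X (Scale C c f) = c \<cdot>\<^sub>v \<theta> X f"

lemma finite_homs_coordinates:
  assumes "linear_category C" "finite_homs_from C Z"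
  obtains n \<theta> where "hom_coordinates C Z n \<theta>"
proof -
  interpret linear_category C by fact
  have "\<exists>n \<theta>. bij_betw \<theta> (Hom C Z X) (carrier_vec n) \<and>
      (\<forall>f \<in> Hom C Z X. \<forall>g \<in> Hom C Z X. \<theta> (Add C f g) = \<theta> f + \<theta> g) \<and>
      (\<forall>c. \<forall>f \<in> Hom C Z X. \<theta> (Scale C c f) = c \<cdot>\<^sub>v \<theta> f)" if X: "X \<in> Ob C" for X
  proof -
    obtain N and \<psi> :: "_ \<Rightarrow> _ vec" where \<psi>: "\<forall>f \<in> Hom C Z X. \<psi> f \<in> carrier_vec N" "inj_on \<psi> (Hom C Z X)"
      "\<forall>f \<in> Hom C Z X. \<forall>g \<in> Hom C Z X. \<psi> (Add C f g) = \<psi> f + \<psi> g"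
      "\<forall>c. \<forall>f \<in> Hom C Z X. \<psi> (Scale C c f) = c \<cdot>\<^sub>v \<psi> f"
      using assms(2) X unfolding finite_homs_from_def by blast
    let ?W = "\<psi> ` Hom C Z X"
    have Z: "Z \<in> Ob C" using assms(2) by (simp add: finite_homs_from_def)
    obtain n \<theta> where \<theta>: "vec_linear N n \<theta>" "bij_betw \<theta> ?W (carrier_vec n)"
    proof (rule subspace_coordinates)
      show "?W \<subseteq> carrier_vec N" using \<psi> by auto
      have z: "Zero C Z X \<in> Hom C Z X" by (rule zero_Hom[OF Z X])
      then have "\<psi> (Scale C 0 (Zero C Z X)) = 0 \<cdot>\<^sub>v \<psi> (Zero C Z X)" using \<psi>(4) by blast
      also have "\<dots> = 0\<^sub>v N" using \<psi>(1) z by (intro eq_vecI) auto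
      finally show "0\<^sub>v N \<in> ?W" using scale_Hom[OF z, of 0] by (metis imageI)
      show "x + y \<in> ?W" if xy: "x \<in> ?W" "y \<in> ?W" for x y
      proof -
        obtain f g where fg: "f \<in> Hom C Z X" "g \<in> Hom C Z X" "x = \<psi> f" "y = \<psi> g" using xy by blast
        then show ?thesis using \<psi>(3) add_Hom[OF fg(1,2)] by (metis imageI)
      qed
      show "c \<cdot>\<^sub>v x \<in> ?W" if x: "x \<in> ?W" for c x
      proof -
        obtain f where f: "f \<in> Hom C Z X" "x = \<psi> f" using x by blast
        then show ?thesis using \<psi>(4) scale_Hom[OF f(1)] by (metis imageI)
      qed
    qed
    have "bij_betw (\<theta> \<circ> \<psi>) (Hom C Z X) (carrier_vec n)"
      using \<theta>(2) \<psi>(2) by (metis bij_betw_trans inj_on_imp_bij_betw)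
    then show ?thesis
      by (intro exI[of _ n] exI[of _ "\<theta> \<circ> \<psi>"]) (use \<theta>(1) \<psi> in \<open>auto simp: vec_linear_def\<close>)
  qed
  then obtain n \<theta> where "\<And>X. X \<in> Ob C \<Longrightarrow> bij_betw (\<theta> X) (Hom C Z X) (carrier_vec (n X)) \<and>
      (\<forall>f \<in> Hom C Z X. \<forall>g \<in> Hom C Z X. \<theta> X (Add C f g) = \<theta> X f + \<theta> X g) \<and>
      (\<forall>c. \<forall>f \<in> Hom C Z X. \<theta> X (Scale C c f) = c \<cdot>\<^sub>v \<theta> X f)" by metis
  then have "hom_coordinates C Z n \<theta>" using assms by unfold_locales (auto simp: finite_homs_from_def)
  then show ?thesis by (rule that)
qed

context hom_coordinates
begin

definition elt :: "'o \<Rightarrow> 'k vec \<Rightarrow> 'm" where "elt X x = inv_into (Hom C Z X) (\<theta> X) x"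

lemma coord_carrier [simp]: "a \<in> Ar C \<Longrightarrow> Src C a = Z \<Longrightarrow> Tgt C a = X \<Longrightarrow> \<theta> X a \<in> carrier_vec (n X)"
  using coord_bij[of X] tgt_Ob[of a] unfolding bij_betw_def Hom_def by auto

lemma elt [simp]: assumes "X \<in> Ob C" "x \<in> carrier_vec (n X)"
  shows "elt X x \<in> Ar C" "Src C (elt X x) = Z" "Tgt C (elt X x) = X" "\<theta> X (elt X x) = x"
proof -
  have "x \<in> \<theta> X ` Hom C Z X" using coord_bij assms by (auto simp: bij_betw_def)
  then have "elt X x \<in> Hom C Z X" "\<theta> X (elt X x) = x" unfolding elt_def by (rule inv_into_into, rule f_inv_into_f)
  then show "elt X x \<in> Ar C" "Src C (elt X x) = Z" "Tgt C (elt X x) = X" "\<theta> X (elt X x) = x" by (auto simp: Hom_def)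
qed

lemma elt_coord [simp]: "a \<in> Ar C \<Longrightarrow> Src C a = Z \<Longrightarrow> Tgt C a = X \<Longrightarrow> elt X (\<theta> X a) = a"
  using coord_bij[of X] tgt_Ob[of a] unfolding elt_def bij_betw_def by (intro inv_into_f_f) (auto simp: Hom_def)

lemma coord_add' [simp]: "f \<in> Ar C \<Longrightarrow> g \<in> Ar C \<Longrightarrow> Src C f = Z \<Longrightarrow> Src C g = Z \<Longrightarrow> Tgt C f = X \<Longrightarrow> Tgt C g = X \<Longrightarrow>
    \<theta> X (Add C f g) = \<theta> X f + \<theta> X g"
  using coord_add[of X f g] tgt_Ob[of f] by (auto simp: Hom_def)

lemma coord_scale' [simp]: "f \<in> Ar C \<Longrightarrow> Src C f = Z \<Longrightarrow> Tgt C f = X \<Longrightarrow> \<theta> X (Scale C c f) = c \<cdot>\<^sub>v \<theta> X f"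
  using coord_scale[of X f] tgt_Ob[of f] by (auto simp: Hom_def)

lemma elt_add: assumes "X \<in> Ob C" "x \<in> carrier_vec (n X)" "y \<in> carrier_vec (n X)"
  shows "elt X (x + y) = Add C (elt X x) (elt X y)"
proof -
  have "elt X (\<theta> X (Add C (elt X x) (elt X y))) = Add C (elt X x) (elt X y)" using assms by (intro elt_coord) auto
  then show ?thesis using assms by simp
qed

lemma elt_scale: assumes "X \<in> Ob C" "x \<in> carrier_vec (n X)"
  shows "elt X (c \<cdot>\<^sub>v x) = Scale C c (elt X x)"
proof -
  have "elt X (\<theta> X (Scale C c (elt X x))) = Scale C c (elt X x)" using assms by (intro elt_coord) auto
  then show ?thesis using assms by simp
qed

text \<open>
  The matrix of \<open>a \<mapsto> f \<cdot> a\<close> in the chosen coordinates. In this way \<open>Hom(Z, -)\<close> becomes a functor to matrices.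
\<close>

definition push :: "'m \<Rightarrow> 'k mat" where
  "push f = mat_of (n (Src C f)) (n (Tgt C f)) (\<lambda>x. \<theta> (Tgt C f) (f \<cdot> elt (Src C f) x))"

lemma push_carrier [simp]: "push f \<in> carrier_mat (n (Tgt C f)) (n (Src C f))"
  by (simp add: push_def)

lemma push_mult: assumes "f \<in> Ar C" "x \<in> carrier_vec (n (Src C f))"
  shows "push f *\<^sub>v x = \<theta> (Tgt C f) (f \<cdot> elt (Src C f) x)"
  unfolding push_def
proof (rule mat_of_mult[OF _ assms(2)])
  show "vec_linear (n (Src C f)) (n (Tgt C f)) (\<lambda>x. \<theta> (Tgt C f) (f \<cdot> elt (Src C f) x))"
    using assms(1) by (auto simp: vec_linear_def elt_add elt_scale)
qed

lemma push_coord: assumes "f \<in> Ar C" "a \<in> Ar C" "Src C a = Z" "Tgt C a = Src C f"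
  shows "push f *\<^sub>v \<theta> (Src C f) a = \<theta> (Tgt C f) (f \<cdot> a)"
  using assms by (subst push_mult) auto

lemma push_idn: "X \<in> Ob C \<Longrightarrow> push (Idn C X) = 1\<^sub>m (n X)"
  using push_carrier[of "Idn C X"] by (intro mat_eq_by_vec[of _ "n X" "n X"]) (auto simp: push_mult)

lemma push_cmp: assumes "f \<in> Ar C" "g \<in> Ar C" "Src C g = Tgt C f" shows "push (g \<cdot> f) = push g * push f"
proof (rule mat_eq_by_vec)
  have c: "push f \<in> carrier_mat (n (Tgt C f)) (n (Src C f))" "push g \<in> carrier_mat (n (Tgt C g)) (n (Tgt C f))"
    using push_carrier[of g] assms by auto
  then show "push g * push f \<in> carrier_mat (n (Tgt C g)) (n (Src C f))" by simp
  show "push (g \<cdot> f) \<in> carrier_mat (n (Tgt C g)) (n (Src C f))" using push_carrier[of "g \<cdot> f"] assms by simp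
  fix x :: "'k vec" assume x: "x \<in> carrier_vec (n (Src C f))"
  have "push g *\<^sub>v (push f *\<^sub>v x) = \<theta> (Tgt C g) (g \<cdot> (f \<cdot> elt (Src C f) x))"
    using push_coord[of g "f \<cdot> elt (Src C f) x"] assms x by (simp add: push_mult)
  then show "push (g \<cdot> f) *\<^sub>v x = (push g * push f) *\<^sub>v x"
    unfolding assoc_mult_mat_vec[OF c(2,1) x] using assms x push_mult[of "g \<cdot> f" x] by simp
qed

lemma push_add: assumes "f \<in> Ar C" "g \<in> Ar C" "Src C g = Src C f" "Tgt C g = Tgt C f"
  shows "push (Add C f g) = push f + push g"
proof (rule mat_eq_by_vec)
  have c: "push f \<in> carrier_mat (n (Tgt C f)) (n (Src C f))" "push g \<in> carrier_mat (n (Tgt C f)) (n (Src C f))"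
    using push_carrier[of g] assms by auto
  then show "push f + push g \<in> carrier_mat (n (Tgt C f)) (n (Src C f))" by simp
  show "push (Add C f g) \<in> carrier_mat (n (Tgt C f)) (n (Src C f))" using push_carrier[of "Add C f g"] assms by simp
  fix x :: "'k vec" assume x: "x \<in> carrier_vec (n (Src C f))"
  show "push (Add C f g) *\<^sub>v x = (push f + push g) *\<^sub>v x"
    unfolding add_mult_distrib_mat_vec[OF c x]
    using assms x push_mult[of "Add C f g" x] push_mult[of f x] push_mult[of g x] by simp
qed

lemma push_scale: assumes "f \<in> Ar C"
  shows "push (Scale C c f) = c \<cdot>\<^sub>m push f"
proof (rule mat_eq_by_vec)
  have cf: "push f \<in> carrier_mat (n (Tgt C f)) (n (Src C f))" by simp
  then show "c \<cdot>\<^sub>m push f \<in> carrier_mat (n (Tgt C f)) (n (Src C f))" by simp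
  show "push (Scale C c f) \<in> carrier_mat (n (Tgt C f)) (n (Src C f))" using push_carrier[of "Scale C c f"] assms by simp
  fix x :: "'k vec" assume x: "x \<in> carrier_vec (n (Src C f))"
  have "(c \<cdot>\<^sub>m push f) *\<^sub>v x = c \<cdot>\<^sub>v (push f *\<^sub>v x)" by (rule smult_mat_mult_vec[OF cf x])
  then show "push (Scale C c f) *\<^sub>v x = (c \<cdot>\<^sub>m push f) *\<^sub>v x"
    using assms x push_mult[of "Scale C c f" x] push_mult[of f x] by simp
qed

end

section \<open>Tensoring a module with vector spaces\<close>

definition field_alg :: "'k::field fd_alg" where
  "field_alg = \<lparr>adim = 1, amult = (\<lambda>u v. vec 1 (\<lambda>_. u $ 0 * v $ 0)), aone = vec 1 (\<lambda>_. 1)\<rparr>"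

lemma field_alg_simps [simp]: "adim field_alg = 1" "aone field_alg = vec 1 (\<lambda>_. 1)"
  "amult field_alg u v = vec 1 (\<lambda>_. u $ 0 * v $ 0)"
  by (simp_all add: field_alg_def)

lemma field_alg: "fd_algebra field_alg"
  unfolding fd_algebra_def vec_bilinear_def
  by (auto simp: algebra_simps intro!: eq_vecI)

abbreviation Vect :: "('k::field fd_mod, 'k fd_arrow, 'k) lcat" where "Vect \<equiv> Mod_cat field_alg"

definition space :: "nat \<Rightarrow> 'k::field fd_mod" where "space n = (n, \<lambda>a v. a $ 0 \<cdot>\<^sub>v v)"

lemma space [simp]: "fd_module field_alg (space n)" "fst (space n) = n"
  unfolding fd_module_def vec_bilinear_def space_def
  by (auto simp: algebra_simps smult_add_distrib_vec add_smult_distrib_vec smult_smult_assoc intro!: eq_vecI)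

lemma field_module_act:
  assumes V: "fd_module field_alg V" and a: "a \<in> carrier_vec 1" and v: "v \<in> carrier_vec (fst V)"
  shows "snd V a v = a $ 0 \<cdot>\<^sub>v v"
proof -
  let ?e = "vec 1 (\<lambda>_. 1)"
  have "snd V ?e v = v" using V v by (simp add: fd_module_def)
  moreover have "?e \<in> carrier_vec (adim field_alg)" by simp
  ultimately have "snd V (a $ 0 \<cdot>\<^sub>v ?e) v = a $ 0 \<cdot>\<^sub>v v"
    using V v unfolding fd_module_def vec_bilinear_def by metis
  moreover have "a $ 0 \<cdot>\<^sub>v ?e = a" using a by (intro eq_vecI) auto
  ultimately show ?thesis by simp
qed

lemma field_module_hom:
  assumes "fd_module field_alg V" "fd_module field_alg W" "f \<in> carrier_mat (fst W) (fst V)"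
  shows "fd_module_hom field_alg V W f"
  using assms unfolding fd_module_hom_def
  by (auto simp: field_module_act mult_mat_vec)

lemma field_Mod_regular: "regular_category (Mod_cat (field_alg :: 'k::field fd_alg))"
  unfolding regular_category_def
proof
  fix f :: "'k fd_arrow" assume f: "f \<in> Ar Vect"
  obtain B where "B \<in> carrier_mat (fst (fst f)) (fst (snd (snd f)))" "marr f * (B * marr f) = marr f"
    using matrix_regular[OF marr_carrier[OF f]] .
  then show "\<exists>g\<in>Hom Vect (Tgt Vect f) (Src Vect f).
      f \<cdot>\<^bsub>Vect\<^esub> (g \<cdot>\<^bsub>Vect\<^esub> f) = f"
    using f by (intro bexI[of _ "(snd (snd f), B, fst f)"]) (auto simp: Hom_def Mod_Ar field_module_hom prod_eq_iff)
qed

text \<open>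
  For an \<open>R\<close>-module \<open>U\<close>, the functor \<open>tensor_with U\<close> sends a vector space \<open>V\<close> to the \<open>R\<close>-module \<open>V \<otimes> U\<close>.
  All its values are given by Kronecker products, so its properties reduce to those of \<open>kron\<close>.
\<close>

definition act_mat :: "'k::field fd_mod \<Rightarrow> 'k vec \<Rightarrow> 'k mat" where
  "act_mat U r = mat_of (fst U) (fst U) (snd U r)"

definition tensor_module :: "'k::field fd_mod \<Rightarrow> 'k fd_mod \<Rightarrow> 'k fd_mod" where
  "tensor_module U V = (fst V * fst U, \<lambda>r v. kron (1\<^sub>m (fst V)) (act_mat U r) *\<^sub>v v)"

definition tensor_with ::
  "'k::field fd_mod \<Rightarrow> ('k fd_mod, 'k fd_arrow, 'k fd_mod, 'k fd_arrow) ftr" where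
  "tensor_with U = \<lparr>FOb = tensor_module U,
     FAr = (\<lambda>f. (tensor_module U (fst f), kron (marr f) (1\<^sub>m (fst U)), tensor_module U (snd (snd f))))\<rparr>"

lemma act_mat_carrier [simp]: "act_mat U r \<in> carrier_mat (fst U) (fst U)"
  by (simp add: act_mat_def)

lemma fst_tensor_module [simp]: "fst (tensor_module U V) = fst V * fst U"
  by (simp add: tensor_module_def)

lemma act_mat_mult:
  assumes "fd_module R U" "r \<in> carrier_vec (adim R)" "v \<in> carrier_vec (fst U)"
  shows "act_mat U r *\<^sub>v v = snd U r v"
  unfolding act_mat_def
proof (rule mat_of_mult[OF _ assms(3)])
  show "vec_linear (fst U) (fst U) (snd U r)"
    using assms(1,2) by (auto simp: vec_linear_def fd_module_def vec_bilinear_def)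
qed

lemma act_mat_simps:
  assumes U: "fd_module R U" and R: "fd_algebra R" and r: "r \<in> carrier_vec (adim R)" and s: "s \<in> carrier_vec (adim R)"
  shows "act_mat U (r + s) = act_mat U r + act_mat U s" "act_mat U (c \<cdot>\<^sub>v r) = c \<cdot>\<^sub>m act_mat U r"
    "act_mat U (aone R) = 1\<^sub>m (fst U)" "act_mat U (amult R r s) = act_mat U r * act_mat U s"
proof -
  let ?d = "fst U"
  have m: "amult R r s \<in> carrier_vec (adim R)" "aone R \<in> carrier_vec (adim R)"
    using R r s by (auto simp: fd_algebra_def vec_bilinear_def)
  have lin: "snd U (r + s) v = snd U r v + snd U s v" "snd U (c \<cdot>\<^sub>v r) v = c \<cdot>\<^sub>v snd U r v" "snd U r v \<in> carrier_vec ?d"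
    "snd U s v \<in> carrier_vec ?d"
    "snd U (aone R) v = v" "snd U (amult R r s) v = snd U r (snd U s v)" if "v \<in> carrier_vec ?d" for v c
    using U r s that by (auto simp: fd_module_def vec_bilinear_def)
  show "act_mat U (r + s) = act_mat U r + act_mat U s"
    by (rule mat_eq_by_vec[of _ ?d ?d])
      (use r s in \<open>auto simp: act_mat_mult[OF U] lin add_mult_distrib_mat_vec[of _ ?d ?d]\<close>)
  have sm: "(c \<cdot>\<^sub>m act_mat U r) *\<^sub>v v = c \<cdot>\<^sub>v (act_mat U r *\<^sub>v v)" if "v \<in> carrier_vec ?d" for v
    by (rule smult_mat_mult_vec[OF act_mat_carrier that])
  show "act_mat U (c \<cdot>\<^sub>v r) = c \<cdot>\<^sub>m act_mat U r"
    by (rule mat_eq_by_vec[of _ ?d ?d])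
      (use r in \<open>auto simp: sm act_mat_mult[OF U] lin\<close>)
  show "act_mat U (aone R) = 1\<^sub>m (fst U)"
    by (rule mat_eq_by_vec[of _ ?d ?d]) (use m in \<open>auto simp: act_mat_mult[OF U] lin\<close>)
  show "act_mat U (amult R r s) = act_mat U r * act_mat U s"
    by (rule mat_eq_by_vec[of _ ?d ?d])
      (use m r s in \<open>auto simp: act_mat_mult[OF U] lin assoc_mult_mat_vec[of _ ?d ?d _ ?d] intro: mult_carrier_mat[of _ _ ?d]\<close>)
qed

lemma tensor_module:
  assumes U: "fd_module R U" and R: "fd_algebra R"
  shows "fd_module R (tensor_module U (V :: 'k::field fd_mod))"
proof -
  let ?v = "fst V" and ?d = "fst U"
  let ?K = "\<lambda>r. kron (1\<^sub>m ?v) (act_mat U r)"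
  have K: "?K r \<in> carrier_mat (?v * ?d) (?v * ?d)" for r by (intro kron_carrier) auto
  note A = act_mat_simps[OF U R]
  have add: "?K (r + s) = ?K r + ?K s" if "r \<in> carrier_vec (adim R)" "s \<in> carrier_vec (adim R)" for r s
    unfolding A(1)[OF that] by (rule kron_add_right[OF one_carrier_mat act_mat_carrier act_mat_carrier])
  have sc: "?K (c \<cdot>\<^sub>v r) = c \<cdot>\<^sub>m ?K r" if "r \<in> carrier_vec (adim R)" for r c
    unfolding A(2)[OF that that] by (intro kron_smult_right) auto
  have mu: "?K (amult R r s) = ?K r * ?K s" if "r \<in> carrier_vec (adim R)" "s \<in> carrier_vec (adim R)" for r s
    unfolding A(4)[OF that] using kron_mult[OF one_carrier_mat act_mat_carrier one_carrier_mat act_mat_carrier, of ?v U r s] by simp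
  have "aone R \<in> carrier_vec (adim R)" using R by (simp add: fd_algebra_def)
  then have one: "?K (aone R) = 1\<^sub>m (?v * ?d)" using A(3) by (simp add: kron_one)
  show ?thesis
    unfolding fd_module_def vec_bilinear_def
  proof (intro conjI ballI allI)
    fix c and r v :: "'k vec" assume r: "r \<in> carrier_vec (adim R)" and v: "v \<in> carrier_vec (fst (tensor_module U V))"
    have "(c \<cdot>\<^sub>m ?K r) *\<^sub>v v = c \<cdot>\<^sub>v (?K r *\<^sub>v v)" using v by (intro smult_mat_mult_vec[OF K]) simp
    then show "snd (tensor_module U V) (c \<cdot>\<^sub>v r) v = c \<cdot>\<^sub>v snd (tensor_module U V) r v"
      using sc[OF r] by (simp add: tensor_module_def)
  qed (use K in \<open>auto simp: tensor_module_def add mu one add_mult_distrib_mat_vec[OF K K] mult_add_distrib_mat_vec[OF K]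
        mult_mat_vec[OF K] assoc_mult_mat_vec[OF K K] intro!: mult_mat_vec_carrier[OF K]\<close>)
qed

lemma tensor_with_simps [simp]:
  "FOb (tensor_with U) = tensor_module U" "fst (FAr (tensor_with U) f) = tensor_module U (fst f)"
  "marr (FAr (tensor_with U) f) = kron (marr f) (1\<^sub>m (fst U))" "snd (snd (FAr (tensor_with U) f)) = tensor_module U (snd (snd f))"
  by (simp_all add: tensor_with_def)

lemma tensor_with_linear:
  fixes U :: "'k::field fd_mod"
  assumes U: "fd_module R U" and R: "fd_algebra R"
  shows "linear_functor Vect (Mod_cat R) (tensor_with U)"
proof -
  note TU = tensor_module[OF U R]
  let ?d = "fst U"
  have arr: "FAr (tensor_with U) f \<in> Ar (Mod_cat R)" if f: "f \<in> Ar Vect" for f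
  proof -
    note c = marr_carrier[OF f]
    let ?n = "fst (fst f)" and ?m = "fst (snd (snd f))"
    have k: "kron (marr f) (1\<^sub>m ?d) \<in> carrier_mat (?m * ?d) (?n * ?d)" using c by auto
    have "kron (marr f) (1\<^sub>m ?d) *\<^sub>v (kron (1\<^sub>m ?n) (act_mat U r) *\<^sub>v v) = kron (1\<^sub>m ?m) (act_mat U r) *\<^sub>v (kron (marr f) (1\<^sub>m ?d) *\<^sub>v v)"
      if v: "v \<in> carrier_vec (?n * ?d)" for r v
    proof -
      have K: "kron (1\<^sub>m p) (act_mat U r) \<in> carrier_mat (p * ?d) (p * ?d)" for p by (intro kron_carrier) auto
      have "kron (marr f) (1\<^sub>m ?d) * kron (1\<^sub>m ?n) (act_mat U r) = kron (marr f) (act_mat U r)"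
        using c left_mult_one_mat[OF act_mat_carrier[of U r]] by (subst kron_mult[of _ ?m ?n _ ?d ?d _ _ _ ?d]) auto
      also have "\<dots> = kron (1\<^sub>m ?m) (act_mat U r) * kron (marr f) (1\<^sub>m ?d)"
        using c right_mult_one_mat[OF act_mat_carrier[of U r]] by (subst kron_mult[of _ ?m ?m _ ?d ?d _ _ _ ?d]) auto
      finally show ?thesis
        unfolding assoc_mult_mat_vec[OF k K v, symmetric] assoc_mult_mat_vec[OF K k v, symmetric] by simp
    qed
    then show ?thesis using k TU by (auto simp: Mod_Ar fd_module_hom_def tensor_module_def tensor_with_def)
  qed
  have mult: "kron (marr g * marr f) (1\<^sub>m ?d) = kron (marr g) (1\<^sub>m ?d) * kron (marr f) (1\<^sub>m ?d)"
    if "f \<in> Ar Vect" "g \<in> Ar Vect" "fst g = snd (snd f)" for f g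
    using kron_mult[OF marr_carrier[OF that(2)] one_carrier_mat marr_carrier[OF that(1), folded that(3)] one_carrier_mat, of ?d] by simp
  have add: "kron (marr f + marr g) (1\<^sub>m ?d) = kron (marr f) (1\<^sub>m ?d) + kron (marr g) (1\<^sub>m ?d)"
    if "f \<in> Ar Vect" "g \<in> Ar Vect" "fst g = fst f" "snd (snd g) = snd (snd f)" for f g
    using marr_carrier[OF that(1)] marr_carrier[OF that(2)] that(3,4) by (intro kron_add_left[OF _ _ one_carrier_mat]) auto
  have scale: "kron (c \<cdot>\<^sub>m marr f) (1\<^sub>m ?d) = c \<cdot>\<^sub>m kron (marr f) (1\<^sub>m ?d)" if "f \<in> Ar Vect" for c f
    by (rule kron_smult_left[OF marr_carrier[OF that] one_carrier_mat])
  show ?thesis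
    unfolding linear_functor_def is_functor_def Hom_def
  proof (intro conjI ballI allI)
    fix X Y Z and f g :: "'k fd_arrow"
    assume "f \<in> {f \<in> Ar Vect. Src Vect f = X \<and> Tgt Vect f = Y}"
      and "g \<in> {f \<in> Ar Vect. Src Vect f = Y \<and> Tgt Vect f = Z}"
    then show "FAr (tensor_with U) (g \<cdot>\<^bsub>Vect\<^esub> f) = FAr (tensor_with U) g \<cdot>\<^bsub>Mod_cat R\<^esub> FAr (tensor_with U) f"
      using mult[of f g] unfolding prod_eq_iff by simp
  next
    fix X Y and f g :: "'k fd_arrow"
    assume "f \<in> {f \<in> Ar Vect. Src Vect f = X \<and> Tgt Vect f = Y}"
      and "g \<in> {f \<in> Ar Vect. Src Vect f = X \<and> Tgt Vect f = Y}"
    then show "FAr (tensor_with U) (Add Vect f g) = Add (Mod_cat R) (FAr (tensor_with U) f) (FAr (tensor_with U) g)"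
      using add[of f g] unfolding prod_eq_iff by simp
  qed (use arr TU scale in \<open>auto simp: prod_eq_iff kron_one simp del: split_paired_All\<close>)
qed

lemmas [simp] = col_mat_carrier[unfolded One_nat_def]

section \<open>Projective objects of a Deligne product\<close>

locale deligne_homs =
  P: hom_coordinates C Z1 n1 \<theta>1 + Q: hom_coordinates D Z2 n2 \<theta>2 + T: abelian_category T
  for C :: "('o1, 'm1, 'k::field, 'r1) lcat_scheme" and Z1 n1 \<theta>1
    and D :: "('o2, 'm2, 'k, 'r2) lcat_scheme" and Z2 n2 \<theta>2
    and T :: "('o3, 'm3, 'k, 'r3) lcat_scheme" +
  fixes bx :: "('o1 \<times> 'o2, 'm1 \<times> 'm2, 'o3, 'm3, 's) ftr_scheme"
  assumes deligne: "deligne_product C D T bx"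
    and regular: "regular_category C" "regular_category D"
begin

lemma bx_bilinear: "bilinear_bifunctor C D T bx"
  using deligne by (simp add: deligne_product_def right_exact_bifunctor_def)

lemmas bx [simp] = bilinear_bifunctorD(1-4)[OF bx_bilinear P.linear_category_axioms Q.linear_category_axioms T.linear_category_axioms]
lemmas bx_idn = bilinear_bifunctorD(5)[OF bx_bilinear P.linear_category_axioms Q.linear_category_axioms T.linear_category_axioms]
lemmas bx_cmp = bilinear_bifunctorD(6)[OF bx_bilinear P.linear_category_axioms Q.linear_category_axioms T.linear_category_axioms]
lemmas bx_linear = bilinear_bifunctorD(7-10)[OF bx_bilinear P.linear_category_axioms Q.linear_category_axioms T.linear_category_axioms]

text \<open>
  The bifunctor \<open>Hom(Z1, -) \<otimes> Hom(Z2, -)\<close> in coordinates. It is right exact in each variable because \<open>C\<close> and \<open>D\<close> are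
  regular.
\<close>

definition hom_tensor :: "('o1 \<times> 'o2, 'm1 \<times> 'm2, 'k fd_mod, 'k fd_arrow) ftr" where
  "hom_tensor = \<lparr>FOb = (\<lambda>(X, Y). space (n1 X * n2 Y)),
     FAr = (\<lambda>(f, g). (space (n1 (Src C f) * n2 (Src D g)), kron (P.push f) (Q.push g), space (n1 (Tgt C f) * n2 (Tgt D g))))\<rparr>"

lemma hom_tensor_simps [simp]:
  "FOb hom_tensor (X, Y) = space (n1 X * n2 Y)"
  "FAr hom_tensor (f, g) = (space (n1 (Src C f) * n2 (Src D g)), kron (P.push f) (Q.push g), space (n1 (Tgt C f) * n2 (Tgt D g)))"
  by (simp_all add: hom_tensor_def)

lemma space_arr: "A \<in> carrier_mat m n \<Longrightarrow> (space n, A, space m) \<in> Ar Vect"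
  by (simp add: Mod_Ar field_module_hom)

lemma hom_tensor_right_exact: "right_exact_bifunctor C D Vect hom_tensor"
proof -
  have arr: "FAr hom_tensor (f, g) \<in> Ar Vect" for f g
    unfolding hom_tensor_simps by (intro space_arr kron_carrier) auto
  have cmp: "FAr hom_tensor (f' \<cdot>\<^bsub>C\<^esub> f, g' \<cdot>\<^bsub>D\<^esub> g) = FAr hom_tensor (f', g') \<cdot>\<^bsub>Vect\<^esub> FAr hom_tensor (f, g)"
    if "f \<in> Ar C" "g \<in> Ar D" "f' \<in> Ar C" "g' \<in> Ar D" "Src C f' = Tgt C f" "Src D g' = Tgt D g" for f g f' g'
  proof -
    have "kron (P.push f') (Q.push g') * kron (P.push f) (Q.push g) = kron (P.push f' * P.push f) (Q.push g' * Q.push g)"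
      using P.push_carrier[of f'] Q.push_carrier[of g'] P.push_carrier[of f] Q.push_carrier[of g]
      unfolding that(5,6) by (rule kron_mult)
    then show ?thesis using that by (simp add: P.push_cmp Q.push_cmp)
  qed
  have idn: "FAr hom_tensor (Idn C X, Idn D Y) = Idn Vect (FOb hom_tensor (X, Y))"
    if "X \<in> Ob C" "Y \<in> Ob D" for X Y
    using that by (simp add: P.push_idn Q.push_idn kron_one)
  have is_fun: "is_functor (prod_cat C D) Vect hom_tensor"
    unfolding is_functor_def
  proof (intro conjI allI ballI)
    fix X assume "X \<in> Ob (prod_cat C D)"
    then show "FOb hom_tensor X \<in> Ob Vect" "FAr hom_tensor (Idn (prod_cat C D) X) = Idn Vect (FOb hom_tensor X)"
      using idn by (auto simp: prod_cat_def hom_tensor_def)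
  next
    fix X Y f assume "f \<in> Hom (prod_cat C D) X Y"
    then show "FAr hom_tensor f \<in> Hom Vect (FOb hom_tensor X) (FOb hom_tensor Y)"
      using arr[of "fst f" "snd f"] by (auto simp: prod_cat_def Hom_def hom_tensor_def)
  next
    fix X Y Z f g assume "f \<in> Hom (prod_cat C D) X Y" "g \<in> Hom (prod_cat C D) Y Z"
    then show "FAr hom_tensor (g \<cdot>\<^bsub>prod_cat C D\<^esub> f) = FAr hom_tensor g \<cdot>\<^bsub>Vect\<^esub> FAr hom_tensor f"
      using cmp[of "fst f" "snd f" "fst g" "snd g"]
      by (cases f; cases g) (auto simp: prod_cat_def Hom_def)
  qed
  have fst: "linear_functor D Vect (fix_fst C hom_tensor X)" if X: "X \<in> Ob C" for X
    unfolding linear_functor_def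
  proof (intro conjI allI ballI)
    fix Y Y' f g assume "f \<in> Hom D Y Y'" "g \<in> Hom D Y Y'"
    then show "FAr (fix_fst C hom_tensor X) (Add D f g) = Add Vect (FAr (fix_fst C hom_tensor X) f) (FAr (fix_fst C hom_tensor X) g)"
      using X Q.push_carrier[of f] Q.push_carrier[of g]
      by (auto simp: fix_fst_def Hom_def Q.push_add intro!: kron_add_right[OF P.push_carrier])
  next
    fix Y Y' c f assume "f \<in> Hom D Y Y'"
    then show "FAr (fix_fst C hom_tensor X) (Scale D c f) = Scale Vect c (FAr (fix_fst C hom_tensor X) f)"
      using X by (auto simp: fix_fst_def Hom_def Q.push_scale intro!: kron_smult_right[OF P.push_carrier Q.push_carrier])
  qed (rule fix_fst_functor[OF P.category_axioms is_fun X])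
  have snd: "linear_functor C Vect (fix_snd D hom_tensor Y)" if Y: "Y \<in> Ob D" for Y
    unfolding linear_functor_def
  proof (intro conjI allI ballI)
    fix X X' f g assume "f \<in> Hom C X X'" "g \<in> Hom C X X'"
    then show "FAr (fix_snd D hom_tensor Y) (Add C f g) = Add Vect (FAr (fix_snd D hom_tensor Y) f) (FAr (fix_snd D hom_tensor Y) g)"
      using Y P.push_carrier[of f] P.push_carrier[of g]
      by (auto simp: fix_snd_def Hom_def P.push_add intro!: kron_add_left[OF _ _ Q.push_carrier])
  next
    fix X X' c f assume "f \<in> Hom C X X'"
    then show "FAr (fix_snd D hom_tensor Y) (Scale C c f) = Scale Vect c (FAr (fix_snd D hom_tensor Y) f)"
      using Y by (auto simp: fix_snd_def Hom_def P.push_scale intro!: kron_smult_left[OF P.push_carrier Q.push_carrier])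
  qed (rule fix_snd_functor[OF Q.category_axioms is_fun Y])
  show ?thesis
    unfolding right_exact_bifunctor_def bilinear_bifunctor_def
    using is_fun fst snd regular_right_exact[OF Q.linear_category_axioms Mod_linear_category fst regular(2)]
      regular_right_exact[OF P.linear_category_axioms Mod_linear_category snd regular(1)] by blast
qed

end

locale deligne_eval = deligne_homs C Z1 n1 \<theta>1 D Z2 n2 \<theta>2 T bx + linear_equivalence T "Mod_cat R" \<Phi>
  for C :: "('o1, 'm1, 'k::field, 'r1) lcat_scheme" and Z1 n1 \<theta>1
    and D :: "('o2, 'm2, 'k, 'r2) lcat_scheme" and Z2 n2 \<theta>2
    and T :: "('o3, 'm3, 'k, 'r3) lcat_scheme"
    and bx :: "('o1 \<times> 'o2, 'm1 \<times> 'm2, 'o3, 'm3, 's) ftr_scheme"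
    and R :: "'k fd_alg" and \<Phi> :: "('o3, 'm3, 'k fd_mod, 'k fd_arrow) ftr" +
  assumes R: "fd_algebra R"
begin

text \<open>
  The equivalence \<open>\<Phi>\<close> moves arrows of \<open>T\<close> to matrices. \<open>U\<close> is the module of the object \<open>Z1 \<boxtimes> Z2\<close>, and
  \<open>eval_mat X Y\<close> is the matrix of the map \<open>Hom(Z1, X) \<otimes> Hom(Z2, Y) \<otimes> U \<rightarrow> \<Phi>(X \<boxtimes> Y)\<close> that sends \<open>a \<otimes> b \<otimes> u\<close> to
  \<open>\<Phi>(a \<boxtimes> b) u\<close>. The products with the matrices \<open>pure\<close> evaluate it at tensors \<open>a \<otimes> b\<close>, and since these span, equations between such maps are
  verified by multiplying both sides with \<open>pure\<close>.
\<close>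

definition U where "U = FOb \<Phi> (FOb bx (Z1, Z2))"

lemma U: "fd_module R U"
  using F(1)[of "FOb bx (Z1, Z2)"] by (simp add: U_def)

definition val :: "'m1 \<Rightarrow> 'm2 \<Rightarrow> 'k mat" where "val a b = marr (FAr \<Phi> (FAr bx (a, b)))"

definition eval_mat :: "'o1 \<Rightarrow> 'o2 \<Rightarrow> 'k mat" where
  "eval_mat X Y = hcat (n1 X * n2 Y) (fst U) (fst (FOb \<Phi> (FOb bx (X, Y))))
     (\<lambda>t. val (P.elt X (unit_vec (n1 X) (t div n2 Y))) (Q.elt Y (unit_vec (n2 Y) (t mod n2 Y))))"

abbreviation pure :: "'k vec \<Rightarrow> 'k vec \<Rightarrow> 'k mat" where
  "pure x y \<equiv> kron (kron (col_mat x) (col_mat y)) (1\<^sub>m (fst U))"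

lemma val_carrier:
  assumes "a \<in> Ar C" "Src C a = Z1" "b \<in> Ar D" "Src D b = Z2"
  shows "val a b \<in> carrier_mat (fst (FOb \<Phi> (FOb bx (Tgt C a, Tgt D b)))) (fst U)"
  using marr_carrier[of "FAr \<Phi> (FAr bx (a, b))" R] F(2,3,4)[of "FAr bx (a, b)"] assms by (simp add: val_def U_def)

text \<open>
  \<open>eval_mat\<close> is defined by the values of \<open>a \<otimes> b \<mapsto> \<Phi>(a \<boxtimes> b)\<close> on basis elements; by bilinearity of \<open>\<boxtimes>\<close> it gives the
  right value everywhere.
\<close>

lemma eval_mat_pure:
  assumes a: "a \<in> Ar C" "Src C a = Z1" "Tgt C a = X" and b: "b \<in> Ar D" "Src D b = Z2" "Tgt D b = Y"
  shows "eval_mat X Y * pure (\<theta>1 X a) (\<theta>2 Y b) = val a b"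
proof (rule eq_matI)
  note vc = val_carrier[OF a(1,2) b(1,2), unfolded a(3) b(3)]
  have XY: "X \<in> Ob C" "Y \<in> Ob D" using a b by auto
  let ?x = "\<theta>1 X a" and ?y = "\<theta>2 Y b"
  have xy: "?x \<in> carrier_vec (n1 X)" "?y \<in> carrier_vec (n2 Y)" using a b by auto
  fix r c assume "r < dim_row (val a b)" "c < dim_col (val a b)"
  then have rc: "r < fst (FOb \<Phi> (FOb bx (X, Y)))" "c < fst U" using vc by auto
  have lin1: "val a' b $$ (r, c) = (\<Sum>i<n1 X. \<theta>1 X a' $ i * val (P.elt X (unit_vec (n1 X) i)) b $$ (r, c))"
    if b: "b \<in> Ar D" "Src D b = Z2" "Tgt D b = Y" and a': "a' \<in> Ar C" "Src C a' = Z1" "Tgt C a' = X" for a' b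
  proof -
    have "(\<lambda>x. val (P.elt X x) b $$ (r, c)) (\<theta>1 X a') = (\<Sum>i<n1 X. \<theta>1 X a' $ i * val (P.elt X (unit_vec (n1 X) i)) b $$ (r, c))"
    proof (rule linear_functional_expand)
      fix x y :: "'k vec" assume x: "x \<in> carrier_vec (n1 X)" and y: "y \<in> carrier_vec (n1 X)"
      have "val (P.elt X (x + y)) b = val (P.elt X x) b + val (P.elt X y) b"
        using x y XY b by (simp add: val_def P.elt_add bx_linear linear_functorD(2)[OF linear])
      then show "val (P.elt X (x + y)) b $$ (r, c) = val (P.elt X x) b $$ (r, c) + val (P.elt X y) b $$ (r, c)"
        using rc val_carrier[of "P.elt X y" b] x y XY b by simp
    next
      fix k and x :: "'k vec" assume x: "x \<in> carrier_vec (n1 X)"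
      have "val (P.elt X (k \<cdot>\<^sub>v x)) b = k \<cdot>\<^sub>m val (P.elt X x) b"
        using x XY b by (simp add: val_def P.elt_scale bx_linear linear_functorD(3)[OF linear])
      then show "val (P.elt X (k \<cdot>\<^sub>v x)) b $$ (r, c) = k * val (P.elt X x) b $$ (r, c)"
        using rc val_carrier[of "P.elt X x" b] x XY b by simp
    qed (use a' in auto)
    then show ?thesis using a' by simp
  qed
  have lin2: "val a b' $$ (r, c) = (\<Sum>j<n2 Y. \<theta>2 Y b' $ j * val a (Q.elt Y (unit_vec (n2 Y) j)) $$ (r, c))"
    if b': "b' \<in> Ar D" "Src D b' = Z2" "Tgt D b' = Y" and a: "a \<in> Ar C" "Src C a = Z1" "Tgt C a = X" for a b'
  proof -
    have "(\<lambda>y. val a (Q.elt Y y) $$ (r, c)) (\<theta>2 Y b') = (\<Sum>j<n2 Y. \<theta>2 Y b' $ j * val a (Q.elt Y (unit_vec (n2 Y) j)) $$ (r, c))"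
    proof (rule linear_functional_expand)
      fix x y :: "'k vec" assume x: "x \<in> carrier_vec (n2 Y)" and y: "y \<in> carrier_vec (n2 Y)"
      have "val a (Q.elt Y (x + y)) = val a (Q.elt Y x) + val a (Q.elt Y y)"
        using x y XY a by (simp add: val_def Q.elt_add bx_linear linear_functorD(2)[OF linear])
      then show "val a (Q.elt Y (x + y)) $$ (r, c) = val a (Q.elt Y x) $$ (r, c) + val a (Q.elt Y y) $$ (r, c)"
        using rc val_carrier[of a "Q.elt Y y"] x y XY a by simp
    next
      fix k and x :: "'k vec" assume x: "x \<in> carrier_vec (n2 Y)"
      have "val a (Q.elt Y (k \<cdot>\<^sub>v x)) = k \<cdot>\<^sub>m val a (Q.elt Y x)"
        using x XY a by (simp add: val_def Q.elt_scale bx_linear linear_functorD(3)[OF linear])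
      then show "val a (Q.elt Y (k \<cdot>\<^sub>v x)) $$ (r, c) = k * val a (Q.elt Y x) $$ (r, c)"
        using rc val_carrier[of a "Q.elt Y x"] x XY a by simp
    qed (use b' in auto)
    then show ?thesis using b' by simp
  qed
  have "(eval_mat X Y * pure ?x ?y) $$ (r, c) =
     (\<Sum>i<n1 X. \<Sum>j<n2 Y. ?x $ i * ?y $ j * val (P.elt X (unit_vec (n1 X) i)) (Q.elt Y (unit_vec (n2 Y) j)) $$ (r, c))"
    unfolding eval_mat_def hcat_kron[OF xy rc] by (intro sum.cong) auto
  also have "\<dots> = (\<Sum>i<n1 X. ?x $ i * (\<Sum>j<n2 Y. ?y $ j * val (P.elt X (unit_vec (n1 X) i)) (Q.elt Y (unit_vec (n2 Y) j)) $$ (r, c)))"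
    by (simp add: sum_distrib_left mult.assoc)
  also have "\<dots> = (\<Sum>i<n1 X. ?x $ i * val (P.elt X (unit_vec (n1 X) i)) b $$ (r, c))"
    using XY b by (intro sum.cong refl) (simp add: lin2[of b])
  also have "\<dots> = val a b $$ (r, c)" using lin1[OF b a] by simp
  finally show "(eval_mat X Y * pure ?x ?y) $$ (r, c) = val a b $$ (r, c)" .
next
  show "dim_row (eval_mat X Y * pure (\<theta>1 X a) (\<theta>2 Y b)) = dim_row (val a b)"
    using val_carrier[OF a(1,2) b(1,2)] a b by (simp add: eval_mat_def hcat_def)
  show "dim_col (eval_mat X Y * pure (\<theta>1 X a) (\<theta>2 Y b)) = dim_col (val a b)"
    using val_carrier[OF a(1,2) b(1,2)] by (simp add: col_mat_def)
qed

lemma eval_mat_carrier [simp]: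
  "eval_mat X Y \<in> carrier_mat (fst (FOb \<Phi> (FOb bx (X, Y)))) (n1 X * n2 Y * fst U)"
  by (simp add: eval_mat_def)

lemma mat_eq_by_pure:
  assumes XY: "X \<in> Ob C" "Y \<in> Ob D"
    and A: "A \<in> carrier_mat m (n1 X * n2 Y * fst U)" and B: "B \<in> carrier_mat m (n1 X * n2 Y * fst U)"
    and eq: "\<And>a b. a \<in> Ar C \<Longrightarrow> Src C a = Z1 \<Longrightarrow> Tgt C a = X \<Longrightarrow> b \<in> Ar D \<Longrightarrow> Src D b = Z2 \<Longrightarrow> Tgt D b = Y \<Longrightarrow>
      A * pure (\<theta>1 X a) (\<theta>2 Y b) = B * pure (\<theta>1 X a) (\<theta>2 Y b)"
  shows "A = B"
proof (rule mat_eq_by_kron[OF A B])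
  fix x y :: "'k vec" assume "x \<in> carrier_vec (n1 X)" "y \<in> carrier_vec (n2 Y)"
  then show "A * pure x y = B * pure x y" using eq[of "P.elt X x" "Q.elt Y y"] XY by simp
qed

lemma pure_carrier: "x \<in> carrier_vec p \<Longrightarrow> y \<in> carrier_vec q \<Longrightarrow> pure x y \<in> carrier_mat (p * q * fst U) (fst U)"
  using kron_carrier[OF kron_carrier[OF col_mat_carrier col_mat_carrier] one_carrier_mat, of x p y q "fst U"] by simp

lemma kron_pure:
  assumes "A \<in> carrier_mat p n" "B \<in> carrier_mat q m" "x \<in> carrier_vec n" "y \<in> carrier_vec m"
  shows "kron (kron A B) (1\<^sub>m (fst U)) * pure x y = pure (A *\<^sub>v x) (B *\<^sub>v y)"
proof -
  have "kron (kron A B) (1\<^sub>m (fst U)) * pure x y = kron (kron A B * kron (col_mat x) (col_mat y)) (1\<^sub>m (fst U) * 1\<^sub>m (fst U))"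
    by (rule kron_mult[OF kron_carrier[OF assms(1,2)] one_carrier_mat kron_carrier[OF col_mat_carrier[OF assms(3)] col_mat_carrier[OF assms(4)]] one_carrier_mat])
  also have "kron A B * kron (col_mat x) (col_mat y) = kron (A * col_mat x) (B * col_mat y)"
    by (rule kron_mult[OF assms(1,2) col_mat_carrier[OF assms(3)] col_mat_carrier[OF assms(4)]])
  finally show ?thesis using assms by (simp add: mult_col_mat)
qed

lemma eval_natural:
  assumes f: "f \<in> Ar C" and g: "g \<in> Ar D"
  shows "eval_mat (Tgt C f) (Tgt D g) * kron (kron (P.push f) (Q.push g)) (1\<^sub>m (fst U)) =
    marr (FAr \<Phi> (FAr bx (f, g))) * eval_mat (Src C f) (Src D g)"
proof (rule mat_eq_by_pure)
  let ?K = "kron (kron (P.push f) (Q.push g)) (1\<^sub>m (fst U))" and ?M = "marr (FAr \<Phi> (FAr bx (f, g)))"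
  let ?m = "fst (FOb \<Phi> (FOb bx (Tgt C f, Tgt D g)))"
  have K: "?K \<in> carrier_mat (n1 (Tgt C f) * n2 (Tgt D g) * fst U) (n1 (Src C f) * n2 (Src D g) * fst U)"
    by (intro kron_carrier) auto
  have M: "?M \<in> carrier_mat ?m (fst (FOb \<Phi> (FOb bx (Src C f, Src D g))))"
    using marr_carrier[of "FAr \<Phi> (FAr bx (f, g))" R] F(2,3,4)[of "FAr bx (f, g)"] f g by simp
  show "eval_mat (Tgt C f) (Tgt D g) * ?K \<in> carrier_mat ?m (n1 (Src C f) * n2 (Src D g) * fst U)"
    by (rule mult_carrier_mat[OF eval_mat_carrier K])
  show "?M * eval_mat (Src C f) (Src D g) \<in> carrier_mat ?m (n1 (Src C f) * n2 (Src D g) * fst U)"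
    by (rule mult_carrier_mat[OF M eval_mat_carrier])
  fix a b assume a: "a \<in> Ar C" "Src C a = Z1" "Tgt C a = Src C f" and b: "b \<in> Ar D" "Src D b = Z2" "Tgt D b = Src D g"
  let ?p = "pure (\<theta>1 (Src C f) a) (\<theta>2 (Src D g) b)"
  have p: "?p \<in> carrier_mat (n1 (Src C f) * n2 (Src D g) * fst U) (fst U)" using a b by (intro pure_carrier) auto
  have "?K * ?p = pure (\<theta>1 (Tgt C f) (f \<cdot>\<^bsub>C\<^esub> a)) (\<theta>2 (Tgt D g) (g \<cdot>\<^bsub>D\<^esub> b))"
    using kron_pure[OF P.push_carrier Q.push_carrier, of "\<theta>1 (Src C f) a" f "\<theta>2 (Src D g) b" g] a b f g
    by (simp add: P.push_coord Q.push_coord)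
  then have "eval_mat (Tgt C f) (Tgt D g) * ?K * ?p = val (f \<cdot>\<^bsub>C\<^esub> a) (g \<cdot>\<^bsub>D\<^esub> b)"
    using eval_mat_pure[of "f \<cdot>\<^bsub>C\<^esub> a" "Tgt C f" "g \<cdot>\<^bsub>D\<^esub> b" "Tgt D g"] a b f g
      assoc_mult_mat[OF eval_mat_carrier K p] by simp
  also have "\<dots> = ?M * val a b"
    using a b f g bx_cmp[of a b f g] F(6)[of "FAr bx (a, b)" "FAr bx (f, g)"] by (simp add: val_def)
  also have "val a b = eval_mat (Src C f) (Src D g) * ?p" using eval_mat_pure[OF a b] by simp
  also have "?M * (eval_mat (Src C f) (Src D g) * ?p) = ?M * eval_mat (Src C f) (Src D g) * ?p"
    by (rule assoc_mult_mat[OF M eval_mat_carrier p, symmetric])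
  finally show "eval_mat (Tgt C f) (Tgt D g) * ?K * ?p = ?M * eval_mat (Src C f) (Src D g) * ?p" .
qed (use f g in auto)

definition eval_arr :: "'o1 \<Rightarrow> 'o2 \<Rightarrow> 'k fd_arrow" where
  "eval_arr X Y = (tensor_module U (space (n1 X * n2 Y)), eval_mat X Y, FOb \<Phi> (FOb bx (X, Y)))"

lemma eval_arr:
  assumes XY: "X \<in> Ob C" "Y \<in> Ob D" shows "eval_arr X Y \<in> Ar (Mod_cat R)"
proof -
  let ?W = "FOb \<Phi> (FOb bx (X, Y))" and ?N = "n1 X * n2 Y" and ?d = "fst U"
  have W: "fd_module R ?W" using F(1)[of "FOb bx (X, Y)"] XY by simp
  have comm: "eval_mat X Y * kron (1\<^sub>m ?N) (act_mat U r) = act_mat ?W r * eval_mat X Y" if r: "r \<in> carrier_vec (adim R)" for r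
  proof (rule mat_eq_by_pure[OF XY])
    have K: "kron (1\<^sub>m ?N) (act_mat U r) \<in> carrier_mat (?N * ?d) (?N * ?d)" by (intro kron_carrier) auto
    show "eval_mat X Y * kron (1\<^sub>m ?N) (act_mat U r) \<in> carrier_mat (fst ?W) (?N * ?d)"
      by (rule mult_carrier_mat[OF eval_mat_carrier K])
    show "act_mat ?W r * eval_mat X Y \<in> carrier_mat (fst ?W) (?N * ?d)"
      by (rule mult_carrier_mat[OF act_mat_carrier eval_mat_carrier])
    fix a b assume a: "a \<in> Ar C" "Src C a = Z1" "Tgt C a = X" and b: "b \<in> Ar D" "Src D b = Z2" "Tgt D b = Y"
    let ?x = "kron (col_mat (\<theta>1 X a)) (col_mat (\<theta>2 Y b))"
    let ?p = "pure (\<theta>1 X a) (\<theta>2 Y b)"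
    have x: "?x \<in> carrier_mat ?N 1" using kron_carrier[OF col_mat_carrier col_mat_carrier, of "\<theta>1 X a" "n1 X" "\<theta>2 Y b" "n2 Y"] a b by simp
    have p: "?p \<in> carrier_mat (?N * ?d) ?d" using a b by (intro pure_carrier) auto
    have "kron (1\<^sub>m ?N) (act_mat U r) * ?p = kron (1\<^sub>m ?N * ?x) (act_mat U r * 1\<^sub>m ?d)"
      by (rule kron_mult[OF one_carrier_mat act_mat_carrier x one_carrier_mat])
    also have "\<dots> = kron (?x * 1\<^sub>m 1) (1\<^sub>m ?d * act_mat U r)"
      using x act_mat_carrier[of U r] by (metis left_mult_one_mat right_mult_one_mat)
    also have "\<dots> = ?p * kron (1\<^sub>m 1) (act_mat U r)"
      by (rule kron_mult[OF x one_carrier_mat one_carrier_mat act_mat_carrier, symmetric])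
    finally have e: "kron (1\<^sub>m ?N) (act_mat U r) * ?p = ?p * act_mat U r" by (simp only: kron_one_one)
    have ar: "FAr \<Phi> (FAr bx (a, b)) \<in> Ar (Mod_cat R)" using a b by simp
    have V: "val a b \<in> carrier_mat (fst ?W) ?d" using val_carrier[OF a(1,2) b(1,2)] a b by simp
    have "val a b * act_mat U r = act_mat ?W r * val a b"
    proof (rule mat_eq_by_vec)
      show "val a b * act_mat U r \<in> carrier_mat (fst ?W) ?d" "act_mat ?W r * val a b \<in> carrier_mat (fst ?W) ?d"
        using V act_mat_carrier mult_carrier_mat by blast+
      fix v :: "'k vec" assume v: "v \<in> carrier_vec ?d"
      have "val a b *\<^sub>v snd U r v = snd ?W r (val a b *\<^sub>v v)"
        using ar r v F(3,4)[of "FAr bx (a, b)"] a b by (simp add: Mod_Ar fd_module_hom_def val_def U_def)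
      moreover have "val a b *\<^sub>v v \<in> carrier_vec (fst ?W)" using V v by auto
      ultimately show "(val a b * act_mat U r) *\<^sub>v v = (act_mat ?W r * val a b) *\<^sub>v v"
        unfolding assoc_mult_mat_vec[OF V act_mat_carrier v] assoc_mult_mat_vec[OF act_mat_carrier V v]
        using r v by (simp add: act_mat_mult[OF U] act_mat_mult[OF W])
    qed
    moreover have "eval_mat X Y * kron (1\<^sub>m ?N) (act_mat U r) * ?p = eval_mat X Y * ?p * act_mat U r"
      unfolding assoc_mult_mat[OF eval_mat_carrier K p] e by (rule assoc_mult_mat[OF eval_mat_carrier p act_mat_carrier, symmetric])
    moreover have "act_mat ?W r * eval_mat X Y * ?p = act_mat ?W r * (eval_mat X Y * ?p)"
      by (rule assoc_mult_mat[OF act_mat_carrier eval_mat_carrier p])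
    ultimately show "eval_mat X Y * kron (1\<^sub>m ?N) (act_mat U r) * ?p = act_mat ?W r * eval_mat X Y * ?p"
      using eval_mat_pure[OF a b] by simp
  qed
  have "eval_mat X Y *\<^sub>v (kron (1\<^sub>m ?N) (act_mat U r) *\<^sub>v v) = snd ?W r (eval_mat X Y *\<^sub>v v)"
    if r: "r \<in> carrier_vec (adim R)" and v: "v \<in> carrier_vec (?N * ?d)" for r v
  proof -
    have K: "kron (1\<^sub>m ?N) (act_mat U r) \<in> carrier_mat (?N * ?d) (?N * ?d)" by (intro kron_carrier) auto
    have "eval_mat X Y *\<^sub>v v \<in> carrier_vec (fst ?W)" by (rule mult_mat_vec_carrier[OF eval_mat_carrier v])
    then show ?thesis
      unfolding assoc_mult_mat_vec[OF eval_mat_carrier K v, symmetric] comm[OF r] assoc_mult_mat_vec[OF act_mat_carrier eval_mat_carrier v]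
      using r by (simp add: act_mat_mult[OF W])
  qed
  then show ?thesis
    using W tensor_module[OF U R] by (simp add: eval_arr_def Mod_Ar fd_module_hom_def) (simp add: tensor_module_def)
qed

abbreviation cmp_R (infixr "\<cdot>\<^sub>R" 70) where "\<beta> \<cdot>\<^sub>R \<alpha> \<equiv> \<beta> \<cdot>\<^bsub>Mod_cat R\<^esub> \<alpha>"
abbreviation cmp_V :: "'k fd_arrow \<Rightarrow> 'k fd_arrow \<Rightarrow> 'k fd_arrow" (infixr "\<cdot>\<^sub>V" 70)
  where "\<beta> \<cdot>\<^sub>V \<alpha> \<equiv> \<beta> \<cdot>\<^bsub>Vect\<^esub> \<alpha>"

text \<open>
  \<open>Z1 \<boxtimes> Z2\<close> is projective. Let \<open>H: T \<rightarrow> Vect\<close> be the right exact extension of \<open>Hom(Z1, -) \<otimes> Hom(Z2, -)\<close>, and let \<open>\<epsilon>\<close> be the extension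
  of the evaluation maps to a natural transformation \<open>H(W) \<otimes> U \<rightarrow> \<Phi>(W)\<close>. The vector \<open>u = id \<otimes> id\<close> in
  \<open>H(Z1 \<boxtimes> Z2)\<close> is evaluated to the identity of \<open>U\<close>, and because cokernels of vector spaces split, \<open>u\<close> is the
  image under \<open>H(e)\<close> of some \<open>w\<close> in \<open>H(W)\<close>. By naturality the evaluation of \<open>w\<close> is a section of \<open>\<Phi>(e)\<close>.
\<close>

lemma epi_onto_box_splits:
  assumes e: "is_epi T e" "Tgt T e = FOb bx (Z1, Z2)"
  shows "\<exists>s \<in> Hom T (Tgt T e) (Src T e). e \<cdot>\<^bsub>T\<^esub> s = Idn T (Tgt T e)"
proof -
  let ?V = "Mod_cat (field_alg :: 'k fd_alg)" and ?M = "Mod_cat R"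
  interpret V: linear_category ?V by (rule Mod_linear_category)
  have ea: "e \<in> Ar T" by (rule T.epi_arr[OF e(1)])
  obtain H :: "('o3, 'm3, 'k fd_mod, 'k fd_arrow) ftr" and \<eta>
    where H: "right_exact_functor T ?V H" and \<eta>: "nat_iso (prod_cat C D) ?V (comp_ftr H bx) hom_tensor \<eta>"
    using deligne hom_tensor_right_exact field_alg unfolding deligne_product_def by metis
  have Hlin: "linear_functor T ?V H" using H by (simp add: right_exact_functor_def)
  note HF = functorD[OF linear_functorD(1)[OF Hlin]]
  note TW = functorD[OF linear_functorD(1)[OF tensor_with_linear[OF U R]]]
  have \<eta>1: "\<eta> (X, Y) \<in> Ar ?V" "fst (\<eta> (X, Y)) = FOb H (FOb bx (X, Y))" "snd (snd (\<eta> (X, Y))) = space (n1 X * n2 Y)"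
    "is_iso ?V (\<eta> (X, Y))" if "X \<in> Ob C" "Y \<in> Ob D" for X Y
    using \<eta> that unfolding nat_iso_def nat_trans_def Hom_def by (auto simp: prod_cat_def comp_ftr_def)
  have \<eta>2: "\<eta> (Tgt C f, Tgt D g) \<cdot>\<^sub>V FAr H (FAr bx (f, g)) = FAr hom_tensor (f, g) \<cdot>\<^sub>V \<eta> (Src C f, Src D g)"
    if "f \<in> Ar C" "g \<in> Ar D" for f g
  proof -
    have "(f, g) \<in> Hom (prod_cat C D) (Src C f, Src D g) (Tgt C f, Tgt D g)" using that by (simp add: Hom_def prod_cat_def)
    then show ?thesis using \<eta> unfolding nat_iso_def nat_trans_def by (simp add: comp_ftr_def del: hom_tensor_simps Mod_simps)
  qed
  let ?H = "comp_ftr (tensor_with U) H"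
  have "right_exact_functor ?V ?M (tensor_with U)"
    unfolding right_exact_functor_def using tensor_with_linear[OF U R]
      regular_right_exact[OF V.linear_category_axioms D.linear_category_axioms tensor_with_linear[OF U R] field_Mod_regular] by blast
  then have H': "right_exact_functor T ?M ?H" by (rule comp_right_exact_functor[OF _ H])
  have \<Phi>: "right_exact_functor T ?M \<Phi>" using linear right_exact by (simp add: right_exact_functor_def)
  \<comment> \<open>the evaluation, precomposed with the isomorphism between the restriction of \<open>H\<close> and \<open>hom_tensor\<close>\<close>
  define \<tau> where "\<tau> p = eval_arr (fst p) (snd p) \<cdot>\<^sub>R FAr (tensor_with U) (\<eta> p)" for p
  have \<tau>: "\<tau> (X, Y) \<in> Ar ?M" "fst (\<tau> (X, Y)) = FOb ?H (FOb bx (X, Y))" "snd (snd (\<tau> (X, Y))) = FOb \<Phi> (FOb bx (X, Y))"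
    if XY: "X \<in> Ob C" "Y \<in> Ob D" for X Y
  proof -
    note ev = eval_arr[OF XY] and TE = TW(2-4)[OF \<eta>1(1)[OF XY]] and n = \<eta>1(1-3)[OF XY]
    have s: "Src ?M (eval_arr X Y) = Tgt ?M (FAr (tensor_with U) (\<eta> (X, Y)))" using n by (simp add: eval_arr_def)
    show "\<tau> (X, Y) \<in> Ar ?M" unfolding \<tau>_def using D.arr_cmp[OF TE(1) ev s] by simp
    show "fst (\<tau> (X, Y)) = FOb ?H (FOb bx (X, Y))" "snd (snd (\<tau> (X, Y))) = FOb \<Phi> (FOb bx (X, Y))"
      using n by (simp_all add: \<tau>_def eval_arr_def comp_ftr_def)
  qed
  have "nat_trans (prod_cat C D) ?M (comp_ftr ?H bx) (comp_ftr \<Phi> bx) \<tau>"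
    unfolding nat_trans_def
  proof (intro conjI allI ballI)
    fix p assume "p \<in> Ob (prod_cat C D)"
    then show "\<tau> p \<in> Hom ?M (FOb (comp_ftr ?H bx) p) (FOb (comp_ftr \<Phi> bx) p)"
      using \<tau>[of "fst p" "snd p"] by (auto simp: prod_cat_def Hom_def comp_ftr_def)
  next
    fix X Y h assume "h \<in> Hom (prod_cat C D) X Y"
    then obtain f g where h: "h = (f, g)" "f \<in> Ar C" "g \<in> Ar D" "X = (Src C f, Src D g)" "Y = (Tgt C f, Tgt D g)"
      by (cases h) (auto simp: Hom_def prod_cat_def)
    note S = P.src_Ob[OF h(2)] Q.src_Ob[OF h(3)] and T = P.tgt_Ob[OF h(2)] Q.tgt_Ob[OF h(3)]
    note nS = \<eta>1(1-3)[OF S] and nT = \<eta>1(1-3)[OF T]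
    have bf: "FAr bx (f, g) \<in> Ar T" using h by simp
    have hb: "FAr H (FAr bx (f, g)) \<in> Ar ?V" "fst (FAr H (FAr bx (f, g))) = FOb H (FOb bx (Src C f, Src D g))"
      "snd (snd (FAr H (FAr bx (f, g)))) = FOb H (FOb bx (Tgt C f, Tgt D g))"
      using HF(2-4)[OF bf] h by simp_all
    let ?t = "tensor_with U"
    have ht: "FAr hom_tensor (f, g) \<in> Ar ?V" unfolding hom_tensor_simps by (intro space_arr kron_carrier) auto
    have 1: "FAr ?t (\<eta> Y) \<cdot>\<^sub>R FAr ?t (FAr H (FAr bx (f, g))) = FAr ?t (FAr hom_tensor (f, g)) \<cdot>\<^sub>R FAr ?t (\<eta> X)"
      using \<eta>2[OF h(2,3)] TW(6)[OF hb(1) nT(1)] TW(6)[OF nS(1) ht] hb nT nS h by simp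
    have 2: "eval_arr (Tgt C f) (Tgt D g) \<cdot>\<^sub>R FAr ?t (FAr hom_tensor (f, g)) = FAr \<Phi> (FAr bx (f, g)) \<cdot>\<^sub>R eval_arr (Src C f) (Src D g)"
      using eval_natural[OF h(2,3)] F(3,4)[OF bf] h(2,3) by (simp add: eval_arr_def prod_eq_iff)
    have c: "Src ?M (eval_arr (Tgt C f) (Tgt D g)) = Tgt ?M (FAr ?t (\<eta> Y))" "Src ?M (FAr ?t (\<eta> Y)) = Tgt ?M (FAr ?t (FAr H (FAr bx (f, g))))"
      "Src ?M (eval_arr (Src C f) (Src D g)) = Tgt ?M (FAr ?t (\<eta> X))" "Src ?M (FAr ?t (FAr hom_tensor (f, g))) = Tgt ?M (FAr ?t (\<eta> X))"
      "Src ?M (eval_arr (Tgt C f) (Tgt D g)) = Tgt ?M (FAr ?t (FAr hom_tensor (f, g)))"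
      "Src ?M (FAr \<Phi> (FAr bx (f, g))) = Tgt ?M (eval_arr (Src C f) (Src D g))"
      using nS nT hb h F(3)[OF bf] by (simp_all add: eval_arr_def)
    note a = eval_arr[OF S] eval_arr[OF T] TW(2)[OF nT(1)] TW(2)[OF nS(1)] TW(2)[OF hb(1)] TW(2)[OF ht] F(2)[OF bf]
    have "\<tau> Y \<cdot>\<^sub>R FAr ?t (FAr H (FAr bx (f, g))) = eval_arr (Tgt C f) (Tgt D g) \<cdot>\<^sub>R (FAr ?t (\<eta> Y) \<cdot>\<^sub>R FAr ?t (FAr H (FAr bx (f, g))))"
      unfolding \<tau>_def h(4,5) fst_conv snd_conv by (rule D.assoc) (simp_all add: a c[unfolded h(4,5)] h del: Mod_simps tensor_with_simps)
    also have "\<dots> = (eval_arr (Tgt C f) (Tgt D g) \<cdot>\<^sub>R FAr ?t (FAr hom_tensor (f, g))) \<cdot>\<^sub>R FAr ?t (\<eta> X)"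
      unfolding 1 by (rule D.assoc[symmetric]) (use a c h in \<open>simp_all del: Mod_simps tensor_with_simps\<close>)
    also have "\<dots> = FAr \<Phi> (FAr bx (f, g)) \<cdot>\<^sub>R \<tau> X"
      unfolding 2 \<tau>_def h(4,5) fst_conv snd_conv by (rule D.assoc) (simp_all add: a c[unfolded h(4,5)] h del: Mod_simps tensor_with_simps)
    finally show "\<tau> Y \<cdot>\<^sub>R FAr (comp_ftr ?H bx) h = FAr (comp_ftr \<Phi> bx) h \<cdot>\<^sub>R \<tau> X" unfolding h(1) by (simp add: comp_ftr_def del: Mod_simps tensor_with_simps)
  qed
  note nt = this
  note univ = mp[OF spec[OF conjunct2[OF conjunct2[OF deligne[unfolded deligne_product_def]]], of R] R, THEN conjunct2, rule_format]
  obtain \<epsilon> where \<epsilon>: "nat_trans T ?M ?H \<Phi> \<epsilon>" and \<epsilon>bx: "\<And>X Y. X \<in> Ob C \<Longrightarrow> Y \<in> Ob D \<Longrightarrow> \<epsilon> (FOb bx (X, Y)) = \<tau> (X, Y)"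
    using ex1_implies_ex[OF univ[OF conjI[OF H' conjI[OF \<Phi> nt]]]] by blast
  have ZZ: "Z1 \<in> Ob C" "Z2 \<in> Ob D" by auto
  obtain f where f: "is_cokernel T f e" using T.epi_is_cokernel[OF e(1)] by blast
  then have "is_cokernel ?V (FAr H f) (FAr H e)" using H by (simp add: right_exact_functor_def right_exact_def)
  then obtain s where s: "s \<in> Hom ?V (Tgt ?V (FAr H e)) (Tgt ?V (FAr H f))" "FAr H e \<cdot>\<^sub>V s = Idn ?V (Tgt ?V (FAr H e))"
    using V.regular_cokernel_splits[OF field_Mod_regular] by blast
  have s': "s \<in> Ar ?V" "Src ?V s = FOb H (FOb bx (Z1, Z2))" "Tgt ?V s = FOb H (Src T e)"
    "FAr H e \<cdot>\<^sub>V s = Idn ?V (FOb H (FOb bx (Z1, Z2)))"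
    using s HF(3,4)[OF ea] HF(3,4)[OF T.cokernelD(1)[OF f]] T.cokernelD(3)[OF f] e(2) by (simp_all add: Hom_def)
  let ?b = "FOb bx (Z1, Z2)" and ?\<eta> = "\<eta> (Z1, Z2)" and ?t = "tensor_with U" and ?n = "n1 Z1 * n2 Z2" and ?W = "Src T e"
  have W: "?W \<in> Ob T" and b: "?b \<in> Ob T" using ea ZZ by auto
  have \<eta>a: "?\<eta> \<in> Ar ?V" "Src ?V ?\<eta> = FOb H ?b" "Tgt ?V ?\<eta> = space ?n" "is_iso ?V ?\<eta>" using \<eta>1[OF ZZ] by simp_all
  have He: "FAr H e \<in> Ar ?V" "Src ?V (FAr H e) = FOb H ?W" "Tgt ?V (FAr H e) = FOb H ?b"
    using HF(2-4)[OF ea] e(2) by simp_all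
  define u :: "'k fd_arrow"
    where "u = (space 1, kron (col_mat (\<theta>1 Z1 (Idn C Z1))) (col_mat (\<theta>2 Z2 (Idn D Z2))), space ?n)"
  have u: "u \<in> Ar ?V" "Src ?V u = space 1" "Tgt ?V u = space ?n"
    using space_arr[OF kron_carrier[OF col_mat_carrier col_mat_carrier], of "\<theta>1 Z1 (Idn C Z1)" "n1 Z1" "\<theta>2 Z2 (Idn D Z2)" "n2 Z2"]
    by (auto simp: u_def)
  define w where "w = s \<cdot>\<^sub>V (Inv ?V ?\<eta> \<cdot>\<^sub>V u)"
  have v: "Inv ?V ?\<eta> \<cdot>\<^sub>V u \<in> Ar ?V" "Src ?V (Inv ?V ?\<eta> \<cdot>\<^sub>V u) = space 1" "Tgt ?V (Inv ?V ?\<eta> \<cdot>\<^sub>V u) = FOb H ?b"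
    using V.arr_cmp[of u "Inv ?V ?\<eta>"] V.src_cmp[of u "Inv ?V ?\<eta>"] V.tgt_cmp[of u "Inv ?V ?\<eta>"] u \<eta>a V.Inv_simps[OF \<eta>a(4)] by simp_all
  have w: "w \<in> Ar ?V" "Src ?V w = space 1" "Tgt ?V w = FOb H ?W"
    unfolding w_def using V.arr_cmp[OF v(1) s'(1)] V.src_cmp[OF v(1) s'(1)] V.tgt_cmp[OF v(1) s'(1)] v s' by (simp_all del: Mod_simps)
  have Hw: "FAr H e \<cdot>\<^sub>V w = Inv ?V ?\<eta> \<cdot>\<^sub>V u"
    unfolding w_def using V.rewrite_pair[OF s'(4) v(1) s'(1) He(1)] V.idn_cmp[OF v(1)] v s' He by (simp del: Mod_simps)
  have \<eta>Hw: "?\<eta> \<cdot>\<^sub>V (FAr H e \<cdot>\<^sub>V w) = u"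
    unfolding Hw using V.rewrite_pair[OF V.Inv_simps(5)[OF \<eta>a(4)] u(1) _ \<eta>a(1)] V.Inv_simps[OF \<eta>a(4)] V.idn_cmp[OF u(1)] u \<eta>a by (simp del: Mod_simps)
  \<comment> \<open>the identification of \<open>U\<close> with \<open>k \<otimes> U\<close>; these modules have the same dimension and act by the same matrices, but are different objects\<close>
  define \<sigma>0 where "\<sigma>0 = (U, 1\<^sub>m (fst U) :: 'k mat, tensor_module U (space 1))"
  have \<sigma>0: "\<sigma>0 \<in> Ar ?M" "Src ?M \<sigma>0 = U" "Tgt ?M \<sigma>0 = tensor_module U (space 1)"
  proof -
    show "Src ?M \<sigma>0 = U" "Tgt ?M \<sigma>0 = tensor_module U (space 1)" by (simp_all add: \<sigma>0_def)
    have act: "snd (tensor_module U (space 1)) r x = snd U r x"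
      if "r \<in> carrier_vec (adim R)" "x \<in> carrier_vec (fst U)" for r x
      using that act_mat_mult[OF U that] kron_one_one[of "act_mat U r"] by (simp add: tensor_module_def)
    show "\<sigma>0 \<in> Ar ?M"
      using U tensor_module[OF U R] act fd_module_act[OF U] by (simp add: \<sigma>0_def Mod_Ar fd_module_hom_def)
  qed
  have \<epsilon>W: "\<epsilon> ?W \<in> Ar ?M" "Src ?M (\<epsilon> ?W) = tensor_module U (FOb H ?W)" "Tgt ?M (\<epsilon> ?W) = FOb \<Phi> ?W"
    using \<epsilon> W unfolding nat_trans_def by (simp_all add: Hom_def comp_ftr_def)
  have \<epsilon>e: "\<epsilon> ?b \<cdot>\<^sub>R FAr ?t (FAr H e) = FAr \<Phi> e \<cdot>\<^sub>R \<epsilon> ?W"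
  proof -
    have "e \<in> Hom T ?W ?b" using ea e(2) by (simp add: Hom_def)
    then show ?thesis using \<epsilon> unfolding nat_trans_def by (simp add: comp_ftr_def del: Mod_simps tensor_with_simps)
  qed
  have \<epsilon>b: "\<epsilon> ?b = eval_arr Z1 Z2 \<cdot>\<^sub>R FAr ?t ?\<eta>" using \<epsilon>bx[OF ZZ] by (simp add: \<tau>_def)
  have tw: "FAr ?t w \<in> Ar ?M" "Src ?M (FAr ?t w) = tensor_module U (space 1)" "Tgt ?M (FAr ?t w) = tensor_module U (FOb H ?W)"
    using TW(2-4)[OF w(1)] w by simp_all
  have tH: "FAr ?t (FAr H e) \<in> Ar ?M" "Src ?M (FAr ?t (FAr H e)) = tensor_module U (FOb H ?W)" "Tgt ?M (FAr ?t (FAr H e)) = tensor_module U (FOb H ?b)"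
    using TW(2-4)[OF He(1)] He by simp_all
  have t\<eta>: "FAr ?t ?\<eta> \<in> Ar ?M" "Src ?M (FAr ?t ?\<eta>) = tensor_module U (FOb H ?b)" "Tgt ?M (FAr ?t ?\<eta>) = tensor_module U (space ?n)"
    using TW(2-4)[OF \<eta>a(1)] \<eta>a by simp_all
  have ev: "eval_arr Z1 Z2 \<in> Ar ?M" "Src ?M (eval_arr Z1 Z2) = tensor_module U (space ?n)" "Tgt ?M (eval_arr Z1 Z2) = FOb \<Phi> ?b"
    using eval_arr[OF ZZ] by (simp_all add: eval_arr_def)
  have \<Phi>e: "FAr \<Phi> e \<in> Ar ?M" "Src ?M (FAr \<Phi> e) = FOb \<Phi> ?W" "Tgt ?M (FAr \<Phi> e) = FOb \<Phi> ?b"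
    using F(2-4)[OF ea] e(2) by simp_all
  define \<sigma> where "\<sigma> = \<epsilon> ?W \<cdot>\<^sub>R (FAr ?t w \<cdot>\<^sub>R \<sigma>0)"
  note types = \<sigma>0 \<epsilon>W tw tH t\<eta> ev \<Phi>e
  have \<sigma>: "\<sigma> \<in> Ar ?M" "Src ?M \<sigma> = U" "Tgt ?M \<sigma> = FOb \<Phi> ?W"
    unfolding \<sigma>_def using types by (simp_all del: Mod_simps tensor_with_simps)
  have tu: "FAr ?t ?\<eta> \<cdot>\<^sub>R (FAr ?t (FAr H e) \<cdot>\<^sub>R FAr ?t w) = FAr ?t u"
  proof -
    have "FAr ?t (FAr H e) \<cdot>\<^sub>R FAr ?t w = FAr ?t (FAr H e \<cdot>\<^sub>V w)"
      by (rule TW(6)[OF w(1) He(1), symmetric]) (use w He in \<open>simp del: Mod_simps\<close>)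
    also have "FAr ?t ?\<eta> \<cdot>\<^sub>R \<dots> = FAr ?t (?\<eta> \<cdot>\<^sub>V (FAr H e \<cdot>\<^sub>V w))"
      by (rule TW(6)[symmetric]) (use w He \<eta>a in \<open>simp_all del: Mod_simps\<close>)
    finally show ?thesis unfolding \<eta>Hw .
  qed
  have "FAr \<Phi> e \<cdot>\<^sub>R \<sigma> = (FAr \<Phi> e \<cdot>\<^sub>R \<epsilon> ?W) \<cdot>\<^sub>R (FAr ?t w \<cdot>\<^sub>R \<sigma>0)"
    unfolding \<sigma>_def using types by (simp del: Mod_simps tensor_with_simps)
  also have "\<dots> = (eval_arr Z1 Z2 \<cdot>\<^sub>R (FAr ?t ?\<eta> \<cdot>\<^sub>R (FAr ?t (FAr H e) \<cdot>\<^sub>R FAr ?t w))) \<cdot>\<^sub>R \<sigma>0"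
    unfolding \<epsilon>e[symmetric] \<epsilon>b using types by (simp del: Mod_simps tensor_with_simps)
  also have "\<dots> = (eval_arr Z1 Z2 \<cdot>\<^sub>R FAr ?t u) \<cdot>\<^sub>R \<sigma>0" unfolding tu ..
  also have "\<dots> = Idn ?M U"
  proof -
    have "eval_mat Z1 Z2 * pure (\<theta>1 Z1 (Idn C Z1)) (\<theta>2 Z2 (Idn D Z2)) = val (Idn C Z1) (Idn D Z2)"
      by (rule eval_mat_pure) (use ZZ in auto)
    also have "\<dots> = 1\<^sub>m (fst U)" using F(5)[OF b] bx_idn[OF ZZ] by (simp add: val_def U_def)
    finally show ?thesis by (simp add: \<sigma>0_def eval_arr_def u_def U_def[symmetric])
  qed
  finally have e\<sigma>: "FAr \<Phi> e \<cdot>\<^sub>R \<sigma> = Idn ?M (FOb \<Phi> ?b)" by (simp add: U_def)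
  obtain s0 where s0: "s0 \<in> Ar T" "Src T s0 = ?b" "Tgt T s0 = ?W" "FAr \<Phi> s0 = \<sigma>"
    using full[OF b W \<sigma>(1)] \<sigma> by (auto simp: U_def simp del: Mod_simps)
  have "FAr \<Phi> (e \<cdot>\<^bsub>T\<^esub> s0) = FAr \<Phi> e \<cdot>\<^sub>R FAr \<Phi> s0" by (rule F(6)) (use s0 ea in auto)
  also have "\<dots> = FAr \<Phi> (Idn T ?b)" unfolding s0(4) e\<sigma> by (rule F(5)[OF b, symmetric])
  finally have "FAr \<Phi> (e \<cdot>\<^bsub>T\<^esub> s0) = FAr \<Phi> (Idn T ?b)" .
  then have "e \<cdot>\<^bsub>T\<^esub> s0 = Idn T ?b" by (rule faithful[rotated -1]) (use s0 ea e(2) b in auto)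
  then show ?thesis using s0 e(2) by (auto simp: Hom_def)
qed

end

section \<open>Right exact endofunctors of a semisimple category\<close>

abbreviation ntr :: "'a \<times> ('o \<Rightarrow> 'm) \<times> 'b \<Rightarrow> 'o \<Rightarrow> 'm" where "ntr \<alpha> \<equiv> fst (snd \<alpha>)"

lemma End_simps [simp]:
  "Ob (End_cat M) = {F. right_exact_functor M M F}"
  "Src (End_cat M) \<alpha> = fst \<alpha>" "Tgt (End_cat M) \<alpha> = snd (snd \<alpha>)"
  "Idn (End_cat M) F = (F, \<lambda>X\<in>Ob M. Idn M (FOb F X), F)"
  "\<beta> \<cdot>\<^bsub>End_cat M\<^esub> \<alpha> = (fst \<alpha>, \<lambda>X\<in>Ob M. ntr \<beta> X \<cdot>\<^bsub>M\<^esub> ntr \<alpha> X, snd (snd \<beta>))"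
  "Add (End_cat M) \<alpha> \<beta> = (fst \<alpha>, \<lambda>X\<in>Ob M. Add M (ntr \<alpha> X) (ntr \<beta> X), snd (snd \<alpha>))"
  "Zero (End_cat M) F G = (F, \<lambda>X\<in>Ob M. Zero M (FOb F X) (FOb G X), G)"
  "Scale (End_cat M) c \<alpha> = (fst \<alpha>, \<lambda>X\<in>Ob M. Scale M c (ntr \<alpha> X), snd (snd \<alpha>))"
  by (auto simp: End_cat_def split: prod.splits)

lemma End_Ar: "\<alpha> \<in> Ar (End_cat M) \<longleftrightarrow> right_exact_functor M M (fst \<alpha>) \<and> right_exact_functor M M (snd (snd \<alpha>)) \<and>
    nat_trans M M (fst \<alpha>) (snd (snd \<alpha>)) (ntr \<alpha>) \<and> ntr \<alpha> \<in> extensional (Ob M)"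
  by (auto simp: End_cat_def split: prod.splits)

lemma nat_transD:
  assumes "nat_trans C D F G \<eta>"
  shows "X \<in> Ob C \<Longrightarrow> \<eta> X \<in> Ar D" "X \<in> Ob C \<Longrightarrow> Src D (\<eta> X) = FOb F X" "X \<in> Ob C \<Longrightarrow> Tgt D (\<eta> X) = FOb G X"
    "f \<in> Ar C \<Longrightarrow> \<eta> (Tgt C f) \<cdot>\<^bsub>D\<^esub> FAr F f = FAr G f \<cdot>\<^bsub>D\<^esub> \<eta> (Src C f)"
  using assms unfolding nat_trans_def Hom_def by auto

lemma nat_transI:
  assumes "\<And>X. X \<in> Ob C \<Longrightarrow> \<eta> X \<in> Ar D \<and> Src D (\<eta> X) = FOb F X \<and> Tgt D (\<eta> X) = FOb G X"
    and "\<And>f. f \<in> Ar C \<Longrightarrow> \<eta> (Tgt C f) \<cdot>\<^bsub>D\<^esub> FAr F f = FAr G f \<cdot>\<^bsub>D\<^esub> \<eta> (Src C f)"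
  shows "nat_trans C D F G \<eta>"
  using assms unfolding nat_trans_def Hom_def by auto

lemma right_exact_functor_linear: "right_exact_functor C D F \<Longrightarrow> linear_functor C D F"
  by (simp add: right_exact_functor_def)

lemma End_linear_category: assumes "linear_category M" shows "linear_category (End_cat M)"
proof -
  interpret M: linear_category M by fact
  let ?E = "End_cat M"
  have eqI: "\<alpha> = \<beta>" if "\<alpha> \<in> Ar ?E" "\<beta> \<in> Ar ?E" "fst \<alpha> = fst \<beta>" "snd (snd \<alpha>) = snd (snd \<beta>)"
    "\<And>X. X \<in> Ob M \<Longrightarrow> ntr \<alpha> X = ntr \<beta> X" for \<alpha> \<beta> :: "('a, 'b) endo_arrow"
    using that extensionalityI[of "ntr \<alpha>" "Ob M" "ntr \<beta>"] by (auto simp: End_Ar prod_eq_iff)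
  have lin: "linear_functor M M F" if "right_exact_functor M M F" for F :: "('a, 'b) endo"
    using that by (rule right_exact_functor_linear)
  note fct = functorD[OF linear_functorD(1)[OF lin]]
  have nt: "ntr \<alpha> X \<in> Ar M" "Src M (ntr \<alpha> X) = FOb (fst \<alpha>) X" "Tgt M (ntr \<alpha> X) = FOb (snd (snd \<alpha>)) X"
    if "\<alpha> \<in> Ar ?E" "X \<in> Ob M" for \<alpha> :: "('a, 'b) endo_arrow" and X
    using that nat_transD[of M M "fst \<alpha>" "snd (snd \<alpha>)" "ntr \<alpha>"] by (auto simp: End_Ar)
  have nt_tuple: "h X \<in> Ar M" "Src M (h X) = FOb F X" "Tgt M (h X) = FOb G X"
    if "(F, h, G) \<in> Ar ?E" "X \<in> Ob M" for F G :: "('a, 'b) endo" and h X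
    using nt[OF that] by auto
  have nat: "ntr \<alpha> (Tgt M f) \<cdot>\<^bsub>M\<^esub> FAr (fst \<alpha>) f = FAr (snd (snd \<alpha>)) f \<cdot>\<^bsub>M\<^esub> ntr \<alpha> (Src M f)"
    if "\<alpha> \<in> Ar ?E" "f \<in> Ar M" for \<alpha> :: "('a, 'b) endo_arrow" and f
    using that nat_transD[of M M "fst \<alpha>" "snd (snd \<alpha>)" "ntr \<alpha>"] by (auto simp: End_Ar)
  have re: "right_exact_functor M M (fst \<alpha>)" "right_exact_functor M M (snd (snd \<alpha>))" if "\<alpha> \<in> Ar ?E" for \<alpha> :: "('a, 'b) endo_arrow"
    using that by (auto simp: End_Ar)
  have idn: "Idn ?E F \<in> Ar ?E" if "right_exact_functor M M F" for F
    using that by (auto simp: End_Ar fct intro!: nat_transI)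
  have cmp: "\<beta> \<cdot>\<^bsub>?E\<^esub> \<alpha> \<in> Ar ?E" if a: "\<alpha> \<in> Ar ?E" "\<beta> \<in> Ar ?E" "fst \<beta> = snd (snd \<alpha>)" for \<alpha> \<beta>
  proof -
    have "nat_trans M M (fst \<alpha>) (snd (snd \<beta>)) (\<lambda>X\<in>Ob M. ntr \<beta> X \<cdot>\<^bsub>M\<^esub> ntr \<alpha> X)"
    proof (rule nat_transI)
      fix f assume f: "f \<in> Ar M"
      note [simp] = nt[OF a(1)] nt[OF a(2)] fct[OF re(1)[OF a(1)]] fct[OF re(2)[OF a(1)]] fct[OF re(2)[OF a(2)]] a(3) f
      have "(ntr \<beta> (Tgt M f) \<cdot>\<^bsub>M\<^esub> ntr \<alpha> (Tgt M f)) \<cdot>\<^bsub>M\<^esub> FAr (fst \<alpha>) f = ntr \<beta> (Tgt M f) \<cdot>\<^bsub>M\<^esub> (FAr (snd (snd \<alpha>)) f \<cdot>\<^bsub>M\<^esub> ntr \<alpha> (Src M f))"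
        using nat[OF a(1) f] by simp
      also have "\<dots> = (ntr \<beta> (Tgt M f) \<cdot>\<^bsub>M\<^esub> FAr (fst \<beta>) f) \<cdot>\<^bsub>M\<^esub> ntr \<alpha> (Src M f)" by simp
      also have "\<dots> = FAr (snd (snd \<beta>)) f \<cdot>\<^bsub>M\<^esub> (ntr \<beta> (Src M f) \<cdot>\<^bsub>M\<^esub> ntr \<alpha> (Src M f))" unfolding nat[OF a(2) f] by simp
      finally show "(\<lambda>X\<in>Ob M. ntr \<beta> X \<cdot>\<^bsub>M\<^esub> ntr \<alpha> X) (Tgt M f) \<cdot>\<^bsub>M\<^esub> FAr (fst \<alpha>) f = FAr (snd (snd \<beta>)) f \<cdot>\<^bsub>M\<^esub> (\<lambda>X\<in>Ob M. ntr \<beta> X \<cdot>\<^bsub>M\<^esub> ntr \<alpha> X) (Src M f)"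
        by simp
    qed (use a nt in auto)
    then show ?thesis using re a by (simp add: End_Ar)
  qed
  have zero: "Zero ?E F G \<in> Ar ?E" if "right_exact_functor M M F" "right_exact_functor M M G" for F G
    using that by (auto simp: End_Ar fct intro!: nat_transI)
  have add: "Add ?E \<alpha> \<beta> \<in> Ar ?E" if "\<alpha> \<in> Ar ?E" "\<beta> \<in> Ar ?E" "fst \<beta> = fst \<alpha>" "snd (snd \<beta>) = snd (snd \<alpha>)" for \<alpha> \<beta>
    using that by (auto simp: End_Ar[of "(_, _)"] re nt fct[OF re(1)[OF that(1)]] fct[OF re(2)[OF that(1)]] nat[OF that(1)] nat[OF that(2), unfolded that(3,4)] intro!: nat_transI)
  have scale: "Scale ?E c \<alpha> \<in> Ar ?E" if "\<alpha> \<in> Ar ?E" for c \<alpha>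
    using that by (auto simp: End_Ar[of "(_, _)"] re nt fct[OF re(1)[OF that]] fct[OF re(2)[OF that]] nat intro!: nat_transI)
  have ext: "(\<lambda>X\<in>Ob M. h X) = ntr \<alpha>" if "\<alpha> \<in> Ar ?E" "\<And>X. X \<in> Ob M \<Longrightarrow> h X = ntr \<alpha> X" for \<alpha> h
    using that by (intro extensionalityI[of _ "Ob M"]) (auto simp: End_Ar)
  have idl: "Idn ?E (snd (snd \<alpha>)) \<cdot>\<^bsub>?E\<^esub> \<alpha> = \<alpha>" "\<alpha> \<cdot>\<^bsub>?E\<^esub> Idn ?E (fst \<alpha>) = \<alpha>" "Scale ?E 1 \<alpha> = \<alpha>"
    "Add ?E \<alpha> (Zero ?E (fst \<alpha>) (snd (snd \<alpha>))) = \<alpha>" if a: "\<alpha> \<in> Ar ?E" for \<alpha>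
    using a by (auto simp: prod_eq_iff nt intro!: ext[OF a])
  show ?thesis
  proof
    show "f \<in> Hom ?E X Y \<Longrightarrow> Idn ?E Y \<cdot>\<^bsub>?E\<^esub> f = f" "f \<in> Hom ?E X Y \<Longrightarrow> f \<cdot>\<^bsub>?E\<^esub> Idn ?E X = f"
      "f \<in> Hom ?E X Y \<Longrightarrow> Scale ?E 1 f = f" "f \<in> Hom ?E X Y \<Longrightarrow> Add ?E f (Zero ?E X Y) = f" for f X Y
      using idl[of f] by (auto simp: Hom_def)
    show "f \<in> Hom ?E X Y \<Longrightarrow> g \<in> Hom ?E Y Z \<Longrightarrow> g \<cdot>\<^bsub>?E\<^esub> f \<in> Hom ?E X Z" for f g X Y Z
      using cmp[of f g] by (simp add: Hom_def)
    show "f \<in> Hom ?E X Y \<Longrightarrow> g \<in> Hom ?E X Y \<Longrightarrow> Add ?E f g \<in> Hom ?E X Y" for f g X Y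
      using add[of f g] by (simp add: Hom_def)
    show "f \<in> Hom ?E X Y \<Longrightarrow> Scale ?E c f \<in> Hom ?E X Y" for c f X Y
      using scale[of f] by (simp add: Hom_def)
    show "X \<in> Ob ?E \<Longrightarrow> Idn ?E X \<in> Hom ?E X X" for X
      using idn[of X] by (simp add: Hom_def)
    show "X \<in> Ob ?E \<Longrightarrow> Y \<in> Ob ?E \<Longrightarrow> Zero ?E X Y \<in> Hom ?E X Y" for X Y
      using zero[of X Y] by (simp add: Hom_def)
    show "f \<in> Hom ?E X Y \<Longrightarrow> g \<in> Hom ?E X Y \<Longrightarrow> Add ?E f g = Add ?E g f" for f g X Y
      by (auto simp: Hom_def nt intro!: restrict_ext M.add_commute)
    show "f \<in> Hom ?E X Y \<Longrightarrow> g \<in> Hom ?E X Y \<Longrightarrow> h \<in> Hom ?E X Y \<Longrightarrow> Add ?E (Add ?E f g) h = Add ?E f (Add ?E g h)" for f g h X Y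
      by (auto simp: Hom_def nt intro!: restrict_ext M.add_assoc)
    show "f \<in> Hom ?E X Y \<Longrightarrow> Add ?E f (Scale ?E (-1) f) = Zero ?E X Y" for f X Y
      by (auto simp: Hom_def nt intro!: restrict_ext M.add_minus)
    show "f \<in> Hom ?E X Y \<Longrightarrow> g \<in> Hom ?E X Y \<Longrightarrow> Scale ?E c (Add ?E f g) = Add ?E (Scale ?E c f) (Scale ?E c g)" for c f g X Y
      by (auto simp: Hom_def nt intro!: restrict_ext M.scale_add_right)
    show "f \<in> Hom ?E X Y \<Longrightarrow> Scale ?E (c + d) f = Add ?E (Scale ?E c f) (Scale ?E d f)" for c d f X Y
      by (auto simp: Hom_def nt intro!: restrict_ext M.scale_add_left)
  qed (auto simp: Hom_def nt nt_tuple re intro!: restrict_ext)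
qed

lemma (in abelian_category) simple_arrow_iso:
  assumes S: "is_simple C S" "is_simple C S'" and f: "f \<in> Ar C" "Src C f = S" "Tgt C f = S'" "f \<noteq> Zero C S S'"
  shows "is_iso C f"
proof -
  obtain k where k: "is_kernel C f k" using has_kernels[OF f(1)] by blast
  note kk = kernelD(1-5)[OF k]
  have "is_zero_object C (Src C k)"
  proof (rule ccontr)
    assume "\<not> is_zero_object C (Src C k)"
    then have i: "is_iso C k" using S(1) kk f unfolding is_simple_def by blast
    have "f = Zero C (Src C f) (Tgt C f)"
      by (rule epi_zeroD[OF iso_is_epi[OF i], of f, unfolded kk(3)]) (use kk f in auto)
    then show False using f by simp
  qed
  then have z: "k = Zero C (Src C k) (Tgt C k)" using zero_object_arr kk(2) by blast
  have "is_mono C f"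
  proof (rule monoI_zero[OF f(1)])
    fix g assume g: "g \<in> Ar C" "Tgt C g = Src C f" "f \<cdot> g = Zero C (Src C g) (Tgt C f)"
    obtain u where u: "u \<in> Ar C" "Src C u = Src C g" "Tgt C u = Src C k" "k \<cdot> u = g" using kernelD(6)[OF k g] by blast
    have "Zero C (Src C k) (Tgt C k) \<cdot> u = Zero C (Src C g) (Src C f)"
      using u(1-3) kk(2,3) f(1) by simp
    then show "g = Zero C (Src C g) (Src C f)" using u(4) z by metis
  qed
  then have "is_zero_object C S \<or> is_iso C f" using S(2) f unfolding is_simple_def by blast
  then show ?thesis using S(1) by (simp add: is_simple_def)
qed

lemma (in finite_abelian) zero_object_dimension: assumes "X \<in> Ob C" "dimension X = 0" shows "is_zero_object C X"
proof (rule zero_objectI[OF assms(1)])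
  show "Idn C X = Zero C X X"
  proof (rule marr_eqD)
    show "marr (FAr F (Idn C X)) = marr (FAr F (Zero C X X))"
      using marr_F[of "Idn C X"] marr_F[of "Zero C X X"] assms by (intro eq_matI) auto
  qed (use assms in auto)
qed

locale finite_semisimple = finite_abelian C R F
  for C :: "('o, 'm, 'k::alg_closed_field) lcat" (structure) and R F +
  assumes split: "epis_split C" and R: "fd_algebra R"
begin

lemma schur:
  assumes S: "is_simple C S" and f: "f \<in> Ar C" "Src C f = S" "Tgt C f = S"
  obtains c where "f = Scale C c (Idn C S)"
proof -
  let ?d = "dimension S" and ?A = "marr (FAr F f)"
  have So: "S \<in> Ob C" using S by (simp add: is_simple_def)
  have A: "?A \<in> carrier_mat ?d ?d" using marr_F[OF f(1)] f by simp
  have "?d \<noteq> 0" using zero_object_dimension[OF So] S by (auto simp: is_simple_def)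
  then have "degree (char_poly ?A) > 0" using degree_monic_char_poly[OF A] by simp
  then obtain c where "poly (char_poly ?A) c = 0" using alg_closed_imp_poly_has_root by blast
  then have "eigenvalue ?A c" using eigenvalue_root_char_poly[OF A] by simp
  then obtain v where v: "v \<in> carrier_vec ?d" "v \<noteq> 0\<^sub>v ?d" "?A *\<^sub>v v = c \<cdot>\<^sub>v v"
    using A by (auto simp: eigenvalue_def eigenvector_def)
  let ?g = "Sub C f (Scale C c (Idn C S))"
  have g: "?g \<in> Ar C" "Src C ?g = S" "Tgt C ?g = S" using f So by auto
  have mg: "marr (FAr F ?g) = ?A + (- 1 * c) \<cdot>\<^sub>m 1\<^sub>m ?d"
    using f So marr_idn[OF So] unfolding Sub_def
    by (simp add: linear_functorD(2)[OF linear] linear_functorD(3)[OF linear])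
  have "?g = Zero C S S"
  proof (rule ccontr)
    assume "?g \<noteq> Zero C S S"
    then have iso: "is_iso C ?g" using simple_arrow_iso[OF S S g] by blast
    let ?h = "Inv C ?g"
    have inv: "marr (FAr F ?h) * marr (FAr F ?g) = 1\<^sub>m ?d"
      using marr_cmp[of ?g ?h] Inv_simps[OF iso] g marr_idn[OF So] by simp
    have h: "marr (FAr F ?h) \<in> carrier_mat ?d ?d" "marr (FAr F ?g) \<in> carrier_mat ?d ?d"
      using marr_F[of ?h] marr_F[of ?g] Inv_simps[OF iso] g by simp_all
    have "v = marr (FAr F ?h) *\<^sub>v (marr (FAr F ?g) *\<^sub>v v)"
      unfolding assoc_mult_mat_vec[OF h v(1), symmetric] inv using v(1) by simp
    also have "marr (FAr F ?g) *\<^sub>v v = 0\<^sub>v ?d"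
      unfolding mg using v A by (simp add: add_mult_distrib_mat_vec[of _ ?d ?d] smult_mat_mult_vec[of _ ?d ?d]) (intro eq_vecI, auto)
    also have "marr (FAr F ?h) *\<^sub>v 0\<^sub>v ?d = 0\<^sub>v ?d" using h by (intro eq_vecI) auto
    finally show False using v by simp
  qed
  then have "Sub C f (Scale C c (Idn C S)) = Zero C (Src C f) (Tgt C f)" unfolding f .
  then have "f = Scale C c (Idn C S)" by (rule sub_eq_zeroD[rotated -1]) (use f So in auto)
  then show ?thesis by (rule that)
qed

lemma simple_decomposition:
  assumes "X \<in> Ob C"
  obtains n S i p where "\<And>j. j < n \<Longrightarrow> is_simple C (S j)" "is_direct_sum C n S X i p"
  using split_semisimple[OF epis_split_monos_split[OF split]] assms unfolding semisimple_category_def by blast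

lemma linear_functor_arrow_sum:
  assumes Y: "linear_functor C C Y" and X: "X \<in> Ob C" "X' \<in> Ob C" and g: "\<And>j. j < n \<Longrightarrow> g j \<in> Hom C X X'"
  shows "FAr Y (arrow_sum C X X' g n) = arrow_sum C (FOb Y X) (FOb Y X') (\<lambda>j. FAr Y (g j)) n"
  using g
proof (induct n)
  case 0
  then show ?case using linear_functor_zero[OF linear_category_axioms linear_category_axioms Y X] by simp
next
  case (Suc n)
  have "arrow_sum C X X' g n \<in> Hom C X X'" using Suc X by (intro arrow_sum_Hom) auto
  then show ?case using Suc(1) Suc(2)[of n] Suc(2) linear_functorD(2)[OF Y, of "arrow_sum C X X' g n" "g n"] by (auto simp: Hom_def)
qed

text \<open>
  The injections of a decomposition of \<open>X\<close> into simple objects are jointly epi, and a linear functor \<open>Y\<close> preserves the equation that expresses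
  this.
\<close>

lemma simples_jointly_epi:
  assumes Y: "linear_functor C C Y" and X: "X \<in> Ob C"
    and a: "a \<in> Ar C" "Src C a = FOb Y X" and b: "b \<in> Ar C" "Src C b = FOb Y X" "Tgt C b = Tgt C a"
    and eq: "\<And>g. g \<in> Ar C \<Longrightarrow> is_simple C (Src C g) \<Longrightarrow> Tgt C g = X \<Longrightarrow> a \<cdot> FAr Y g = b \<cdot> FAr Y g"
  shows "a = b"
proof -
  note Y' [simp] = functorD[OF linear_functorD(1)[OF Y]]
  obtain n S i p where S: "\<And>j. j < n \<Longrightarrow> is_simple C (S j)" and sum: "is_direct_sum C n S X i p"
    using simple_decomposition[OF X] by blast
  note d [simp] = direct_sumD[OF sum]
  have dec: "FAr Y (Idn C X) = arrow_sum C (FOb Y X) (FOb Y X) (\<lambda>j. FAr Y (i j \<cdot> p j)) n"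
    using linear_functor_arrow_sum[OF Y X X, of n "\<lambda>j. i j \<cdot> p j"] sum by (simp add: is_direct_sum_def Hom_def)
  have *: "c = arrow_sum C (FOb Y X) (Tgt C c) (\<lambda>j. (c \<cdot> FAr Y (i j)) \<cdot> FAr Y (p j)) n" if c: "c \<in> Ar C" "Src C c = FOb Y X" for c
  proof -
    have "c = c \<cdot> FAr Y (Idn C X)" using c X by simp
    also have "\<dots> = arrow_sum C (FOb Y X) (Tgt C c) (\<lambda>j. c \<cdot> FAr Y (i j \<cdot> p j)) n"
      unfolding dec using c X by (intro cmp_arrow_sum) (auto simp: Hom_def)
    also have "\<dots> = arrow_sum C (FOb Y X) (Tgt C c) (\<lambda>j. (c \<cdot> FAr Y (i j)) \<cdot> FAr Y (p j)) n"
      using c by (intro arrow_sum_cong) simp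
    finally show ?thesis .
  qed
  have "arrow_sum C (FOb Y X) (Tgt C a) (\<lambda>j. (a \<cdot> FAr Y (i j)) \<cdot> FAr Y (p j)) n =
      arrow_sum C (FOb Y X) (Tgt C a) (\<lambda>j. (b \<cdot> FAr Y (i j)) \<cdot> FAr Y (p j)) n"
    using eq S by (intro arrow_sum_cong) simp
  then show ?thesis using *[OF a] *[OF b(1,2)] b(3) by simp
qed

text \<open>
  The value at \<open>X\<close> is \<open>\<Sum>\<^sub>j Y'(i\<^sub>j) b(S\<^sub>j) Y(p\<^sub>j)\<close> for a decomposition of \<open>X\<close> into simple objects \<open>S\<^sub>j\<close>. It is
  characterised by its composites with the arrows \<open>Y(g)\<close> for \<open>g\<close> from a simple object to \<open>X\<close>, and the naturality in
  \<open>X\<close> follows from this without a second decomposition.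
\<close>

lemma extend_from_simples:
  assumes Y: "linear_functor C C Y" and Y': "linear_functor C C Y'"
    and b: "\<And>s. is_simple C s \<Longrightarrow> b s \<in> Ar C \<and> Src C (b s) = FOb Y s \<and> Tgt C (b s) = FOb Y' s"
    and nat: "\<And>f. f \<in> Ar C \<Longrightarrow> is_simple C (Src C f) \<Longrightarrow> is_simple C (Tgt C f) \<Longrightarrow> b (Tgt C f) \<cdot> FAr Y f = FAr Y' f \<cdot> b (Src C f)"
  obtains \<beta> where "nat_trans C C Y Y' \<beta>"
    "\<And>g. g \<in> Ar C \<Longrightarrow> is_simple C (Src C g) \<Longrightarrow> \<beta> (Tgt C g) \<cdot> FAr Y g = FAr Y' g \<cdot> b (Src C g)"
proof -
  note Yf [simp] = functorD[OF linear_functorD(1)[OF Y]] and Yf' [simp] = functorD[OF linear_functorD(1)[OF Y']]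
  have "\<exists>c. c \<in> Ar C \<and> Src C c = FOb Y X \<and> Tgt C c = FOb Y' X \<and>
      (\<forall>g. g \<in> Ar C \<and> is_simple C (Src C g) \<and> Tgt C g = X \<longrightarrow> c \<cdot> FAr Y g = FAr Y' g \<cdot> b (Src C g))" if X: "X \<in> Ob C" for X
  proof -
    obtain n S i p where S: "\<And>j. j < n \<Longrightarrow> is_simple C (S j)" and sum: "is_direct_sum C n S X i p"
      using simple_decomposition[OF X] by blast
    note d [simp] = direct_sumD[OF sum]
    let ?t = "\<lambda>j. FAr Y' (i j) \<cdot> (b (S j) \<cdot> FAr Y (p j))"
    let ?c = "arrow_sum C (FOb Y X) (FOb Y' X) ?t n"
    have t: "?t j \<in> Hom C (FOb Y X) (FOb Y' X)" if "j < n" for j using b[OF S[OF that]] that by (simp add: Hom_def)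
    have c: "?c \<in> Hom C (FOb Y X) (FOb Y' X)" using t X by (intro arrow_sum_Hom) auto
    have "?c \<cdot> FAr Y g = FAr Y' g \<cdot> b (Src C g)" if g: "g \<in> Ar C" "is_simple C (Src C g)" "Tgt C g = X" for g
    proof -
      note bg = b[OF g(2)]
      have "?c \<cdot> FAr Y g = arrow_sum C (FOb Y (Src C g)) (FOb Y' X) (\<lambda>j. ?t j \<cdot> FAr Y g) n"
        using t X g by (subst arrow_sum_cmp[of "FOb Y' X" "FAr Y g" "FOb Y X"]) auto
      also have "\<dots> = arrow_sum C (FOb Y (Src C g)) (FOb Y' X) (\<lambda>j. FAr Y' ((i j \<cdot> p j) \<cdot> g) \<cdot> b (Src C g)) n"
      proof (rule arrow_sum_cong)
        fix j assume j: "j < n"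
        note bj = b[OF S[OF j]]
        have pg: "p j \<cdot> g \<in> Ar C" "Src C (p j \<cdot> g) = Src C g" "Tgt C (p j \<cdot> g) = S j" using j g by auto
        have "?t j \<cdot> FAr Y g = FAr Y' (i j) \<cdot> (b (S j) \<cdot> FAr Y (p j \<cdot> g))" using bj j g by simp
        also have "b (S j) \<cdot> FAr Y (p j \<cdot> g) = FAr Y' (p j \<cdot> g) \<cdot> b (Src C g)"
          using nat[OF pg(1)] pg(2,3) S[OF j] g by simp
        finally show "?t j \<cdot> FAr Y g = FAr Y' ((i j \<cdot> p j) \<cdot> g) \<cdot> b (Src C g)" using j g bg by simp
      qed
      also have "\<dots> = arrow_sum C (FOb Y' (Src C g)) (FOb Y' X) (\<lambda>j. FAr Y' ((i j \<cdot> p j) \<cdot> g)) n \<cdot> b (Src C g)"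
        using bg X g by (subst arrow_sum_cmp[of "FOb Y' X" "b (Src C g)" "FOb Y' (Src C g)"]) (auto simp: Hom_def)
      also have "arrow_sum C (FOb Y' (Src C g)) (FOb Y' X) (\<lambda>j. FAr Y' ((i j \<cdot> p j) \<cdot> g)) n =
          FAr Y' (arrow_sum C (Src C g) X (\<lambda>j. (i j \<cdot> p j) \<cdot> g) n)"
        using X g by (subst linear_functor_arrow_sum[OF Y']) (auto simp: Hom_def)
      also have "arrow_sum C (Src C g) X (\<lambda>j. (i j \<cdot> p j) \<cdot> g) n = arrow_sum C X X (\<lambda>j. i j \<cdot> p j) n \<cdot> g"
        using X g by (subst arrow_sum_cmp[of X g X]) (auto simp: Hom_def)
      also have "\<dots> = g" using sum g by (simp add: is_direct_sum_def)
      finally show ?thesis .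
    qed
    then show ?thesis using c by (intro exI[of _ ?c]) (auto simp: Hom_def)
  qed
  then obtain \<beta> where \<beta>: "\<And>X. X \<in> Ob C \<Longrightarrow> \<beta> X \<in> Ar C \<and> Src C (\<beta> X) = FOb Y X \<and> Tgt C (\<beta> X) = FOb Y' X"
    and \<beta>s: "\<And>X g. X \<in> Ob C \<Longrightarrow> g \<in> Ar C \<Longrightarrow> is_simple C (Src C g) \<Longrightarrow> Tgt C g = X \<Longrightarrow> \<beta> X \<cdot> FAr Y g = FAr Y' g \<cdot> b (Src C g)"
    by metis
  have "nat_trans C C Y Y' \<beta>"
  proof (rule nat_transI)
    fix f assume f: "f \<in> Ar C"
    note bs = \<beta>[OF src_Ob[OF f]] \<beta>[OF tgt_Ob[OF f]]
    show "\<beta> (Tgt C f) \<cdot> FAr Y f = FAr Y' f \<cdot> \<beta> (Src C f)"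
    proof (rule simples_jointly_epi[OF Y src_Ob[OF f]])
      fix g assume g: "g \<in> Ar C" "is_simple C (Src C g)" "Tgt C g = Src C f"
      have fg: "f \<cdot> g \<in> Ar C" "Src C (f \<cdot> g) = Src C g" "Tgt C (f \<cdot> g) = Tgt C f" using f g by auto
      have "(\<beta> (Tgt C f) \<cdot> FAr Y f) \<cdot> FAr Y g = \<beta> (Tgt C f) \<cdot> FAr Y (f \<cdot> g)" using f g bs by simp
      also have "\<dots> = FAr Y' (f \<cdot> g) \<cdot> b (Src C g)" using \<beta>s[OF tgt_Ob[OF f] fg(1)] fg g by simp
      also have "\<dots> = FAr Y' f \<cdot> (FAr Y' g \<cdot> b (Src C g))" using f g b[OF g(2)] by simp
      also have "\<dots> = FAr Y' f \<cdot> (\<beta> (Src C f) \<cdot> FAr Y g)" using \<beta>s[OF src_Ob[OF f] g] by simp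
      finally show "(\<beta> (Tgt C f) \<cdot> FAr Y f) \<cdot> FAr Y g = (FAr Y' f \<cdot> \<beta> (Src C f)) \<cdot> FAr Y g" using f g bs by simp
    qed (use f bs in auto)
  qed (use \<beta> in auto)
  then show ?thesis using that[of \<beta>] \<beta>s by auto
qed

end

context finite_semisimple
begin

lemma regular: "regular_category C"
  by (rule split_regular[OF split])

text \<open>
  Choose generalised inverses \<open>b t\<close> of the components of \<open>\<alpha>\<close> at one representative \<open>t\<close> of each isomorphism class of simple objects, and
  carry them over to the other simple objects \<open>s\<close> along isomorphisms \<open>\<phi> s\<close>. By Schur's lemma, every nonzero arrow between simple
  objects of a class is a scalar multiple of a composite of these isomorphisms, so the resulting family is natural and extends to all objects.
\<close>

lemma End_regular: "regular_category (End_cat C)"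
  unfolding regular_category_def
proof
  fix \<alpha> assume \<alpha>: "\<alpha> \<in> Ar (End_cat C)"
  let ?Y = "fst \<alpha>" and ?Z = "snd (snd \<alpha>)"
  have Y: "linear_functor C C ?Y" and Z: "linear_functor C C ?Z" and nat: "nat_trans C C ?Y ?Z (ntr \<alpha>)"
    using \<alpha> by (auto simp: End_Ar right_exact_functor_def)
  note Yf [simp] = functorD[OF linear_functorD(1)[OF Y]] and Zf [simp] = functorD[OF linear_functorD(1)[OF Z]]
  note a [simp] = nat_transD(1-3)[OF nat] and a_nat = nat_transD(4)[OF nat]
  \<comment> \<open>representatives of the isomorphism classes of simple objects\<close>
  define iso_simple where "iso_simple s t \<longleftrightarrow> is_simple C t \<and> (\<exists>f. f \<in> Ar C \<and> Src C f = s \<and> Tgt C f = t \<and> is_iso C f)" for s t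
  define rep where "rep s = (SOME t. iso_simple s t)" for s
  have rep: "iso_simple s (rep s)" if "is_simple C s" for s
  proof -
    have s: "s \<in> Ob C" using that by (simp add: is_simple_def)
    have "iso_simple s s" unfolding iso_simple_def using that s iso_idn[OF s]
      by (intro conjI exI[of _ "Idn C s"]) auto
    then show ?thesis unfolding rep_def by (rule someI)
  qed
  then obtain \<phi> where \<phi>: "\<And>s. is_simple C s \<Longrightarrow> \<phi> s \<in> Ar C \<and> Src C (\<phi> s) = s \<and> Tgt C (\<phi> s) = rep s \<and> is_iso C (\<phi> s) \<and> is_simple C (rep s)"
    unfolding iso_simple_def by metis
  have rep_eq: "rep s = rep s'" if f: "f \<in> Ar C" "Src C f = s" "Tgt C f = s'" "is_iso C f" for f s s'
  proof -
    have "iso_simple s = iso_simple s'"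
    proof
      fix t
      have "\<exists>g. g \<in> Ar C \<and> Src C g = s' \<and> Tgt C g = t \<and> is_iso C g"
        if "g \<in> Ar C \<and> Src C g = s \<and> Tgt C g = t \<and> is_iso C g" for g
        using that f Inv_simps[OF f(4)] iso_Inv[OF f(4)] by (intro exI[of _ "g \<cdot> Inv C f"]) (auto intro: iso_cmp)
      moreover have "\<exists>g. g \<in> Ar C \<and> Src C g = s \<and> Tgt C g = t \<and> is_iso C g"
        if "g \<in> Ar C \<and> Src C g = s' \<and> Tgt C g = t \<and> is_iso C g" for g
        using that f by (intro exI[of _ "g \<cdot> f"]) (auto intro: iso_cmp)
      ultimately show "iso_simple s t = iso_simple s' t" unfolding iso_simple_def by blast
    qed
    then show ?thesis by (simp add: rep_def)
  qed
  have "\<exists>g. g \<in> Ar C \<and> Src C g = FOb ?Z t \<and> Tgt C g = FOb ?Y t \<and> ntr \<alpha> t \<cdot> (g \<cdot> ntr \<alpha> t) = ntr \<alpha> t" if t: "t \<in> Ob C" for t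
  proof -
    obtain g where "g \<in> Hom C (Tgt C (ntr \<alpha> t)) (Src C (ntr \<alpha> t))" "ntr \<alpha> t \<cdot> (g \<cdot> ntr \<alpha> t) = ntr \<alpha> t"
      using regular a(1)[OF t] unfolding regular_category_def by blast
    then show ?thesis using a(2,3)[OF t] by (intro exI[of _ g]) (simp add: Hom_def)
  qed
  then obtain b where b: "\<And>t. t \<in> Ob C \<Longrightarrow> b t \<in> Ar C \<and> Src C (b t) = FOb ?Z t \<and> Tgt C (b t) = FOb ?Y t \<and> ntr \<alpha> t \<cdot> (b t \<cdot> ntr \<alpha> t) = ntr \<alpha> t"
    by metis
  define c where "c s = FAr ?Y (Inv C (\<phi> s)) \<cdot> (b (rep s) \<cdot> FAr ?Z (\<phi> s))" for s
  have fs: "\<phi> s \<in> Ar C" "Src C (\<phi> s) = s" "Tgt C (\<phi> s) = rep s" "is_iso C (\<phi> s)" "is_simple C (rep s)" "rep s \<in> Ob C"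
    "b (rep s) \<in> Ar C" "Src C (b (rep s)) = FOb ?Z (rep s)" "Tgt C (b (rep s)) = FOb ?Y (rep s)"
    "s \<in> Ob C" if "is_simple C s" for s
    using \<phi>[OF that] b[of "rep s"] that by (auto simp: is_simple_def)
  have cs: "c s \<in> Ar C" "Src C (c s) = FOb ?Z s" "Tgt C (c s) = FOb ?Y s" if "is_simple C s" for s
    using fs[OF that] by (simp_all add: c_def)
  have inv_inv: "FAr ?Y (Inv C (\<phi> s)) \<cdot> FAr ?Y (\<phi> s) = Idn C (FOb ?Y s)" "FAr ?Z (Inv C (\<phi> s)) \<cdot> FAr ?Z (\<phi> s) = Idn C (FOb ?Z s)"
     "FAr ?Y (\<phi> s) \<cdot> FAr ?Y (Inv C (\<phi> s)) = Idn C (FOb ?Y (rep s))"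
    if s: "is_simple C s" for s
    using functor_iso(2,3)[OF category_axioms category_axioms linear_functorD(1)[OF Y] fs(4)[OF s]]
      functor_iso(2)[OF category_axioms category_axioms linear_functorD(1)[OF Z] fs(4)[OF s]] fs[OF s] by simp_all
  have c_nat: "c (Tgt C f) \<cdot> FAr ?Z f = FAr ?Y f \<cdot> c (Src C f)"
    if f: "f \<in> Ar C" "is_simple C (Src C f)" "is_simple C (Tgt C f)" for f
  proof (cases "f = Zero C (Src C f) (Tgt C f)")
    case True
    have o: "Src C f \<in> Ob C" "Tgt C f \<in> Ob C" using f by auto
    have z: "FAr ?Z f = Zero C (FOb ?Z (Src C f)) (FOb ?Z (Tgt C f))" "FAr ?Y f = Zero C (FOb ?Y (Src C f)) (FOb ?Y (Tgt C f))"
      using True linear_functor_zero[OF linear_category_axioms linear_category_axioms Z o]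
        linear_functor_zero[OF linear_category_axioms linear_category_axioms Y o] by metis+
    show ?thesis unfolding z using cs[OF f(2)] cs[OF f(3)] o by simp
  next
    case False
    let ?s = "Src C f" and ?t = "Tgt C f"
    have iso: "is_iso C f" using simple_arrow_iso[OF f(2,3,1)] False by blast
    have r: "rep ?s = rep ?t" using rep_eq[OF f(1) _ _ iso] by simp
    note s = fs[OF f(2)] and t = fs[OF f(3)]
    have iv: "Inv C (\<phi> ?s) \<in> Ar C" "Src C (Inv C (\<phi> ?s)) = rep ?s" "Tgt C (Inv C (\<phi> ?s)) = ?s" "Inv C (\<phi> ?s) \<cdot> \<phi> ?s = Idn C ?s"
      "Inv C (\<phi> ?t) \<in> Ar C" "Src C (Inv C (\<phi> ?t)) = rep ?t" "Tgt C (Inv C (\<phi> ?t)) = ?t"  "Inv C (\<phi> ?t) \<cdot> \<phi> ?t = Idn C ?t"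
      using Inv_simps[OF s(4)] Inv_simps[OF t(4)] s t by simp_all
    obtain k where k: "\<phi> ?t \<cdot> (f \<cdot> Inv C (\<phi> ?s)) = Scale C k (Idn C (rep ?t))"
      using schur[OF t(5), of "\<phi> ?t \<cdot> (f \<cdot> Inv C (\<phi> ?s))"] s t iv f(1) r by auto
    have "\<phi> ?t \<cdot> f = (\<phi> ?t \<cdot> (f \<cdot> Inv C (\<phi> ?s))) \<cdot> \<phi> ?s" using s t iv f(1) r by simp
    also have "\<dots> = Scale C k (\<phi> ?s)" unfolding k using s t r by simp
    finally have 1: "\<phi> ?t \<cdot> f = Scale C k (\<phi> ?s)" .
    have "f = (Inv C (\<phi> ?t) \<cdot> \<phi> ?t) \<cdot> f" using iv t f(1) by simp
    also have "\<dots> = Inv C (\<phi> ?t) \<cdot> (\<phi> ?t \<cdot> f)" using iv(5-7) t(1-3) f(1) by simp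
    also have "\<dots> = Scale C k (Inv C (\<phi> ?t) \<cdot> \<phi> ?s)" unfolding 1 using iv(5-7) s(1-3) r by simp
    finally have 2: "f = Scale C k (Inv C (\<phi> ?t) \<cdot> \<phi> ?s)" .
    have "c ?t \<cdot> FAr ?Z f = FAr ?Y (Inv C (\<phi> ?t)) \<cdot> (b (rep ?t) \<cdot> FAr ?Z (\<phi> ?t \<cdot> f))"
      unfolding c_def using iv(5-7) t f(1) by simp
    also have "\<dots> = Scale C k (FAr ?Y (Inv C (\<phi> ?t)) \<cdot> (b (rep ?t) \<cdot> FAr ?Z (\<phi> ?s)))"
      unfolding 1 using linear_functorD(3)[OF Z s(1), of k] iv(5-7) s t r by simp
    finally have L: "c ?t \<cdot> FAr ?Z f = Scale C k (FAr ?Y (Inv C (\<phi> ?t)) \<cdot> (b (rep ?t) \<cdot> FAr ?Z (\<phi> ?s)))" .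
    have Yf: "FAr ?Y f = Scale C k (FAr ?Y (Inv C (\<phi> ?t)) \<cdot> FAr ?Y (\<phi> ?s))"
    proof -
      have "FAr ?Y f = FAr ?Y (Scale C k (Inv C (\<phi> ?t) \<cdot> \<phi> ?s))" using 2 by (rule arg_cong)
      also have "\<dots> = Scale C k (FAr ?Y (Inv C (\<phi> ?t) \<cdot> \<phi> ?s))" using iv(5-7) s r by (intro linear_functorD(3)[OF Y]) simp
      finally show ?thesis using iv(5-7) s r by simp
    qed
    have "FAr ?Y (\<phi> ?s) \<cdot> c ?s = (FAr ?Y (\<phi> ?s) \<cdot> FAr ?Y (Inv C (\<phi> ?s))) \<cdot> (b (rep ?s) \<cdot> FAr ?Z (\<phi> ?s))"
      unfolding c_def using iv(1-3) s by simp
    also have "\<dots> = b (rep ?t) \<cdot> FAr ?Z (\<phi> ?s)" unfolding inv_inv(3)[OF f(2)] using s r by simp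
    finally have "FAr ?Y (\<phi> ?s) \<cdot> c ?s = b (rep ?t) \<cdot> FAr ?Z (\<phi> ?s)" .
    then have "FAr ?Y f \<cdot> c ?s = Scale C k (FAr ?Y (Inv C (\<phi> ?t)) \<cdot> (b (rep ?t) \<cdot> FAr ?Z (\<phi> ?s)))"
      unfolding Yf using iv(5-7) s t r cs[OF f(2)] by simp
    then show ?thesis using L by simp
  qed
  have acas: "ntr \<alpha> s \<cdot> (c s \<cdot> ntr \<alpha> s) = ntr \<alpha> s" if s: "is_simple C s" for s
  proof -
    note f = fs[OF s]
    have i: "Inv C (\<phi> s) \<in> Ar C" "Src C (Inv C (\<phi> s)) = rep s" "Tgt C (Inv C (\<phi> s)) = s"
      using Inv_simps[OF f(4)] f by simp_all
    have bb: "ntr \<alpha> (rep s) \<cdot> (b (rep s) \<cdot> ntr \<alpha> (rep s)) = ntr \<alpha> (rep s)" using b[OF f(6)] by blast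
    have n1: "FAr ?Z (\<phi> s) \<cdot> ntr \<alpha> s = ntr \<alpha> (rep s) \<cdot> FAr ?Y (\<phi> s)" using a_nat[OF f(1)] f by simp
    have n2: "ntr \<alpha> s \<cdot> FAr ?Y (Inv C (\<phi> s)) = FAr ?Z (Inv C (\<phi> s)) \<cdot> ntr \<alpha> (rep s)" using a_nat[OF i(1)] i by simp
    have "ntr \<alpha> s \<cdot> (c s \<cdot> ntr \<alpha> s) = (ntr \<alpha> s \<cdot> FAr ?Y (Inv C (\<phi> s))) \<cdot> (b (rep s) \<cdot> (FAr ?Z (\<phi> s) \<cdot> ntr \<alpha> s))"
      unfolding c_def using i f by simp
    also have "\<dots> = FAr ?Z (Inv C (\<phi> s)) \<cdot> ((ntr \<alpha> (rep s) \<cdot> (b (rep s) \<cdot> ntr \<alpha> (rep s))) \<cdot> FAr ?Y (\<phi> s))"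
      unfolding n1 n2 using i f by simp
    also have "\<dots> = FAr ?Z (Inv C (\<phi> s)) \<cdot> (FAr ?Z (\<phi> s) \<cdot> ntr \<alpha> s)" unfolding bb n1 ..
    also have "\<dots> = (FAr ?Z (Inv C (\<phi> s)) \<cdot> FAr ?Z (\<phi> s)) \<cdot> ntr \<alpha> s" using i f by (simp del: Zf(6))
    also have "\<dots> = ntr \<alpha> s" unfolding inv_inv(2)[OF s] using f by simp
    finally show ?thesis .
  qed
  obtain \<beta> where \<beta>: "nat_trans C C ?Z ?Y \<beta>"
    and \<beta>s: "\<And>g. g \<in> Ar C \<Longrightarrow> is_simple C (Src C g) \<Longrightarrow> \<beta> (Tgt C g) \<cdot> FAr ?Z g = FAr ?Y g \<cdot> c (Src C g)"
    using extend_from_simples[OF Z Y, of c] cs c_nat by metis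
  note be [simp] = nat_transD(1-3)[OF \<beta>]
  have aba: "ntr \<alpha> X \<cdot> (\<beta> X \<cdot> ntr \<alpha> X) = ntr \<alpha> X" if X: "X \<in> Ob C" for X
  proof (rule simples_jointly_epi[OF Y X])
    fix g assume g: "g \<in> Ar C" "is_simple C (Src C g)" "Tgt C g = X"
    have 1: "ntr \<alpha> X \<cdot> FAr ?Y g = FAr ?Z g \<cdot> ntr \<alpha> (Src C g)" using a_nat[OF g(1)] g by simp
    have 2: "\<beta> X \<cdot> FAr ?Z g = FAr ?Y g \<cdot> c (Src C g)" using \<beta>s[OF g(1,2)] g by simp
    have "(ntr \<alpha> X \<cdot> (\<beta> X \<cdot> ntr \<alpha> X)) \<cdot> FAr ?Y g = ntr \<alpha> X \<cdot> ((\<beta> X \<cdot> FAr ?Z g) \<cdot> ntr \<alpha> (Src C g))"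
      using 1 g X by simp
    also have "\<dots> = (ntr \<alpha> X \<cdot> FAr ?Y g) \<cdot> (c (Src C g) \<cdot> ntr \<alpha> (Src C g))"
      unfolding 2 using g X cs[OF g(2)] by simp
    also have "\<dots> = FAr ?Z g \<cdot> (ntr \<alpha> (Src C g) \<cdot> (c (Src C g) \<cdot> ntr \<alpha> (Src C g)))"
      unfolding 1 using g X cs[OF g(2)] by simp
    also have "\<dots> = ntr \<alpha> X \<cdot> FAr ?Y g" unfolding acas[OF g(2)] 1 ..
    finally show "(ntr \<alpha> X \<cdot> (\<beta> X \<cdot> ntr \<alpha> X)) \<cdot> FAr ?Y g = ntr \<alpha> X \<cdot> FAr ?Y g" .
  qed (use X in auto)
  let ?\<beta> = "(?Z, restrict \<beta> (Ob C), ?Y)"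
  have "nat_trans C C ?Z ?Y (restrict \<beta> (Ob C))"
    using be nat_transD(4)[OF \<beta>] by (intro nat_transI) auto
  then have "?\<beta> \<in> Ar (End_cat C)" using \<alpha> by (simp add: End_Ar)
  moreover have "\<alpha> \<cdot>\<^bsub>End_cat C\<^esub> (?\<beta> \<cdot>\<^bsub>End_cat C\<^esub> \<alpha>) = \<alpha>"
    using \<alpha> aba by (auto simp: prod_eq_iff End_Ar intro!: extensionalityI[of _ "Ob C"])
  ultimately show "\<exists>g\<in>Hom (End_cat C) (Tgt (End_cat C) \<alpha>) (Src (End_cat C) \<alpha>). \<alpha> \<cdot>\<^bsub>End_cat C\<^esub> (g \<cdot>\<^bsub>End_cat C\<^esub> \<alpha>) = \<alpha>"
    by (intro bexI[of _ ?\<beta>]) (simp_all add: Hom_def)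
qed

end

context finite_abelian
begin

text \<open>
  The entries of a matrix, row by row.
\<close>

definition flat :: "nat \<Rightarrow> nat \<Rightarrow> 'k mat \<Rightarrow> 'k vec" where
  "flat r c A = vec (r * c) (\<lambda>i. A $$ (i div c, i mod c))"

lemma flat_carrier [simp]: "flat r c A \<in> carrier_vec (r * c)"
  by (simp add: flat_def)

lemma flat_inj: assumes "A \<in> carrier_mat r c" "B \<in> carrier_mat r c" "flat r c A = flat r c B" shows "A = B"
proof (rule eq_matI)
  fix i j assume "i < dim_row B" "j < dim_col B"
  then have ij: "i < r" "j < c" using assms by auto
  have "i * c + j < Suc i * c" using ij by simp
  also have "\<dots> \<le> r * c" using ij by (intro mult_le_mono1) simp
  finally have "i * c + j < r * c" .
  moreover have "flat r c A $ (i * c + j) = flat r c B $ (i * c + j)" using assms by simp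
  ultimately show "A $$ (i, j) = B $$ (i, j)" using ij by (simp add: flat_def)
qed (use assms in auto)

lemma flat_linear:
  "A \<in> carrier_mat r c \<Longrightarrow> B \<in> carrier_mat r c \<Longrightarrow> flat r c (A + B) = flat r c A + flat r c B"
  "A \<in> carrier_mat r c \<Longrightarrow> flat r c (x \<cdot>\<^sub>m A) = x \<cdot>\<^sub>v flat r c A"
  by (auto simp: flat_def intro!: eq_vecI dest: div_less_mult) (auto simp: div_less_mult mod_less_mult)

lemma hom_flat:
  "f \<in> Ar C \<Longrightarrow> g \<in> Ar C \<Longrightarrow> Src C f = X \<Longrightarrow> Src C g = X \<Longrightarrow> Tgt C f = Y \<Longrightarrow> Tgt C g = Y \<Longrightarrow>
    flat (dimension Y) (dimension X) (marr (FAr F (Add C f g))) =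
      flat (dimension Y) (dimension X) (marr (FAr F f)) + flat (dimension Y) (dimension X) (marr (FAr F g))"
  "f \<in> Ar C \<Longrightarrow> Src C f = X \<Longrightarrow> Tgt C f = Y \<Longrightarrow>
    flat (dimension Y) (dimension X) (marr (FAr F (Scale C c f))) = c \<cdot>\<^sub>v flat (dimension Y) (dimension X) (marr (FAr F f))"
  using marr_F[of f] marr_F[of g]
  by (auto simp: linear_functorD(2,3)[OF linear] flat_linear)

lemma hom_flat_inj:
  assumes "f \<in> Ar C" "g \<in> Ar C" "Src C f = X" "Src C g = X" "Tgt C f = Y" "Tgt C g = Y"
    and "flat (dimension Y) (dimension X) (marr (FAr F f)) = flat (dimension Y) (dimension X) (marr (FAr F g))"
  shows "f = g"
  using assms marr_F[of f] marr_F[of g] by (intro marr_eqD[of f g] flat_inj) auto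

lemma finite_homs: "Z \<in> Ob C \<Longrightarrow> finite_homs_from C Z"
  unfolding finite_homs_from_def
proof (intro conjI ballI)
  fix X assume X: "Z \<in> Ob C" "X \<in> Ob C"
  show "\<exists>N (\<psi> :: _ \<Rightarrow> 'k vec). (\<forall>f \<in> Hom C Z X. \<psi> f \<in> carrier_vec N) \<and> inj_on \<psi> (Hom C Z X) \<and>
     (\<forall>f \<in> Hom C Z X. \<forall>g \<in> Hom C Z X. \<psi> (Add C f g) = \<psi> f + \<psi> g) \<and>
     (\<forall>c. \<forall>f \<in> Hom C Z X. \<psi> (Scale C c f) = c \<cdot>\<^sub>v \<psi> f)"
    by (intro exI[of _ "dimension X * dimension Z"] exI[of _ "\<lambda>f. flat (dimension X) (dimension Z) (marr (FAr F f))"])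
      (auto simp: Hom_def hom_flat inj_on_def intro: hom_flat_inj)
qed

text \<open>
  The object \<open>G\<close> corresponds to the regular module: every vector \<open>v\<close> of a module \<open>X\<close> is the image of \<open>1\<close> under the
  homomorphism \<open>r \<mapsto> r v\<close> from the algebra to \<open>X\<close>.
\<close>

lemma generator:
  assumes R: "fd_algebra R"
  obtains G where "G \<in> Ob C" "\<And>a b. a \<in> Ar C \<Longrightarrow> b \<in> Ar C \<Longrightarrow> Src C a = Src C b \<Longrightarrow> Tgt C a = Tgt C b \<Longrightarrow>
    (\<And>g. g \<in> Ar C \<Longrightarrow> Src C g = G \<Longrightarrow> Tgt C g = Src C a \<Longrightarrow> a \<cdot> g = b \<cdot> g) \<Longrightarrow> a = b"
proof -
  let ?P = "(adim R, amult R)"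
  have P: "fd_module R ?P" using R by (simp add: fd_algebra_def fd_module_def)
  have one: "aone R \<in> carrier_vec (adim R)" using R by (simp add: fd_algebra_def)
  obtain G e where G: "G \<in> Ob C" "e \<in> Ar (Mod_cat R)" "Src (Mod_cat R) e = FOb F G" "Tgt (Mod_cat R) e = ?P" "is_iso (Mod_cat R) e"
    using ess_surj[of ?P] P by (metis Mod_simps(1) mem_Collect_eq)
  have "a = b" if ab: "a \<in> Ar C" "b \<in> Ar C" "Src C a = Src C b" "Tgt C a = Tgt C b"
    and eq: "\<And>g. g \<in> Ar C \<Longrightarrow> Src C g = G \<Longrightarrow> Tgt C g = Src C a \<Longrightarrow> a \<cdot> g = b \<cdot> g" for a b
  proof (rule marr_eqD[OF ab])
    let ?X = "FOb F (Src C a)"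
    have X: "fd_module R ?X" using F(1)[OF src_Ob[OF ab(1)]] by simp
    have ca: "marr (FAr F a) \<in> carrier_mat (dimension (Tgt C a)) (fst ?X)" "marr (FAr F b) \<in> carrier_mat (dimension (Tgt C a)) (fst ?X)"
      using marr_F[OF ab(1)] marr_F[OF ab(2)] ab(3,4) by (simp_all add: dimension_def)
    show "marr (FAr F a) = marr (FAr F b)"
    proof (rule mat_eq_by_vec[OF ca])
      fix v :: "'k vec" assume v: "v \<in> carrier_vec (fst ?X)"
      let ?h = "(?P, mat_of (adim R) (fst ?X) (\<lambda>r. snd ?X r v), ?X)"
      have lin: "vec_linear (adim R) (fst ?X) (\<lambda>r. snd ?X r v)"
        using X v by (auto simp: vec_linear_def fd_module_def vec_bilinear_def)
      have mult: "amult R r s \<in> carrier_vec (adim R)" if "r \<in> carrier_vec (adim R)" "s \<in> carrier_vec (adim R)" for r s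
        using R that by (auto simp: fd_algebra_def vec_bilinear_def)
      have h: "?h \<in> Ar (Mod_cat R)"
        using X P v by (auto simp: Mod_Ar fd_module_hom_def mat_of_mult[OF lin] mult fd_module_def)
      have "?h \<cdot>\<^bsub>Mod_cat R\<^esub> e \<in> Ar (Mod_cat R)" by (rule D.arr_cmp) (use h G in auto)
      then obtain g where g: "g \<in> Ar C" "Src C g = G" "Tgt C g = Src C a" "FAr F g = ?h \<cdot>\<^bsub>Mod_cat R\<^esub> e"
        using full[of G "Src C a" "?h \<cdot>\<^bsub>Mod_cat R\<^esub> e"] G ab by auto
      let ?e' = "Inv (Mod_cat R) e"
      note i = D.Inv_simps[OF G(5)]
      let ?w = "marr ?e' *\<^sub>v aone R"
      have ce: "marr e \<in> carrier_mat (adim R) (fst (FOb F G))" "marr ?e' \<in> carrier_mat (fst (FOb F G)) (adim R)"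
        using marr_carrier[OF G(2)] marr_carrier[OF i(1)] G i by simp_all
      have "marr e * marr ?e' = 1\<^sub>m (adim R)" using i(5) G by simp
      then have ew: "marr e *\<^sub>v ?w = aone R" using assoc_mult_mat_vec[OF ce one] one by simp
      have w: "?w \<in> carrier_vec (fst (FOb F G))" using ce one by auto
      have "marr (FAr F g) *\<^sub>v ?w = mat_of (adim R) (fst ?X) (\<lambda>r. snd ?X r v) *\<^sub>v (marr e *\<^sub>v ?w)"
        unfolding g(4) using assoc_mult_mat_vec[OF mat_of_carrier ce(1) w] by simp
      also have "\<dots> = snd ?X (aone R) v" unfolding ew by (rule mat_of_mult[OF lin one])
      also have "\<dots> = v" using X v by (simp add: fd_module_def)
      finally have gw: "marr (FAr F g) *\<^sub>v ?w = v" .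
      have cg: "marr (FAr F g) \<in> carrier_mat (fst ?X) (fst (FOb F G))" using marr_F[OF g(1)] g by (simp add: dimension_def)
      have "marr (FAr F a) * marr (FAr F g) = marr (FAr F b) * marr (FAr F g)"
        using eq[OF g(1-3)] marr_cmp[OF g(1) ab(1)] marr_cmp[OF g(1) ab(2)] g ab by simp
      then show "marr (FAr F a) *\<^sub>v v = marr (FAr F b) *\<^sub>v v"
        using assoc_mult_mat_vec[OF ca(1) cg w] assoc_mult_mat_vec[OF ca(2) cg w] gw by simp
    qed
  qed
  then show ?thesis using that G(1) by blast
qed

end

lemma id_right_exact: "right_exact_functor M M id_ftr"
  by (simp add: right_exact_functor_def id_linear right_exact_def) (simp add: id_ftr_def)

text \<open>
  A natural transformation from the identity to \<open>Y\<close> is determined by its component at a generator \<open>G\<close>, which lies in the finite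
  dimensional space \<open>Hom(G, Y(G))\<close>.
\<close>

lemma End_finite_homs:
  fixes M :: "('o, 'm, 'k::field) lcat"
  assumes "finite_abelian M R F" and R: "fd_algebra R"
  shows "finite_homs_from (End_cat M) id_ftr"
  unfolding finite_homs_from_def
proof (intro conjI ballI)
  interpret finite_abelian M R F by fact
  show "id_ftr \<in> Ob (End_cat M)" by (simp add: id_right_exact)
  fix Y assume Y: "Y \<in> Ob (End_cat M)"
  obtain G where G: "G \<in> Ob M" and gen: "\<And>a b. a \<in> Ar M \<Longrightarrow> b \<in> Ar M \<Longrightarrow> Src M a = Src M b \<Longrightarrow> Tgt M a = Tgt M b \<Longrightarrow>
    (\<And>g. g \<in> Ar M \<Longrightarrow> Src M g = G \<Longrightarrow> Tgt M g = Src M a \<Longrightarrow> a \<cdot>\<^bsub>M\<^esub> g = b \<cdot>\<^bsub>M\<^esub> g) \<Longrightarrow> a = b"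
    using generator[OF R] by blast
  let ?r = "dimension (FOb Y G)" and ?c = "dimension G"
  let ?\<psi> = "\<lambda>\<alpha>. flat ?r ?c (marr (FAr F (ntr \<alpha> G)))"
  have nt: "ntr \<alpha> X \<in> Ar M" "Src M (ntr \<alpha> X) = X" "Tgt M (ntr \<alpha> X) = FOb Y X" if "\<alpha> \<in> Hom (End_cat M) id_ftr Y" "X \<in> Ob M" for \<alpha> X
    using nat_transD(1-3)[of M M id_ftr Y "ntr \<alpha>" X] that by (auto simp: Hom_def End_Ar id_ftr_def)
  have "inj_on ?\<psi> (Hom (End_cat M) id_ftr Y)"
  proof (rule inj_onI)
    fix \<alpha> \<beta> assume \<alpha>: "\<alpha> \<in> Hom (End_cat M) id_ftr Y" and \<beta>: "\<beta> \<in> Hom (End_cat M) id_ftr Y" and eq: "?\<psi> \<alpha> = ?\<psi> \<beta>"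
    have eG: "ntr \<alpha> G = ntr \<beta> G" by (rule hom_flat_inj[OF _ _ _ _ _ _ eq]) (use nt[OF \<alpha> G] nt[OF \<beta> G] in auto)
    have "ntr \<alpha> X = ntr \<beta> X" if X: "X \<in> Ob M" for X
    proof (rule gen)
      fix g assume g: "g \<in> Ar M" "Src M g = G" "Tgt M g = Src M (ntr \<alpha> X)"
      then have "Tgt M g = X" using nt[OF \<alpha> X] by simp
      then show "ntr \<alpha> X \<cdot>\<^bsub>M\<^esub> g = ntr \<beta> X \<cdot>\<^bsub>M\<^esub> g"
        using \<alpha> \<beta> nat_transD(4)[of M M id_ftr Y "ntr \<alpha>" g] nat_transD(4)[of M M id_ftr Y "ntr \<beta>" g] g eG
        by (auto simp: Hom_def End_Ar id_ftr_def)
    qed (use nt[OF \<alpha> X] nt[OF \<beta> X] in auto)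
    then show "\<alpha> = \<beta>" using \<alpha> \<beta> by (auto simp: Hom_def End_Ar prod_eq_iff intro!: extensionalityI[of _ "Ob M"])
  qed
  then show "\<exists>N (\<psi> :: _ \<Rightarrow> 'k vec). (\<forall>f \<in> Hom (End_cat M) id_ftr Y. \<psi> f \<in> carrier_vec N) \<and> inj_on \<psi> (Hom (End_cat M) id_ftr Y) \<and>
     (\<forall>f \<in> Hom (End_cat M) id_ftr Y. \<forall>g \<in> Hom (End_cat M) id_ftr Y. \<psi> (Add (End_cat M) f g) = \<psi> f + \<psi> g) \<and>
     (\<forall>c. \<forall>f \<in> Hom (End_cat M) id_ftr Y. \<psi> (Scale (End_cat M) c f) = c \<cdot>\<^sub>v \<psi> f)"
    by (intro exI[of _ "?r * ?c"] exI[of _ ?\<psi>]) (auto simp: G hom_flat nt simp del: split_paired_All)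
qed

section \<open>Duality in monoidal categories\<close>

lemma (in category) Inv_cancel [simp]:
  assumes "is_iso C a"
  shows "y \<in> Ar C \<Longrightarrow> Tgt C y = Src C a \<Longrightarrow> Inv C a \<cdot> (a \<cdot> y) = y"
    and "x \<in> Ar C \<Longrightarrow> Tgt C x = Tgt C a \<Longrightarrow> a \<cdot> (Inv C a \<cdot> x) = x"
  using rewrite_pair[OF Inv_simps(4)[OF assms], of y] rewrite_pair[OF Inv_simps(5)[OF assms], of x]
    iso_arr[OF assms] assms by auto

lemma (in category) isomorphicI: "f \<in> Ar C \<Longrightarrow> is_iso C f \<Longrightarrow> Src C f = X \<Longrightarrow> Tgt C f = Y \<Longrightarrow> isomorphic C X Y"
  by (auto simp: isomorphic_def Hom_def)

lemma (in category) isomorphicE: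
  assumes "isomorphic C X Y"
  obtains f where "f \<in> Ar C" "is_iso C f" "Src C f = X" "Tgt C f = Y"
  using assms by (auto simp: isomorphic_def Hom_def)

lemma (in category) isomorphic_trans: "isomorphic C X Y \<Longrightarrow> isomorphic C Y Z \<Longrightarrow> isomorphic C X Z"
  by (elim isomorphicE, rule isomorphicI[of "_ \<cdot> _"]) (auto intro: iso_cmp)

lemma (in category) isomorphic_sym: "isomorphic C X Y \<Longrightarrow> isomorphic C Y X"
  by (elim isomorphicE, rule isomorphicI[of "Inv C _"]) (auto intro: iso_Inv)

lemma (in category) epis_onto_isomorphic_split:
  assumes iso: "isomorphic C P Q" and split: "\<And>e. is_epi C e \<Longrightarrow> Tgt C e = P \<Longrightarrow> \<exists>s \<in> Hom C P (Src C e). e \<cdot> s = Idn C P"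
    and e: "is_epi C e" "Tgt C e = Q"
  shows "\<exists>s. s \<in> Ar C \<and> Src C s = Q \<and> Tgt C s = Src C e \<and> e \<cdot> s = Idn C Q"
proof -
  obtain f where f: "f \<in> Ar C" "is_iso C f" "Src C f = P" "Tgt C f = Q" using isomorphicE[OF iso] .
  note i = Inv_simps[OF f(2)] and ea = epi_arr[OF e(1)]
  have "is_epi C (Inv C f \<cdot> e)" by (rule epi_cmp[OF iso_is_epi[OF iso_Inv[OF f(2)]] e(1)]) (use e i f in simp)
  then obtain s where s: "s \<in> Ar C" "Src C s = P" "Tgt C s = Src C e" "(Inv C f \<cdot> e) \<cdot> s = Idn C P"
    using split[of "Inv C f \<cdot> e"] e i f ea by (auto simp: Hom_def)
  have "f \<cdot> ((Inv C f \<cdot> e) \<cdot> s) = (f \<cdot> Inv C f) \<cdot> (e \<cdot> s)" using s(1-3) e(2) i(1-3) f ea by simp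
  then have 1: "f = e \<cdot> s" unfolding s(4) i(5) using s(1-3) e(2) f ea by simp
  have "e \<cdot> (s \<cdot> Inv C f) = (e \<cdot> s) \<cdot> Inv C f" using s(1-3) e(2) i(1-3) f ea by simp
  also have "\<dots> = Idn C Q" unfolding 1[symmetric] using i f by simp
  finally show ?thesis using s i f by (intro exI[of _ "s \<cdot> Inv C f"]) auto
qed

locale linear_monoidal = abelian_category C + monoidal_category C
  for C :: "('o, 'm, 'k::field, 'r) moncat_scheme" (structure) +
  assumes tens_bilinear: "bilinear_bifunctor C C C (Tens C)"
begin

lemmas tens [simp] = bilinear_bifunctorD(1-5)[OF tens_bilinear linear_category_axioms linear_category_axioms linear_category_axioms]
lemmas interchange = bilinear_bifunctorD(6)[OF tens_bilinear linear_category_axioms linear_category_axioms linear_category_axioms]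
lemmas tens_linear = bilinear_bifunctorD(7-10)[OF tens_bilinear linear_category_axioms linear_category_axioms linear_category_axioms]

lemmas unit [simp] = unit_Ob

lemma structure_arrows [simp]:
  "X \<in> Ob C \<Longrightarrow> Y \<in> Ob C \<Longrightarrow> Z \<in> Ob C \<Longrightarrow> Assoc C X Y Z \<in> Ar C"
  "X \<in> Ob C \<Longrightarrow> Y \<in> Ob C \<Longrightarrow> Z \<in> Ob C \<Longrightarrow> Src C (Assoc C X Y Z) = (X \<otimes>\<^sub>o Y) \<otimes>\<^sub>o Z"
  "X \<in> Ob C \<Longrightarrow> Y \<in> Ob C \<Longrightarrow> Z \<in> Ob C \<Longrightarrow> Tgt C (Assoc C X Y Z) = X \<otimes>\<^sub>o (Y \<otimes>\<^sub>o Z)"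
  "X \<in> Ob C \<Longrightarrow> Y \<in> Ob C \<Longrightarrow> Z \<in> Ob C \<Longrightarrow> is_iso C (Assoc C X Y Z)"
  "X \<in> Ob C \<Longrightarrow> LUnit C X \<in> Ar C" "X \<in> Ob C \<Longrightarrow> Src C (LUnit C X) = Unit C \<otimes>\<^sub>o X"
  "X \<in> Ob C \<Longrightarrow> Tgt C (LUnit C X) = X" "X \<in> Ob C \<Longrightarrow> is_iso C (LUnit C X)"
  "X \<in> Ob C \<Longrightarrow> RUnit C X \<in> Ar C" "X \<in> Ob C \<Longrightarrow> Src C (RUnit C X) = X \<otimes>\<^sub>o Unit C"
  "X \<in> Ob C \<Longrightarrow> Tgt C (RUnit C X) = X" "X \<in> Ob C \<Longrightarrow> is_iso C (RUnit C X)"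
  using assoc_Hom assoc_iso lunit_Hom lunit_iso runit_Hom runit_iso by (auto simp: Hom_def)

lemma assoc_nat: "f \<in> Ar C \<Longrightarrow> g \<in> Ar C \<Longrightarrow> h \<in> Ar C \<Longrightarrow>
    Assoc C (Tgt C f) (Tgt C g) (Tgt C h) \<cdot> ((f \<otimes>\<^sub>a g) \<otimes>\<^sub>a h) = (f \<otimes>\<^sub>a (g \<otimes>\<^sub>a h)) \<cdot> Assoc C (Src C f) (Src C g) (Src C h)"
  by (rule assoc_natural) (auto simp: Hom_def)

lemma lunit_nat: "f \<in> Ar C \<Longrightarrow> LUnit C (Tgt C f) \<cdot> (Idn C (Unit C) \<otimes>\<^sub>a f) = f \<cdot> LUnit C (Src C f)"
  by (rule lunit_natural) (auto simp: Hom_def)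

lemma runit_nat: "f \<in> Ar C \<Longrightarrow> RUnit C (Tgt C f) \<cdot> (f \<otimes>\<^sub>a Idn C (Unit C)) = f \<cdot> RUnit C (Src C f)"
  by (rule runit_natural) (auto simp: Hom_def)

lemma Inv_cancel_left: assumes "is_iso C a" "x \<in> Ar C" "y \<in> Ar C" "Tgt C x = Tgt C a" "Tgt C y = Src C a"
    "a \<cdot> y = x" shows "Inv C a \<cdot> x = y"
  using assms by auto

text \<open>
  The section is the arrow \<open>Y \<rightarrow> X\<close> that corresponds to \<open>t: 1 \<rightarrow> X \<otimes> Y'\<close> under the adjunction between \<open>- \<otimes> Y\<close> and
  \<open>- \<otimes> Y'\<close>, and the coevaluation corresponds to the identity of \<open>Y\<close>.
\<close>

lemma section_from_coev_lift:
  assumes dual: "left_dual C Y Y' ev coev" and e: "e \<in> Ar C" "Src C e = X" "Tgt C e = Y"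
    and t: "t \<in> Ar C" "Src C t = Unit C" "Tgt C t = X \<otimes>\<^sub>o Y'" "(e \<otimes>\<^sub>a Idn C Y') \<cdot> t = coev"
  shows "\<exists>s \<in> Hom C Y X. e \<cdot> s = Idn C Y"
proof -
  have o [simp]: "Y \<in> Ob C" "Y' \<in> Ob C" "X \<in> Ob C" using dual e by (auto simp: left_dual_def)
  have ev: "ev \<in> Ar C" "Src C ev = Y' \<otimes>\<^sub>o Y" "Tgt C ev = Unit C"
    and coev: "coev \<in> Ar C" "Src C coev = Unit C" "Tgt C coev = Y \<otimes>\<^sub>o Y'"
    and snake: "RUnit C Y \<cdot> (Idn C Y \<otimes>\<^sub>a ev) \<cdot> Assoc C Y Y' Y \<cdot> (coev \<otimes>\<^sub>a Idn C Y) = LUnit C Y"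
    using dual by (auto simp: left_dual_def Hom_def)
  let ?l = "Inv C (LUnit C Y)"
  note l = Inv_simps[of "LUnit C Y", OF structure_arrows(8)[OF o(1)]]
  let ?s = "RUnit C X \<cdot> (Idn C X \<otimes>\<^sub>a ev) \<cdot> Assoc C X Y' Y \<cdot> (t \<otimes>\<^sub>a Idn C Y)"
  have s: "?s \<in> Ar C" "Src C ?s = Unit C \<otimes>\<^sub>o Y" "Tgt C ?s = X" using ev t by auto
  have 1: "(e \<otimes>\<^sub>a Idn C (Unit C)) \<cdot> (Idn C X \<otimes>\<^sub>a ev) = (Idn C Y \<otimes>\<^sub>a ev) \<cdot> (e \<otimes>\<^sub>a Idn C (Y' \<otimes>\<^sub>o Y))"
    using interchange[of "Idn C X" ev e "Idn C (Unit C)"] interchange[of e "Idn C (Y' \<otimes>\<^sub>o Y)" "Idn C Y" ev] e ev by simp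
  have 2: "(e \<otimes>\<^sub>a Idn C (Y' \<otimes>\<^sub>o Y)) \<cdot> Assoc C X Y' Y = Assoc C Y Y' Y \<cdot> ((e \<otimes>\<^sub>a Idn C Y') \<otimes>\<^sub>a Idn C Y)"
    using assoc_nat[of e "Idn C Y'" "Idn C Y"] e by simp
  have 3: "((e \<otimes>\<^sub>a Idn C Y') \<otimes>\<^sub>a Idn C Y) \<cdot> (t \<otimes>\<^sub>a Idn C Y) = coev \<otimes>\<^sub>a Idn C Y"
    using interchange[of t "Idn C Y" "e \<otimes>\<^sub>a Idn C Y'" "Idn C Y"] e t by simp
  have 4: "e \<cdot> RUnit C X = RUnit C Y \<cdot> (e \<otimes>\<^sub>a Idn C (Unit C))" using runit_nat[OF e(1)] e by simp
  have "e \<cdot> ?s = (e \<cdot> RUnit C X) \<cdot> (Idn C X \<otimes>\<^sub>a ev) \<cdot> Assoc C X Y' Y \<cdot> (t \<otimes>\<^sub>a Idn C Y)"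
    using e ev t by simp
  also have "\<dots> = RUnit C Y \<cdot> ((e \<otimes>\<^sub>a Idn C (Unit C)) \<cdot> (Idn C X \<otimes>\<^sub>a ev)) \<cdot> Assoc C X Y' Y \<cdot> (t \<otimes>\<^sub>a Idn C Y)"
    unfolding 4 using e ev t by simp
  also have "\<dots> = RUnit C Y \<cdot> (Idn C Y \<otimes>\<^sub>a ev) \<cdot> ((e \<otimes>\<^sub>a Idn C (Y' \<otimes>\<^sub>o Y)) \<cdot> Assoc C X Y' Y) \<cdot> (t \<otimes>\<^sub>a Idn C Y)"
    unfolding 1 using e ev t by simp
  also have "\<dots> = RUnit C Y \<cdot> (Idn C Y \<otimes>\<^sub>a ev) \<cdot> Assoc C Y Y' Y \<cdot> (((e \<otimes>\<^sub>a Idn C Y') \<otimes>\<^sub>a Idn C Y) \<cdot> (t \<otimes>\<^sub>a Idn C Y))"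
    unfolding 2 using e ev t by simp
  also have "\<dots> = LUnit C Y" unfolding 3 by (rule snake)
  finally have es: "e \<cdot> ?s = LUnit C Y" .
  have "e \<cdot> (?s \<cdot> ?l) = (e \<cdot> ?s) \<cdot> ?l" using e s l by (intro assoc[symmetric]) simp_all
  then have "e \<cdot> (?s \<cdot> ?l) = Idn C Y" unfolding es using l by simp
  then show ?thesis by (intro bexI[of _ "?s \<cdot> ?l"]) (use s l in \<open>simp_all add: Hom_def del: assoc\<close>)
qed

context
  fixes X D ev coev q
  assumes dual: "left_dual C D X ev coev" and q: "q \<in> Ar C" "Src C q = X" "Tgt C q = Unit C"
begin

text \<open>
  The transpose of \<open>q: X \<rightarrow> 1\<close> is kept as an arrow to \<open>D \<otimes> 1\<close>, and the evaluation is replaced by a pairing of \<open>X\<close> with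
  \<open>D \<otimes> 1\<close>. Identifying \<open>D \<otimes> 1\<close> with \<open>D\<close> would require that the unit constraint of \<open>X \<otimes> D\<close> is compatible with
  the associator, which is not an axiom but a consequence of the pentagon and the triangle.
\<close>

definition transpose_arrow where "transpose_arrow = (Idn C D \<otimes>\<^sub>a q) \<cdot> coev"

definition transpose_pairing where
  "transpose_pairing = RUnit C (Unit C) \<cdot> (ev \<otimes>\<^sub>a Idn C (Unit C)) \<cdot> Inv C (Assoc C X D (Unit C))"

lemma dual_simps [simp]:
  "X \<in> Ob C" "D \<in> Ob C" "ev \<in> Ar C" "Src C ev = X \<otimes>\<^sub>o D" "Tgt C ev = Unit C"
  "coev \<in> Ar C" "Src C coev = Unit C" "Tgt C coev = D \<otimes>\<^sub>o X"
  using dual by (auto simp: left_dual_def Hom_def)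

lemma Inv_assoc [simp]:
  assumes "A \<in> Ob C" "B \<in> Ob C" "Z \<in> Ob C"
  shows "Inv C (Assoc C A B Z) \<in> Ar C" "Src C (Inv C (Assoc C A B Z)) = A \<otimes>\<^sub>o (B \<otimes>\<^sub>o Z)"
    "Tgt C (Inv C (Assoc C A B Z)) = (A \<otimes>\<^sub>o B) \<otimes>\<^sub>o Z"
  using Inv_simps[OF structure_arrows(4)[OF assms]] assms by auto

lemma Inv_unit [simp]:
  assumes "A \<in> Ob C"
  shows "Inv C (LUnit C A) \<in> Ar C" "Src C (Inv C (LUnit C A)) = A" "Tgt C (Inv C (LUnit C A)) = Unit C \<otimes>\<^sub>o A"
    "Inv C (RUnit C A) \<in> Ar C" "Src C (Inv C (RUnit C A)) = A" "Tgt C (Inv C (RUnit C A)) = A \<otimes>\<^sub>o Unit C"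
  using Inv_simps[OF structure_arrows(8)[OF assms]] Inv_simps[OF structure_arrows(12)[OF assms]] assms by auto

lemma transpose_simps [simp]:
  "transpose_arrow \<in> Ar C" "Src C transpose_arrow = Unit C" "Tgt C transpose_arrow = D \<otimes>\<^sub>o Unit C"
  "transpose_pairing \<in> Ar C" "Src C transpose_pairing = X \<otimes>\<^sub>o (D \<otimes>\<^sub>o Unit C)" "Tgt C transpose_pairing = Unit C"
  using q by (auto simp: transpose_arrow_def transpose_pairing_def)

text \<open>
  Up to unit constraints, which are isomorphisms, \<open>q\<close> is recovered from its transpose; this is one of the two
  zigzag equations.
\<close>

lemma pairing_transpose:
  "transpose_pairing \<cdot> (Idn C X \<otimes>\<^sub>a transpose_arrow) = RUnit C (Unit C) \<cdot> Inv C (LUnit C (Unit C)) \<cdot> q \<cdot> RUnit C X"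
proof -
  let ?I = "Unit C" and ?\<alpha> = "Inv C (Assoc C X D (Unit C))" and ?\<alpha>' = "Inv C (Assoc C X D X)"
  have snake: "LUnit C X \<cdot> (ev \<otimes>\<^sub>a Idn C X) \<cdot> ?\<alpha>' \<cdot> (Idn C X \<otimes>\<^sub>a coev) = RUnit C X"
    using dual by (simp add: left_dual_def)
  have 1: "Idn C X \<otimes>\<^sub>a transpose_arrow = (Idn C X \<otimes>\<^sub>a (Idn C D \<otimes>\<^sub>a q)) \<cdot> (Idn C X \<otimes>\<^sub>a coev)"
    using interchange[of "Idn C X" coev "Idn C X" "Idn C D \<otimes>\<^sub>a q"] q by (simp add: transpose_arrow_def)
  have 2: "?\<alpha> \<cdot> (Idn C X \<otimes>\<^sub>a (Idn C D \<otimes>\<^sub>a q)) = (Idn C (X \<otimes>\<^sub>o D) \<otimes>\<^sub>a q) \<cdot> ?\<alpha>'"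
  proof (rule Inv_cancel_left)
    have n: "Assoc C X D ?I \<cdot> (Idn C (X \<otimes>\<^sub>o D) \<otimes>\<^sub>a q) = (Idn C X \<otimes>\<^sub>a (Idn C D \<otimes>\<^sub>a q)) \<cdot> Assoc C X D X"
      using assoc_nat[of "Idn C X" "Idn C D" q] q by simp
    have "Assoc C X D ?I \<cdot> (Idn C (X \<otimes>\<^sub>o D) \<otimes>\<^sub>a q) \<cdot> ?\<alpha>' = (Assoc C X D ?I \<cdot> (Idn C (X \<otimes>\<^sub>o D) \<otimes>\<^sub>a q)) \<cdot> ?\<alpha>'" using q by simp
    also have "\<dots> = (Idn C X \<otimes>\<^sub>a (Idn C D \<otimes>\<^sub>a q)) \<cdot> (Assoc C X D X \<cdot> ?\<alpha>')" unfolding n using q by simp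
    also have "\<dots> = Idn C X \<otimes>\<^sub>a (Idn C D \<otimes>\<^sub>a q)" using q Inv_simps(5)[of "Assoc C X D X"] by simp
    finally show "Assoc C X D ?I \<cdot> (Idn C (X \<otimes>\<^sub>o D) \<otimes>\<^sub>a q) \<cdot> ?\<alpha>' = Idn C X \<otimes>\<^sub>a (Idn C D \<otimes>\<^sub>a q)" .
  qed (use q in auto)
  have 3: "(ev \<otimes>\<^sub>a Idn C ?I) \<cdot> (Idn C (X \<otimes>\<^sub>o D) \<otimes>\<^sub>a q) = (Idn C ?I \<otimes>\<^sub>a q) \<cdot> (ev \<otimes>\<^sub>a Idn C X)"
    using interchange[of "Idn C (X \<otimes>\<^sub>o D)" q ev "Idn C ?I"] interchange[of ev "Idn C X" "Idn C ?I" q] q by simp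
  have 4: "Inv C (LUnit C ?I) \<cdot> q \<cdot> LUnit C X = Idn C ?I \<otimes>\<^sub>a q"
    by (rule Inv_cancel_left) (use lunit_nat[OF q(1)] q in auto)
  have "transpose_pairing \<cdot> (Idn C X \<otimes>\<^sub>a transpose_arrow) =
      RUnit C ?I \<cdot> (ev \<otimes>\<^sub>a Idn C ?I) \<cdot> (?\<alpha> \<cdot> (Idn C X \<otimes>\<^sub>a (Idn C D \<otimes>\<^sub>a q))) \<cdot> (Idn C X \<otimes>\<^sub>a coev)"
    unfolding 1 transpose_pairing_def using q by simp
  also have "\<dots> = RUnit C ?I \<cdot> ((ev \<otimes>\<^sub>a Idn C ?I) \<cdot> (Idn C (X \<otimes>\<^sub>o D) \<otimes>\<^sub>a q)) \<cdot> ?\<alpha>' \<cdot> (Idn C X \<otimes>\<^sub>a coev)"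
    unfolding 2 using q by simp
  also have "\<dots> = RUnit C ?I \<cdot> (Idn C ?I \<otimes>\<^sub>a q) \<cdot> (ev \<otimes>\<^sub>a Idn C X) \<cdot> ?\<alpha>' \<cdot> (Idn C X \<otimes>\<^sub>a coev)"
    unfolding 3 using q by simp
  also have "\<dots> = RUnit C ?I \<cdot> Inv C (LUnit C ?I) \<cdot> q \<cdot> (LUnit C X \<cdot> (ev \<otimes>\<^sub>a Idn C X) \<cdot> ?\<alpha>' \<cdot> (Idn C X \<otimes>\<^sub>a coev))"
    unfolding 4[symmetric] using q by simp
  finally show ?thesis unfolding snake .
qed

lemma section_from_transpose_retraction:
  assumes r: "r \<in> Ar C" "Src C r = D \<otimes>\<^sub>o Unit C" "Tgt C r = Unit C" "r \<cdot> transpose_arrow = Idn C (Unit C)"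
  shows "\<exists>s. s \<in> Ar C \<and> Src C s = Unit C \<and> Tgt C s = X \<and> q \<cdot> s = Idn C (Unit C)"
proof -
  let ?I = "Unit C"
  let ?r = "r \<cdot> Inv C (RUnit C D)"
  have r': "?r \<in> Ar C" "Src C ?r = D" "Tgt C ?r = ?I" using r by auto
  have "RUnit C ?I \<cdot> (?r \<otimes>\<^sub>a Idn C ?I) = ?r \<cdot> RUnit C D" using runit_nat[OF r'(1)] r' by simp
  also have "\<dots> = r" using r(1-3) Inv_simps(4)[of "RUnit C D"] by simp
  finally have 1: "RUnit C ?I \<cdot> (?r \<otimes>\<^sub>a Idn C ?I) = r" .
  let ?y = "LUnit C X \<cdot> (?r \<otimes>\<^sub>a Idn C X) \<cdot> coev"
  have y: "?y \<in> Ar C" "Src C ?y = ?I" "Tgt C ?y = X" using r' by auto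
  have 2: "(Idn C ?I \<otimes>\<^sub>a q) \<cdot> (?r \<otimes>\<^sub>a Idn C X) = (?r \<otimes>\<^sub>a Idn C ?I) \<cdot> (Idn C D \<otimes>\<^sub>a q)"
    using interchange[of ?r "Idn C X" "Idn C ?I" q] interchange[of "Idn C D" q ?r "Idn C ?I"] q r' by simp
  have lq: "q \<cdot> LUnit C X = LUnit C ?I \<cdot> (Idn C ?I \<otimes>\<^sub>a q)" using lunit_nat[OF q(1)] q by simp
  have "q \<cdot> ?y = (q \<cdot> LUnit C X) \<cdot> (?r \<otimes>\<^sub>a Idn C X) \<cdot> coev" using q r' by (simp del: assoc add: assoc[symmetric])
  also have "\<dots> = LUnit C ?I \<cdot> ((Idn C ?I \<otimes>\<^sub>a q) \<cdot> (?r \<otimes>\<^sub>a Idn C X)) \<cdot> coev"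
    unfolding lq using q r(1-3) by simp
  also have "\<dots> = LUnit C ?I \<cdot> (?r \<otimes>\<^sub>a Idn C ?I) \<cdot> transpose_arrow"
    unfolding 2 transpose_arrow_def using q r(1-3) by simp
  finally have qy: "q \<cdot> ?y = LUnit C ?I \<cdot> (?r \<otimes>\<^sub>a Idn C ?I) \<cdot> transpose_arrow" .
  have "(RUnit C ?I \<cdot> (?r \<otimes>\<^sub>a Idn C ?I)) \<cdot> transpose_arrow = Idn C ?I" unfolding 1 by (rule r(4))
  then have "RUnit C ?I \<cdot> ((?r \<otimes>\<^sub>a Idn C ?I) \<cdot> transpose_arrow) = Idn C ?I" using r(1-3) by simp
  then have "Inv C (RUnit C ?I) \<cdot> Idn C ?I = (?r \<otimes>\<^sub>a Idn C ?I) \<cdot> transpose_arrow"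
    by (intro Inv_cancel_left) (use r(1-3) in auto)
  then have "q \<cdot> ?y = LUnit C ?I \<cdot> Inv C (RUnit C ?I)" unfolding qy by simp
  then have "q \<cdot> (?y \<cdot> (RUnit C ?I \<cdot> Inv C (LUnit C ?I))) = (LUnit C ?I \<cdot> Inv C (RUnit C ?I)) \<cdot> (RUnit C ?I \<cdot> Inv C (LUnit C ?I))"
    using y q by (subst rewrite_pair[of q ?y]) (auto simp del: assoc)
  also have "\<dots> = LUnit C ?I \<cdot> ((Inv C (RUnit C ?I) \<cdot> RUnit C ?I) \<cdot> Inv C (LUnit C ?I))" by (subst assoc, auto)
  also have "\<dots> = Idn C ?I" using Inv_simps(4)[of "RUnit C ?I"] Inv_simps(5)[of "LUnit C ?I"] by simp
  finally show ?thesis using y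
    by (intro exI[of _ "?y \<cdot> (RUnit C ?I \<cdot> Inv C (LUnit C ?I))"]) (simp del: assoc)
qed

end

end

section \<open>Splitting of epis\<close>

text \<open>
  What the argument uses of an exact sequence. \<open>E\<close> is the predicate of lying in \<open>End(M)\<close>, and \<open>unit_split\<close> is the
  consequence of \<open>epi_onto_box_splits\<close> for the object \<open>F 1\<close>.
\<close>

locale normal_sequence =
  B: linear_monoidal B + T: linear_monoidal T + A: linear_category A
  for A :: "('ao, 'am, 'k::field) moncat" and B :: "('bo, 'bm, 'k) moncat" and T :: "('to, 'tm, 'k) moncat" +
  fixes \<iota> :: "('ao, 'am, 'bo, 'bm) mftr" and F :: "('bo, 'bm, 'to, 'tm) mftr" and E :: "'to \<Rightarrow> bool"
  assumes rigid_B: "rigid B"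
    and End_unit: "\<And>f. f \<in> Hom B (Unit B) (Unit B) \<Longrightarrow> \<exists>c. f = Scale B c (Idn B (Unit B))"
    and Tens_T: "right_exact_bifunctor T T T (Tens T)"
    and regular_A: "regular_category A"
    and \<iota>_functor: "is_functor A B \<iota>" and \<iota>_full: "fully_faithful A B \<iota>"
    and unit_image: "in_image B A \<iota> (Unit B)"
    and F_monoidal: "monoidal_functor B T F" and F_exact: "exact_functor B T F"
    and ker: "\<And>X. X \<in> Ob B \<Longrightarrow> in_image B A \<iota> X \<longleftrightarrow> E (FOb F X)"
    and E_iso: "\<And>Y Y'. E Y \<Longrightarrow> isomorphic T Y' Y \<Longrightarrow> E Y'"
    and normal: "normal_sub B T E F \<or> normal_quot B T E F"
    and unit_split: "\<And>e. is_epi T e \<Longrightarrow> Tgt T e = FOb F (Unit B) \<Longrightarrow>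
       \<exists>s. s \<in> Ar T \<and> Src T s = FOb F (Unit B) \<and> Tgt T s = Src T e \<and> e \<cdot>\<^bsub>T\<^esub> s = Idn T (FOb F (Unit B))"
begin

abbreviation cmp_B (infixr "\<cdot>\<^sub>B" 70) where "g \<cdot>\<^sub>B f \<equiv> g \<cdot>\<^bsub>B\<^esub> f"
abbreviation cmp_T (infixr "\<cdot>\<^sub>T" 70) where "g \<cdot>\<^sub>T f \<equiv> g \<cdot>\<^bsub>T\<^esub> f"
abbreviation tens_B (infixr "\<otimes>\<^sub>B" 75) where "f \<otimes>\<^sub>B g \<equiv> f \<otimes>\<^sub>a\<^bsub>B\<^esub> g"
abbreviation tens_T (infixr "\<otimes>\<^sub>T" 75) where "f \<otimes>\<^sub>T g \<equiv> f \<otimes>\<^sub>a\<^bsub>T\<^esub> g"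

abbreviation I where "I \<equiv> Unit B"
abbreviation J where "J \<equiv> FOb F (Unit B)"

lemma F_linear: "linear_functor B T F" using F_exact by (simp add: exact_functor_def)
lemmas F [simp] = functorD[OF linear_functorD(1)[OF F_linear]]
lemmas F_scale = linear_functorD(3)[OF F_linear]
lemmas F_zero = linear_functor_zero[OF B.linear_category_axioms T.linear_category_axioms F_linear]
lemmas \<iota>_simps [simp] = functorD[OF \<iota>_functor]

lemma F_kernel: "is_kernel B f k \<Longrightarrow> is_kernel T (FAr F f) (FAr F k)"
  using F_exact by (simp add: exact_functor_def left_exact_def)

lemma F_epi: assumes "is_epi B e" shows "is_epi T (FAr F e)"
proof -
  obtain f where "is_cokernel B f e" using B.epi_is_cokernel[OF assms] by blast
  then have "is_cokernel T (FAr F f) (FAr F e)" using F_exact by (simp add: exact_functor_def right_exact_def)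
  then show ?thesis by (rule T.cokernelD(5))
qed

lemma MTens [simp]:
  "X \<in> Ob B \<Longrightarrow> Y \<in> Ob B \<Longrightarrow> MTens F X Y \<in> Ar T"
  "X \<in> Ob B \<Longrightarrow> Y \<in> Ob B \<Longrightarrow> Src T (MTens F X Y) = FOb F X \<otimes>\<^sub>o\<^bsub>T\<^esub> FOb F Y"
  "X \<in> Ob B \<Longrightarrow> Y \<in> Ob B \<Longrightarrow> Tgt T (MTens F X Y) = FOb F (X \<otimes>\<^sub>o\<^bsub>B\<^esub> Y)"
  "X \<in> Ob B \<Longrightarrow> Y \<in> Ob B \<Longrightarrow> is_iso T (MTens F X Y)"
  "MUnit F \<in> Ar T" "Src T (MUnit F) = Unit T" "Tgt T (MUnit F) = J" "is_iso T (MUnit F)"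
  using F_monoidal by (auto simp: monoidal_functor_def Hom_def)

lemma MTens_natural:
  "f \<in> Ar B \<Longrightarrow> g \<in> Ar B \<Longrightarrow> MTens F (Tgt B f) (Tgt B g) \<cdot>\<^sub>T (FAr F f \<otimes>\<^sub>T FAr F g) =
     FAr F (f \<otimes>\<^sub>B g) \<cdot>\<^sub>T MTens F (Src B f) (Src B g)"
  using F_monoidal unfolding monoidal_functor_def Hom_def by blast

lemma MTens_runit:
  "X \<in> Ob B \<Longrightarrow> FAr F (RUnit B X) \<cdot>\<^sub>T MTens F X I \<cdot>\<^sub>T (Idn T (FOb F X) \<otimes>\<^sub>T MUnit F) = RUnit T (FOb F X)"
  using F_monoidal by (simp add: monoidal_functor_def)

text \<open>
  As \<open>\<iota>\<close> is full, an arrow between objects in its image comes from \<open>A\<close> up to isomorphisms at both ends.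
\<close>

lemma image_regular:
  assumes y: "y \<in> Ar B" and im: "in_image B A \<iota> (Src B y)" "in_image B A \<iota> (Tgt B y)"
  obtains g where "g \<in> Ar B" "Src B g = Tgt B y" "Tgt B g = Src B y" "y \<cdot>\<^sub>B (g \<cdot>\<^sub>B y) = y"
proof -
  obtain a where a: "a \<in> Ob A" "isomorphic B (Src B y) (FOb \<iota> a)" using im(1) by (auto simp: in_image_def)
  obtain b where b: "b \<in> Ob A" "isomorphic B (Tgt B y) (FOb \<iota> b)" using im(2) by (auto simp: in_image_def)
  obtain p where p: "p \<in> Ar B" "is_iso B p" "Src B p = Src B y" "Tgt B p = FOb \<iota> a" using B.isomorphicE[OF a(2)] .
  obtain q where q: "q \<in> Ar B" "is_iso B q" "Src B q = Tgt B y" "Tgt B q = FOb \<iota> b" using B.isomorphicE[OF b(2)] .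
  note ip = B.Inv_simps[OF p(2)] and iq = B.Inv_simps[OF q(2)]
  have "q \<cdot>\<^sub>B y \<cdot>\<^sub>B Inv B p \<in> Hom B (FOb \<iota> a) (FOb \<iota> b)" using p q ip(1-3) y by (simp add: Hom_def)
  then obtain f where f: "f \<in> Hom A a b" "FAr \<iota> f = q \<cdot>\<^sub>B y \<cdot>\<^sub>B Inv B p"
    using \<iota>_full a(1) b(1) unfolding fully_faithful_def bij_betw_def by (metis imageE)
  have fa: "f \<in> Ar A" "Src A f = a" "Tgt A f = b" using f by (auto simp: Hom_def)
  obtain g where g: "g \<in> Ar A" "Src A g = b" "Tgt A g = a" "f \<cdot>\<^bsub>A\<^esub> (g \<cdot>\<^bsub>A\<^esub> f) = f"
    using regular_A fa unfolding regular_category_def Hom_def by blast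
  have "FAr \<iota> (f \<cdot>\<^bsub>A\<^esub> (g \<cdot>\<^bsub>A\<^esub> f)) = FAr \<iota> f" using g(4) by simp
  then have 1: "FAr \<iota> f \<cdot>\<^sub>B (FAr \<iota> g \<cdot>\<^sub>B FAr \<iota> f) = FAr \<iota> f" using g(1-3) fa by simp
  let ?G = "Inv B p \<cdot>\<^sub>B FAr \<iota> g \<cdot>\<^sub>B q"
  have y': "y = Inv B q \<cdot>\<^sub>B (FAr \<iota> f \<cdot>\<^sub>B p)" unfolding f(2) using p q ip y by simp
  have gi: "FAr \<iota> g \<in> Ar B" "Src B (FAr \<iota> g) = FOb \<iota> b" "Tgt B (FAr \<iota> g) = FOb \<iota> a" using g by auto
  have fi: "FAr \<iota> f \<in> Ar B" "Src B (FAr \<iota> f) = FOb \<iota> a" "Tgt B (FAr \<iota> f) = FOb \<iota> b" using fa by auto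
  have "(Inv B q \<cdot>\<^sub>B (FAr \<iota> f \<cdot>\<^sub>B p)) \<cdot>\<^sub>B (?G \<cdot>\<^sub>B (Inv B q \<cdot>\<^sub>B (FAr \<iota> f \<cdot>\<^sub>B p))) =
      Inv B q \<cdot>\<^sub>B ((FAr \<iota> f \<cdot>\<^sub>B (FAr \<iota> g \<cdot>\<^sub>B FAr \<iota> f)) \<cdot>\<^sub>B p)"
    using p q ip(1-3) iq(1-3) gi fi by simp
  also have "\<dots> = Inv B q \<cdot>\<^sub>B (FAr \<iota> f \<cdot>\<^sub>B p)" unfolding 1 ..
  finally have "y \<cdot>\<^sub>B (?G \<cdot>\<^sub>B y) = y" unfolding y'[symmetric] .
  then show ?thesis using that[of ?G] p q ip(1-3) gi by simp
qed

text \<open>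
  If \<open>F 1 = 0\<close> then \<open>F X\<close>, which is isomorphic to \<open>F X \<otimes> 1\<close>, is zero for all \<open>X\<close>. Then it is isomorphic to \<open>F 1\<close>,
  so that every object of \<open>B\<close> is in the kernel of \<open>F\<close>.
\<close>

lemma regular_if_F_unit_zero:
  assumes zero: "Idn T J = Zero T J J" shows "regular_category B"
proof -
  have J: "J \<in> Ob T" by simp
  have u: "Idn T (Unit T) = Zero T (Unit T) (Unit T)"
  proof -
    have "Idn T (Unit T) = Inv T (MUnit F) \<cdot>\<^sub>T (Idn T J \<cdot>\<^sub>T MUnit F)"
      using T.Inv_simps[OF MTens(8)] by simp
    also have "\<dots> = Zero T (Unit T) (Unit T)" unfolding zero using T.Inv_simps[OF MTens(8)] by simp
    finally show ?thesis .
  qed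
  have im: "in_image B A \<iota> X" if X: "X \<in> Ob B" for X
  proof -
    let ?Y = "FOb F X"
    have Y: "?Y \<in> Ob T" using X by simp
    have "Idn T ?Y \<otimes>\<^sub>T Idn T (Unit T) = Idn T ?Y \<otimes>\<^sub>T Scale T 0 (Idn T (Unit T))"
      using u T.scale_zero_left[of "Idn T (Unit T)"] by simp
    also have "\<dots> = Zero T (?Y \<otimes>\<^sub>o\<^bsub>T\<^esub> Unit T) (?Y \<otimes>\<^sub>o\<^bsub>T\<^esub> Unit T)"
      using Y by (subst T.tens_linear(4)) (auto simp: T.scale_zero_left)
    finally have z: "Idn T (?Y \<otimes>\<^sub>o\<^bsub>T\<^esub> Unit T) = Zero T (?Y \<otimes>\<^sub>o\<^bsub>T\<^esub> Unit T) (?Y \<otimes>\<^sub>o\<^bsub>T\<^esub> Unit T)" using Y by simp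
    note r = T.Inv_simps[OF T.structure_arrows(12)[OF Y]]
    have "Idn T ?Y = RUnit T ?Y \<cdot>\<^sub>T (Idn T (?Y \<otimes>\<^sub>o\<^bsub>T\<^esub> Unit T) \<cdot>\<^sub>T Inv T (RUnit T ?Y))" using r Y by simp
    also have "\<dots> = Zero T ?Y ?Y" unfolding z using r Y by simp
    finally have "Idn T ?Y = Zero T ?Y ?Y" .
    then have "is_iso T (Zero T ?Y J)" using zero Y by (intro T.isoI[of _ "Zero T J ?Y"]) auto
    then have "isomorphic T ?Y J" using Y by (intro T.isomorphicI[of "Zero T ?Y J"]) auto
    moreover have "E J" using ker[of I] unit_image by simp
    ultimately have "E ?Y" by (rule E_iso[rotated])
    then show ?thesis using ker[OF X] by simp
  qed
  show ?thesis
    unfolding regular_category_def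
  proof
    fix y assume y: "y \<in> Ar B"
    obtain g where "g \<in> Ar B" "Src B g = Tgt B y" "Tgt B g = Src B y" "y \<cdot>\<^sub>B (g \<cdot>\<^sub>B y) = y"
      using image_regular[OF y] im y by auto
    then show "\<exists>g\<in>Hom B (Tgt B y) (Src B y). y \<cdot>\<^sub>B (g \<cdot>\<^sub>B y) = y" by (auto simp: Hom_def)
  qed
qed

lemma scalar_inverse:
  assumes e: "e \<in> Ar B" "Src B e = I" "Tgt B e = I" and nz: "e \<noteq> Zero B I I"
  obtains c where "Scale B c e = Idn B I"
proof -
  obtain c where c: "e = Scale B c (Idn B I)" using End_unit[of e] e by (auto simp: Hom_def)
  then have "c \<noteq> 0" using nz B.scale_zero_left[of "Idn B I"] by auto
  then have "Scale B (inverse c) e = Idn B I" unfolding c by simp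
  then show ?thesis by (rule that)
qed

lemma E_unit: "E J" using ker[of I] unit_image by simp

text \<open>
  The section of \<open>F q\<close> is a subobject of \<open>F X\<close> that lies in \<open>End(M)\<close>, so it factors through \<open>F X0\<close>. The arrow
  \<open>q j: X0 \<rightarrow> 1\<close> between objects of \<open>A\<close> has a generalised inverse \<open>g\<close>, and \<open>q j g\<close> is a scalar; it is not zero because
  \<open>F (q j)\<close> still has a section.
\<close>

lemma unit_section_sub:
  assumes nz: "Idn T J \<noteq> Zero T J J" and sub: "normal_sub B T E F"
    and q: "q \<in> Ar B" "Tgt B q = I" and s: "s \<in> Ar T" "Src T s = J" "Tgt T s = FOb F (Src B q)" "FAr F q \<cdot>\<^sub>T s = Idn T J"
  shows "\<exists>z. z \<in> Ar B \<and> Src B z = I \<and> Tgt B z = Src B q \<and> q \<cdot>\<^sub>B z = Idn B I"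
proof -
  let ?X = "Src B q"
  have X: "?X \<in> Ob B" using q by simp
  obtain X0 j where j: "j \<in> Hom B X0 ?X" "E (FOb F X0)"
    and uni: "\<And>m. is_mono T m \<Longrightarrow> Tgt T m = FOb F ?X \<Longrightarrow> E (Src T m) \<Longrightarrow> \<exists>u \<in> Hom T (Src T m) (FOb F X0). FAr F j \<cdot>\<^sub>T u = m"
    using sub X unfolding normal_sub_def by metis
  have ja: "j \<in> Ar B" "Src B j = X0" "Tgt B j = ?X" using j by (auto simp: Hom_def)
  have X0: "X0 \<in> Ob B" using ja by auto
  have "is_mono T s" by (rule T.split_mono_is_mono[of s "FAr F q"]) (use s q in simp_all)
  then obtain u where u: "u \<in> Ar T" "Src T u = J" "Tgt T u = FOb F X0" "FAr F j \<cdot>\<^sub>T u = s"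
    using uni[of s] s E_unit by (auto simp: Hom_def)
  let ?y = "q \<cdot>\<^sub>B j"
  have y: "?y \<in> Ar B" "Src B ?y = X0" "Tgt B ?y = I" using q ja by auto
  have Fy: "FAr F ?y \<cdot>\<^sub>T u = Idn T J" using u s q ja by simp
  obtain g where g: "g \<in> Ar B" "Src B g = I" "Tgt B g = X0" "?y \<cdot>\<^sub>B (g \<cdot>\<^sub>B ?y) = ?y"
    using image_regular[OF y(1)] y unit_image ker[OF X0] j(2) by metis
  have "?y \<cdot>\<^sub>B g \<noteq> Zero B I I"
  proof
    assume z: "?y \<cdot>\<^sub>B g = Zero B I I"
    have "?y \<cdot>\<^sub>B (g \<cdot>\<^sub>B ?y) = (?y \<cdot>\<^sub>B g) \<cdot>\<^sub>B ?y" using y g(1-3) by (intro B.assoc[symmetric]) auto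
    then have "?y = Zero B X0 I" unfolding g(4) z using y by simp
    then have "Zero T (FOb F X0) J \<cdot>\<^sub>T u = Idn T J" using Fy F_zero[OF X0 B.unit] by simp
    then show False using nz u X0 by simp
  qed
  then obtain c where c: "Scale B c (?y \<cdot>\<^sub>B g) = Idn B I" using scalar_inverse[of "?y \<cdot>\<^sub>B g"] y g(1-3) by auto
  have "q \<cdot>\<^sub>B Scale B c (j \<cdot>\<^sub>B g) = Idn B I" using c q ja g(1-3) by simp
  then show ?thesis using q ja g(1-3) by (intro exI[of _ "Scale B c (j \<cdot>\<^sub>B g)"]) simp
qed

text \<open>
  The same argument with all arrows reversed.
\<close>

lemma unit_retraction_quot:
  assumes nz: "Idn T J \<noteq> Zero T J J" and quot: "normal_quot B T E F"
    and q: "q \<in> Ar B" "Src B q = I" and r: "r \<in> Ar T" "Src T r = FOb F (Tgt B q)" "Tgt T r = J" "r \<cdot>\<^sub>T FAr F q = Idn T J"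
  shows "\<exists>z. z \<in> Ar B \<and> Src B z = Tgt B q \<and> Tgt B z = I \<and> z \<cdot>\<^sub>B q = Idn B I"
proof -
  let ?X = "Tgt B q"
  have X: "?X \<in> Ob B" using q by simp
  obtain X0 j where j: "j \<in> Hom B ?X X0" "E (FOb F X0)"
    and uni: "\<And>m. is_epi T m \<Longrightarrow> Src T m = FOb F ?X \<Longrightarrow> E (Tgt T m) \<Longrightarrow> \<exists>u \<in> Hom T (FOb F X0) (Tgt T m). u \<cdot>\<^sub>T FAr F j = m"
    using quot X unfolding normal_quot_def by metis
  have ja: "j \<in> Ar B" "Src B j = ?X" "Tgt B j = X0" using j by (auto simp: Hom_def)
  have X0: "X0 \<in> Ob B" using ja by auto
  have "is_epi T r" by (rule T.split_epi_is_epi[of r "FAr F q"]) (use r q in simp_all)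
  then obtain u where u: "u \<in> Ar T" "Src T u = FOb F X0" "Tgt T u = J" "u \<cdot>\<^sub>T FAr F j = r"
    using uni[of r] r E_unit by (auto simp: Hom_def)
  let ?y = "j \<cdot>\<^sub>B q"
  have y: "?y \<in> Ar B" "Src B ?y = I" "Tgt B ?y = X0" using q ja by auto
  have Fy: "u \<cdot>\<^sub>T FAr F ?y = Idn T J"
  proof -
    have "u \<cdot>\<^sub>T FAr F ?y = (u \<cdot>\<^sub>T FAr F j) \<cdot>\<^sub>T FAr F q" using u(1-3) q ja by simp
    then show ?thesis unfolding u(4) r(4) .
  qed
  obtain g where g: "g \<in> Ar B" "Src B g = X0" "Tgt B g = I" "?y \<cdot>\<^sub>B (g \<cdot>\<^sub>B ?y) = ?y"
    using image_regular[OF y(1)] y unit_image ker[OF X0] j(2) by metis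
  have "g \<cdot>\<^sub>B ?y \<noteq> Zero B I I"
  proof
    assume z: "g \<cdot>\<^sub>B ?y = Zero B I I"
    have "?y = Zero B I X0" using g(4) y unfolding z by simp
    then have "u \<cdot>\<^sub>T Zero T J (FOb F X0) = Idn T J" using Fy F_zero[OF B.unit X0] by simp
    then show False using nz u X0 by simp
  qed
  then obtain c where c: "Scale B c (g \<cdot>\<^sub>B ?y) = Idn B I" using scalar_inverse[of "g \<cdot>\<^sub>B ?y"] y g(1-3) by auto
  have "Scale B c (g \<cdot>\<^sub>B j) \<cdot>\<^sub>B q = Idn B I" using c q ja g(1-3) by simp
  then show ?thesis using q ja g(1-3) by (intro exI[of _ "Scale B c (g \<cdot>\<^sub>B j)"]) simp
qed

text \<open>
  Pairing with the section \<open>s\<close> gives an arrow \<open>F (D \<otimes> 1) \<rightarrow> F 1\<close>. On the transpose of \<open>q\<close> it takes, by \<open>pairing_transpose\<close>, the value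
  \<open>F q \<cdot> s = 1\<close>, up to the isomorphisms \<open>k0\<close> and \<open>k1\<close> that are composed of unit constraints. The pairing is moved to \<open>T\<close> by the
  naturality of the structure of \<open>F\<close> and its compatibility with the right unit.
\<close>

lemma F_transpose_retraction:
  assumes dual: "left_dual B D X ev coev" and q: "q \<in> Ar B" "Src B q = X" "Tgt B q = I"
    and s: "s \<in> Ar T" "Src T s = J" "Tgt T s = FOb F X" "FAr F q \<cdot>\<^sub>T s = Idn T J"
  shows "\<exists>r. r \<in> Ar T \<and> Src T r = FOb F (D \<otimes>\<^sub>o\<^bsub>B\<^esub> I) \<and> Tgt T r = J \<and> r \<cdot>\<^sub>T FAr F (B.transpose_arrow D coev q) = Idn T J"
proof -
  note [simp] = B.transpose_simps[OF dual q]
  note [simp] = B.dual_simps[OF dual q]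
  let ?V = "D \<otimes>\<^sub>o\<^bsub>B\<^esub> I" and ?q' = "B.transpose_arrow D coev q" and ?p = "B.transpose_pairing X D ev" and ?U = "Unit T" and ?u = "MUnit F"
  let ?FV = "FOb F ?V" and ?FX = "FOb F X"
  let ?su = "s \<cdot>\<^sub>T ?u"
  have su: "?su \<in> Ar T" "Src T ?su = ?U" "Tgt T ?su = ?FX" using s by auto
  let ?t = "FAr F ?p \<cdot>\<^sub>T MTens F X ?V \<cdot>\<^sub>T (?su \<otimes>\<^sub>T Idn T ?FV) \<cdot>\<^sub>T Inv T (LUnit T ?FV)"
  have lV: "Inv T (LUnit T ?FV) \<in> Ar T" "Src T (Inv T (LUnit T ?FV)) = ?FV" "Tgt T (Inv T (LUnit T ?FV)) = ?U \<otimes>\<^sub>o\<^bsub>T\<^esub> ?FV"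
    using T.Inv_simps(1-3)[OF T.structure_arrows(8)[of ?FV]] by simp_all
  have t: "?t \<in> Ar T" "Src T ?t = ?FV" "Tgt T ?t = J" by (simp_all add: su lV)
  let ?k = "LUnit T J \<cdot>\<^sub>T (Idn T ?U \<otimes>\<^sub>T ?u)"
  have k_eq: "?k = ?u \<cdot>\<^sub>T LUnit T ?U" using T.lunit_nat[of ?u] by simp
  have k: "?k \<in> Ar T" "Src T ?k = ?U \<otimes>\<^sub>o\<^bsub>T\<^esub> ?U" "Tgt T ?k = J" "is_iso T ?k"
    unfolding k_eq by (simp_all add: T.iso_cmp)
  let ?a = "RUnit B I \<cdot>\<^sub>B Inv B (LUnit B I)"
  have a: "?a \<in> Ar B" "Src B ?a = I" "Tgt B ?a = I" "is_iso B ?a"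
    by (simp_all add: B.Inv_simps(1-3)[OF B.structure_arrows(8)[of I]] B.iso_cmp B.iso_Inv)
  let ?k' = "FAr F ?a \<cdot>\<^sub>T ?u \<cdot>\<^sub>T RUnit T ?U"
  have Fa: "FAr F ?a \<in> Ar T" "Src T (FAr F ?a) = J" "Tgt T (FAr F ?a) = J" "is_iso T (FAr F ?a)"
    using a(1-3) functor_iso(1)[OF B.category_axioms T.category_axioms linear_functorD(1)[OF F_linear] a(4)] F(2-4)[OF a(1)] by simp_all
  have k': "?k' \<in> Ar T" "Src T ?k' = ?U \<otimes>\<^sub>o\<^bsub>T\<^esub> ?U" "Tgt T ?k' = J" "is_iso T ?k'"
    by (simp_all add: Fa T.iso_cmp del: F(6))
  have 1: "Inv T (LUnit T ?FV) \<cdot>\<^sub>T FAr F ?q' \<cdot>\<^sub>T LUnit T J = Idn T ?U \<otimes>\<^sub>T FAr F ?q'"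
    by (rule T.Inv_cancel_left) (use T.lunit_nat[of "FAr F ?q'"] in simp_all)
  have 2: "(?su \<otimes>\<^sub>T Idn T ?FV) \<cdot>\<^sub>T (Idn T ?U \<otimes>\<^sub>T FAr F ?q') = (FAr F (Idn B X) \<otimes>\<^sub>T FAr F ?q') \<cdot>\<^sub>T (?su \<otimes>\<^sub>T Idn T J)"
    using T.interchange[of "Idn T ?U" "FAr F ?q'" ?su "Idn T ?FV"] T.interchange[of ?su "Idn T J" "Idn T ?FX" "FAr F ?q'"] su by simp
  have 3: "MTens F X ?V \<cdot>\<^sub>T (FAr F (Idn B X) \<otimes>\<^sub>T FAr F ?q') = FAr F (Idn B X \<otimes>\<^sub>B ?q') \<cdot>\<^sub>T MTens F X I"
    using MTens_natural[of "Idn B X" ?q'] by (simp del: F(5))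
  have 4: "FAr F ?p \<cdot>\<^sub>T FAr F (Idn B X \<otimes>\<^sub>B ?q') = FAr F ?a \<cdot>\<^sub>T FAr F q \<cdot>\<^sub>T FAr F (RUnit B X)"
  proof -
    have "FAr F ?p \<cdot>\<^sub>T FAr F (Idn B X \<otimes>\<^sub>B ?q') = FAr F (?p \<cdot>\<^sub>B (Idn B X \<otimes>\<^sub>B ?q'))"
      by (rule F(6)[symmetric]) simp_all
    also have "?p \<cdot>\<^sub>B (Idn B X \<otimes>\<^sub>B ?q') = ?a \<cdot>\<^sub>B (q \<cdot>\<^sub>B RUnit B X)"
      unfolding B.pairing_transpose[OF dual q] using q B.Inv_simps(1-3)[OF B.structure_arrows(8)[of I]] by simp
    also have "FAr F \<dots> = FAr F ?a \<cdot>\<^sub>T FAr F (q \<cdot>\<^sub>B RUnit B X)"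
      by (rule F(6)) (use a(1-3) q in simp_all)
    also have "FAr F (q \<cdot>\<^sub>B RUnit B X) = FAr F q \<cdot>\<^sub>T FAr F (RUnit B X)" by (rule F(6)) (use q in simp_all)
    finally show ?thesis .
  qed
  have 5: "(?su \<otimes>\<^sub>T Idn T J) \<cdot>\<^sub>T (Idn T ?U \<otimes>\<^sub>T ?u) = (Idn T ?FX \<otimes>\<^sub>T ?u) \<cdot>\<^sub>T (?su \<otimes>\<^sub>T Idn T ?U)"
    using T.interchange[of "Idn T ?U" ?u ?su "Idn T J"] T.interchange[of ?su "Idn T ?U" "Idn T ?FX" ?u] su by simp
  have 6: "RUnit T ?FX \<cdot>\<^sub>T (?su \<otimes>\<^sub>T Idn T ?U) = ?su \<cdot>\<^sub>T RUnit T ?U" using T.runit_nat[OF su(1)] su by simp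
  note ty = su(1-3) lV q s(1-3) Fa(1-3)
  have "?t \<cdot>\<^sub>T FAr F ?q' \<cdot>\<^sub>T ?k =
      FAr F ?p \<cdot>\<^sub>T MTens F X ?V \<cdot>\<^sub>T (?su \<otimes>\<^sub>T Idn T ?FV) \<cdot>\<^sub>T
       (Inv T (LUnit T ?FV) \<cdot>\<^sub>T FAr F ?q' \<cdot>\<^sub>T LUnit T J) \<cdot>\<^sub>T (Idn T ?U \<otimes>\<^sub>T ?u)"
    by (simp add: ty)
  also have "\<dots> = FAr F ?p \<cdot>\<^sub>T MTens F X ?V \<cdot>\<^sub>T
       ((?su \<otimes>\<^sub>T Idn T ?FV) \<cdot>\<^sub>T (Idn T ?U \<otimes>\<^sub>T FAr F ?q')) \<cdot>\<^sub>T (Idn T ?U \<otimes>\<^sub>T ?u)"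
    unfolding 1 by (simp add: ty)
  also have "\<dots> = FAr F ?p \<cdot>\<^sub>T (MTens F X ?V \<cdot>\<^sub>T (FAr F (Idn B X) \<otimes>\<^sub>T FAr F ?q')) \<cdot>\<^sub>T
       ((?su \<otimes>\<^sub>T Idn T J) \<cdot>\<^sub>T (Idn T ?U \<otimes>\<^sub>T ?u))"
    unfolding 2 by (simp add: ty)
  also have "\<dots> = (FAr F ?p \<cdot>\<^sub>T FAr F (Idn B X \<otimes>\<^sub>B ?q')) \<cdot>\<^sub>T MTens F X I \<cdot>\<^sub>T
       (Idn T ?FX \<otimes>\<^sub>T ?u) \<cdot>\<^sub>T (?su \<otimes>\<^sub>T Idn T ?U)"
    unfolding 3 5 by (simp add: ty)
  also have "\<dots> = FAr F ?a \<cdot>\<^sub>T FAr F q \<cdot>\<^sub>T (FAr F (RUnit B X) \<cdot>\<^sub>T MTens F X I \<cdot>\<^sub>T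
       (Idn T ?FX \<otimes>\<^sub>T ?u)) \<cdot>\<^sub>T (?su \<otimes>\<^sub>T Idn T ?U)"
    unfolding 4 by (simp add: ty del: F(6))
  also have "\<dots> = FAr F ?a \<cdot>\<^sub>T FAr F q \<cdot>\<^sub>T (RUnit T ?FX \<cdot>\<^sub>T (?su \<otimes>\<^sub>T Idn T ?U))"
    unfolding MTens_runit[OF B.dual_simps(1)[OF dual q]] ..
  also have "\<dots> = FAr F ?a \<cdot>\<^sub>T (FAr F q \<cdot>\<^sub>T s) \<cdot>\<^sub>T ?u \<cdot>\<^sub>T RUnit T ?U"
    unfolding 6 by (simp add: ty del: F(6))
  also have "\<dots> = ?k'" unfolding s(4) by simp
  finally have main: "?t \<cdot>\<^sub>T FAr F ?q' \<cdot>\<^sub>T ?k = ?k'" .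
  define k0 k1 t0 where "k0 = ?k" and "k1 = ?k'" and "t0 = ?t"
  note k = k[folded k0_def] and k' = k'[folded k1_def] and t = t[folded t0_def] and main = main[folded k0_def k1_def t0_def]
  note i0 = T.Inv_simps[OF k(4)] and i1 = T.Inv_simps[OF k'(4)]
  let ?r = "k0 \<cdot>\<^sub>T Inv T k1 \<cdot>\<^sub>T t0"
  have "?r \<cdot>\<^sub>T FAr F ?q' = k0 \<cdot>\<^sub>T Inv T k1 \<cdot>\<^sub>T (t0 \<cdot>\<^sub>T FAr F ?q' \<cdot>\<^sub>T k0) \<cdot>\<^sub>T Inv T k0"
    using k k' t i0 i1(1-3) by simp
  also have "\<dots> = Idn T J" unfolding main using k k' i0 i1 by simp
  finally show ?thesis by (intro exI[of _ ?r]) (use k k' t i1 in simp)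
qed

lemma unit_section:
  assumes nz: "Idn T J \<noteq> Zero T J J"
    and q: "q \<in> Ar B" "Tgt B q = I" and s: "s \<in> Ar T" "Src T s = J" "Tgt T s = FOb F (Src B q)" "FAr F q \<cdot>\<^sub>T s = Idn T J"
  shows "\<exists>z. z \<in> Ar B \<and> Src B z = I \<and> Tgt B z = Src B q \<and> q \<cdot>\<^sub>B z = Idn B I"
  using normal
proof
  assume "normal_sub B T E F" then show ?thesis using unit_section_sub[OF nz _ q s] by blast
next
  assume quot: "normal_quot B T E F"
  have "Src B q \<in> Ob B" using q by simp
  then obtain D ev coev where dual: "left_dual B D (Src B q) ev coev" using rigid_B unfolding rigid_def by blast
  note ts = B.transpose_simps[OF dual q(1) refl q(2)]
  obtain r where r: "r \<in> Ar T" "Src T r = FOb F (D \<otimes>\<^sub>o\<^bsub>B\<^esub> I)" "Tgt T r = J" "r \<cdot>\<^sub>T FAr F (B.transpose_arrow D coev q) = Idn T J"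
    using F_transpose_retraction[OF dual q(1) refl q(2) s] by blast
  obtain z where z: "z \<in> Ar B" "Src B z = D \<otimes>\<^sub>o\<^bsub>B\<^esub> I" "Tgt B z = I" "z \<cdot>\<^sub>B B.transpose_arrow D coev q = Idn B I"
    using unit_retraction_quot[OF nz quot ts(1,2), of r] r ts(3) by auto
  show ?thesis by (rule B.section_from_transpose_retraction[OF dual q(1) refl q(2) z])
qed

lemma B_epis_split: "epis_split B"
proof (cases "Idn T J = Zero T J J")
  case True
  then have reg: "regular_category B" by (rule regular_if_F_unit_zero)
  show ?thesis unfolding epis_split_def
  proof (intro allI impI)
    fix e assume e: "is_epi B e"
    have ea: "e \<in> Ar B" by (rule B.epi_arr[OF e])
    obtain g where g: "g \<in> Ar B" "Src B g = Tgt B e" "Tgt B g = Src B e" "e \<cdot>\<^sub>B (g \<cdot>\<^sub>B e) = e"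
      using reg ea unfolding regular_category_def Hom_def by blast
    have "(e \<cdot>\<^sub>B g) \<cdot>\<^sub>B e = Idn B (Tgt B e) \<cdot>\<^sub>B e" using g ea by simp
    then have "e \<cdot>\<^sub>B g = Idn B (Tgt B e)" by (rule B.epiD[OF e, rotated -1]) (use g ea in auto)
    then show "\<exists>s\<in>Hom B (Tgt B e) (Src B e). e \<cdot>\<^sub>B s = Idn B (Tgt B e)" using g by (auto simp: Hom_def)
  qed
next
  case nz: False
  show ?thesis unfolding epis_split_def
  proof (intro allI impI)
    fix e assume e: "is_epi B e"
    let ?X = "Src B e" and ?Y = "Tgt B e"
    have ea: "e \<in> Ar B" by (rule B.epi_arr[OF e])
    have XY: "?X \<in> Ob B" "?Y \<in> Ob B" using ea by auto
    obtain Y' ev coev where dual: "left_dual B ?Y Y' ev coev" using rigid_B XY unfolding rigid_def by blast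
    have Y': "Y' \<in> Ob B" and coev: "coev \<in> Ar B" "Src B coev = I" "Tgt B coev = ?Y \<otimes>\<^sub>o\<^bsub>B\<^esub> Y'"
      using dual unfolding left_dual_def Hom_def mem_Collect_eq by blast+
    let ?f = "e \<otimes>\<^sub>B Idn B Y'" and ?W = "?X \<otimes>\<^sub>o\<^bsub>B\<^esub> Y'"
    have f: "?f \<in> Ar B" "Src B ?f = ?W" "Tgt B ?f = ?Y \<otimes>\<^sub>o\<^bsub>B\<^esub> Y'" using ea Y' by auto
    have W: "?W \<in> Ob B" using XY Y' by auto
    \<comment> \<open>\<open>F (e \<otimes> Y')\<close> is isomorphic to \<open>F e \<otimes> F Y'\<close>, and the tensor product of \<open>T\<close> is right exact\<close>
    have Ff: "is_epi T (FAr F ?f)"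
    proof -
      obtain g where g: "is_cokernel T g (FAr F e)" using T.epi_is_cokernel[OF F_epi[OF e]] by blast
      have "right_exact T T (fix_snd T (Tens T) (FOb F Y'))" using Tens_T Y' by (simp add: right_exact_bifunctor_def)
      then have "is_cokernel T (FAr (fix_snd T (Tens T) (FOb F Y')) g) (FAr (fix_snd T (Tens T) (FOb F Y')) (FAr F e))"
        using g unfolding right_exact_def by blast
      then have ep: "is_epi T (FAr F e \<otimes>\<^sub>T Idn T (FOb F Y'))" using T.cokernelD(5) by (simp add: fix_snd_def)
      have "is_epi T (MTens F ?Y Y' \<cdot>\<^sub>T (FAr F e \<otimes>\<^sub>T Idn T (FOb F Y')))"
        by (rule T.epi_cmp[OF T.iso_is_epi ep]) (use XY Y' ea in simp_all)
      then have "is_epi T (FAr F ?f \<cdot>\<^sub>T MTens F ?X Y')" using MTens_natural[of e "Idn B Y'"] ea Y' by simp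
      then show ?thesis by (rule T.epi_right_factor) (use XY Y' f in simp_all)
    qed
    have "\<exists>P i p. is_direct_sum B 2 (\<lambda>j. if j = 0 then I else ?W) P i p"
      by (rule B.has_direct_sums) (use W in auto)
    then obtain P i p where sum: "is_direct_sum B 2 (\<lambda>j. if j = 0 then I else ?W) P i p" by blast
    note One_nat_def [simp del]
    have d: "i 0 \<in> Ar B" "Src B (i 0) = I" "Tgt B (i 0) = P" "p 0 \<in> Ar B" "Src B (p 0) = P" "Tgt B (p 0) = I"
      "i 1 \<in> Ar B" "Src B (i 1) = ?W" "Tgt B (i 1) = P" "p 1 \<in> Ar B" "Src B (p 1) = P" "Tgt B (p 1) = ?W"
      by (simp_all add: B.direct_sumD[OF sum, of 0] B.direct_sumD[OF sum, of 1])
    have pi: "p 0 \<cdot>\<^sub>B i 0 = Idn B I" "p 0 \<cdot>\<^sub>B i 1 = Zero B ?W I" "p 1 \<cdot>\<^sub>B i 1 = Idn B ?W"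
      using sum unfolding is_direct_sum_def by (auto dest: spec[of _ 0] spec[of _ 1])
    \<comment> \<open>the kernel of \<open>d\<close> is the pullback of \<open>e \<otimes> Y'\<close> along the coevaluation\<close>
    let ?d = "Sub B (coev \<cdot>\<^sub>B p 0) (?f \<cdot>\<^sub>B p 1)"
    have da: "?d \<in> Ar B" "Src B ?d = P" "Tgt B ?d = ?Y \<otimes>\<^sub>o\<^bsub>B\<^esub> Y'" by (simp_all add: d coev f)
    obtain k where k: "is_kernel B ?d k" using B.has_kernels[OF da(1)] by blast
    note kk = B.kernelD(1-4)[OF k]
    have k': "k \<in> Ar B" "Tgt B k = P" using kk da by simp_all
    have di: "?d \<cdot>\<^sub>B i 1 = Scale B (-1) ?f"
    proof -
      have "?d \<cdot>\<^sub>B i 1 = Sub B (coev \<cdot>\<^sub>B (p 0 \<cdot>\<^sub>B i 1)) (?f \<cdot>\<^sub>B (p 1 \<cdot>\<^sub>B i 1))"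
        using d coev f by (simp add: B.sub_cmp)
      also have "\<dots> = Sub B (Zero B ?W (?Y \<otimes>\<^sub>o\<^bsub>B\<^esub> Y')) ?f" unfolding pi using coev f W by simp
      finally show ?thesis using f W XY Y' by (simp add: Sub_def)
    qed
    have "is_epi T (FAr F ?d \<cdot>\<^sub>T FAr F (i 1))"
    proof -
      have "FAr F ?d \<cdot>\<^sub>T FAr F (i 1) = FAr F (?d \<cdot>\<^sub>B i 1)"
        by (rule F(6)[symmetric]) (simp_all add: d da)
      then have "FAr F ?d \<cdot>\<^sub>T FAr F (i 1) = Scale T (-1) (FAr F ?f)"
        unfolding di F_scale[OF f(1)] .
      moreover have "is_epi T (Scale T (-1) (FAr F ?f))"
      proof (rule T.epiI_zero)
        fix g assume g: "g \<in> Ar T" "Src T g = Tgt T (Scale T (-1) (FAr F ?f))"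
          "g \<cdot>\<^sub>T Scale T (-1) (FAr F ?f) = Zero T (Src T (Scale T (-1) (FAr F ?f))) (Tgt T g)"
        have c: "FAr F ?f \<in> Ar T" "Src T g = Tgt T (FAr F ?f)" using f(1) g(2) by simp_all
        then have "Scale T (-1) g \<cdot>\<^sub>T FAr F ?f = Zero T (Src T (FAr F ?f)) (Tgt T g)" using g by simp
        then have "Scale T (-1) g = Zero T (Tgt T (FAr F ?f)) (Tgt T g)"
          using T.epi_zeroD[OF Ff, of "Scale T (-1) g"] g(1) c by simp
        then have "Scale T (-1) (Scale T (-1) g) = Scale T (-1) (Scale T 0 g)"
          using g(1) c by (simp add: T.scale_zero_left)
        then have "g = Scale T 0 g" using g(1) by simp
        also have "\<dots> = Zero T (Src T g) (Tgt T g)" by (rule T.scale_zero_left[OF g(1)])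
        finally show "g = Zero T (Tgt T (Scale T (-1) (FAr F ?f))) (Tgt T g)" unfolding g(2) .
      qed (use f in simp)
      ultimately show ?thesis by simp
    qed
    then have "is_epi T (FAr F (p 0) \<cdot>\<^sub>T FAr F k)"
    proof (rule T.pullback_epi[where pA = "FAr F (p 0)" and iA = "FAr F (i 0)" and P = "FOb F P" and A = J
          and B = "FOb F ?W" and Z = "FOb F (?Y \<otimes>\<^sub>o\<^bsub>B\<^esub> Y')", rotated -2])
      show "is_kernel T (FAr F ?d) (FAr F k)" by (rule F_kernel[OF k])
      show "FAr F (p 0) \<in> Hom T (FOb F P) J" "FAr F (i 0) \<in> Hom T J (FOb F P)" "FAr F (i 1) \<in> Hom T (FOb F ?W) (FOb F P)"
        by (simp_all add: d Hom_def)
      show "FAr F ?d \<in> Hom T (FOb F P) (FOb F (?Y \<otimes>\<^sub>o\<^bsub>B\<^esub> Y'))" by (simp add: F(2-4)[OF da(1)] da Hom_def)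
      show "FAr F (p 0) \<cdot>\<^sub>T FAr F (i 0) = Idn T J" by (subst F(6)[symmetric]) (simp_all add: d pi)
      show "FAr F (p 0) \<cdot>\<^sub>T FAr F (i 1) = Zero T (FOb F ?W) J" by (subst F(6)[symmetric]) (simp_all add: d pi F_zero[OF W B.unit])
    qed
    then have ep: "is_epi T (FAr F (p 0 \<cdot>\<^sub>B k))" using k' d by simp
    have pk: "p 0 \<cdot>\<^sub>B k \<in> Ar B" "Src B (p 0 \<cdot>\<^sub>B k) = Src B k" "Tgt B (p 0 \<cdot>\<^sub>B k) = I" using k' d by simp_all
    obtain s where s: "s \<in> Ar T" "Src T s = J" "Tgt T s = FOb F (Src B (p 0 \<cdot>\<^sub>B k))" "FAr F (p 0 \<cdot>\<^sub>B k) \<cdot>\<^sub>T s = Idn T J"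
      using unit_split[OF ep] F(3,4)[OF pk(1)] pk(3) by auto
    obtain z where z: "z \<in> Ar B" "Src B z = I" "Tgt B z = Src B k" "(p 0 \<cdot>\<^sub>B k) \<cdot>\<^sub>B z = Idn B I"
      using unit_section[OF nz pk(1,3) s] pk(2) by auto
    \<comment> \<open>the component of the section \<open>z\<close> of the pullback in \<open>X \<otimes> Y'\<close> lifts the coevaluation\<close>
    let ?t = "p 1 \<cdot>\<^sub>B k \<cdot>\<^sub>B z"
    have t: "?t \<in> Ar B" "Src B ?t = I" "Tgt B ?t = ?W" by (simp_all add: z(1-3) k' d)
    have kz: "k \<cdot>\<^sub>B z \<in> Ar B" "Src B (k \<cdot>\<^sub>B z) = I" "Tgt B (k \<cdot>\<^sub>B z) = P" using z k' by simp_all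
    have pz: "p 0 \<cdot>\<^sub>B (k \<cdot>\<^sub>B z) = Idn B I" using z k' d by simp
    have "?d \<cdot>\<^sub>B (k \<cdot>\<^sub>B z) = Zero B I (?Y \<otimes>\<^sub>o\<^bsub>B\<^esub> Y')"
      by (subst B.rewrite_pair[OF kk(4)]) (simp_all add: z(1-3) kk(1-3) da(2,3) k' W XY Y')
    moreover have "?d \<cdot>\<^sub>B (k \<cdot>\<^sub>B z) = Sub B (coev \<cdot>\<^sub>B (p 0 \<cdot>\<^sub>B (k \<cdot>\<^sub>B z))) (?f \<cdot>\<^sub>B ?t)"
      by (subst B.sub_cmp) (simp_all del: B.assoc add: d coev f kz B.assoc[of "k \<cdot>\<^sub>B z"])
    ultimately have "Sub B coev (?f \<cdot>\<^sub>B ?t) = Zero B (Src B coev) (Tgt B coev)" unfolding pz using coev by simp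
    then have "?f \<cdot>\<^sub>B ?t = coev" using B.sub_eq_zeroD[of coev "?f \<cdot>\<^sub>B ?t"] coev f t by simp
    then show "\<exists>s\<in>Hom B ?Y ?X. e \<cdot>\<^sub>B s = Idn B ?Y"
      by (rule B.section_from_coev_lift[OF dual ea refl refl t])
  qed
qed

end

section \<open>Semisimplicity of the middle term\<close>

text \<open>
  The unit of \<open>A\<close> is projective, so by exactness each object \<open>1 \<rhd> m\<close> is projective, and it is isomorphic to \<open>m\<close>.
\<close>

lemma module_category_epis_split:
  assumes A: "epis_split A" "monoidal_category A" and M: "exact_module_category A M S" "category M"
  shows "epis_split M"
  unfolding epis_split_def
proof (intro allI impI)
  interpret A: monoidal_category A by fact
  interpret M: category M by fact
  interpret S: module_category A M S using M by (simp add: exact_module_category_def)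
  fix e assume e: "is_epi M e"
  let ?m = "Tgt M e" and ?I = "Unit A"
  have ea: "e \<in> Ar M" by (rule M.epi_arr[OF e])
  have m: "?m \<in> Ob M" using ea by simp
  have "is_projective A ?I" unfolding is_projective_def
  proof (intro conjI allI impI ballI)
    fix c f assume c: "is_epi A c" and f: "f \<in> Hom A ?I (Tgt A c)"
    obtain s where s: "s \<in> Ar A" "Src A s = Tgt A c" "Tgt A s = Src A c" "c \<cdot>\<^bsub>A\<^esub> s = Idn A (Tgt A c)"
      using A(1) c unfolding epis_split_def Hom_def by blast
    have "c \<cdot>\<^bsub>A\<^esub> (s \<cdot>\<^bsub>A\<^esub> f) = f"
      using A.rewrite_pair[OF s(4), of f] s(1-3) f A.epi_arr[OF c] by (auto simp: Hom_def)
    then show "\<exists>g\<in>Hom A ?I (Src A c). c \<cdot>\<^bsub>A\<^esub> g = f" using s f by (intro bexI[of _ "s \<cdot>\<^bsub>A\<^esub> f"]) (auto simp: Hom_def)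
  qed (rule A.unit_Ob)
  then have "is_projective M (?I \<rhd>\<^sub>o\<^bsub>S\<^esub> ?m)" using M m by (simp add: exact_module_category_def)
  moreover note l = S.mlunit_Hom[OF m] S.mlunit_iso[OF m]
  ultimately obtain g where g: "g \<in> Hom M (?I \<rhd>\<^sub>o\<^bsub>S\<^esub> ?m) (Src M e)" "e \<cdot>\<^bsub>M\<^esub> g = MLUnit S ?m"
    using e unfolding is_projective_def by blast
  note il = M.Inv_simps[OF l(2)]
  have "e \<cdot>\<^bsub>M\<^esub> (g \<cdot>\<^bsub>M\<^esub> Inv M (MLUnit S ?m)) = Idn M ?m"
    using M.rewrite_pair[OF g(2), of "Inv M (MLUnit S ?m)"] g(1) ea il l(1) by (auto simp: Hom_def)
  then show "\<exists>s\<in>Hom M ?m (Src M e). e \<cdot>\<^bsub>M\<^esub> s = Idn M ?m"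
    using g(1) il l(1) by (intro bexI[of _ "g \<cdot>\<^bsub>M\<^esub> Inv M (MLUnit S ?m)"]) (auto simp: Hom_def)
qed

lemma linear_monoidalI:
  assumes "finite_category C" "monoidal_category C" "bilinear_bifunctor C C C (Tens C)"
  shows "linear_monoidal C"
  using assms by (simp add: linear_monoidal_def linear_monoidal_axioms_def finite_category_def)

text \<open>
  The object \<open>F 1\<close> is isomorphic to the unit of \<open>T\<close> and hence to \<open>1 \<boxtimes> Id\<close>, to which \<open>epi_onto_box_splits\<close> applies.
\<close>

theorem theorem3p8:
  fixes A :: "('ao, 'am, 'k::alg_closed_field) moncat"
    and B :: "('bo, 'bm, 'k) moncat"
    and C :: "('co, 'cm, 'k) moncat"
    and M :: "('mo, 'mm, 'k) lcat"
    and S :: "('ao, 'am, 'mo, 'mm) modstr"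
    and T :: "('to, 'tm, 'k) moncat"
    and bx :: "('co \<times> ('mo, 'mm) endo, 'cm \<times> ('mo, 'mm) endo_arrow, 'to, 'tm) mftr"
    and \<iota> :: "('ao, 'am, 'bo, 'bm) mftr"
    and F :: "('bo, 'bm, 'to, 'tm) mftr"
  assumes "fusion_category A"
    and "fusion_category C"
    and "finite_tensor_category B"
    and "indecomposable_module_category A M S"
    and "exact_module_category A M S"
    and "exact_sequence_wrt A B C M S T bx \<iota> F"
  shows "fusion_category B"
proof -
  have A: "linear_monoidal A" "semisimple_category A" and C: "finite_category C" "semisimple_category C" "monoidal_category C" and B: "linear_monoidal B"
    using assms(1,2,3) by (auto simp: fusion_category_def finite_tensor_category_def intro!: linear_monoidalI)
  have T: "deligne_product C (End_cat M) T bx" "finite_category T" "monoidal_category T" "right_exact_bifunctor T T T (Tens T)"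
      "monoidal_functor (prod_moncat C (End_cat M)) T bx"
    using assms(6) by (auto simp: exact_sequence_wrt_def monoidal_deligne_product_def deligne_product_def Let_def)
  have Tm: "linear_monoidal T" using T by (intro linear_monoidalI) (auto simp: right_exact_bifunctor_def)
  interpret A: linear_monoidal A by fact
  interpret B: linear_monoidal B by fact
  interpret T: linear_monoidal T by fact
  interpret C: abelian_category C using C by (simp add: finite_category_def)
  have A_split: "epis_split A" using A.monos_split_epis_split[OF A.semisimple_monos_split] A by blast
  have C_split: "epis_split C" using C.monos_split_epis_split[OF C.semisimple_monos_split] C by blast
  have Mfin: "finite_category M" using assms(5) by (simp add: exact_module_category_def module_category_def)
  then interpret M: abelian_category M by (simp add: finite_category_def)
  have M_split: "epis_split M"
    by (rule module_category_epis_split[OF A_split A.monoidal_category_axioms assms(5) M.category_axioms])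
  obtain RM FM where M_eq: "fd_algebra RM" "finite_abelian M RM FM" using finite_abelianI[OF Mfin] .
  obtain RC FC where C_eq: "fd_algebra RC" "finite_abelian C RC FC" using finite_abelianI[OF C(1)] .
  obtain RT FT where T_eq: "fd_algebra RT" "finite_abelian T RT FT" using finite_abelianI[OF T(2)] .
  obtain RB FB where B_eq: "fd_algebra RB" "finite_abelian B RB FB"
    using finite_abelianI[of B] assms(3) by (auto simp: finite_tensor_category_def)
  let ?D = "End_cat M" and ?I = "Unit B"
  have D_reg: "regular_category ?D"
    using M_eq M_split by (intro finite_semisimple.End_regular) (simp add: finite_semisimple_def finite_semisimple_axioms_def)
  have D_lin: "linear_category ?D" by (rule End_linear_category) (rule M.linear_category_axioms)
  have C_unit: "Unit C \<in> Ob C" using C(3) by (rule monoidal_category.unit_Ob)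
  obtain n1 \<theta>1 where h1: "hom_coordinates C (Unit C) n1 \<theta>1"
    using finite_homs_coordinates[OF C.linear_category_axioms finite_abelian.finite_homs[OF C_eq(2) C_unit]] .
  obtain n2 \<theta>2 where h2: "hom_coordinates ?D id_ftr n2 \<theta>2"
    using finite_homs_coordinates[OF D_lin End_finite_homs[OF M_eq(2,1)]] .
  interpret K: deligne_eval C "Unit C" n1 \<theta>1 ?D id_ftr n2 \<theta>2 T bx RT FT
    using h1 h2 T T_eq C.split_regular[OF C_split] D_reg
    by (simp add: deligne_eval_def deligne_eval_axioms_def deligne_homs_def deligne_homs_axioms_def finite_abelian_def)
  let ?b = "FOb bx (Unit C, id_ftr)"
  have F_mon: "monoidal_functor B T F" and F_ex: "exact_functor B T F" and \<iota>_mon: "monoidal_functor A B \<iota>"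
    and \<iota>_ff: "fully_faithful A B \<iota>"
    using assms(6) by (auto simp: exact_sequence_wrt_def Let_def)
  let ?E = "in_image T ?D (unit_box C ?D T bx)"
  have ker: "\<And>X. X \<in> Ob B \<Longrightarrow> in_image B A \<iota> X \<longleftrightarrow> ?E (FOb F X)" and normal: "normal_sub B T ?E F \<or> normal_quot B T ?E F"
    using assms(6) by (auto simp: exact_sequence_wrt_def Let_def)
  have "isomorphic T (Unit T) ?b"
  proof -
    have "MUnit bx \<in> Hom T (Unit T) (FOb bx (Unit (prod_moncat C ?D)))" "is_iso T (MUnit bx)"
      using T(5) by (auto simp: monoidal_functor_def)
    moreover have "Unit (prod_moncat C ?D) = (Unit C, id_ftr)"
      by (simp add: prod_moncat_def lcat.defs moncat.defs prod_cat_def End_cat_def)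
    ultimately show ?thesis by (auto simp: isomorphic_def)
  qed
  moreover have "isomorphic T (Unit T) (FOb F ?I)"
    using F_mon by (auto simp: monoidal_functor_def isomorphic_def)
  ultimately have bF: "isomorphic T ?b (FOb F ?I)" using T.isomorphic_sym T.isomorphic_trans by blast
  have "normal_sequence A B T \<iota> F ?E"
  proof (unfold_locales)
    show "rigid B" using assms(3) by (simp add: finite_tensor_category_def)
    show "\<exists>c. f = Scale B c (Idn B ?I)" if "f \<in> Hom B ?I ?I" for f
      using assms(3) that unfolding finite_tensor_category_def bij_betw_def by blast
    show "regular_category A" by (rule A.split_regular[OF A_split])
    show "is_functor A B \<iota>" using \<iota>_mon by (simp add: monoidal_functor_def)
    show "in_image B A \<iota> ?I"
      using \<iota>_mon A.unit B.unit by (auto simp: in_image_def isomorphic_def monoidal_functor_def)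
    show "?E Y'" if "?E Y" "isomorphic T Y' Y" for Y Y'
      using that T.isomorphic_trans T.isomorphicE[OF that(2)] T.src_Ob unfolding in_image_def by metis
    show "\<exists>s. s \<in> Ar T \<and> Src T s = FOb F ?I \<and> Tgt T s = Src T e \<and> e \<cdot>\<^bsub>T\<^esub> s = Idn T (FOb F ?I)"
      if "is_epi T e" "Tgt T e = FOb F ?I" for e
      by (rule T.epis_onto_isomorphic_split[OF bF _ that]) (use K.epi_onto_box_splits in metis)
  qed (use T F_mon F_ex \<iota>_ff ker normal in auto)
  then have "epis_split B" by (rule normal_sequence.B_epis_split)
  then have "monos_split B" by (rule B.epis_split_monos_split)
  then have "semisimple_category B" by (rule finite_abelian.split_semisimple[OF B_eq(2)])
  then show ?thesis using assms(3) by (simp add: fusion_category_def)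
qed

end
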